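(* Let $Q=Q(x,y,p)$ be a function, $i$ a fixed nonzero real constant, and for a nowhere vanishing function $\rho=\rho(x,y,p,\phi)$ let $$g_F=2\rho^2\Big[(dp-Q\,dx)\,dx-(dy-p\,dx)\Big(\tfrac23 i\,d\phi+\tfrac23Q_p\,dx+\tfrac16Q_{pp}(dy-p\,dx)\Big)\Big].$$ All the metrics $g_F$ satisfying $Ric(g_F)=\Lambda g_F$ are described as follows. The metrics $g_F$ may be conformal to Einstein metrics only if $w_1=w_2=0$, or $w_2=0,\ w_1\neq0$, or $w_2\neq 0,\ w_1=0$. (1) If $w_1=w_2=0$, the metrics $g_F$ are conformally flat. (2) If $w_2=0$ and $w_1\neq 0$, the general solution of the Einstein equations $Ric(g_F)=\Lambda g_F$ is given (up to the sign of $\rho$) by either $$\rho=\frac{\exp(-\frac23a)}{p+2b}\exp\Big(-\frac{i\phi}{3}\Big),$$ $$Q=p^3c+p^2(6bc-2a_y)+p(12b^2c-3b_y-6ba_y-a_x)+8b^3c-2bb_y-4b^2a_y-2b_x-2ba_x,$$ or $$\rho=\exp\big(-\tfrac23a\big)\exp\Big(-\frac{i\phi}{3}\Big),\qquad Q=p^2a_y+2pa_x+b,$$ where $a=a(x,y)$, $b=b(x,y)$, $c=c(x,y)$ are arbitrary functions of $x,y$. All these solutions are Ricci flat. (3) If $w_2\neq 0$ and $w_1=0$, the Einstein equations reduce to $$\rho=a\exp\Big(\frac{i\phi}{3}\Big),$$ where the function $a=a(x,y)$ satisfies the single differential equation $$36(Da)^2+6a(-3D^2a+Q_pDa)+a^2(6DQ_p-18Q_y-4Q_p^2)=0.$$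 All the metrics $g_F$ corresponding to these solutions are Ricci flat. In particular, conformally non-flat Fefferman–Einstein metrics have vanishing cosmological constant.
   Context: All considerations are local and concern nonsingular points. The metrics $g_F$ are defined on the 4-dimensional space with coordinates $(x,y,p,\phi)$ and are called the Fefferman metrics of the ODE $y''=Q(x,y,y')$; products of 1-forms are symmetrized tensor products; $i$ is a nonzero REAL constant. Subscripts denote partial derivatives. Put $D=\partial_x+p\partial_y+Q\partial_p$ and $$w_1=D^2Q_{pp}-4DQ_{py}-DQ_{pp}\,Q_p+4Q_pQ_{py}-3Q_{pp}Q_y+6Q_{yy},\qquad w_2=Q_{pppp}.$$ $\Lambda$ denotes the cosmological constant. *)

theory Defs
  imports "HOL-Analysis.Analysis"
begin

section \<open>Smooth functions and partial derivatives\<close>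

text \<open>Both notions are meant for open sets \<open>S\<close>: all derivatives are two-sided.\<close>

primrec times_cont_diff_on ::
  "nat \<Rightarrow> 'a::real_normed_vector set \<Rightarrow> ('a \<Rightarrow> 'b::real_normed_vector) \<Rightarrow> bool" where
  "times_cont_diff_on 0 S f \<longleftrightarrow> continuous_on S f"
| "times_cont_diff_on (Suc k) S f \<longleftrightarrow>
     (\<forall>x\<in>S. f differentiable (at x)) \<and>
     (\<forall>v. times_cont_diff_on k S (\<lambda>x. frechet_derivative f (at x) v))"

definition smooth_on ::
  "'a::real_normed_vector set \<Rightarrow> ('a \<Rightarrow> 'b::real_normed_vector) \<Rightarrow> bool" where
  "smooth_on S f \<longleftrightarrow> (\<forall>k. times_cont_diff_on k S f)"

definition pd :: "'n::finite \<Rightarrow> (real^'n \<Rightarrow> real) \<Rightarrow> real^'n \<Rightarrow> real" where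
  "pd k f z = frechet_derivative f (at z) (axis k 1)"

section \<open>Local statements\<close>

definition locally_everywhere ::
  "'a::topological_space set \<Rightarrow> ('a set \<Rightarrow> bool) \<Rightarrow> bool" where
  "locally_everywhere U P \<longleftrightarrow> (\<forall>z\<in>U. \<exists>N. open N \<and> z \<in> N \<and> N \<subseteq> U \<and> P N)"

text \<open>The points having a neighbourhood on which \<open>P\<close> holds form an open set; it is
  required to be dense in \<open>U\<close>. The points outside it are the singular ones.\<close>

definition locally_generic ::
  "'a::topological_space set \<Rightarrow> ('a set \<Rightarrow> bool) \<Rightarrow> bool" where
  "locally_generic U P \<longleftrightarrow>
     U \<subseteq> closure {z\<in>U. \<exists>N. open N \<and> z \<in> N \<and> N \<subseteq> U \<and> P N}"

section \<open>Curvature of a metric given by its coefficient matrix\<close>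

text \<open>\<open>christoffel g k i j\<close> is $\Gamma^k_{ij}$, and \<open>riemann g l k i j\<close> is
  $R^l{}_{kij} = \partial_i\Gamma^l_{jk} - \partial_j\Gamma^l_{ik}
    + \Gamma^l_{im}\Gamma^m_{jk} - \Gamma^l_{jm}\Gamma^m_{ik}$.
  The sign of the Ricci tensor is the one for which round spheres are positive.\<close>

definition christoffel ::
  "(real^'n \<Rightarrow> real^'n^'n) \<Rightarrow> 'n \<Rightarrow> 'n \<Rightarrow> 'n \<Rightarrow> real^'n \<Rightarrow> real" where
  "christoffel g k i j z =
     (\<Sum>l\<in>UNIV. matrix_inv (g z) $ k $ l *
        (pd i (\<lambda>w. g w $ j $ l) z + pd j (\<lambda>w. g w $ i $ l) z - pd l (\<lambda>w. g w $ i $ j) z)) / 2"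

definition riemann ::
  "(real^'n \<Rightarrow> real^'n^'n) \<Rightarrow> 'n \<Rightarrow> 'n \<Rightarrow> 'n \<Rightarrow> 'n \<Rightarrow> real^'n \<Rightarrow> real" where
  "riemann g l k i j z =
     pd i (christoffel g l j k) z - pd j (christoffel g l i k) z
     + (\<Sum>m\<in>UNIV. christoffel g l i m z * christoffel g m j k z
                 - christoffel g l j m z * christoffel g m i k z)"

definition ricci :: "(real^'n \<Rightarrow> real^'n^'n) \<Rightarrow> real^'n \<Rightarrow> real^'n^'n" where
  "ricci g z = (\<chi> k j. \<Sum>l\<in>UNIV. riemann g l k l j z)"

definition einstein_on :: "(real^'n) set \<Rightarrow> (real^'n \<Rightarrow> real^'n^'n) \<Rightarrow> real \<Rightarrow> bool" where
  "einstein_on U g \<Lambda> \<longleftrightarrow> (\<forall>z\<in>U. ricci g z = \<Lambda> *\<^sub>R g z)"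

definition ricci_flat_on :: "(real^'n) set \<Rightarrow> (real^'n \<Rightarrow> real^'n^'n) \<Rightarrow> bool" where
  "ricci_flat_on U g \<longleftrightarrow> (\<forall>z\<in>U. ricci g z = 0)"

definition flat_on :: "(real^'n) set \<Rightarrow> (real^'n \<Rightarrow> real^'n^'n) \<Rightarrow> bool" where
  "flat_on U g \<longleftrightarrow> (\<forall>z\<in>U. \<forall>l k i j. riemann g l k i j z = 0)"

definition scale_factor_on :: "(real^'n) set \<Rightarrow> (real^'n \<Rightarrow> real) \<Rightarrow> bool" where
  "scale_factor_on U \<rho> \<longleftrightarrow> smooth_on U \<rho> \<and> (\<forall>z\<in>U. \<rho> z \<noteq> 0)"

definition conformally_flat_on :: "(real^'n) set \<Rightarrow> (real^'n \<Rightarrow> real^'n^'n) \<Rightarrow> bool" where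
  "conformally_flat_on U g \<longleftrightarrow>
     locally_everywhere U (\<lambda>N. \<exists>\<sigma>. scale_factor_on N \<sigma> \<and> flat_on N (\<lambda>z. (\<sigma> z)\<^sup>2 *\<^sub>R g z))"

definition conformally_einstein_on :: "(real^'n) set \<Rightarrow> (real^'n \<Rightarrow> real^'n^'n) \<Rightarrow> bool" where
  "conformally_einstein_on U g \<longleftrightarrow>
     locally_everywhere U (\<lambda>N. \<exists>\<sigma> \<Lambda>. scale_factor_on N \<sigma> \<and>
       einstein_on N (\<lambda>z. (\<sigma> z)\<^sup>2 *\<^sub>R g z) \<Lambda>)"

section \<open>Second order ODEs and their Fefferman metrics\<close>

text \<open>Coordinates: \<open>real^4\<close> carries $(x,y,p,\phi)$, \<open>real^3\<close> carries $(x,y,p)$ and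
  \<open>real^2\<close> carries $(x,y)$.\<close>

definition jet :: "real^4 \<Rightarrow> real^3" where
  "jet z = vector [z$1, z$2, z$3]"

definition base :: "real^3 \<Rightarrow> real^2" where
  "base v = vector [v$1, v$2]"

definition total_deriv :: "(real^3 \<Rightarrow> real) \<Rightarrow> (real^3 \<Rightarrow> real) \<Rightarrow> real^3 \<Rightarrow> real" where
  "total_deriv Q f v = pd 1 f v + v$3 * pd 2 f v + Q v * pd 3 f v"

definition w1 :: "(real^3 \<Rightarrow> real) \<Rightarrow> real^3 \<Rightarrow> real" where
  "w1 Q v =
    (let D = total_deriv Q; Qy = pd 2 Q; Qp = pd 3 Q;
         Qpp = pd 3 Qp; Qpy = pd 2 Qp; Qyy = pd 2 Qy
     in D (D Qpp) v - 4 * D Qpy v - D Qpp v * Qp v + 4 * Qp v * Qpy v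
        - 3 * Qpp v * Qy v + 6 * Qyy v)"

definition w2 :: "(real^3 \<Rightarrow> real) \<Rightarrow> real^3 \<Rightarrow> real" where
  "w2 Q = pd 3 (pd 3 (pd 3 (pd 3 Q)))"

definition sym_prod :: "real^'n \<Rightarrow> real^'n \<Rightarrow> real^'n^'n" where
  "sym_prod \<alpha> \<beta> = (\<chi> j k. (\<alpha>$j * \<beta>$k + \<beta>$j * \<alpha>$k) / 2)"

definition fefferman ::
  "real \<Rightarrow> (real^3 \<Rightarrow> real) \<Rightarrow> (real^4 \<Rightarrow> real) \<Rightarrow> real^4 \<Rightarrow> real^4^4" where
  "fefferman i Q \<rho> z =
    (let dx = axis 1 1; dy = axis 2 1; dp = axis 3 1; d\<phi> = axis 4 1;
         p = z$3; q = Q (jet z); qp = pd 3 Q (jet z); qpp = pd 3 (pd 3 Q) (jet z)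
     in (2 * (\<rho> z)\<^sup>2) *\<^sub>R
        (sym_prod (dp - q *\<^sub>R dx) dx
         - sym_prod (dy - p *\<^sub>R dx)
             ((2/3 * i) *\<^sub>R d\<phi> + (2/3 * qp) *\<^sub>R dx + (1/6 * qpp) *\<^sub>R (dy - p *\<^sub>R dx))))"

section \<open>The explicit families of solutions\<close>

definition cubic_rhs ::
  "(real^2 \<Rightarrow> real) \<Rightarrow> (real^2 \<Rightarrow> real) \<Rightarrow> (real^2 \<Rightarrow> real) \<Rightarrow> real^3 \<Rightarrow> real" where
  "cubic_rhs a b c v =
    (let p = v$3; u = base v; B = b u; C = c u;
         a_x = pd 1 a u; a_y = pd 2 a u; b_x = pd 1 b u; b_y = pd 2 b u
     in p^3 * C + p^2 * (6 * B * C - 2 * a_y)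
        + p * (12 * B^2 * C - 3 * b_y - 6 * B * a_y - a_x)
        + 8 * B^3 * C - 2 * B * b_y - 4 * B^2 * a_y - 2 * b_x - 2 * B * a_x)"

definition quadratic_rhs :: "(real^2 \<Rightarrow> real) \<Rightarrow> (real^2 \<Rightarrow> real) \<Rightarrow> real^3 \<Rightarrow> real" where
  "quadratic_rhs a b v =
    (let p = v$3; u = base v in p^2 * pd 2 a u + 2 * p * pd 1 a u + b u)"

definition equal_up_to_sign_on :: "'a set \<Rightarrow> ('a \<Rightarrow> real) \<Rightarrow> ('a \<Rightarrow> real) \<Rightarrow> bool" where
  "equal_up_to_sign_on N f h \<longleftrightarrow> (\<forall>z\<in>N. f z = h z) \<or> (\<forall>z\<in>N. f z = - h z)"

definition first_family_on ::
  "real \<Rightarrow> (real^3 \<Rightarrow> real) \<Rightarrow> (real^4 \<Rightarrow> real) \<Rightarrow> (real^4) set \<Rightarrow> bool" where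
  "first_family_on i Q \<rho> N \<longleftrightarrow>
    (\<exists>a b c. smooth_on (base ` jet ` N) a \<and> smooth_on (base ` jet ` N) b \<and>
       smooth_on (base ` jet ` N) c \<and>
       (\<forall>z\<in>N. z$3 + 2 * b (base (jet z)) \<noteq> 0) \<and>
       equal_up_to_sign_on N \<rho>
         (\<lambda>z. exp (- (2/3) * a (base (jet z))) / (z$3 + 2 * b (base (jet z)))
              * exp (- (i * z$4 / 3))) \<and>
       (\<forall>v\<in>jet ` N. Q v = cubic_rhs a b c v))"

definition second_family_on ::
  "real \<Rightarrow> (real^3 \<Rightarrow> real) \<Rightarrow> (real^4 \<Rightarrow> real) \<Rightarrow> (real^4) set \<Rightarrow> bool" where
  "second_family_on i Q \<rho> N \<longleftrightarrow>
    (\<exists>a b. smooth_on (base ` jet ` N) a \<and> smooth_on (base ` jet ` N) b \<and>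
       equal_up_to_sign_on N \<rho>
         (\<lambda>z. exp (- (2/3) * a (base (jet z))) * exp (- (i * z$4 / 3))) \<and>
       (\<forall>v\<in>jet ` N. Q v = quadratic_rhs a b v))"

definition third_family_on ::
  "real \<Rightarrow> (real^3 \<Rightarrow> real) \<Rightarrow> (real^4 \<Rightarrow> real) \<Rightarrow> (real^4) set \<Rightarrow> bool" where
  "third_family_on i Q \<rho> N \<longleftrightarrow>
    (\<exists>a. smooth_on (base ` jet ` N) a \<and>
       (\<forall>z\<in>N. \<rho> z = a (base (jet z)) * exp (i * z$4 / 3)) \<and>
       (\<forall>v\<in>jet ` N.
          let D = total_deriv Q; A = (\<lambda>v. a (base v)); Qy = pd 2 Q; Qp = pd 3 Q
          in 36 * (D A v)^2 + 6 * A v * (- 3 * D (D A) v + Qp v * D A v)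
             + (A v)^2 * (6 * D Qp v - 18 * Qy v - 4 * (Qp v)^2) = 0))"

end

(*
  Write the metric as h / sigma^2, where h is the metric with scale factor 1 and
  sigma = 1 / rho.  The components of Ric = Lambda g not involving Lambda force sigma to be a
  sum alpha e^{i phi/3} + beta e^{-i phi/3} with alpha affine in p and beta independent
  of p, and decouple into one linear equation for alpha and one for beta.  Differentiating these
  equations with respect to p shows that w2 alpha = 0 and w1 beta = 0, so wherever an invariant
  is nonzero only one of the two exponentials survives, and either one alone gives a Ricci flat
  metric.  The equations for alpha and for beta integrate to the listed families.  When both
  invariants vanish, the equation for beta is equivalent to a flat linear connection on a
  bundle of rank three; a nonvanishing parallel section produces a flat metric in the
  conformal class.
*)
theory Submission
  imports Defs
begin

section \<open>Stability of smoothness and of partial derivatives under the operations used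
  below\<close>

section \<open>Calculus of smooth functions\<close>

text \<open>Multiplied by sigma, the Ricci tensor of h / sigma^2 is linear in sigma up to a multiple
  of h. All components of the Einstein equations therefore share one unknown factor, and those
  combinations in which the entries of h cancel are linear and free of Lambda.

  The domain U is an arbitrary open set, so its fibres over (x,y,p) or (x,y) may be disconnected.
  Hence the two exponential parts are taken as eigenprojections of d/dphi on U itself, the equations
  are studied on slices phi = const, and coefficients descend to functions of (x,y) only on
  coordinate boxes.

  The p-slope of alpha may vanish at some points. Where it is nonzero the first family arises, in
  the interior of its zero set the second, and boundary points belong to neither; this is why that
  case is a statement about a dense set, and why its converse rests on continuity.

  For the rank three system, w2 = 0 makes the coefficients independent of p, and its curvature is
  built from w1 and its p-derivative. Its solutions come from a Neumann series along rays in small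
  balls, and flatness upgrades the radial equation to the full system.\<close>

lemma times_cont_diff_on_continuous: "times_cont_diff_on k S f \<Longrightarrow> continuous_on S f"
  by (cases k) (auto simp: differentiable_imp_continuous_within continuous_at_imp_continuous_on)

lemma times_cont_diff_on_SucD: "times_cont_diff_on (Suc k) S f \<Longrightarrow> times_cont_diff_on k S f"
proof (induction k arbitrary: f)
  case 0
  then show ?case using times_cont_diff_on_continuous by fastforce
next
  case (Suc k)
  then show ?case by (metis times_cont_diff_on.simps(2))
qed

text \<open>Functions agreeing near \<open>x\<close> have the same set of derivatives there,
  possibly empty, so the choice operator inside \<open>frechet_derivative\<close> returns the same
  map for both. Every later congruence for \<open>pd\<close> therefore holds at points of
  non-differentiability too.\<close>

lemma frechet_derivative_cong_open:
  assumes "open S" "x \<in> S" "\<And>y. y \<in> S \<Longrightarrow> f y = g y"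
  shows "frechet_derivative f (at x) = frechet_derivative g (at x)"
proof -
  have "(f has_derivative D) (at x) \<longleftrightarrow> (g has_derivative D) (at x)" for D
    using has_derivative_transform_within_open[OF _ assms(1,2)] assms(3) by metis
  then show ?thesis by (simp add: frechet_derivative_def)
qed

lemma differentiable_cong_open:
  assumes "open S" "x \<in> S" "\<And>y. y \<in> S \<Longrightarrow> f y = g y" "f differentiable (at x)"
  shows "g differentiable (at x)"
  using assms has_derivative_transform_within_open unfolding differentiable_def by metis

lemma times_cont_diff_on_cong:
  assumes "open S" "\<And>x. x \<in> S \<Longrightarrow> f x = g x" "times_cont_diff_on k S f"
  shows "times_cont_diff_on k S g"
  using assms(2,3)
proof (induction k arbitrary: f g)
  case 0
  then show ?case by (metis continuous_on_cong times_cont_diff_on.simps(1))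
next
  case (Suc k)
  have e: "frechet_derivative f (at x) = frechet_derivative g (at x)" if "x \<in> S" for x
    using frechet_derivative_cong_open[OF assms(1) that] Suc.prems(1) by blast
  have "times_cont_diff_on k S (\<lambda>x. frechet_derivative g (at x) v)" for v
    by (rule Suc.IH[of "\<lambda>x. frechet_derivative f (at x) v"]) (use Suc.prems e in simp_all)
  moreover have "g differentiable (at x)" if "x \<in> S" for x
    using differentiable_cong_open[OF assms(1) that, of f g] Suc.prems that by simp
  ultimately show ?case by simp
qed

lemma times_cont_diff_on_subset: "times_cont_diff_on k S f \<Longrightarrow> T \<subseteq> S \<Longrightarrow> times_cont_diff_on k T f"
proof (induction k arbitrary: f)
  case 0
  then show ?case using continuous_on_subset by auto
next
  case (Suc k)
  then show ?case by (simp add: subset_eq)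
qed

text \<open>The recursive clause speaks of the total function sending \<open>x\<close> to
  \<open>frechet_derivative f (at x) v\<close>, while the rules of calculus provide a derivative
  \<open>f'\<close> on \<open>S\<close> only. Since \<open>S\<close> is open,
  \<open>times_cont_diff_on_cong\<close> bridges the two.\<close>

lemma times_cont_diff_on_SucI:
  assumes "open S" "\<And>x. x \<in> S \<Longrightarrow> (f has_derivative f' x) (at x)"
    and "\<And>v. times_cont_diff_on k S (\<lambda>x. f' x v)"
  shows "times_cont_diff_on (Suc k) S f"
proof -
  have "times_cont_diff_on k S (\<lambda>x. frechet_derivative f (at x) v)" for v
    by (rule times_cont_diff_on_cong[OF assms(1) _ assms(3)[of v]])
      (use assms(2) frechet_derivative_at in metis)
  then show ?thesis using assms(2) by (auto simp: differentiable_def)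
qed

lemma times_cont_diff_on_has_derivative:
  "times_cont_diff_on (Suc k) S f \<Longrightarrow> x \<in> S \<Longrightarrow> (f has_derivative frechet_derivative f (at x)) (at x)"
  by (simp add: frechet_derivative_works)

lemma times_cont_diff_on_const: "times_cont_diff_on k S (\<lambda>x. c)"
  by (induction k arbitrary: c) auto

lemma times_cont_diff_on_bounded_linear:
  assumes "bounded_linear f" shows "times_cont_diff_on k S f"
proof (cases k)
  case 0
  then show ?thesis using assms by (simp add: linear_continuous_on)
next
  case (Suc n)
  have d: "(f has_derivative f) (at x)" for x
    by (rule bounded_linear_imp_has_derivative[OF assms])
  then have "frechet_derivative f (at x) = f" for x
    by (metis frechet_derivative_at)
  then show ?thesis using Suc d by (auto simp: differentiable_def times_cont_diff_on_const)
qed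

lemma times_cont_diff_on_add:
  assumes "open S" "times_cont_diff_on k S f" "times_cont_diff_on k S g"
  shows "times_cont_diff_on k S (\<lambda>x. f x + g x)"
  using assms(2,3)
proof (induction k arbitrary: f g)
  case 0
  then show ?case by (auto intro: continuous_on_add)
next
  case (Suc k)
  show ?case
    by (rule times_cont_diff_on_SucI[OF assms(1) has_derivative_add[OF
            times_cont_diff_on_has_derivative[OF Suc.prems(1)]
            times_cont_diff_on_has_derivative[OF Suc.prems(2)]]])
      (use Suc in auto)
qed

lemma times_cont_diff_on_mult:
  fixes f g :: "'a::real_normed_vector \<Rightarrow> real"
  assumes "open S" "times_cont_diff_on k S f" "times_cont_diff_on k S g"
  shows "times_cont_diff_on k S (\<lambda>x. f x * g x)"
  using assms(2,3)
proof (induction k arbitrary: f g)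
  case 0
  then show ?case by (auto intro: continuous_on_mult)
next
  case (Suc k)
  show ?case
    by (rule times_cont_diff_on_SucI[OF assms(1) has_derivative_mult[OF
            times_cont_diff_on_has_derivative[OF Suc.prems(1)]
            times_cont_diff_on_has_derivative[OF Suc.prems(2)]]])
      (use Suc times_cont_diff_on_SucD[OF Suc.prems(1)] times_cont_diff_on_SucD[OF Suc.prems(2)]
        in \<open>auto intro!: times_cont_diff_on_add assms(1)\<close>)
qed

lemma times_cont_diff_on_exp:
  fixes f :: "'a::real_normed_vector \<Rightarrow> real"
  assumes "open S" "times_cont_diff_on k S f"
  shows "times_cont_diff_on k S (\<lambda>x. exp (f x))"
  using assms(2)
proof (induction k arbitrary: f)
  case 0
  then show ?case by (auto intro: continuous_on_exp)
next
  case (Suc k)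
  show ?case
  proof (rule times_cont_diff_on_SucI[OF assms(1)])
    show "((\<lambda>x. exp (f x)) has_derivative (\<lambda>v. exp (f x) * frechet_derivative f (at x) v)) (at x)"
      if "x \<in> S" for x
      by (rule derivative_eq_intros refl times_cont_diff_on_has_derivative[OF Suc.prems that])+ auto
  qed (use Suc times_cont_diff_on_SucD[OF Suc.prems] in
      \<open>auto intro!: times_cont_diff_on_mult assms(1)\<close>)
qed

lemma times_cont_diff_on_inverse:
  fixes f :: "'a::real_normed_vector \<Rightarrow> real"
  assumes "open S" "times_cont_diff_on k S f" "\<And>x. x \<in> S \<Longrightarrow> f x \<noteq> 0"
  shows "times_cont_diff_on k S (\<lambda>x. inverse (f x))"
  using assms(2,3)
proof (induction k arbitrary: f)
  case 0
  then show ?case by (auto intro: continuous_on_inverse)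
next
  case (Suc k)
  show ?case
  proof (rule times_cont_diff_on_SucI[OF assms(1)])
    show "((\<lambda>x. inverse (f x)) has_derivative
        (\<lambda>v. - 1 * (inverse (f x) * (frechet_derivative f (at x) v * inverse (f x))))) (at x)"
      if "x \<in> S" for x
      by (rule has_derivative_eq_rhs[OF Deriv.has_derivative_inverse[OF Suc.prems(2)[OF that]
            times_cont_diff_on_has_derivative[OF Suc.prems(1) that]]]) auto
  next
    have i: "times_cont_diff_on k S (\<lambda>x. inverse (f x))"
      using Suc times_cont_diff_on_SucD by blast
    show "times_cont_diff_on k S
        (\<lambda>x. - 1 * (inverse (f x) * (frechet_derivative f (at x) v * inverse (f x))))" for v
      by (intro times_cont_diff_on_mult times_cont_diff_on_const i assms(1))
        (use Suc.prems(1) in simp)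
  qed
qed

lemma times_cont_diff_on_ln:
  fixes f :: "'a::real_normed_vector \<Rightarrow> real"
  assumes "open S" "times_cont_diff_on k S f" "\<And>x. x \<in> S \<Longrightarrow> 0 < f x"
  shows "times_cont_diff_on k S (\<lambda>x. ln (f x))"
proof (cases k)
  case 0
  then show ?thesis using assms by (fastforce intro: continuous_on_ln)
next
  case (Suc n)
  show ?thesis unfolding Suc
  proof (rule times_cont_diff_on_SucI[OF assms(1)])
    show "((\<lambda>x. ln (f x)) has_derivative
        (\<lambda>v. inverse (f x) * frechet_derivative f (at x) v)) (at x)"
      if "x \<in> S" for x
      by (rule has_derivative_eq_rhs[OF has_derivative_ln[OF assms(3)[OF that]
            times_cont_diff_on_has_derivative[OF assms(2)[unfolded Suc] that]]]) auto
    show "times_cont_diff_on n S (\<lambda>x. inverse (f x) * frechet_derivative f (at x) v)" for v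
      using assms Suc times_cont_diff_on_SucD[OF assms(2)[unfolded Suc]]
      by (fastforce intro!: times_cont_diff_on_mult times_cont_diff_on_inverse)
  qed
qed

text \<open>All maps between the coordinate spaces are affine. Their derivative \<open>L\<close> is
  constant, so differentiating the composite gives again a composite with the same affine map and
  the induction closes without a chain rule of higher order.\<close>

lemma times_cont_diff_on_compose_affine:
  assumes "bounded_linear L" "times_cont_diff_on k T f" "open T" "open S" "\<And>x. x \<in> S \<Longrightarrow> c + L x \<in> T"
  shows "times_cont_diff_on k S (\<lambda>x. f (c + L x))"
  using assms(2)
proof (induction k arbitrary: f)
  case 0
  then have "continuous_on T f" by simp
  then show ?case
    using assms(5) by (auto intro!: continuous_on_compose2[of T f S "\<lambda>x. c + L x"] continuous_intros
      linear_continuous_on[OF assms(1)])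
next
  case (Suc k)
  show ?case
  proof (rule times_cont_diff_on_SucI[OF assms(4)])
    have a: "((\<lambda>x. c + L x) has_derivative L) (at x)" for x
      by (rule derivative_eq_intros refl bounded_linear_imp_has_derivative[OF assms(1)])+ auto
    show "((\<lambda>x. f (c + L x)) has_derivative
        (\<lambda>v. frechet_derivative f (at (c + L x)) (L v))) (at x)"
      if "x \<in> S" for x
      using diff_chain_at[OF a[of x] times_cont_diff_on_has_derivative[OF Suc.prems assms(5)[OF that]]]
      by (simp add: o_def)
  qed (use Suc in auto)
qed

lemma smooth_on_cong: "open S \<Longrightarrow> (\<And>x. x \<in> S \<Longrightarrow> f x = g x) \<Longrightarrow> smooth_on S f \<Longrightarrow> smooth_on S g"
  unfolding smooth_on_def using times_cont_diff_on_cong by blast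

lemma smooth_on_subset: "smooth_on S f \<Longrightarrow> T \<subseteq> S \<Longrightarrow> smooth_on T f"
  unfolding smooth_on_def using times_cont_diff_on_subset by blast

lemma smooth_on_differentiable: "smooth_on S f \<Longrightarrow> x \<in> S \<Longrightarrow> f differentiable (at x)"
  unfolding smooth_on_def by (metis times_cont_diff_on.simps(2))

lemma smooth_on_continuous: "smooth_on S f \<Longrightarrow> continuous_on S f"
  unfolding smooth_on_def using times_cont_diff_on_continuous by blast

lemma smooth_on_frechet_derivative:
  "smooth_on S f \<Longrightarrow> smooth_on S (\<lambda>x. frechet_derivative f (at x) v)"
  unfolding smooth_on_def by (metis times_cont_diff_on.simps(2))

lemma smooth_on_pd: "smooth_on S f \<Longrightarrow> smooth_on S (pd k f)"
  unfolding pd_def[abs_def] by (rule smooth_on_frechet_derivative)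

lemma smooth_on_const [simp]: "smooth_on S (\<lambda>x. c)"
  by (simp add: smooth_on_def times_cont_diff_on_const)

lemma smooth_on_bounded_linear: "bounded_linear f \<Longrightarrow> smooth_on S f"
  by (simp add: smooth_on_def times_cont_diff_on_bounded_linear)

lemma smooth_on_component: "smooth_on S (\<lambda>x::real^'n. x $ j)"
  by (rule smooth_on_bounded_linear) (rule bounded_linear_vec_nth)

lemma smooth_on_add: "open S \<Longrightarrow> smooth_on S f \<Longrightarrow> smooth_on S g \<Longrightarrow> smooth_on S (\<lambda>x. f x + g x)"
  by (simp add: smooth_on_def times_cont_diff_on_add)

lemma smooth_on_mult:
  fixes f g :: "'a::real_normed_vector \<Rightarrow> real"
  shows "open S \<Longrightarrow> smooth_on S f \<Longrightarrow> smooth_on S g \<Longrightarrow> smooth_on S (\<lambda>x. f x * g x)"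
  by (simp add: smooth_on_def times_cont_diff_on_mult)

lemma smooth_on_minus:
  fixes f :: "'a::real_normed_vector \<Rightarrow> real"
  shows "open S \<Longrightarrow> smooth_on S f \<Longrightarrow> smooth_on S (\<lambda>x. - f x)"
  using smooth_on_mult[of S "\<lambda>x. -1" f] by simp

lemma smooth_on_diff:
  fixes f g :: "'a::real_normed_vector \<Rightarrow> real"
  shows "open S \<Longrightarrow> smooth_on S f \<Longrightarrow> smooth_on S g \<Longrightarrow> smooth_on S (\<lambda>x. f x - g x)"
  using smooth_on_add[of S f "\<lambda>x. - g x"] smooth_on_minus[of S g] by simp

lemma smooth_on_exp:
  fixes f :: "'a::real_normed_vector \<Rightarrow> real"
  shows "open S \<Longrightarrow> smooth_on S f \<Longrightarrow> smooth_on S (\<lambda>x. exp (f x))"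
  by (simp add: smooth_on_def times_cont_diff_on_exp)

lemma smooth_on_inverse:
  fixes f :: "'a::real_normed_vector \<Rightarrow> real"
  shows "open S \<Longrightarrow> smooth_on S f \<Longrightarrow> (\<And>x. x \<in> S \<Longrightarrow> f x \<noteq> 0) \<Longrightarrow> smooth_on S (\<lambda>x. inverse (f x))"
  by (simp add: smooth_on_def times_cont_diff_on_inverse)

lemma smooth_on_divide:
  fixes f g :: "'a::real_normed_vector \<Rightarrow> real"
  shows "open S \<Longrightarrow> smooth_on S f \<Longrightarrow> smooth_on S g \<Longrightarrow> (\<And>x. x \<in> S \<Longrightarrow> g x \<noteq> 0) \<Longrightarrow>
    smooth_on S (\<lambda>x. f x / g x)"
  unfolding divide_inverse by (intro smooth_on_mult smooth_on_inverse)

lemma smooth_on_ln: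
  fixes f :: "'a::real_normed_vector \<Rightarrow> real"
  shows "open S \<Longrightarrow> smooth_on S f \<Longrightarrow> (\<And>x. x \<in> S \<Longrightarrow> 0 < f x) \<Longrightarrow> smooth_on S (\<lambda>x. ln (f x))"
  by (simp add: smooth_on_def times_cont_diff_on_ln)

lemma smooth_on_power:
  fixes f :: "'a::real_normed_vector \<Rightarrow> real"
  shows "open S \<Longrightarrow> smooth_on S f \<Longrightarrow> smooth_on S (\<lambda>x. f x ^ n)"
  by (induction n) (auto intro: smooth_on_mult)

lemma smooth_on_compose_affine:
  "bounded_linear L \<Longrightarrow> smooth_on T f \<Longrightarrow> open T \<Longrightarrow> open S \<Longrightarrow> (\<And>x. x \<in> S \<Longrightarrow> c + L x \<in> T) \<Longrightarrow>
    smooth_on S (\<lambda>x. f (c + L x))"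
  unfolding smooth_on_def using times_cont_diff_on_compose_affine by blast

lemma smooth_on_sum:
  assumes "open S" "\<And>i. i \<in> I \<Longrightarrow> smooth_on S (f i)"
  shows "smooth_on S (\<lambda>x. \<Sum>i\<in>I. f i x)"
  using assms(2) by (induction I rule: infinite_finite_induct) (auto intro: smooth_on_add assms(1))

lemmas smooth_intros = smooth_on_const smooth_on_component smooth_on_add smooth_on_mult
  smooth_on_minus smooth_on_diff smooth_on_exp smooth_on_power smooth_on_pd smooth_on_sum

subsection \<open>Partial derivatives\<close>

lemma pd_cong:
  assumes "open S" "z \<in> S" "\<And>w. w \<in> S \<Longrightarrow> f w = g w"
  shows "pd k f z = pd k g z"
  unfolding pd_def using frechet_derivative_cong_open[OF assms] by simp

lemma pd_eqI: "(f has_derivative f') (at z) \<Longrightarrow> pd k f z = f' (axis k 1)"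
  unfolding pd_def using frechet_derivative_at by metis

lemma pd_const [simp]: "pd k (\<lambda>w. c) z = 0"
  by (simp add: pd_def)

lemma pd_component [simp]: "pd k (\<lambda>w. w $ j) z = (if j = k then 1 else 0)"
  by (subst pd_eqI[OF bounded_linear_imp_has_derivative[OF bounded_linear_vec_nth]])
    (auto simp: axis_def)

lemma pd_add [simp]:
  "f differentiable (at z) \<Longrightarrow> g differentiable (at z) \<Longrightarrow>
    pd k (\<lambda>w. f w + g w) z = pd k f z + pd k g z"
  by (subst pd_eqI[OF has_derivative_add]) (auto simp: frechet_derivative_works pd_def)

lemma pd_minus [simp]:
  "f differentiable (at z) \<Longrightarrow> pd k (\<lambda>w. - f w) z = - pd k f z"
  by (subst pd_eqI[OF has_derivative_minus]) (auto simp: frechet_derivative_works pd_def)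

lemma pd_diff [simp]:
  "f differentiable (at z) \<Longrightarrow> g differentiable (at z) \<Longrightarrow>
    pd k (\<lambda>w. f w - g w) z = pd k f z - pd k g z"
  by (subst pd_eqI[OF has_derivative_diff]) (auto simp: frechet_derivative_works pd_def)

lemma pd_mult [simp]:
  "f differentiable (at z) \<Longrightarrow> g differentiable (at z) \<Longrightarrow>
    pd k (\<lambda>w. f w * g w) z = f z * pd k g z + pd k f z * g z"
  by (subst pd_eqI[OF has_derivative_mult]) (auto simp: frechet_derivative_works pd_def)

lemma pd_divide [simp]:
  assumes "f differentiable (at z)" "g differentiable (at z)" "g z \<noteq> 0"
  shows "pd k (\<lambda>w. f w / g w) z = (pd k f z * g z - f z * pd k g z) / (g z * g z)"
  by (subst pd_eqI[OF has_derivative_divide'])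
    (use assms in \<open>auto simp: frechet_derivative_works pd_def\<close>)

lemma pd_power [simp]:
  assumes "f differentiable (at z)"
  shows "pd k (\<lambda>w. f w ^ n) z = of_nat n * pd k f z * f z ^ (n - 1)"
  by (subst pd_eqI[OF has_derivative_power])
    (use assms in \<open>auto simp: frechet_derivative_works pd_def\<close>)

lemma pd_exp [simp]:
  assumes "f differentiable (at z)"
  shows "pd k (\<lambda>w. exp (f w)) z = exp (f z) * pd k f z"
  by (subst pd_eqI[OF has_derivative_exp])
    (use assms in \<open>auto simp: frechet_derivative_works pd_def\<close>)

lemma pd_sum [simp]:
  assumes "\<And>i. i \<in> I \<Longrightarrow> f i differentiable (at z)"
  shows "pd k (\<lambda>w. \<Sum>i\<in>I. f i w) z = (\<Sum>i\<in>I. pd k (f i) z)"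
  by (subst pd_eqI[OF has_derivative_sum])
    (use assms in \<open>auto simp: frechet_derivative_works pd_def\<close>)

lemma differentiable_exp [simp]:
  fixes f :: "'a::real_normed_vector \<Rightarrow> real"
  assumes "f differentiable (at z)"
  shows "(\<lambda>w. exp (f w)) differentiable (at z)"
  using has_derivative_exp assms unfolding differentiable_def by blast

lemma differentiable_component [simp]: "(\<lambda>w::real^'n. w $ j) differentiable (at z)"
  by (rule bounded_linear_imp_differentiable) (rule bounded_linear_vec_nth)

lemma pd_compose_affine:
  assumes "bounded_linear L" "f differentiable (at (c + L z))" "L (axis k 1) = axis m 1"
  shows "pd k (\<lambda>w. f (c + L w)) z = pd m f (c + L z)"
proof -
  have "((\<lambda>w. c + L w) has_derivative L) (at z)"
    by (rule derivative_eq_intros refl bounded_linear_imp_has_derivative[OF assms(1)])+ auto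
  from diff_chain_at[OF this] assms(2)
  show ?thesis
    by (subst pd_eqI[of _ "frechet_derivative f (at (c + L z)) \<circ> L"])
      (auto simp: frechet_derivative_works o_def assms(3) pd_def)
qed

lemma differentiable_compose_affine:
  assumes "bounded_linear L" "f differentiable (at (c + L z))"
  shows "(\<lambda>w. f (c + L w)) differentiable (at z)"
proof -
  have "((\<lambda>w. c + L w) has_derivative L) (at z)"
    by (rule derivative_eq_intros refl bounded_linear_imp_has_derivative[OF assms(1)])+ auto
  from diff_chain_at[OF this] assms(2)
  show ?thesis unfolding differentiable_def by (auto simp: o_def)
qed

lemma has_real_derivative_pd:
  assumes "f differentiable (at (z + t *\<^sub>R axis k 1))"
  shows "((\<lambda>s. f (z + s *\<^sub>R axis k 1)) has_real_derivative pd k f (z + t *\<^sub>R axis k 1)) (at t)"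
proof -
  let ?F = "frechet_derivative f (at (z + t *\<^sub>R axis k 1))"
  have F: "(f has_derivative ?F) (at (z + t *\<^sub>R axis k 1))"
    using assms frechet_derivative_works by blast
  have "((\<lambda>s. z + s *\<^sub>R axis k (1::real)) has_derivative (\<lambda>s. s *\<^sub>R axis k 1)) (at t)"
    by (auto intro!: derivative_eq_intros)
  from diff_chain_at[OF this F]
  have "((\<lambda>s. f (z + s *\<^sub>R axis k 1)) has_derivative (\<lambda>s. ?F (s *\<^sub>R axis k 1))) (at t)"
    by (simp add: o_def)
  moreover have "?F (s *\<^sub>R axis k 1) = s * ?F (axis k 1)" for s
    using has_derivative_linear[OF F] by (simp add: linear_cmul)
  moreover have "(\<lambda>s. s * c) = (*) c" for c :: real by (simp add: fun_eq_iff mult.commute)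
  ultimately show ?thesis
    by (simp add: has_field_derivative_def pd_def)
qed

lemma frechet_derivative_eq_sum_pd:
  assumes "f differentiable (at z)"
  shows "frechet_derivative f (at z) v = (\<Sum>j\<in>UNIV. v $ j * pd j f z)"
proof -
  have l: "linear (frechet_derivative f (at z))" using assms linear_frechet_derivative by blast
  have "frechet_derivative f (at z) v = frechet_derivative f (at z) (\<Sum>j\<in>UNIV. v $ j *\<^sub>R axis j 1)"
    by (simp add: basis_expansion scalar_mult_eq_scaleR[symmetric])
  also have "\<dots> = (\<Sum>j\<in>UNIV. v $ j * pd j f z)"
    using l by (simp add: linear_sum linear_cmul pd_def)
  finally show ?thesis .
qed

text \<open>Two applications of the mean value theorem express the second difference of \<open>f\<close>
  through \<open>pd j (pd i f)\<close>; the second difference is symmetric in \<open>i\<close> and \<open>j\<close>.\<close>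

lemma second_difference_tendsto:
  fixes f :: "real^'n::finite \<Rightarrow> real"
  assumes "open S" "z \<in> S" and f: "\<And>w. w \<in> S \<Longrightarrow> f differentiable (at w)"
    and fi: "pd i f differentiable (at z)"
  shows "((\<lambda>h. (f (z + h *\<^sub>R axis i 1 + h *\<^sub>R axis j 1) - f (z + h *\<^sub>R axis i 1)
      - f (z + h *\<^sub>R axis j 1) + f z) / h\<^sup>2) \<longlongrightarrow> pd j (pd i f) z) (at_right 0)"
    (is "(?q \<longlongrightarrow> _) _")
proof (rule tendstoI)
  fix e :: real assume "e > 0"
  let ?i = "axis i 1 :: real^'n" and ?j = "axis j 1 :: real^'n"
  obtain r where r: "r > 0" "ball z r \<subseteq> S" using assms(1,2) openE by blast
  let ?D = "frechet_derivative (pd i f) (at z)"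
  have "(pd i f has_derivative ?D) (at z)" using fi frechet_derivative_works by blast
  then obtain d where d: "d > 0"
    "\<And>y. norm (y - z) < d \<Longrightarrow> norm (pd i f y - pd i f z - ?D (y - z)) \<le> e/4 * norm (y - z)"
    using \<open>e > 0\<close> unfolding has_derivative_at_alt by (metis divide_pos_pos zero_less_numeral)
  have lin: "linear ?D" using fi linear_frechet_derivative by blast
  define b where "b = min d r / 2"
  have b: "b > 0" "2 * b \<le> d" "2 * b \<le> r" using d r by (auto simp: b_def)
  have "dist (?q h) (pd j (pd i f) z) < e" if h: "0 < h" "h < b" for h
  proof -
    have n: "norm (s *\<^sub>R ?i + t *\<^sub>R ?j) \<le> 2 * h" if "0 \<le> s" "s \<le> h" "0 \<le> t" "t \<le> h" for s t
      using norm_triangle_ineq[of "s *\<^sub>R ?i" "t *\<^sub>R ?j"] that by simp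
    have inS: "z + s *\<^sub>R ?i + t *\<^sub>R ?j \<in> S" if "0 \<le> s" "s \<le> h" "0 \<le> t" "t \<le> h" for s t
    proof -
      have "dist z (z + (s *\<^sub>R ?i + t *\<^sub>R ?j)) < r"
        using n[OF that] h b dist_add_cancel[of z 0 "s *\<^sub>R ?i + t *\<^sub>R ?j"] by simp
      then show ?thesis using r by (auto simp: add.assoc)
    qed
    \<comment> \<open>The mean value theorem along \<open>?i\<close>, applied to the difference of
      \<open>f\<close> on two parallel lines, leaves two values of \<open>pd i f\<close> at
      displacements of norm at most 2h and h from \<open>z\<close>. Comparing both with the
      derivative of \<open>pd i f\<close> at \<open>z\<close>, whose values on the two displacements
      differ by \<open>h * pd j (pd i f) z\<close>, costs at most 3/4 e h, which is below e
      h.\<close>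
    let ?\<phi> = "\<lambda>s. f ((z + h *\<^sub>R ?j) + s *\<^sub>R ?i) - f (z + s *\<^sub>R ?i)"
    have "(?\<phi> has_real_derivative
        pd i f ((z + h *\<^sub>R ?j) + s *\<^sub>R ?i) - pd i f (z + s *\<^sub>R ?i)) (at s)"
      if "0 \<le> s" "s \<le> h" for s
      using inS[of s h] inS[of s 0] that h
      by (intro DERIV_diff has_real_derivative_pd f) (auto simp: ac_simps)
    from MVT2[OF h(1) this] obtain s where s: "0 < s" "s < h" and \<phi>: "?\<phi> h - ?\<phi> 0 =
        (h - 0) * (pd i f ((z + h *\<^sub>R ?j) + s *\<^sub>R ?i) - pd i f (z + s *\<^sub>R ?i))"
      by blast
    have D2: "\<bar>pd i f (z + v) - pd i f z - ?D v\<bar> \<le> e/4 * c" if "norm v \<le> c" "c < d" for v c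
      using order_trans[OF d(2)[of "z + v"], of "e/4 * c"] that \<open>e > 0\<close> by simp
    have e1: "\<bar>pd i f ((z + h *\<^sub>R ?j) + s *\<^sub>R ?i) - pd i f z - ?D (s *\<^sub>R ?i + h *\<^sub>R ?j)\<bar> \<le> e/4 * (2 * h)"
      using D2[OF n[of s h]] s h b by (simp add: ac_simps)
    have e2: "\<bar>pd i f (z + s *\<^sub>R ?i) - pd i f z - ?D (s *\<^sub>R ?i)\<bar> \<le> e/4 * h"
      using D2[of "s *\<^sub>R ?i" h] s h b by simp
    have D: "?D (s *\<^sub>R ?i + h *\<^sub>R ?j) = ?D (s *\<^sub>R ?i) + h * pd j (pd i f) z"
      using lin by (simp add: linear_add linear_cmul pd_def)
    have "?q h = (?\<phi> h - ?\<phi> 0) / h\<^sup>2" by (simp add: algebra_simps)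
    also have "\<dots> = (pd i f ((z + h *\<^sub>R ?j) + s *\<^sub>R ?i) - pd i f (z + s *\<^sub>R ?i)) / h"
      unfolding \<phi> using h by (simp add: power2_eq_square)
    finally have q: "?q h = (pd i f ((z + h *\<^sub>R ?j) + s *\<^sub>R ?i) - pd i f (z + s *\<^sub>R ?i)) / h" .
    have "X / h - Y = (X - h * Y) / h" for X Y using h by (simp add: field_simps)
    then have "\<bar>?q h - pd j (pd i f) z\<bar> =
      \<bar>pd i f ((z + h *\<^sub>R ?j) + s *\<^sub>R ?i) - pd i f (z + s *\<^sub>R ?i) - h * pd j (pd i f) z\<bar> / h"
      unfolding q using h by (simp only: abs_divide abs_of_pos)
    also have "\<dots> \<le> (e/4 * (2 * h) + e/4 * h) / h"
      using e1 e2 h unfolding D by (intro divide_right_mono) linarith+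
    also have "\<dots> < e" using h \<open>e > 0\<close> by (simp add: field_simps)
    finally show ?thesis by (simp add: dist_norm)
  qed
  then show "\<forall>\<^sub>F h in at_right 0. dist (?q h) (pd j (pd i f) z) < e"
    using b(1) eventually_at_right_field by blast
qed

lemma pd_commute:
  fixes f :: "real^'n::finite \<Rightarrow> real"
  assumes "open S" "z \<in> S" "smooth_on S f"
  shows "pd i (pd j f) z = pd j (pd i f) z"
proof (rule tendsto_unique[OF trivial_limit_at_right_real])
  have d: "f differentiable (at w)" if "w \<in> S" for w
    using assms(3) that smooth_on_differentiable by blast
  have d2: "pd k f differentiable (at z)" for k
    using assms(2,3) smooth_on_differentiable smooth_on_pd by blast
  note q = second_difference_tendsto[OF assms(1,2) d d2]
  show "((\<lambda>h. (f (z + h *\<^sub>R axis i 1 + h *\<^sub>R axis j 1) - f (z + h *\<^sub>R axis i 1)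
      - f (z + h *\<^sub>R axis j 1) + f z) / h\<^sup>2) \<longlongrightarrow> pd j (pd i f) z) (at_right 0)"
    by (rule q)
  show "((\<lambda>h. (f (z + h *\<^sub>R axis i 1 + h *\<^sub>R axis j 1) - f (z + h *\<^sub>R axis i 1)
      - f (z + h *\<^sub>R axis j 1) + f z) / h\<^sup>2) \<longlongrightarrow> pd i (pd j f) z) (at_right 0)"
    using q[of j i] by (simp add: algebra_simps)
qed

text \<open>Bootstrapping: if all components of \<open>W\<close> are of class k, the system
  expresses their derivatives through smooth coefficients and functions of class k, so the
  components are of class k + 1. Differentiability supplies the start at k = 0.\<close>

lemma smooth_on_linear_system:
  fixes W :: "'m::finite \<Rightarrow> real^'n::finite \<Rightarrow> real"
  assumes "open S" and M: "\<And>j a b. smooth_on S (M j a b)"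
    and d: "\<And>a x. x \<in> S \<Longrightarrow> W a differentiable (at x)"
    and W: "\<And>j a x. x \<in> S \<Longrightarrow> pd j (W a) x = (\<Sum>b\<in>UNIV. M j a b x * W b x)"
  shows "smooth_on S (W a)"
proof -
  have sum: "times_cont_diff_on k S (\<lambda>x. \<Sum>i\<in>I. g i x)"
    if "\<And>i. times_cont_diff_on k S (g i)" for k and I :: "'c::finite set" and g :: "'c \<Rightarrow> real^'n \<Rightarrow> real"
  proof -
    have "finite I" by simp
    then show ?thesis
      by (induction I) (auto intro: times_cont_diff_on_add[OF assms(1)] times_cont_diff_on_const that)
  qed
  have "times_cont_diff_on k S (W a)" for k a
  proof (induction k arbitrary: a)
    case 0
    then show ?case using d by (auto simp: differentiable_imp_continuous_within continuous_at_imp_continuous_on)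
  next
    case (Suc k)
    have "times_cont_diff_on k S (\<lambda>x. \<Sum>j\<in>UNIV. v $ j * (\<Sum>b\<in>UNIV. M j a b x * W b x))" for v
      by (intro sum times_cont_diff_on_mult times_cont_diff_on_const assms(1) Suc.IH)
        (use M[unfolded smooth_on_def] in blast)
    then have "times_cont_diff_on k S (\<lambda>x. frechet_derivative (W a) (at x) v)" for v
      by (rule times_cont_diff_on_cong[OF assms(1), rotated])
        (simp add: frechet_derivative_eq_sum_pd[OF d] W)
    then show ?case using d by simp
  qed
  then show ?thesis by (simp add: smooth_on_def)
qed

subsection \<open>Mixed partial derivatives on the jet space\<close>

text \<open>Derivatives are kept in a fixed order, x outermost and p innermost, so that every jet
  has a single name and identities between jets become polynomial identities for the simplifier.
  Appending an x-derivative is then definitional, whereas y- and p-derivatives have to be commuted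
  inwards.\<close>

definition mpd :: "nat \<Rightarrow> nat \<Rightarrow> nat \<Rightarrow> (real^3 \<Rightarrow> real) \<Rightarrow> real^3 \<Rightarrow> real" where
  "mpd a b c f = (pd 1 ^^ a) ((pd 2 ^^ b) ((pd 3 ^^ c) f))"

lemma smooth_on_funpow_pd: "smooth_on S f \<Longrightarrow> smooth_on S ((pd k ^^ n) f)"
  by (induction n) (auto intro: smooth_on_pd)

lemma smooth_on_mpd: "smooth_on S f \<Longrightarrow> smooth_on S (mpd a b c f)"
  unfolding mpd_def by (intro smooth_on_funpow_pd)

lemma mpd_0 [simp]: "mpd 0 0 0 f = f"
  by (simp add: mpd_def)

lemma pd1_mpd [simp]: "pd 1 (mpd a b c f) = mpd (Suc a) b c f"
  by (simp add: mpd_def)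

lemma pd2_mpd_0 [simp]: "pd 2 (mpd 0 b c f) = mpd 0 (Suc b) c f"
  by (simp add: mpd_def)

lemma pd3_mpd_0 [simp]: "pd 3 (mpd 0 0 c f) = mpd 0 0 (Suc c) f"
  by (simp add: mpd_def)

lemma pd2_mpd:
  assumes "open S" "smooth_on S f" "v \<in> S"
  shows "pd 2 (mpd a b c f) v = mpd a (Suc b) c f v"
  using assms(3)
proof (induction a arbitrary: v)
  case (Suc a)
  have "pd 2 (mpd (Suc a) b c f) v = pd 1 (pd 2 (mpd a b c f)) v"
    using pd_commute[OF assms(1) Suc.prems smooth_on_mpd[OF assms(2), of a b c], of 2 1] by simp
  also have "\<dots> = pd 1 (mpd a (Suc b) c f) v"
    by (rule pd_cong[OF assms(1) Suc.prems Suc.IH])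
  finally show ?case by simp
qed simp

lemma pd3_mpd:
  assumes "open S" "smooth_on S f" "v \<in> S"
  shows "pd 3 (mpd a b c f) v = mpd a b (Suc c) f v"
  using assms(3)
proof (induction a arbitrary: v)
  case 0
  then show ?case
  proof (induction b arbitrary: v)
    case (Suc b)
    have "pd 3 (mpd 0 (Suc b) c f) v = pd 2 (pd 3 (mpd 0 b c f)) v"
      using pd_commute[OF assms(1) Suc.prems smooth_on_mpd[OF assms(2), of 0 b c], of 3 2] by simp
    also have "\<dots> = pd 2 (mpd 0 b (Suc c) f) v"
      by (rule pd_cong[OF assms(1) Suc.prems Suc.IH])
    finally show ?case by simp
  qed simp
next
  case (Suc a)
  have "pd 3 (mpd (Suc a) b c f) v = pd 1 (pd 3 (mpd a b c f)) v"
    using pd_commute[OF assms(1) Suc.prems smooth_on_mpd[OF assms(2), of a b c], of 3 1] by simp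
  also have "\<dots> = pd 1 (mpd a b (Suc c) f) v"
    by (rule pd_cong[OF assms(1) Suc.prems Suc.IH])
  finally show ?case by simp
qed

lemma mpd_cong:
  assumes "open S" "v \<in> S" "\<And>w. w \<in> S \<Longrightarrow> f w = g w"
  shows "mpd a b c f v = mpd a b c g v"
proof -
  have *: "\<forall>v\<in>S. (pd k ^^ n) f v = (pd k ^^ n) g v" if "\<forall>v\<in>S. f v = g v" for k :: 3 and n f g
  proof (induction n)
    case (Suc n)
    then show ?case using pd_cong[OF assms(1), of _ "(pd k ^^ n) f" "(pd k ^^ n) g" k] by simp
  qed (simp add: that)
  have "\<forall>v\<in>S. f v = g v" using assms(3) by blast
  from *[OF *[OF *[OF this]]] show ?thesis unfolding mpd_def using assms(2) by blast
qed

lemma mpd_differentiable [simp]: "smooth_on S f \<Longrightarrow> v \<in> S \<Longrightarrow> mpd a b c f differentiable (at v)"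
  using smooth_on_mpd smooth_on_differentiable by blast

section \<open>Linear projections and affine sections relating (x,y,p,phi), (x,y,p) and
  (x,y)\<close>

subsection \<open>The projections between the coordinate spaces\<close>

text \<open>The section of \<open>jet\<close> with phi = t. Slicing along it turns functions on
  \<open>U\<close> into functions on the jet space without any connectedness of the
  phi-fibres.\<close>

definition level :: "real \<Rightarrow> real^3 \<Rightarrow> real^4" where
  "level t v = vector [v $ 1, v $ 2, v $ 3, t]"

lemma vector_4 [simp]:
  "(vector [x,y,z,w] :: ('a::zero)^4) $ 1 = x"
  "(vector [x,y,z,w] :: ('a::zero)^4) $ 2 = y"
  "(vector [x,y,z,w] :: ('a::zero)^4) $ 3 = z"
  "(vector [x,y,z,w] :: ('a::zero)^4) $ 4 = w"
  unfolding vector_def by simp_all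

lemma jet_nth [simp]: "jet z $ 1 = z $ 1" "jet z $ 2 = z $ 2" "jet z $ 3 = z $ 3"
  by (simp_all add: jet_def)

lemma base_nth [simp]: "base v $ 1 = v $ 1" "base v $ 2 = v $ 2"
  by (simp_all add: base_def)

lemma level_nth [simp]: "level t v $ 1 = v $ 1" "level t v $ 2 = v $ 2" "level t v $ 3 = v $ 3"
    "level t v $ 4 = t"
  by (simp_all add: level_def)

lemma jet_level [simp]: "jet (level t v) = v"
  by (simp add: vec_eq_iff forall_3)

lemma level_jet [simp]: "level (z $ 4) (jet z) = z"
  by (simp add: vec_eq_iff forall_4)

lemma bounded_linear_jet: "bounded_linear jet"
  unfolding linear_conv_bounded_linear[symmetric] by (rule linearI; simp add: vec_eq_iff forall_3)

lemma bounded_linear_base: "bounded_linear base"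
  unfolding linear_conv_bounded_linear[symmetric] by (rule linearI; simp add: vec_eq_iff forall_2)

lemma bounded_linear_level0: "bounded_linear (level 0)"
  unfolding linear_conv_bounded_linear[symmetric] by (rule linearI; simp add: vec_eq_iff forall_4)

lemma level_affine: "level t v = axis 4 t + level 0 v"
  by (simp add: vec_eq_iff forall_4 axis_def)

lemma jet_axis [simp]: "jet (axis 1 x) = axis 1 x" "jet (axis 2 x) = axis 2 x"
  "jet (axis 3 x) = axis 3 x" "jet (axis 4 x) = 0"
  by (simp_all add: vec_eq_iff forall_3 axis_def)

lemma base_axis [simp]: "base (axis 1 x) = axis 1 x" "base (axis 2 x) = axis 2 x"
  "base (axis 3 x) = 0"
  by (simp_all add: vec_eq_iff forall_2 axis_def)

lemma level_axis [simp]: "level 0 (axis 1 x) = axis 1 x" "level 0 (axis 2 x) = axis 2 x"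
  "level 0 (axis 3 x) = axis 3 x"
  by (simp_all add: vec_eq_iff forall_4 axis_def)

lemma open_jet_image: "open U \<Longrightarrow> open (jet ` U)"
  by (rule open_surjective_linear_image)
    (auto simp: linear_conv_bounded_linear bounded_linear_jet surj_def intro: jet_level[symmetric])

lemma open_base_image: "open S \<Longrightarrow> open (base ` S)"
proof (rule open_surjective_linear_image)
  show "surj base"
    unfolding surj_def
  proof
    fix q :: "real^2"
    show "\<exists>v. q = base v"
      by (rule exI[of _ "vector [q $ 1, q $ 2, 0]"]) (simp add: vec_eq_iff forall_2)
  qed
qed (simp_all add: linear_conv_bounded_linear bounded_linear_base)

lemma open_level_vimage: "open U \<Longrightarrow> open (level t -` U)"
proof (rule open_vimage)
  have "level t = (\<lambda>v. axis 4 t + level 0 v)" by (rule ext) (rule level_affine)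
  then show "continuous_on UNIV (level t)"
    by (simp add: continuous_on_add linear_continuous_on bounded_linear_level0)
qed

lemma pd_compose_zero:
  assumes "bounded_linear L" "f differentiable (at (L z))" "L (axis k 1) = 0"
  shows "pd k (\<lambda>w. f (L w)) z = 0"
proof -
  from diff_chain_at[OF bounded_linear_imp_has_derivative[OF assms(1)], of f "frechet_derivative f (at (L z))" z] assms(2)
  have "((\<lambda>w. f (L w)) has_derivative (\<lambda>v. frechet_derivative f (at (L z)) (L v))) (at z)"
    by (auto simp: frechet_derivative_works o_def)
  from pd_eqI[OF this, of k] show ?thesis
    using assms(3) linear_0[OF linear_frechet_derivative[OF assms(2)]] by simp
qed

lemma pd_jet [simp]:
  assumes "F differentiable (at (jet z))"
  shows "pd 1 (\<lambda>w. F (jet w)) z = pd 1 F (jet z)" "pd 2 (\<lambda>w. F (jet w)) z = pd 2 F (jet z)"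
    "pd 3 (\<lambda>w. F (jet w)) z = pd 3 F (jet z)" "pd 4 (\<lambda>w. F (jet w)) z = 0"
  using pd_compose_affine[OF bounded_linear_jet, of F 0 z] pd_compose_zero[OF bounded_linear_jet, of F z 4]
    assms by simp_all

lemma differentiable_jet [simp]:
  "F differentiable (at (jet z)) \<Longrightarrow> (\<lambda>w. F (jet w)) differentiable (at z)"
  using differentiable_compose_affine[OF bounded_linear_jet, of F 0 z] by simp

lemma pd_base [simp]:
  assumes "F differentiable (at (base v))"
  shows "pd 1 (\<lambda>w. F (base w)) v = pd 1 F (base v)" "pd 2 (\<lambda>w. F (base w)) v = pd 2 F (base v)"
    "pd 3 (\<lambda>w. F (base w)) v = 0"
  using pd_compose_affine[OF bounded_linear_base, of F 0 v] pd_compose_zero[OF bounded_linear_base, of F v 3]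
    assms by simp_all

lemma differentiable_base [simp]:
  "F differentiable (at (base v)) \<Longrightarrow> (\<lambda>w. F (base w)) differentiable (at v)"
  using differentiable_compose_affine[OF bounded_linear_base, of F 0 v] by simp

lemma pd_level [simp]:
  assumes "f differentiable (at (level t v))"
  shows "pd 1 (\<lambda>w. f (level t w)) v = pd 1 f (level t v)" "pd 2 (\<lambda>w. f (level t w)) v = pd 2 f (level t v)"
    "pd 3 (\<lambda>w. f (level t w)) v = pd 3 f (level t v)"
  using pd_compose_affine[OF bounded_linear_level0, of f "axis 4 t" v] assms
  by (simp_all add: level_affine[symmetric])

lemma smooth_on_level:
  assumes "open U" "smooth_on U f"
  shows "smooth_on (level t -` U) (\<lambda>v. f (level t v))"
  using smooth_on_compose_affine[OF bounded_linear_level0 assms(2,1) open_level_vimage[OF assms(1), of t], of "axis 4 t"]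
  by (simp add: level_affine[symmetric])

lemma smooth_on_jet:
  assumes "open U" "smooth_on (jet ` U) F"
  shows "smooth_on U (\<lambda>z. F (jet z))"
  using smooth_on_compose_affine[OF bounded_linear_jet assms(2) open_jet_image[OF assms(1)] assms(1), of 0]
  by simp

lemma smooth_on_base:
  assumes "open S" "smooth_on (base ` S) F"
  shows "smooth_on S (\<lambda>z. F (base z))"
  using smooth_on_compose_affine[OF bounded_linear_base assms(2) open_base_image[OF assms(1)] assms(1), of 0]
  by simp

section \<open>Levi-Civita connection and Ricci tensor under a conformal rescaling in any
  dimension\<close>

section \<open>Conformal change of a metric\<close>

lemma matrix_inv_eqI:
  fixes A B :: "real^'n^'n"
  assumes "A ** B = mat 1" "B ** A = mat 1"
  shows "matrix_inv A = B"
proof -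
  have "A ** matrix_inv A = mat 1 \<and> matrix_inv A ** A = mat 1"
    unfolding matrix_inv_def by (rule someI[of _ B]) (use assms in simp)
  then show ?thesis
    by (metis assms(2) matrix_mul_assoc matrix_mul_lid matrix_mul_rid)
qed

text \<open>The inverse \<open>H\<close> is carried along as data because \<open>matrix_inv\<close>
  is defined by choice and shows no smoothness by itself. Symmetry is imposed at every point, so
  that symmetry of the Christoffel symbols is an equality of functions and may be rewritten under
  \<open>pd\<close>.\<close>

locale metric_patch =
  fixes U :: "(real^'n) set" and h H :: "real^'n \<Rightarrow> real^'n^'n"
  assumes open_U: "open U"
    and symmetric: "h z $ j $ k = h z $ k $ j"
    and smooth_h: "smooth_on U (\<lambda>z. h z $ j $ k)"
    and smooth_H: "smooth_on U (\<lambda>z. H z $ j $ k)"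
    and h_H: "z \<in> U \<Longrightarrow> h z ** H z = mat 1"
    and H_h: "z \<in> U \<Longrightarrow> H z ** h z = mat 1"
begin

abbreviation \<Gamma> :: "'n \<Rightarrow> 'n \<Rightarrow> 'n \<Rightarrow> real^'n \<Rightarrow> real" where "\<Gamma> \<equiv> christoffel h"

lemma matrix_inv_h: "z \<in> U \<Longrightarrow> matrix_inv (h z) = H z"
  using matrix_inv_eqI h_H H_h by blast

lemma sum_h_H: "z \<in> U \<Longrightarrow> (\<Sum>m\<in>UNIV. h z $ i $ m * H z $ m $ j) = (if i = j then 1 else 0)"
  using arg_cong[OF h_H, of z "\<lambda>M. M $ i $ j"] by (simp add: matrix_matrix_mult_def mat_def)

lemma sum_H_h: "z \<in> U \<Longrightarrow> (\<Sum>m\<in>UNIV. H z $ i $ m * h z $ m $ j) = (if i = j then 1 else 0)"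
  using arg_cong[OF H_h, of z "\<lambda>M. M $ i $ j"] by (simp add: matrix_matrix_mult_def mat_def)

lemma contract_h_H: "z \<in> U \<Longrightarrow> (\<Sum>m\<in>UNIV. h z $ i $ m * (\<Sum>j\<in>UNIV. H z $ m $ j * x j)) = x i"
proof -
  assume z: "z \<in> U"
  have "(\<Sum>m\<in>UNIV. h z $ i $ m * (\<Sum>j\<in>UNIV. H z $ m $ j * x j))
      = (\<Sum>j\<in>UNIV. (\<Sum>m\<in>UNIV. h z $ i $ m * H z $ m $ j) * x j)"
    by (simp add: sum_distrib_left sum_distrib_right mult.assoc) (rule sum.swap)
  also have "\<dots> = (\<Sum>j\<in>UNIV. if i = j then x j else 0)"
    by (rule sum.cong) (auto simp: sum_h_H[OF z])
  finally show ?thesis by simp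
qed

lemma christoffel_sym: "christoffel h l i j z = christoffel h l j i z"
  unfolding christoffel_def using symmetric by (simp add: algebra_simps)

text \<open>Lowering the upper index with \<open>h\<close> gives the Christoffel symbols of the
  first kind; in the sum of the two, all terms except the wanted derivative of \<open>h\<close>
  cancel by symmetry.\<close>

lemma metric_compatible:
  assumes "z \<in> U"
  shows "pd l (\<lambda>w. h w $ j $ k) z =
    (\<Sum>m\<in>UNIV. h z $ k $ m * christoffel h m l j z) + (\<Sum>m\<in>UNIV. h z $ j $ m * christoffel h m l k z)"
proof -
  have s: "pd a (\<lambda>w. h w $ b $ c) z = pd a (\<lambda>w. h w $ c $ b) z" for a b c
    using symmetric by metis
  have lower: "(\<Sum>m\<in>UNIV. h z $ k $ m * christoffel h m l j z) =
      (pd l (\<lambda>w. h w $ j $ k) z + pd j (\<lambda>w. h w $ l $ k) z - pd k (\<lambda>w. h w $ l $ j) z) / 2" for l j k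
    using contract_h_H[OF assms] unfolding christoffel_def matrix_inv_h[OF assms]
    by (simp add: sum_divide_distrib[symmetric])
  show ?thesis unfolding lower using s[of l j k] s[of j l k] s[of k l j] by (simp add: field_simps)
qed

lemma smooth_christoffel: "smooth_on U (christoffel h l i j)"
proof (rule smooth_on_cong[OF open_U])
  show "smooth_on U (\<lambda>z. (\<Sum>m\<in>UNIV. H z $ l $ m *
        (pd i (\<lambda>w. h w $ j $ m) z + pd j (\<lambda>w. h w $ i $ m) z - pd m (\<lambda>w. h w $ i $ j) z)) * (1/2))"
    by (intro smooth_intros smooth_h smooth_H open_U)
qed (simp add: christoffel_def matrix_inv_h)

text \<open>The trace of the Christoffel symbols is the logarithmic derivative of the volume
  density. When it vanishes on an open set, so do its derivatives and its contraction with the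
  symbols, and two of the four terms of the Ricci tensor drop out.\<close>

lemma ricci_trace_free:
  assumes "z \<in> U" and trace: "\<And>w k. w \<in> U \<Longrightarrow> (\<Sum>l\<in>UNIV. christoffel h l l k w) = 0"
  shows "ricci h z $ k $ j = (\<Sum>l\<in>UNIV. pd l (christoffel h l j k) z)
    - (\<Sum>l\<in>UNIV. \<Sum>m\<in>UNIV. christoffel h l j m z * christoffel h m l k z)"
proof -
  have "(\<Sum>l\<in>UNIV. pd j (christoffel h l l k) z) = pd j (\<lambda>w. \<Sum>l\<in>UNIV. christoffel h l l k w) z"
    using smooth_on_differentiable[OF smooth_christoffel assms(1)] by simp
  also have "\<dots> = pd j (\<lambda>_. 0) z"
    by (rule pd_cong[OF open_U assms(1) trace])
  also have "\<dots> = 0" by simp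
  finally have 1: "(\<Sum>l\<in>UNIV. pd j (christoffel h l l k) z) = 0" .
  have "(\<Sum>l\<in>UNIV. \<Sum>m\<in>UNIV. christoffel h l l m z * christoffel h m j k z) =
      (\<Sum>m\<in>UNIV. (\<Sum>l\<in>UNIV. christoffel h l l m z) * christoffel h m j k z)"
    unfolding sum_distrib_right by (rule sum.swap)
  then have 2: "(\<Sum>l\<in>UNIV. \<Sum>m\<in>UNIV. christoffel h l l m z * christoffel h m j k z) = 0"
    using trace[OF assms(1)] by simp
  show ?thesis
    unfolding ricci_def riemann_def vec_lambda_beta sum.distrib sum_subtractf 1 2 by simp
qed

end

locale conformal_patch = metric_patch U h H for U :: "(real^'n) set" and h H +
  fixes \<sigma> :: "real^'n \<Rightarrow> real"
  assumes smooth_s: "smooth_on U \<sigma>" and nonzero_s: "z \<in> U \<Longrightarrow> \<sigma> z \<noteq> 0"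
begin

text \<open>With the square of \<open>\<sigma>\<close> in the denominator, the Hessian of
  \<open>\<sigma>\<close> enters the Ricci tensor linearly and no tensor square of its differential
  appears.\<close>

definition g :: "real^'n \<Rightarrow> real^'n^'n" where "g z = (1 / (\<sigma> z)\<^sup>2) *\<^sub>R h z"

definition grad :: "'n \<Rightarrow> real^'n \<Rightarrow> real" where
  "grad l z = (\<Sum>m\<in>UNIV. H z $ l $ m * pd m \<sigma> z)"

lemma matrix_inv_g: "z \<in> U \<Longrightarrow> matrix_inv (g z) = (\<sigma> z)\<^sup>2 *\<^sub>R H z"
proof -
  assume z: "z \<in> U"
  have "(c *\<^sub>R A) ** (d *\<^sub>R B) = (c * d) *\<^sub>R (A ** B)" for c d and A B :: "real^'n^'n"
    by (simp add: matrix_matrix_mult_def vec_eq_iff sum_distrib_left ac_simps)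
  then show ?thesis
    by (intro matrix_inv_eqI) (simp_all add: g_def nonzero_s z h_H H_h)
qed

lemma h_grad: "z \<in> U \<Longrightarrow> (\<Sum>l\<in>UNIV. h z $ j $ l * grad l z) = pd j \<sigma> z"
  unfolding grad_def by (rule contract_h_H)

lemma diff_s: "z \<in> U \<Longrightarrow> \<sigma> differentiable (at z)"
  using smooth_s smooth_on_differentiable by blast

lemma diff_h: "z \<in> U \<Longrightarrow> (\<lambda>z. h z $ j $ k) differentiable (at z)"
  using smooth_h smooth_on_differentiable by blast

lemma pd_g:
  assumes "z \<in> U"
  shows "pd i (\<lambda>w. g w $ j $ k) z =
    pd i (\<lambda>w. h w $ j $ k) z / (\<sigma> z)\<^sup>2 - 2 * h z $ j $ k * pd i \<sigma> z / (\<sigma> z)^3"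
proof -
  have "pd i (\<lambda>w. g w $ j $ k) z = pd i (\<lambda>w. h w $ j $ k / (\<sigma> w)\<^sup>2) z"
    by (simp add: g_def)
  also have "\<dots> = (pd i (\<lambda>w. h w $ j $ k) z * (\<sigma> z)\<^sup>2 - h z $ j $ k * (2 * pd i \<sigma> z * \<sigma> z)) /
      ((\<sigma> z)\<^sup>2 * (\<sigma> z)\<^sup>2)"
    using assms diff_s diff_h nonzero_s by simp
  also have "\<dots> = pd i (\<lambda>w. h w $ j $ k) z / (\<sigma> z)\<^sup>2 - 2 * h z $ j $ k * pd i \<sigma> z / (\<sigma> z)^3"
    using nonzero_s[OF assms] by (simp add: field_simps power2_eq_square power3_eq_cube)
  finally show ?thesis .
qed

text \<open>The difference of the Levi-Civita connections of \<open>g\<close> and \<open>h\<close>.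
  For a conformal factor e^(2f) it is delta^l_i f_j + delta^l_j f_i - h_ij f^l; here f = - ln
  |sigma|.\<close>

definition shift :: "'n \<Rightarrow> 'n \<Rightarrow> 'n \<Rightarrow> real^'n \<Rightarrow> real" where
  "shift l i j z = (h z $ i $ j * grad l z - (if l = i then pd j \<sigma> z else 0) - (if l = j then pd i \<sigma> z else 0)) / \<sigma> z"

lemma christoffel_conformal:
  assumes "z \<in> U"
  shows "christoffel g l i j z = christoffel h l i j z + shift l i j z"
proof -
  have nz: "\<sigma> z \<noteq> 0" using assms nonzero_s by blast
  have sum_H_h': "(\<Sum>m\<in>UNIV. H z $ l $ m * h z $ j $ m) = (if l = j then 1 else 0)" for j
    using sum_H_h[OF assms, of l j] symmetric[of z j] by simp
  have e: "((\<sigma> z)\<^sup>2 * x) * ((a / (\<sigma> z)\<^sup>2 - 2 * b * c / (\<sigma> z)^3) + (a' / (\<sigma> z)\<^sup>2 - 2 * b' * c' / (\<sigma> z)^3)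
        - (a'' / (\<sigma> z)\<^sup>2 - 2 * b'' * c'' / (\<sigma> z)^3))
      = x * (a + a' - a'') + 2 / \<sigma> z * (x * c'' * b'' - x * b * c - x * b' * c')" for x a a' a'' b b' b'' c c' c''
  proof -
    have p: "(\<sigma> z)\<^sup>2 * (a / (\<sigma> z)\<^sup>2 - 2 * b * c / (\<sigma> z)^3) = a - 2 / \<sigma> z * (b * c)" for a b c
      using nz by (simp add: field_simps power2_eq_square power3_eq_cube)
    have q: "(s * x) * (p + q - r) = x * (s * p + s * q - s * r)" for s p q r :: real
      by (simp add: algebra_simps)
    show ?thesis unfolding q p by (simp add: algebra_simps)
  qed
  have "christoffel g l i j z =
    (\<Sum>m\<in>UNIV. H z $ l $ m * (pd i (\<lambda>w. h w $ j $ m) z + pd j (\<lambda>w. h w $ i $ m) z - pd m (\<lambda>w. h w $ i $ j) z)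
     + 2 / \<sigma> z * (H z $ l $ m * pd m \<sigma> z * h z $ i $ j - H z $ l $ m * h z $ j $ m * pd i \<sigma> z
       - H z $ l $ m * h z $ i $ m * pd j \<sigma> z)) / 2"
    unfolding christoffel_def matrix_inv_g[OF assms] pd_g[OF assms] vector_scaleR_component real_scaleR_def e ..
  also have "\<dots> = christoffel h l i j z + (1 / \<sigma> z) * ((\<Sum>m\<in>UNIV. H z $ l $ m * pd m \<sigma> z) * h z $ i $ j
      - (\<Sum>m\<in>UNIV. H z $ l $ m * h z $ j $ m) * pd i \<sigma> z - (\<Sum>m\<in>UNIV. H z $ l $ m * h z $ i $ m) * pd j \<sigma> z)"
    unfolding christoffel_def matrix_inv_h[OF assms] sum.distrib sum_distrib_left[symmetric] sum_subtractf
      sum_distrib_right[symmetric]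
    using nz by (simp add: add_divide_distrib diff_divide_distrib right_diff_distrib)
  also have "\<dots> = christoffel h l i j z + shift l i j z"
    unfolding sum_H_h' sum_H_h[OF assms] shift_def grad_def
    using nz symmetric[of z i j] by (simp add: field_simps)
  finally show ?thesis .
qed

lemma smooth_grad: "smooth_on U (grad l)"
proof (rule smooth_on_cong[OF open_U])
  show "smooth_on U (\<lambda>z. \<Sum>m\<in>UNIV. H z $ l $ m * pd m \<sigma> z)"
    by (intro smooth_intros smooth_H open_U smooth_s)
qed (simp add: grad_def)

lemma smooth_shift: "smooth_on U (shift l i j)"
proof -
  have "smooth_on U (if c then pd k \<sigma> else (\<lambda>_. 0))" for c k
    using smooth_on_pd[OF smooth_s] by simp
  then have "smooth_on U (\<lambda>z. if c then pd k \<sigma> z else 0)" for c k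
    by (cases c) (simp_all add: smooth_on_pd[OF smooth_s])
  then show ?thesis
    unfolding shift_def[abs_def]
    by (intro smooth_on_divide smooth_intros smooth_h smooth_grad open_U smooth_s nonzero_s)
qed

lemma pd_christoffel_g:
  assumes "z \<in> U"
  shows "pd k (christoffel g l i j) z = pd k (christoffel h l i j) z + pd k (shift l i j) z"
proof -
  have "pd k (christoffel g l i j) z = pd k (\<lambda>w. christoffel h l i j w + shift l i j w) z"
    by (rule pd_cong[OF open_U assms christoffel_conformal])
  then show ?thesis
    using smooth_on_differentiable[OF smooth_christoffel assms] smooth_on_differentiable[OF smooth_shift assms]
    by simp
qed

text \<open>Covariant and contravariant components of the differential of - ln |sigma|, the natural
  variables for contracting \<open>shift\<close>.\<close>

abbreviation \<tau> :: "'n \<Rightarrow> real^'n \<Rightarrow> real" where "\<tau> j z \<equiv> - pd j \<sigma> z / \<sigma> z"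
abbreviation \<omega> :: "'n \<Rightarrow> real^'n \<Rightarrow> real" where "\<omega> j z \<equiv> - grad j z / \<sigma> z"

lemma shift_eq: "shift l i j z =
    (if l = i then 1 else 0) * \<tau> j z + (if l = j then 1 else 0) * \<tau> i z - h z $ i $ j * \<omega> l z"
  by (simp add: shift_def diff_divide_distrib)

lemma sum_delta: "(\<Sum>l\<in>UNIV. (if l = i then 1 else 0) * (x l::real)) = x (i::'n)"
  "(\<Sum>l\<in>UNIV. (if i = l then 1 else 0) * (x l::real)) = x (i::'n)"
proof -
  have "(\<Sum>l\<in>UNIV. (if l = i then 1 else 0) * (x l::real)) = (\<Sum>l\<in>UNIV. if l = i then x l else 0)"
    by (rule sum.cong) auto
  then show "(\<Sum>l\<in>UNIV. (if l = i then 1 else 0) * (x l::real)) = x i" by simp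
  then show "(\<Sum>l\<in>UNIV. (if i = l then 1 else 0) * (x l::real)) = x i"
    by (simp add: eq_commute[of i])
qed

lemma h_W:
  assumes "z \<in> U"
  shows "(\<Sum>l\<in>UNIV. h z $ j $ l * \<omega> l z) = \<tau> j z"
proof -
  have "(\<Sum>l\<in>UNIV. h z $ j $ l * \<omega> l z) = (\<Sum>l\<in>UNIV. h z $ j $ l * grad l z) * (- 1 / \<sigma> z)"
    unfolding sum_distrib_right by (rule sum.cong) simp_all
  then show ?thesis unfolding h_grad[OF assms] by simp
qed

lemma h_W': "z \<in> U \<Longrightarrow> (\<Sum>l\<in>UNIV. h z $ l $ j * \<omega> l z) = \<tau> j z"
  using h_W[of z j] by (simp only: symmetric[of z j])

lemma shift_trace: "z \<in> U \<Longrightarrow> (\<Sum>l\<in>UNIV. shift l l k z) = real CARD('n) * \<tau> k z"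
  unfolding shift_eq sum_subtractf sum.distrib sum_delta h_W' by simp

lemma t_diff: "z \<in> U \<Longrightarrow> \<tau> j differentiable (at z)"
  using smooth_on_differentiable[OF smooth_on_pd[OF smooth_s], of z j] diff_s[of z] nonzero_s[of z] by simp

lemma W_diff: "z \<in> U \<Longrightarrow> \<omega> j differentiable (at z)"
  using smooth_on_differentiable[OF smooth_grad, of z j] diff_s[of z] nonzero_s[of z] by simp

lemma pd_t: "z \<in> U \<Longrightarrow> pd k (\<tau> j) z = - pd k (pd j \<sigma>) z / \<sigma> z + \<tau> j z * \<tau> k z"
  using smooth_on_differentiable[OF smooth_on_pd[OF smooth_s], of z j] diff_s[of z] nonzero_s[of z]
  by (simp add: diff_divide_distrib)

lemma pd_W: "z \<in> U \<Longrightarrow> pd k (\<omega> j) z = - pd k (grad j) z / \<sigma> z + \<omega> j z * \<tau> k z"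
  using smooth_on_differentiable[OF smooth_grad, of z j] diff_s[of z] nonzero_s[of z]
  by (simp add: diff_divide_distrib)

lemma pd_shift_divergence:
  assumes "z \<in> U"
  shows "(\<Sum>l\<in>UNIV. pd l (shift l j k) z) = pd j (\<tau> k) z + pd k (\<tau> j) z
    - (\<Sum>l\<in>UNIV. pd l (\<lambda>w. h w $ j $ k) z * \<omega> l z) - h z $ j $ k * (\<Sum>l\<in>UNIV. pd l (\<omega> l) z)"
proof -
  note d = t_diff[OF assms] W_diff[OF assms] diff_h[OF assms]
  have e: "pd l (shift l j k) z = (if l = j then 1 else 0) * pd l (\<tau> k) z + (if l = k then 1 else 0) * pd l (\<tau> j) z
     - (pd l (\<lambda>w. h w $ j $ k) z * \<omega> l z + h z $ j $ k * pd l (\<omega> l) z)" for l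
  proof -
    have "shift l j k = (\<lambda>w. (if l = j then 1 else 0) * \<tau> k w + (if l = k then 1 else 0) * \<tau> j w - h w $ j $ k * \<omega> l w)"
      by (rule ext) (rule shift_eq)
    moreover have "pd l (\<lambda>w. c * \<tau> k w + c' * \<tau> j w - h w $ j $ k * \<omega> l w) z =
      c * pd l (\<tau> k) z + c' * pd l (\<tau> j) z - (pd l (\<lambda>w. h w $ j $ k) z * \<omega> l z + h z $ j $ k * pd l (\<omega> l) z)" for c c'
      by (subst pd_diff pd_add pd_mult pd_const, (intro differentiable_add differentiable_mult differentiable_const d)+)+
        (simp add: algebra_simps)
    ultimately show ?thesis by presburger
  qed
  show ?thesis
    unfolding e sum_subtractf sum.distrib sum_delta sum_distrib_left[symmetric] by simp
qed

lemma pd_shift_trace: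
  assumes "z \<in> U"
  shows "(\<Sum>l\<in>UNIV. pd j (shift l l k) z) = real CARD('n) * pd j (\<tau> k) z"
proof -
  have "(\<Sum>l\<in>UNIV. pd j (shift l l k) z) = pd j (\<lambda>w. \<Sum>l\<in>UNIV. shift l l k w) z"
    using smooth_on_differentiable[OF smooth_shift assms] by simp
  also have "\<dots> = pd j (\<lambda>w. real CARD('n) * \<tau> k w) z"
    by (rule pd_cong[OF open_U assms shift_trace])
  also have "\<dots> = real CARD('n) * pd j (\<tau> k) z"
    by (subst pd_mult[OF differentiable_const t_diff[OF assms]]) (simp del: pd_minus pd_divide)
  finally show ?thesis .
qed

text \<open>The four terms of the Ricci tensor that are bilinear in the old symbols and in
  \<open>shift\<close>. The lowered Christoffel symbols left over in \<open>?C\<close> and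
  \<open>?D\<close> are exactly those that \<open>metric_compatible\<close> produces from the
  derivative of \<open>h\<close> in \<open>pd_shift_divergence\<close>; they cancel in
  \<open>ricci_conformal\<close>.\<close>

lemma contraction_terms:
  assumes "z \<in> U"
  shows "(\<Sum>l\<in>UNIV. \<Sum>m\<in>UNIV. \<Gamma> l l m z * shift m j k z) =
      (\<Sum>l\<in>UNIV. \<Gamma> l l j z) * \<tau> k z + (\<Sum>l\<in>UNIV. \<Gamma> l l k z) * \<tau> j z
      - h z $ j $ k * (\<Sum>l\<in>UNIV. \<Sum>m\<in>UNIV. \<Gamma> l l m z * \<omega> m z)" (is ?A)
    and "(\<Sum>l\<in>UNIV. \<Sum>m\<in>UNIV. shift l l m z * \<Gamma> m j k z) =
      real CARD('n) * (\<Sum>m\<in>UNIV. \<tau> m z * \<Gamma> m j k z)" (is ?B)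
    and "(\<Sum>l\<in>UNIV. \<Sum>m\<in>UNIV. \<Gamma> l j m z * shift m l k z) =
      (\<Sum>l\<in>UNIV. \<Gamma> l l j z) * \<tau> k z + (\<Sum>m\<in>UNIV. \<tau> m z * \<Gamma> m j k z)
      - (\<Sum>m\<in>UNIV. (\<Sum>l\<in>UNIV. h z $ k $ l * \<Gamma> l m j z) * \<omega> m z)" (is ?C)
    and "(\<Sum>l\<in>UNIV. \<Sum>m\<in>UNIV. shift l j m z * \<Gamma> m l k z) =
      (\<Sum>l\<in>UNIV. \<Gamma> l l k z) * \<tau> j z + (\<Sum>m\<in>UNIV. \<tau> m z * \<Gamma> m j k z)
      - (\<Sum>l\<in>UNIV. (\<Sum>m\<in>UNIV. h z $ j $ m * \<Gamma> m l k z) * \<omega> l z)" (is ?D)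
proof -
  have d: "(\<Sum>m\<in>UNIV. x m * ((if m = i then 1 else 0) * c)) = x i * c" for x :: "'n \<Rightarrow> real" and i c
    using sum_delta(1)[of i "\<lambda>m. x m * c"] by (simp add: ac_simps)
  have d': "(\<Sum>m\<in>UNIV. x m * ((if i = m then 1 else 0) * y m)) = x i * y i" for x y :: "'n \<Rightarrow> real" and i
    using sum_delta(2)[of i "\<lambda>m. x m * y m"] by (simp add: ac_simps)
  show ?A
    unfolding shift_eq right_diff_distrib distrib_left sum_subtractf sum.distrib d
    by (simp only: sum_distrib_left sum_distrib_right ac_simps)
  show ?B
    unfolding sum.swap[of "\<lambda>l m. shift l l m z * _ m"] sum_distrib_right[symmetric] shift_trace[OF assms]
    by (simp only: sum_distrib_left ac_simps)
  have "(\<Sum>l\<in>UNIV. \<Sum>m\<in>UNIV. \<Gamma> l j m z * (h z $ l $ k * \<omega> m z)) =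
      (\<Sum>m\<in>UNIV. (\<Sum>l\<in>UNIV. h z $ k $ l * \<Gamma> l m j z) * \<omega> m z)"
    by (subst sum.swap) (simp only: sum_distrib_left sum_distrib_right ac_simps symmetric[of _ _ k] christoffel_sym[of _ j])
  moreover have "(\<Sum>l\<in>UNIV. \<Gamma> l j l z * \<tau> k z) = (\<Sum>l\<in>UNIV. \<Gamma> l l j z) * \<tau> k z"
    by (simp only: sum_distrib_right christoffel_sym[of _ j])
  moreover have "(\<Sum>l\<in>UNIV. \<Gamma> l j k z * \<tau> l z) = (\<Sum>m\<in>UNIV. \<tau> m z * \<Gamma> m j k z)"
    by (simp only: ac_simps)
  ultimately show ?C
    unfolding shift_eq right_diff_distrib distrib_left sum_subtractf sum.distrib d by linarith
  have "(\<Sum>l\<in>UNIV. \<Sum>m\<in>UNIV. (h z $ j $ m * \<omega> l z) * \<Gamma> m l k z) =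
      (\<Sum>l\<in>UNIV. (\<Sum>m\<in>UNIV. h z $ j $ m * \<Gamma> m l k z) * \<omega> l z)"
    by (simp only: sum_distrib_left sum_distrib_right ac_simps)
  moreover have "(\<Sum>l\<in>UNIV. \<Sum>m\<in>UNIV. ((if l = j then 1 else 0) * \<tau> m z) * \<Gamma> m l k z) =
      (\<Sum>m\<in>UNIV. \<tau> m z * \<Gamma> m j k z)"
    using sum_delta(1)[of j "\<lambda>l. \<Sum>m\<in>UNIV. \<tau> m z * \<Gamma> m l k z"] by (simp add: sum_distrib_left ac_simps)
  moreover have "(\<Sum>l\<in>UNIV. \<Sum>m\<in>UNIV. ((if l = m then 1 else 0) * \<tau> j z) * \<Gamma> m l k z) =
      (\<Sum>l\<in>UNIV. \<Gamma> l l k z) * \<tau> j z"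
  proof -
    have "(\<Sum>m\<in>UNIV. ((if l = m then 1 else 0) * \<tau> j z) * \<Gamma> m l k z) = \<tau> j z * \<Gamma> l l k z" for l
      using sum_delta(2)[of l "\<lambda>m. \<tau> j z * \<Gamma> m l k z"] by (simp only: ac_simps)
    then show ?thesis by (simp only: sum_distrib_left sum_distrib_right ac_simps)
  qed
  ultimately show ?D
    unfolding shift_eq left_diff_distrib distrib_right sum_subtractf sum.distrib by linarith
qed

lemma shift_contraction:
  assumes "z \<in> U"
  shows "(\<Sum>m\<in>UNIV. \<tau> m z * shift m j k z) =
    2 * (\<tau> j z * \<tau> k z) - h z $ j $ k * (\<Sum>m\<in>UNIV. \<tau> m z * \<omega> m z)"
proof -
  have d: "(\<Sum>m\<in>UNIV. x m * ((if m = i then 1 else 0) * c)) = x i * c" for x :: "'n \<Rightarrow> real" and i c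
    using sum_delta(1)[of i "\<lambda>m. x m * c"] by (simp add: ac_simps)
  have "(\<Sum>m\<in>UNIV. \<tau> m z * (h z $ j $ k * \<omega> m z)) = h z $ j $ k * (\<Sum>m\<in>UNIV. \<tau> m z * \<omega> m z)"
    by (simp only: sum_distrib_left ac_simps)
  then show ?thesis
    unfolding shift_eq right_diff_distrib distrib_left sum_subtractf sum.distrib d by simp
qed

text \<open>The difference of the two contractions is (n - 2) (tau_j tau_k - h_jk |tau|^2), the
  quadratic part of the conformal change of the Ricci tensor.\<close>

lemma shift_square:
  assumes "z \<in> U"
  shows "(\<Sum>l\<in>UNIV. \<Sum>m\<in>UNIV. shift l l m z * shift m j k z) =
      real CARD('n) * (2 * (\<tau> j z * \<tau> k z) - h z $ j $ k * (\<Sum>m\<in>UNIV. \<tau> m z * \<omega> m z))" (is ?A)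
    and "(\<Sum>l\<in>UNIV. \<Sum>m\<in>UNIV. shift l j m z * shift m l k z) =
      (real CARD('n) + 2) * (\<tau> j z * \<tau> k z) - 2 * (h z $ j $ k * (\<Sum>m\<in>UNIV. \<tau> m z * \<omega> m z))" (is ?B)
proof -
  have "(\<Sum>l\<in>UNIV. \<Sum>m\<in>UNIV. shift l l m z * shift m j k z) =
      (\<Sum>m\<in>UNIV. (\<Sum>l\<in>UNIV. shift l l m z) * shift m j k z)"
    unfolding sum_distrib_right by (rule sum.swap)
  also have "\<dots> = real CARD('n) * (\<Sum>m\<in>UNIV. \<tau> m z * shift m j k z)"
    unfolding shift_trace[OF assms] by (simp only: sum_distrib_left ac_simps)
  finally show ?A unfolding shift_contraction[OF assms] .
  have s1: "(\<Sum>m\<in>UNIV. h z $ j $ m * shift m l k z) =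
      h z $ j $ l * \<tau> k z + h z $ j $ k * \<tau> l z - h z $ l $ k * \<tau> j z" for l
  proof -
    have d: "(\<Sum>m\<in>UNIV. x m * ((if m = i then 1 else 0) * c)) = x i * c" for x :: "'n \<Rightarrow> real" and i c
      using sum_delta(1)[of i "\<lambda>m. x m * c"] by (simp add: ac_simps)
    have "(\<Sum>m\<in>UNIV. h z $ j $ m * (h z $ l $ k * \<omega> m z)) = h z $ l $ k * (\<Sum>m\<in>UNIV. h z $ j $ m * \<omega> m z)"
      by (simp only: sum_distrib_left ac_simps)
    then show ?thesis
      unfolding shift_eq right_diff_distrib distrib_left sum_subtractf sum.distrib d h_W[OF assms] by simp
  qed
  have d1: "(\<Sum>m\<in>UNIV. ((if l = m then 1 else 0) * \<tau> j z) * shift m l k z) = \<tau> j z * shift l l k z" for l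
    using sum_delta(2)[of l "\<lambda>m. \<tau> j z * shift m l k z"] by (simp only: ac_simps)
  have d2: "(\<Sum>m\<in>UNIV. ((if l = j then 1 else 0) * \<tau> m z) * shift m l k z) =
     (if l = j then 1 else 0) * (\<Sum>m\<in>UNIV. \<tau> m z * shift m l k z)" for l
    by (simp only: sum_distrib_left ac_simps)
  have d3: "(\<Sum>m\<in>UNIV. (h z $ j $ m * \<omega> l z) * shift m l k z) =
     \<omega> l z * (\<Sum>m\<in>UNIV. h z $ j $ m * shift m l k z)" for l
    by (simp only: sum_distrib_left ac_simps)
  have "(\<Sum>m\<in>UNIV. shift l j m z * shift m l k z) =
      (if l = j then 1 else 0) * (\<Sum>m\<in>UNIV. \<tau> m z * shift m l k z) + \<tau> j z * shift l l k z
      - \<omega> l z * (h z $ j $ l * \<tau> k z + h z $ j $ k * \<tau> l z - h z $ l $ k * \<tau> j z)" for l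
    unfolding shift_eq[of l j] left_diff_distrib distrib_right sum_subtractf sum.distrib d1 d2 d3 s1 ..
  then have "(\<Sum>l\<in>UNIV. \<Sum>m\<in>UNIV. shift l j m z * shift m l k z) =
      (\<Sum>m\<in>UNIV. \<tau> m z * shift m j k z) + \<tau> j z * (\<Sum>l\<in>UNIV. shift l l k z)
      - ((\<Sum>l\<in>UNIV. h z $ j $ l * \<omega> l z) * \<tau> k z + h z $ j $ k * (\<Sum>l\<in>UNIV. \<tau> l z * \<omega> l z)
         - (\<Sum>l\<in>UNIV. h z $ l $ k * \<omega> l z) * \<tau> j z)"
    by (simp only: sum_subtractf sum.distrib sum_delta)
      (simp only: sum_subtractf sum.distrib right_diff_distrib distrib_left
        sum_distrib_left sum_distrib_right ac_simps)
  then show ?B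
    unfolding shift_contraction[OF assms] shift_trace[OF assms] h_W[OF assms] h_W'[OF assms]
    by (simp add: algebra_simps add_divide_distrib)
qed

text \<open>The classical formula: (n - 2) / sigma times the covariant Hessian of sigma, plus
  \<open>h\<close> times the Laplacian of sigma over sigma minus (n - 1) |d sigma|^2 / sigma^2.
  Differentiating tau = - d sigma / sigma produces a term tau tau that cancels the quadratic term
  coming from \<open>shift_square\<close>.\<close>

theorem ricci_conformal:
  assumes "z \<in> U"
  shows "ricci g z $ k $ j = ricci h z $ k $ j
    + (real CARD('n) - 2) / \<sigma> z * (pd j (pd k \<sigma>) z - (\<Sum>m\<in>UNIV. \<Gamma> m j k z * pd m \<sigma> z))
    + h z $ j $ k * (((\<Sum>l\<in>UNIV. pd l (grad l) z) + (\<Sum>l\<in>UNIV. \<Sum>m\<in>UNIV. \<Gamma> l l m z * grad m z)) / \<sigma> z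
      - (real CARD('n) - 1) * (\<Sum>m\<in>UNIV. pd m \<sigma> z * grad m z) / (\<sigma> z)\<^sup>2)"
proof -
  have nz: "\<sigma> z \<noteq> 0" using assms nonzero_s by blast
  let ?N = "\<Sum>m\<in>UNIV. \<tau> m z * \<omega> m z" and ?P = "\<Sum>m\<in>UNIV. \<tau> m z * \<Gamma> m j k z"
  let ?w = "\<Sum>l\<in>UNIV. (\<Sum>m\<in>UNIV. h z $ k $ m * \<Gamma> m l j z) * \<omega> l z"
  let ?w' = "\<Sum>l\<in>UNIV. (\<Sum>m\<in>UNIV. h z $ j $ m * \<Gamma> m l k z) * \<omega> l z"
  have e: "riemann g l k l j z = riemann h l k l j z + (pd l (shift l j k) z - pd j (shift l l k) z)
    + (\<Sum>m\<in>UNIV. \<Gamma> l l m z * shift m j k z) + (\<Sum>m\<in>UNIV. shift l l m z * \<Gamma> m j k z)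
    + (\<Sum>m\<in>UNIV. shift l l m z * shift m j k z) - (\<Sum>m\<in>UNIV. \<Gamma> l j m z * shift m l k z)
    - (\<Sum>m\<in>UNIV. shift l j m z * \<Gamma> m l k z) - (\<Sum>m\<in>UNIV. shift l j m z * shift m l k z)" for l
    unfolding riemann_def pd_christoffel_g[OF assms] christoffel_conformal[OF assms]
    by (simp add: sum.distrib sum_subtractf algebra_simps)
  have compat: "(\<Sum>l\<in>UNIV. pd l (\<lambda>w. h w $ j $ k) z * \<omega> l z) = ?w + ?w'"
    unfolding metric_compatible[OF assms] by (simp only: distrib_right sum.distrib)
  have "ricci g z $ k $ j = (\<Sum>l\<in>UNIV. riemann g l k l j z)"
    by (simp add: ricci_def)
  also have "\<dots> = ricci h z $ k $ j + (pd j (\<tau> k) z + pd k (\<tau> j) z - real CARD('n) * pd j (\<tau> k) z)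
     + (real CARD('n) - 2) * ?P + (real CARD('n) - 2) * (\<tau> j z * \<tau> k z)
     - h z $ j $ k * ((\<Sum>l\<in>UNIV. pd l (\<omega> l) z) + (\<Sum>l\<in>UNIV. \<Sum>m\<in>UNIV. \<Gamma> l l m z * \<omega> m z) + (real CARD('n) - 2) * ?N)"
    unfolding e sum_subtractf sum.distrib pd_shift_divergence[OF assms] pd_shift_trace[OF assms]
      contraction_terms[OF assms] shift_square[OF assms] compat
    by (simp add: ricci_def algebra_simps add_divide_distrib diff_divide_distrib del: pd_minus pd_divide)
  also have "pd k (\<tau> j) z = pd j (\<tau> k) z"
    unfolding pd_t[OF assms] using pd_commute[OF open_U assms smooth_s, of k j] by simp
  also have "pd j (\<tau> k) z = - pd j (pd k \<sigma>) z / \<sigma> z + \<tau> k z * \<tau> j z"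
    by (rule pd_t[OF assms])
  also have "(\<Sum>l\<in>UNIV. pd l (\<omega> l) z) = - (\<Sum>l\<in>UNIV. pd l (grad l) z) / \<sigma> z + ?N"
    unfolding pd_W[OF assms] sum.distrib
    by (simp add: sum_divide_distrib sum_negf ac_simps)
  also have "(\<Sum>l\<in>UNIV. \<Sum>m\<in>UNIV. \<Gamma> l l m z * \<omega> m z) =
      - (\<Sum>l\<in>UNIV. \<Sum>m\<in>UNIV. \<Gamma> l l m z * grad m z) / \<sigma> z"
    by (simp add: sum_divide_distrib sum_negf)
  also have "?N = (\<Sum>m\<in>UNIV. pd m \<sigma> z * grad m z) / (\<sigma> z)\<^sup>2"
    by (simp add: sum_divide_distrib power2_eq_square)
  also have "?P = - (\<Sum>m\<in>UNIV. \<Gamma> m j k z * pd m \<sigma> z) / \<sigma> z"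
    by (simp add: sum_divide_distrib sum_negf ac_simps)
  finally show ?thesis
    by (simp add: algebra_simps diff_divide_distrib add_divide_distrib)
qed

end

section \<open>Christoffel symbols and Ricci tensor of the Fefferman metric with scale factor
  1\<close>

section \<open>The curvature of the Fefferman metric\<close>

text \<open>The simplifier turns 1 into \<open>Suc 0\<close> and the derivative rules count up with
  \<open>Suc\<close>; without this rule second order jets would occur under two different names. The
  variants unfolding \<open>One_nat_def\<close> further below serve the same purpose.\<close>

lemma two_eq_Suc: "Suc (Suc 0) = 2"
  by simp

locale fefferman_patch =
  fixes i :: real and Q :: "real^3 \<Rightarrow> real" and U :: "(real^4) set"
  assumes i_nonzero: "i \<noteq> 0" and open_dom: "open U" and smooth_Q: "smooth_on (jet ` U) Q"
begin

abbreviation J :: "nat \<Rightarrow> nat \<Rightarrow> nat \<Rightarrow> real^4 \<Rightarrow> real" where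
  "J a b c z \<equiv> mpd a b c Q (jet z)"

abbreviation h :: "real^4 \<Rightarrow> real^4^4" where "h \<equiv> fefferman i Q (\<lambda>_. 1)"

text \<open>The inverse of \<open>h\<close>. Apart from division by the constant \<open>i\<close>,
  its entries are polynomials in p and the jets of Q, because the determinant of \<open>h\<close> is
  the constant 4 i^2 / 9.\<close>

definition H :: "real^4 \<Rightarrow> real^4^4" where
  "H z = vector [vector [0, 0, 1, 0],
     vector [0, 0, z $ 3, - 3 / (2 * i)],
     vector [1, z $ 3, 2 * J 0 0 0 z, - J 0 0 1 z / i],
     vector [0, - 3 / (2 * i), - J 0 0 1 z / i, 3 * J 0 0 2 z / (4 * i^2)]]"

lemma open_jet_dom: "open (jet ` U)"
  by (rule open_jet_image[OF open_dom])

lemma J_pd: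
  assumes "z \<in> U"
  shows "pd 1 (\<lambda>w. J a b c w) z = J (Suc a) b c z" "pd 2 (\<lambda>w. J a b c w) z = J a (Suc b) c z"
    "pd 3 (\<lambda>w. J a b c w) z = J a b (Suc c) z" "pd 4 (\<lambda>w. J a b c w) z = 0"
  using mpd_differentiable[OF smooth_Q, of "jet z"] pd2_mpd[OF open_jet_dom smooth_Q, of "jet z"]
    pd3_mpd[OF open_jet_dom smooth_Q, of "jet z"] assms by simp_all

lemma J_diff: "z \<in> U \<Longrightarrow> (\<lambda>w. J a b c w) differentiable (at z)"
  using mpd_differentiable[OF smooth_Q, of "jet z"] by simp

lemma Q_pd:
  assumes "z \<in> U"
  shows "pd 1 (\<lambda>w. Q (jet w)) z = J 1 0 0 z" "pd 2 (\<lambda>w. Q (jet w)) z = J 0 1 0 z"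
    "pd 3 (\<lambda>w. Q (jet w)) z = J 0 0 1 z" "pd 4 (\<lambda>w. Q (jet w)) z = 0"
    "(\<lambda>w. Q (jet w)) differentiable (at z)"
  using J_pd[OF assms, of 0 0 0] J_diff[OF assms, of 0 0 0] by simp_all

lemmas J_rules = J_pd J_diff Q_pd two_eq_Suc

lemma h_entries:
  shows "h z $ 1 $ 1 = - 2 * J 0 0 0 z + 4 * J 0 0 1 z * z $ 3 / 3 - J 0 0 2 z * ((z $ 3)^2) / 3"
    "h z $ 1 $ 2 = - 2 * J 0 0 1 z / 3 + J 0 0 2 z * z $ 3 / 3"
    "h z $ 1 $ 3 = 1"
    "h z $ 1 $ 4 = 2 * i * z $ 3 / 3"
    "h z $ 2 $ 1 = - 2 * J 0 0 1 z / 3 + J 0 0 2 z * z $ 3 / 3"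
    "h z $ 2 $ 2 = - J 0 0 2 z / 3"
    "h z $ 2 $ 3 = 0"
    "h z $ 2 $ 4 = - 2 * i / 3"
    "h z $ 3 $ 1 = 1"
    "h z $ 3 $ 2 = 0"
    "h z $ 3 $ 3 = 0"
    "h z $ 3 $ 4 = 0"
    "h z $ 4 $ 1 = 2 * i * z $ 3 / 3"
    "h z $ 4 $ 2 = - 2 * i / 3"
    "h z $ 4 $ 3 = 0"
    "h z $ 4 $ 4 = 0"
  by (simp_all add: fefferman_def Let_def sym_prod_def axis_def mpd_def numeral_2_eq_2 field_simps)

lemma H_entries:
  shows "H z $ 1 $ 1 = 0"
    "H z $ 1 $ 2 = 0"
    "H z $ 1 $ 3 = 1"
    "H z $ 1 $ 4 = 0"
    "H z $ 2 $ 1 = 0"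
    "H z $ 2 $ 2 = 0"
    "H z $ 2 $ 3 = z $ 3"
    "H z $ 2 $ 4 = - 3 / (2 * i)"
    "H z $ 3 $ 1 = 1"
    "H z $ 3 $ 2 = z $ 3"
    "H z $ 3 $ 3 = 2 * J 0 0 0 z"
    "H z $ 3 $ 4 = - J 0 0 1 z / i"
    "H z $ 4 $ 1 = 0"
    "H z $ 4 $ 2 = - 3 / (2 * i)"
    "H z $ 4 $ 3 = - J 0 0 1 z / i"
    "H z $ 4 $ 4 = 3 * J 0 0 2 z / (4 * (i^2))"
  by (simp_all add: H_def)

lemma smooth_J: "smooth_on U (\<lambda>z. J a b c z)"
  by (rule smooth_on_jet[OF open_dom smooth_on_mpd[OF smooth_Q]])

sublocale metric_patch U h H
proof
  show "open U" by (rule open_dom)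
  fix j k :: 4
  show "h z $ j $ k = h z $ k $ j" for z
    using exhaust_4[of j] exhaust_4[of k] by (auto simp: h_entries)
  show "smooth_on U (\<lambda>z. h z $ j $ k)"
    using exhaust_4[of j] exhaust_4[of k]
    by (elim disjE; simp only: h_entries divide_inverse; intro smooth_intros smooth_J open_dom)
  show "smooth_on U (\<lambda>z. H z $ j $ k)"
    using exhaust_4[of j] exhaust_4[of k]
    by (elim disjE; simp only: H_entries divide_inverse; intro smooth_intros smooth_J open_dom)
next
  show "h z ** H z = mat 1" for z
    using i_nonzero
    by (simp add: vec_eq_iff forall_4 matrix_matrix_mult_def mat_def sum_4 h_entries H_entries)
      (simp add: field_simps power2_eq_square)
  show "H z ** h z = mat 1" for z
    using i_nonzero
    by (simp add: vec_eq_iff forall_4 matrix_matrix_mult_def mat_def sum_4 h_entries H_entries)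
      (simp add: field_simps power2_eq_square)
qed

lemma christoffel_hat:
  assumes "z \<in> U"
  shows "\<Gamma> 1 1 1 z = J 0 0 1 z / 3 - J 0 0 2 z * z $ 3 / 3 + J 0 0 3 z * ((z $ 3)^2) / 6"
    "\<Gamma> 1 1 2 z = J 0 0 2 z / 6 - J 0 0 3 z * z $ 3 / 6"
    "\<Gamma> 1 1 3 z = 0"
    "\<Gamma> 1 1 4 z = - i / 3"
    "\<Gamma> 1 2 2 z = J 0 0 3 z / 6"
    "\<Gamma> 1 2 3 z = 0"
    "\<Gamma> 1 2 4 z = 0"
    "\<Gamma> 1 3 3 z = 0"
    "\<Gamma> 1 3 4 z = 0"
    "\<Gamma> 1 4 4 z = 0"
    "\<Gamma> 2 1 1 z = J 0 0 1 z * z $ 3 / 3 - J 0 0 2 z * ((z $ 3)^2) / 3 + J 0 0 3 z * ((z $ 3)^3) / 6"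
    "\<Gamma> 2 1 2 z = J 0 0 2 z * z $ 3 / 6 - J 0 0 3 z * ((z $ 3)^2) / 6"
    "\<Gamma> 2 1 3 z = - 1 / 2"
    "\<Gamma> 2 1 4 z = - i * z $ 3 / 3"
    "\<Gamma> 2 2 2 z = J 0 0 3 z * z $ 3 / 6"
    "\<Gamma> 2 2 3 z = 0"
    "\<Gamma> 2 2 4 z = 0"
    "\<Gamma> 2 3 3 z = 0"
    "\<Gamma> 2 3 4 z = 0"
    "\<Gamma> 2 4 4 z = 0"
    "\<Gamma> 3 1 1 z = - J 1 0 0 z + 2 * J 0 0 0 z * J 0 0 1 z / 3 + J 0 1 0 z * z $ 3 - 2 * J 0 1 1 z * ((z $ 3)^2) / 3 + J 0 1 2 z * ((z $ 3)^3) / 6 + J 1 0 2 z * ((z $ 3)^2) / 6 - 2 * J 0 0 0 z * J 0 0 2 z * z $ 3 / 3 + J 0 0 0 z * J 0 0 3 z * ((z $ 3)^2) / 3"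
    "\<Gamma> 3 1 2 z = - J 0 1 0 z + J 0 0 0 z * J 0 0 2 z / 3 + 2 * J 0 1 1 z * z $ 3 / 3 - J 0 1 2 z * ((z $ 3)^2) / 6 - J 1 0 2 z * z $ 3 / 6 - J 0 0 0 z * J 0 0 3 z * z $ 3 / 3"
    "\<Gamma> 3 1 3 z = - 2 * J 0 0 1 z / 3 + J 0 0 2 z * z $ 3 / 6"
    "\<Gamma> 3 1 4 z = - 2 * J 0 0 0 z * i / 3"
    "\<Gamma> 3 2 2 z = - 2 * J 0 1 1 z / 3 + J 1 0 2 z / 6 + J 0 0 0 z * J 0 0 3 z / 3 + J 0 1 2 z * z $ 3 / 6"
    "\<Gamma> 3 2 3 z = - J 0 0 2 z / 6"
    "\<Gamma> 3 2 4 z = 0"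
    "\<Gamma> 3 3 3 z = 0"
    "\<Gamma> 3 3 4 z = i / 3"
    "\<Gamma> 3 4 4 z = 0"
    "\<Gamma> 4 1 1 z = - ((J 0 0 1 z)^2) / (3 * i) - 3 * J 0 1 0 z / (2 * i) + J 1 0 1 z / i + J 0 1 1 z * z $ 3 / i - J 0 1 2 z * ((z $ 3)^2) / (4 * i) - J 1 0 2 z * z $ 3 / (2 * i) + J 0 0 1 z * J 0 0 2 z * z $ 3 / (3 * i) - J 0 0 1 z * J 0 0 3 z * ((z $ 3)^2) / (6 * i)"
    "\<Gamma> 4 1 2 z = J 1 0 2 z / (4 * i) - J 0 0 1 z * J 0 0 2 z / (6 * i) + J 0 0 1 z * J 0 0 3 z * z $ 3 / (6 * i)"
    "\<Gamma> 4 1 3 z = J 0 0 2 z / (2 * i) - J 0 0 3 z * z $ 3 / (4 * i)"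
    "\<Gamma> 4 1 4 z = J 0 0 1 z / 3"
    "\<Gamma> 4 2 2 z = J 0 1 2 z / (4 * i) - J 0 0 1 z * J 0 0 3 z / (6 * i)"
    "\<Gamma> 4 2 3 z = J 0 0 3 z / (4 * i)"
    "\<Gamma> 4 2 4 z = 0"
    "\<Gamma> 4 3 3 z = 0"
    "\<Gamma> 4 3 4 z = 0"
    "\<Gamma> 4 4 4 z = 0"
  using i_nonzero unfolding christoffel_def matrix_inv_h[OF assms] sum_4 h_entries H_entries
  by (simp_all add: J_rules assms)
    (simp_all add: field_simps power2_eq_square power3_eq_cube)

text \<open>Stated for functions rather than values, since the symbols with unordered indices also
  occur under \<open>pd\<close> in the Ricci tensor.\<close>

lemma christoffel_hat_sym:
  "\<Gamma> l 2 1 = \<Gamma> l 1 2" "\<Gamma> l 3 1 = \<Gamma> l 1 3" "\<Gamma> l 4 1 = \<Gamma> l 1 4"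
  "\<Gamma> l 3 2 = \<Gamma> l 2 3" "\<Gamma> l 4 2 = \<Gamma> l 2 4" "\<Gamma> l 4 3 = \<Gamma> l 3 4"
  by (rule ext, rule christoffel_sym)+

text \<open>The determinant of \<open>h\<close> is constant, hence so is its volume density. This
  makes \<open>ricci_trace_free\<close> applicable.\<close>

lemma christoffel_trace: "z \<in> U \<Longrightarrow> (\<Sum>l\<in>UNIV. \<Gamma> l l k z) = 0"
  using i_nonzero exhaust_4[of k] by (auto simp: sum_4 christoffel_hat christoffel_hat_sym field_simps)

lemma ricci_hat:
  assumes z: "z \<in> U"
  shows "ricci h z $ 1 $ 1 = - 2 * ((J 0 0 1 z)^2) / 9 - J 0 1 0 z + J 0 0 0 z * J 0 0 2 z - ((J 0 0 2 z)^2) * ((z $ 3)^2) / 18 + 4 * J 0 1 1 z * z $ 3 / 3 - 5 * J 0 1 2 z * ((z $ 3)^2) / 6 + J 0 1 3 z * ((z $ 3)^3) / 3 - J 1 0 2 z * z $ 3 / 3 + J 1 0 3 z * ((z $ 3)^2) / 3 - 2 * J 0 0 0 z * J 0 0 3 z * z $ 3 / 3 + J 0 0 0 z * J 0 0 4 z * ((z $ 3)^2) / 3 - 2 * J 0 0 1 z * J 0 0 2 z * z $ 3 / 9 + J 0 0 1 z * J 0 0 3 z * ((z $ 3)^2) / 3"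
    "ricci h z $ 1 $ 2 = - 2 * J 0 1 1 z / 3 + J 1 0 2 z / 6 + J 0 0 0 z * J 0 0 3 z / 3 + J 0 0 1 z * J 0 0 2 z / 9 + ((J 0 0 2 z)^2) * z $ 3 / 18 + 2 * J 0 1 2 z * z $ 3 / 3 - J 0 1 3 z * ((z $ 3)^2) / 3 - J 1 0 3 z * z $ 3 / 3 - J 0 0 0 z * J 0 0 4 z * z $ 3 / 3 - J 0 0 1 z * J 0 0 3 z * z $ 3 / 3"
    "ricci h z $ 1 $ 3 = - J 0 0 2 z / 2 + J 0 0 3 z * z $ 3 / 6"
    "ricci h z $ 1 $ 4 = - 2 * J 0 0 1 z * i / 9 - J 0 0 2 z * i * z $ 3 / 9"
    "ricci h z $ 2 $ 2 = - ((J 0 0 2 z)^2) / 18 - J 0 1 2 z / 2 + J 1 0 3 z / 3 + J 0 0 0 z * J 0 0 4 z / 3 + J 0 0 1 z * J 0 0 3 z / 3 + J 0 1 3 z * z $ 3 / 3"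
    "ricci h z $ 2 $ 3 = - J 0 0 3 z / 6"
    "ricci h z $ 2 $ 4 = J 0 0 2 z * i / 9"
    "ricci h z $ 3 $ 3 = 0"
    "ricci h z $ 3 $ 4 = 0"
    "ricci h z $ 4 $ 4 = - 2 * (i^2) / 9"
proof -
  have r: "ricci h z $ k $ j = (\<Sum>l\<in>UNIV. pd l (\<Gamma> l j k) z)
    - (\<Sum>l\<in>UNIV. \<Sum>m\<in>UNIV. \<Gamma> l j m z * \<Gamma> m l k z)" for j k
    by (rule ricci_trace_free[OF z christoffel_trace])
  show "ricci h z $ 1 $ 1 = - 2 * ((J 0 0 1 z)^2) / 9 - J 0 1 0 z + J 0 0 0 z * J 0 0 2 z - ((J 0 0 2 z)^2) * ((z $ 3)^2) / 18 + 4 * J 0 1 1 z * z $ 3 / 3 - 5 * J 0 1 2 z * ((z $ 3)^2) / 6 + J 0 1 3 z * ((z $ 3)^3) / 3 - J 1 0 2 z * z $ 3 / 3 + J 1 0 3 z * ((z $ 3)^2) / 3 - 2 * J 0 0 0 z * J 0 0 3 z * z $ 3 / 3 + J 0 0 0 z * J 0 0 4 z * ((z $ 3)^2) / 3 - 2 * J 0 0 1 z * J 0 0 2 z * z $ 3 / 9 + J 0 0 1 z * J 0 0 3 z * ((z $ 3)^2) / 3"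
    "ricci h z $ 1 $ 2 = - 2 * J 0 1 1 z / 3 + J 1 0 2 z / 6 + J 0 0 0 z * J 0 0 3 z / 3 + J 0 0 1 z * J 0 0 2 z / 9 + ((J 0 0 2 z)^2) * z $ 3 / 18 + 2 * J 0 1 2 z * z $ 3 / 3 - J 0 1 3 z * ((z $ 3)^2) / 3 - J 1 0 3 z * z $ 3 / 3 - J 0 0 0 z * J 0 0 4 z * z $ 3 / 3 - J 0 0 1 z * J 0 0 3 z * z $ 3 / 3"
    "ricci h z $ 1 $ 3 = - J 0 0 2 z / 2 + J 0 0 3 z * z $ 3 / 6"
    "ricci h z $ 1 $ 4 = - 2 * J 0 0 1 z * i / 9 - J 0 0 2 z * i * z $ 3 / 9"
    "ricci h z $ 2 $ 2 = - ((J 0 0 2 z)^2) / 18 - J 0 1 2 z / 2 + J 1 0 3 z / 3 + J 0 0 0 z * J 0 0 4 z / 3 + J 0 0 1 z * J 0 0 3 z / 3 + J 0 1 3 z * z $ 3 / 3"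
    "ricci h z $ 2 $ 3 = - J 0 0 3 z / 6"
    "ricci h z $ 2 $ 4 = J 0 0 2 z * i / 9"
    "ricci h z $ 3 $ 3 = 0"
    "ricci h z $ 3 $ 4 = 0"
    "ricci h z $ 4 $ 4 = - 2 * (i^2) / 9"
    \<comment> \<open>The closed forms of the Christoffel symbols are valid on \<open>U\<close>
      only, so their derivatives are replaced through \<open>pd_cong\<close>. After clearing
      \<open>i\<close>, polynomial identities in the jets of Q remain.\<close>
    using i_nonzero
    unfolding r sum_4 christoffel_hat_sym christoffel_hat[OF z]
    by (simp_all add: christoffel_hat[THEN pd_cong[OF open_dom z]] J_rules z)
      (simp_all add: field_simps power2_eq_square power3_eq_cube)
qed

end

section \<open>Differential consequences of the linear equations for alpha and beta, and their
  obstructions\<close>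

section \<open>Two linear equations on the jet space\<close>

locale jet_patch =
  fixes Q :: "real^3 \<Rightarrow> real" and S :: "(real^3) set"
  assumes open_S: "open S" and smooth_QS: "smooth_on S Q"
begin

abbreviation q :: "nat \<Rightarrow> nat \<Rightarrow> nat \<Rightarrow> real^3 \<Rightarrow> real" where
  "q a b c \<equiv> mpd a b c Q"

lemma jet_rules:
  assumes "smooth_on S f" "v \<in> S"
  shows "pd 2 (mpd a b c f) v = mpd a (Suc b) c f v" "pd 3 (mpd a b c f) v = mpd a b (Suc c) f v"
    "mpd a b c f differentiable (at v)" "pd 1 f v = mpd 1 0 0 f v" "pd 2 f v = mpd 0 1 0 f v"
    "pd 3 f v = mpd 0 0 1 f v" "f differentiable (at v)"
  using pd2_mpd[OF open_S assms] pd3_mpd[OF open_S assms] mpd_differentiable[OF assms]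
    pd1_mpd[of 0 0 0 f] pd2_mpd[OF open_S assms, of 0 0 0] pd3_mpd[OF open_S assms, of 0 0 0]
    smooth_on_differentiable[OF assms]
  by simp_all

lemma pd_eq_0: "v \<in> S \<Longrightarrow> (\<And>w. w \<in> S \<Longrightarrow> f w = 0) \<Longrightarrow> pd k f v = 0"
  using pd_cong[OF open_S, of v f "\<lambda>_. 0" k] by simp

lemma mpd_eq_0:
  assumes "smooth_on S f" "\<And>v. v \<in> S \<Longrightarrow> mpd a b c f v = 0" "v \<in> S"
  shows "mpd (a + a') (b + b') (c + c') f v = 0"
proof -
  have "\<forall>v\<in>S. mpd (a + a') b c f v = 0"
    by (induction a') (use assms(2) pd_eq_0[of _ "mpd (a + _) b c f" 1] in auto)
  then have "\<forall>v\<in>S. mpd (a + a') (b + b') c f v = 0"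
    by (induction b') (use pd_eq_0[of _ "mpd (a + a') (b + _) c f" 2] jet_rules(1)[OF assms(1)] in auto)
  then have "\<forall>v\<in>S. mpd (a + a') (b + b') (c + c') f v = 0"
    by (induction c') (use pd_eq_0[of _ "mpd (a + a') (b + b') (c + _) f" 3] jet_rules(2)[OF assms(1)] in auto)
  then show ?thesis using assms(3) by blast
qed

text \<open>The coefficients of $e^{i\phi/3}$ and of $e^{-i\phi/3}$ in the reciprocal of the scale factor
  are governed by \<open>eq_plus\<close> and \<open>eq_minus\<close> respectively.\<close>

definition eq_plus :: "(real^3 \<Rightarrow> real) \<Rightarrow> real^3 \<Rightarrow> real" where
  "eq_plus \<alpha> v = mpd 1 0 0 \<alpha> v + v $ 3 * mpd 0 1 0 \<alpha> v + Q v * mpd 0 0 1 \<alpha> v - q 0 0 1 v * \<alpha> v / 3"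

definition eq_minus :: "(real^3 \<Rightarrow> real) \<Rightarrow> real^3 \<Rightarrow> real" where
  "eq_minus \<beta> v =
    18 * (mpd 2 0 0 \<beta> v + 2 * v $ 3 * mpd 1 1 0 \<beta> v + (v $ 3)^2 * mpd 0 2 0 \<beta> v + Q v * mpd 0 1 0 \<beta> v)
    - 6 * q 0 0 1 v * (mpd 1 0 0 \<beta> v + v $ 3 * mpd 0 1 0 \<beta> v)
    + (6 * (q 1 0 1 v + v $ 3 * q 0 1 1 v + Q v * q 0 0 2 v) - 18 * q 0 1 0 v - 4 * (q 0 0 1 v)^2) * \<beta> v"

context
  fixes \<alpha> assumes sa: "smooth_on S \<alpha>" and app: "\<And>v. v \<in> S \<Longrightarrow> mpd 0 0 2 \<alpha> v = 0"
    and eq: "\<And>v. v \<in> S \<Longrightarrow> eq_plus \<alpha> v = 0"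
begin

lemma affine_jets:
  assumes "v \<in> S"
  shows "mpd k l 2 \<alpha> v = 0" "mpd k l 3 \<alpha> v = 0" "mpd k l 4 \<alpha> v = 0"
  using mpd_eq_0[OF sa app assms, of k l 0] mpd_eq_0[OF sa app assms, of k l 1]
    mpd_eq_0[OF sa app assms, of k l 2] by (simp_all add: numeral_3_eq_3 numeral_2_eq_2 eval_nat_numeral)

lemma eq_plus_p:
  assumes "v \<in> S"
  shows "mpd 0 1 0 \<alpha> v + mpd 1 0 1 \<alpha> v + 2 * q 0 0 1 v * mpd 0 0 1 \<alpha> v / 3 - q 0 0 2 v * mpd 0 0 0 \<alpha> v / 3 + mpd 0 1 1 \<alpha> v * v $ 3 = 0"
proof -
  have "0 = pd 3 (eq_plus \<alpha>) v"
    using pd_eq_0[OF assms eq] by simp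
  also have "\<dots> = pd 3 (\<lambda>v. mpd 1 0 0 \<alpha> v + v $ 3 * mpd 0 1 0 \<alpha> v + Q v * mpd 0 0 1 \<alpha> v - q 0 0 1 v * \<alpha> v / 3) v"
    by (simp add: eq_plus_def[abs_def])
  finally show ?thesis
    by (simp add: jet_rules[OF sa assms] jet_rules[OF smooth_QS assms] affine_jets[OF assms] two_eq_Suc field_simps)
qed

lemma eq_plus_pp:
  assumes "v \<in> S"
  shows "2 * mpd 0 1 1 \<alpha> v + q 0 0 2 v * mpd 0 0 1 \<alpha> v / 3 - q 0 0 3 v * mpd 0 0 0 \<alpha> v / 3 = 0"
proof -
  have "0 = pd 3 (\<lambda>v. mpd 0 1 0 \<alpha> v + mpd 1 0 1 \<alpha> v + 2 * q 0 0 1 v * mpd 0 0 1 \<alpha> v / 3 - q 0 0 2 v * mpd 0 0 0 \<alpha> v / 3 + mpd 0 1 1 \<alpha> v * v $ 3) v"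
    using pd_eq_0[OF assms eq_plus_p] by simp
  then show ?thesis
    by (simp add: jet_rules[OF sa assms] jet_rules[OF smooth_QS assms] affine_jets[OF assms] two_eq_Suc field_simps)
qed

text \<open>The third p-derivative of D alpha = Q_p alpha / 3. Since alpha is affine in p, all
  derivatives of alpha have cancelled at this stage and only the fourth p-derivative of Q times
  alpha is left.\<close>

lemma eq_plus_obstruction:
  assumes "v \<in> S"
  shows "q 0 0 4 v * \<alpha> v = 0"
proof -
  have "0 = pd 3 (\<lambda>v. 2 * mpd 0 1 1 \<alpha> v + q 0 0 2 v * mpd 0 0 1 \<alpha> v / 3 - q 0 0 3 v * mpd 0 0 0 \<alpha> v / 3) v"
    using pd_eq_0[OF assms eq_plus_pp] by simp
  then show ?thesis
    by (simp add: jet_rules[OF sa assms] jet_rules[OF smooth_QS assms] affine_jets[OF assms] two_eq_Suc field_simps)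
qed

lemma eq_plus_x:
  assumes "v \<in> S"
  shows "mpd 2 0 0 \<alpha> v + q 0 0 0 v * mpd 1 0 1 \<alpha> v - q 0 0 1 v * mpd 1 0 0 \<alpha> v / 3 + q 1 0 0 v * mpd 0 0 1 \<alpha> v - q 1 0 1 v * mpd 0 0 0 \<alpha> v / 3 + mpd 1 1 0 \<alpha> v * v $ 3 = 0"
proof -
  have "0 = pd 1 (eq_plus \<alpha>) v"
    using pd_eq_0[OF assms eq] by simp
  also have "\<dots> = pd 1 (\<lambda>v. mpd 1 0 0 \<alpha> v + v $ 3 * mpd 0 1 0 \<alpha> v + Q v * mpd 0 0 1 \<alpha> v - q 0 0 1 v * \<alpha> v / 3) v"
    by (simp add: eq_plus_def[abs_def])
  finally show ?thesis
    by (simp add: jet_rules[OF sa assms] jet_rules[OF smooth_QS assms] affine_jets[OF assms] two_eq_Suc field_simps)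
qed

lemma eq_plus_y:
  assumes "v \<in> S"
  shows "mpd 1 1 0 \<alpha> v + q 0 0 0 v * mpd 0 1 1 \<alpha> v - q 0 0 1 v * mpd 0 1 0 \<alpha> v / 3 + q 0 1 0 v * mpd 0 0 1 \<alpha> v - q 0 1 1 v * mpd 0 0 0 \<alpha> v / 3 + mpd 0 2 0 \<alpha> v * v $ 3 = 0"
proof -
  have "0 = pd 2 (eq_plus \<alpha>) v"
    using pd_eq_0[OF assms eq] by simp
  also have "\<dots> = pd 2 (\<lambda>v. mpd 1 0 0 \<alpha> v + v $ 3 * mpd 0 1 0 \<alpha> v + Q v * mpd 0 0 1 \<alpha> v - q 0 0 1 v * \<alpha> v / 3) v"
    by (simp add: eq_plus_def[abs_def])
  finally show ?thesis
    by (simp add: jet_rules[OF sa assms] jet_rules[OF smooth_QS assms] affine_jets[OF assms] two_eq_Suc field_simps)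
qed

text \<open>Twice the y-derivative of \<open>eq_plus_p\<close> minus the total derivative D of
  \<open>eq_plus_pp\<close>. Both contain 2 alpha_xyp + 2 p alpha_yyp, which cancels and leaves an
  equation for alpha_yy; it is needed for the component 22 of the Ricci tensor.\<close>

lemma eq_plus_mixed:
  assumes "v \<in> S"
  shows "2 * mpd 0 2 0 \<alpha> v + 4 * q 0 0 1 v * mpd 0 1 1 \<alpha> v / 3 - 2 * q 0 0 2 v * mpd 0 1 0 \<alpha> v / 3 - q 0 0 2 v * mpd 1 0 1 \<alpha> v / 3 + q 0 0 3 v * mpd 1 0 0 \<alpha> v / 3 + 4 * q 0 1 1 v * mpd 0 0 1 \<alpha> v / 3 - 2 * q 0 1 2 v * mpd 0 0 0 \<alpha> v / 3 - q 1 0 2 v * mpd 0 0 1 \<alpha> v / 3 + q 1 0 3 v * mpd 0 0 0 \<alpha> v / 3 + q 0 0 0 v * q 0 0 4 v * mpd 0 0 0 \<alpha> v / 3 - q 0 0 2 v * mpd 0 1 1 \<alpha> v * v $ 3 / 3 + q 0 0 3 v * mpd 0 1 0 \<alpha> v * v $ 3 / 3 - q 0 1 2 v * mpd 0 0 1 \<alpha> v * v $ 3 / 3 + q 0 1 3 v * mpd 0 0 0 \<alpha> v * v $ 3 / 3 = 0"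
proof -
  have 1: "0 = pd 2 (\<lambda>v. mpd 0 1 0 \<alpha> v + mpd 1 0 1 \<alpha> v + 2 * q 0 0 1 v * mpd 0 0 1 \<alpha> v / 3 - q 0 0 2 v * mpd 0 0 0 \<alpha> v / 3 + mpd 0 1 1 \<alpha> v * v $ 3) v"
    using pd_eq_0[OF assms eq_plus_p] by simp
  have 2: "0 = pd 1 (\<lambda>v. 2 * mpd 0 1 1 \<alpha> v + q 0 0 2 v * mpd 0 0 1 \<alpha> v / 3 - q 0 0 3 v * mpd 0 0 0 \<alpha> v / 3) v" "0 = pd 2 (\<lambda>v. 2 * mpd 0 1 1 \<alpha> v + q 0 0 2 v * mpd 0 0 1 \<alpha> v / 3 - q 0 0 3 v * mpd 0 0 0 \<alpha> v / 3) v"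
    using pd_eq_0[OF assms eq_plus_pp] by simp_all
  have "2 * mpd 0 2 0 \<alpha> v + 4 * q 0 0 1 v * mpd 0 1 1 \<alpha> v / 3 - 2 * q 0 0 2 v * mpd 0 1 0 \<alpha> v / 3 - q 0 0 2 v * mpd 1 0 1 \<alpha> v / 3 + q 0 0 3 v * mpd 1 0 0 \<alpha> v / 3 + 4 * q 0 1 1 v * mpd 0 0 1 \<alpha> v / 3 - 2 * q 0 1 2 v * mpd 0 0 0 \<alpha> v / 3 - q 1 0 2 v * mpd 0 0 1 \<alpha> v / 3 + q 1 0 3 v * mpd 0 0 0 \<alpha> v / 3 + q 0 0 0 v * q 0 0 4 v * mpd 0 0 0 \<alpha> v / 3 - q 0 0 2 v * mpd 0 1 1 \<alpha> v * v $ 3 / 3 + q 0 0 3 v * mpd 0 1 0 \<alpha> v * v $ 3 / 3 - q 0 1 2 v * mpd 0 0 1 \<alpha> v * v $ 3 / 3 + q 0 1 3 v * mpd 0 0 0 \<alpha> v * v $ 3 / 3 =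
      2 * pd 2 (\<lambda>v. mpd 0 1 0 \<alpha> v + mpd 1 0 1 \<alpha> v + 2 * q 0 0 1 v * mpd 0 0 1 \<alpha> v / 3 - q 0 0 2 v * mpd 0 0 0 \<alpha> v / 3 + mpd 0 1 1 \<alpha> v * v $ 3) v - pd 1 (\<lambda>v. 2 * mpd 0 1 1 \<alpha> v + q 0 0 2 v * mpd 0 0 1 \<alpha> v / 3 - q 0 0 3 v * mpd 0 0 0 \<alpha> v / 3) v - v $ 3 * pd 2 (\<lambda>v. 2 * mpd 0 1 1 \<alpha> v + q 0 0 2 v * mpd 0 0 1 \<alpha> v / 3 - q 0 0 3 v * mpd 0 0 0 \<alpha> v / 3) v
      + Q v * (q 0 0 4 v * \<alpha> v) / 3"
    by (simp add: jet_rules[OF sa assms] jet_rules[OF smooth_QS assms] affine_jets[OF assms] two_eq_Suc field_simps)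
  then show ?thesis
    unfolding 1[symmetric] 2[symmetric] eq_plus_obstruction[OF assms] by simp
qed

end

lemma w1_jets:
  assumes "v \<in> S"
  shows "w1 Q v = 6 * q 0 2 0 v - 4 * q 1 1 1 v + q 2 0 2 v - 3 * q 0 0 0 v * q 0 1 2 v + 2 * q 0 0 0 v * q 1 0 3 v + ((q 0 0 0 v)^2) * q 0 0 4 v + 4 * q 0 0 1 v * q 0 1 1 v - q 0 0 1 v * q 1 0 2 v - 3 * q 0 0 2 v * q 0 1 0 v + q 0 0 3 v * q 1 0 0 v - 4 * q 0 2 1 v * v $ 3 + q 0 2 2 v * ((v $ 3)^2) + 2 * q 1 1 2 v * v $ 3 + 2 * q 0 0 0 v * q 0 1 3 v * v $ 3 - q 0 0 1 v * q 0 1 2 v * v $ 3 + q 0 0 3 v * q 0 1 0 v * v $ 3"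
proof -
  have j: "pd 3 (q 0 0 1) = q 0 0 2" "pd 2 (q 0 0 1) = q 0 1 1" "pd 2 (q 0 1 0) = q 0 2 0"
    by (simp_all add: mpd_def numeral_2_eq_2)
  have j1: "pd 3 Q = q 0 0 1" "pd 2 Q = q 0 1 0"
    by (simp_all add: mpd_def)
  have D: "total_deriv Q f = (\<lambda>v. pd 1 f v + v $ 3 * pd 2 f v + Q v * pd 3 f v)" for f
    by (simp add: total_deriv_def[abs_def])
  show ?thesis
    unfolding w1_def Let_def j1 j D
    using smooth_QS assms
    by (simp add: jet_rules[OF smooth_QS assms] two_eq_Suc)
      (simp add: jet_rules[OF smooth_QS assms] two_eq_Suc algebra_simps power2_eq_square)
qed

lemma w2_jets: "w2 Q v = q 0 0 4 v"
  by (simp add: w2_def mpd_def numeral_eq_Suc)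

context
  fixes \<beta> assumes sb: "smooth_on S \<beta>" and bp: "\<And>v. v \<in> S \<Longrightarrow> mpd 0 0 1 \<beta> v = 0"
    and eq: "\<And>v. v \<in> S \<Longrightarrow> eq_minus \<beta> v = 0"
begin

lemma base_jets:
  assumes "v \<in> S"
  shows "mpd k l 1 \<beta> v = 0" "mpd k l 2 \<beta> v = 0" "mpd k l 3 \<beta> v = 0"
  using mpd_eq_0[OF sb bp assms, of k l 0] mpd_eq_0[OF sb bp assms, of k l 1]
    mpd_eq_0[OF sb bp assms, of k l 2] by (simp_all add: numeral_3_eq_3 numeral_2_eq_2)

text \<open>As beta does not depend on p, this is 18 D^2 beta - 6 Q_p D beta + (6 D Q_p - 18 Q_y - 4
  Q_p^2) beta = 0, expanded into jets so that it can be differentiated.\<close>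

lemma eq_minus_0:
  assumes "v \<in> S"
  shows "18 * mpd 2 0 0 \<beta> v + 18 * q 0 0 0 v * mpd 0 1 0 \<beta> v - 6 * q 0 0 1 v * mpd 1 0 0 \<beta> v - 4 * ((q 0 0 1 v)^2) * mpd 0 0 0 \<beta> v - 18 * q 0 1 0 v * mpd 0 0 0 \<beta> v + 6 * q 1 0 1 v * mpd 0 0 0 \<beta> v + 18 * mpd 0 2 0 \<beta> v * ((v $ 3)^2) + 36 * mpd 1 1 0 \<beta> v * v $ 3 + 6 * q 0 0 0 v * q 0 0 2 v * mpd 0 0 0 \<beta> v - 6 * q 0 0 1 v * mpd 0 1 0 \<beta> v * v $ 3 + 6 * q 0 1 1 v * mpd 0 0 0 \<beta> v * v $ 3 = 0"
  using eq[OF assms] unfolding eq_minus_def by (simp add: algebra_simps)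

lemma eq_minus_p:
  assumes "v \<in> S"
  shows "36 * mpd 1 1 0 \<beta> v + 12 * q 0 0 1 v * mpd 0 1 0 \<beta> v - 6 * q 0 0 2 v * mpd 1 0 0 \<beta> v - 12 * q 0 1 1 v * mpd 0 0 0 \<beta> v + 6 * q 1 0 2 v * mpd 0 0 0 \<beta> v + 36 * mpd 0 2 0 \<beta> v * v $ 3 + 6 * q 0 0 0 v * q 0 0 3 v * mpd 0 0 0 \<beta> v - 2 * q 0 0 1 v * q 0 0 2 v * mpd 0 0 0 \<beta> v - 6 * q 0 0 2 v * mpd 0 1 0 \<beta> v * v $ 3 + 6 * q 0 1 2 v * mpd 0 0 0 \<beta> v * v $ 3 = 0"
proof -
  have "0 = pd 3 (\<lambda>v. 18 * mpd 2 0 0 \<beta> v + 18 * q 0 0 0 v * mpd 0 1 0 \<beta> v - 6 * q 0 0 1 v * mpd 1 0 0 \<beta> v - 4 * ((q 0 0 1 v)^2) * mpd 0 0 0 \<beta> v - 18 * q 0 1 0 v * mpd 0 0 0 \<beta> v + 6 * q 1 0 1 v * mpd 0 0 0 \<beta> v + 18 * mpd 0 2 0 \<beta> v * ((v $ 3)^2) + 36 * mpd 1 1 0 \<beta> v * v $ 3 + 6 * q 0 0 0 v * q 0 0 2 v * mpd 0 0 0 \<beta> v - 6 * q 0 0 1 v * mpd 0 1 0 \<beta> v * v $ 3 + 6 * q 0 1 1 v * mpd 0 0 0 \<beta> v * v $ 3) v"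
    using pd_eq_0[OF assms eq_minus_0] by simp
  then show ?thesis
    by (simp add: jet_rules[OF sb assms] jet_rules[OF smooth_QS assms] base_jets[OF assms] 
      base_jets(1)[OF assms, unfolded One_nat_def] two_eq_Suc algebra_simps power2_eq_square)
qed

text \<open>Together with the two preceding equations this determines beta_yy, beta_xy and beta_xx,
  in this order, through beta, beta_x and beta_y. The system is thus of finite type and has
  compatibility conditions.\<close>

lemma eq_minus_pp:
  assumes "v \<in> S"
  shows "36 * mpd 0 2 0 \<beta> v + 6 * q 0 0 2 v * mpd 0 1 0 \<beta> v - 2 * ((q 0 0 2 v)^2) * mpd 0 0 0 \<beta> v - 6 * q 0 0 3 v * mpd 1 0 0 \<beta> v - 6 * q 0 1 2 v * mpd 0 0 0 \<beta> v + 6 * q 1 0 3 v * mpd 0 0 0 \<beta> v + 6 * q 0 0 0 v * q 0 0 4 v * mpd 0 0 0 \<beta> v + 4 * q 0 0 1 v * q 0 0 3 v * mpd 0 0 0 \<beta> v - 6 * q 0 0 3 v * mpd 0 1 0 \<beta> v * v $ 3 + 6 * q 0 1 3 v * mpd 0 0 0 \<beta> v * v $ 3 = 0"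
proof -
  have "0 = pd 3 (\<lambda>v. 36 * mpd 1 1 0 \<beta> v + 12 * q 0 0 1 v * mpd 0 1 0 \<beta> v - 6 * q 0 0 2 v * mpd 1 0 0 \<beta> v - 12 * q 0 1 1 v * mpd 0 0 0 \<beta> v + 6 * q 1 0 2 v * mpd 0 0 0 \<beta> v + 36 * mpd 0 2 0 \<beta> v * v $ 3 + 6 * q 0 0 0 v * q 0 0 3 v * mpd 0 0 0 \<beta> v - 2 * q 0 0 1 v * q 0 0 2 v * mpd 0 0 0 \<beta> v - 6 * q 0 0 2 v * mpd 0 1 0 \<beta> v * v $ 3 + 6 * q 0 1 2 v * mpd 0 0 0 \<beta> v * v $ 3) v"
    using pd_eq_0[OF assms eq_minus_p] by simp
  then show ?thesis
    by (simp add: jet_rules[OF sb assms] jet_rules[OF smooth_QS assms] base_jets[OF assms] 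
      base_jets(1)[OF assms, unfolded One_nat_def] two_eq_Suc algebra_simps power2_eq_square)
qed

text \<open>In D(T_p) / 6 - T_y / 3, where T is the left side of the equation, the third derivatives
  of beta cancel. Suitable multiples of T_p and T remove what is left of the second and first
  derivatives, and the coefficient of beta turns out to be \<open>w1\<close>.\<close>

lemma eq_minus_obstruction:
  assumes "v \<in> S"
  shows "w1 Q v * \<beta> v = 0"
proof -
  let ?T = "\<lambda>v. 18 * mpd 2 0 0 \<beta> v + 18 * q 0 0 0 v * mpd 0 1 0 \<beta> v - 6 * q 0 0 1 v * mpd 1 0 0 \<beta> v - 4 * ((q 0 0 1 v)^2) * mpd 0 0 0 \<beta> v - 18 * q 0 1 0 v * mpd 0 0 0 \<beta> v + 6 * q 1 0 1 v * mpd 0 0 0 \<beta> v + 18 * mpd 0 2 0 \<beta> v * ((v $ 3)^2) + 36 * mpd 1 1 0 \<beta> v * v $ 3 + 6 * q 0 0 0 v * q 0 0 2 v * mpd 0 0 0 \<beta> v - 6 * q 0 0 1 v * mpd 0 1 0 \<beta> v * v $ 3 + 6 * q 0 1 1 v * mpd 0 0 0 \<beta> v * v $ 3" and ?Tp = "\<lambda>v. 36 * mpd 1 1 0 \<beta> v + 12 * q 0 0 1 v * mpd 0 1 0 \<beta> v - 6 * q 0 0 2 v * mpd 1 0 0 \<beta> v - 12 * q 0 1 1 v * mpd 0 0 0 \<beta> v + 6 * q 1 0 2 v * mpd 0 0 0 \<beta> v + 36 * mpd 0 2 0 \<beta> v * v $ 3 + 6 * q 0 0 0 v * q 0 0 3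 v * mpd 0 0 0 \<beta> v - 2 * q 0 0 1 v * q 0 0 2 v * mpd 0 0 0 \<beta> v - 6 * q 0 0 2 v * mpd 0 1 0 \<beta> v * v $ 3 + 6 * q 0 1 2 v * mpd 0 0 0 \<beta> v * v $ 3"
  have "w1 Q v * \<beta> v = (pd 1 ?Tp v + v $ 3 * pd 2 ?Tp v + Q v * pd 3 ?Tp v) / 6 - pd 2 ?T v / 3
      - q 0 0 1 v * ?Tp v / 9 + q 0 0 2 v * ?T v / 18"
    unfolding w1_jets[OF assms]
    by (simp add: jet_rules[OF sb assms] jet_rules[OF smooth_QS assms] base_jets[OF assms] 
      base_jets(1)[OF assms, unfolded One_nat_def] two_eq_Suc)
      (simp add: field_simps power2_eq_square)
  also have "\<dots> = 0"
    using pd_eq_0[OF assms eq_minus_p] pd_eq_0[OF assms eq_minus_0] eq_minus_0[OF assms] eq_minus_p[OF assms]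
    by simp
  finally show ?thesis .
qed

end

end

section \<open>Ricci tensor of h / sigma^2 and the linear equations contained in the Einstein
  condition\<close>

section \<open>The Einstein equations of a Fefferman metric\<close>

lemma (in fefferman_patch) ricci_hat_sym:
  assumes z: "z \<in> U"
  shows "ricci h z $ k $ j = ricci h z $ j $ k"
proof -
  have f: "\<Gamma> l j k = \<Gamma> l k j" for l j k
    by (rule ext) (rule christoffel_sym)
  have r: "ricci h z $ k $ j = (\<Sum>l\<in>UNIV. pd l (\<Gamma> l j k) z)
    - (\<Sum>l\<in>UNIV. \<Sum>m\<in>UNIV. \<Gamma> l j m z * \<Gamma> m l k z)" for j k
    by (rule ricci_trace_free[OF z christoffel_trace])
  have "(\<Sum>l\<in>UNIV. \<Sum>m\<in>UNIV. \<Gamma> l j m z * \<Gamma> m l k z) = (\<Sum>m\<in>UNIV. \<Sum>l\<in>UNIV. \<Gamma> l j m z * \<Gamma> m l k z)"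
    by (rule sum.swap)
  also have "\<dots> = (\<Sum>m\<in>UNIV. \<Sum>l\<in>UNIV. \<Gamma> m k l z * \<Gamma> l m j z)"
    by (intro sum.cong refl) (metis f mult.commute)
  finally show ?thesis
    unfolding r f[of _ j k] by simp
qed

locale fefferman_scaled = fefferman_patch +
  fixes \<sigma> :: "real^4 \<Rightarrow> real"
  assumes smooth_sigma: "smooth_on U \<sigma>" and sigma_nonzero: "z \<in> U \<Longrightarrow> \<sigma> z \<noteq> 0"
begin

sublocale conformal_patch U h H \<sigma>
  by unfold_locales (rule smooth_sigma, rule sigma_nonzero)

lemma sigma_commute:
  assumes "z \<in> U"
  shows "pd 2 (pd 1 \<sigma>) z = pd 1 (pd 2 \<sigma>) z" "pd 3 (pd 1 \<sigma>) z = pd 1 (pd 3 \<sigma>) z"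
    "pd 4 (pd 1 \<sigma>) z = pd 1 (pd 4 \<sigma>) z" "pd 3 (pd 2 \<sigma>) z = pd 2 (pd 3 \<sigma>) z"
    "pd 4 (pd 2 \<sigma>) z = pd 2 (pd 4 \<sigma>) z" "pd 4 (pd 3 \<sigma>) z = pd 3 (pd 4 \<sigma>) z"
  by (rule pd_commute[OF open_dom assms smooth_sigma])+

lemma pd_sigma_differentiable: "z \<in> U \<Longrightarrow> pd j \<sigma> differentiable (at z)" "z \<in> U \<Longrightarrow> \<sigma> differentiable (at z)"
  using smooth_on_differentiable[OF smooth_on_pd[OF smooth_sigma]] smooth_on_differentiable[OF smooth_sigma]
  by blast+

text \<open>Collects the terms proportional to \<open>h\<close> in dimension four. As the
  Christoffel symbols of \<open>h\<close> are trace free, the Laplacian of \<open>\<sigma>\<close>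
  is the plain divergence of \<open>grad\<close>.\<close>

definition mu :: "real^4 \<Rightarrow> real" where
  "mu z = (\<Sum>l\<in>UNIV. pd l (grad l) z) - 3 * (\<Sum>m\<in>UNIV. pd m \<sigma> z * grad m z) / \<sigma> z"

lemma mu_explicit:
  assumes "z \<in> U"
  shows "\<sigma> z * mu z = - 6 * J 0 0 0 z * ((pd 3 \<sigma> z)^2) + \<sigma> z * pd 2 \<sigma> z + 2 * \<sigma> z * pd 1 (pd 3 \<sigma>) z - 6 * pd 3 \<sigma> z * pd 1 \<sigma> z - 3 * \<sigma> z * pd 2 (pd 4 \<sigma>) z / i + 9 * pd 4 \<sigma> z * pd 2 \<sigma> z / i + 2 * z $ 3 * \<sigma> z * pd 2 (pd 3 \<sigma>) z - 6 * z $ 3 * pd 3 \<sigma> z * pd 2 \<sigma> z + 2 * J 0 0 0 z * \<sigma> z * pd 3 (pd 3 \<sigma>) z + 2 * J 0 0 1 z * \<sigma> z * pd 3 \<sigma> z - 9 * J 0 0 2 z * ((pd 4 \<sigma> z)^2) / (4 * (i^2)) - 2 * J 0 0 1 z * \<sigma> z * pd 3 (pd 4 \<sigma>) z / i + 6 * J 0 0 1 z * pd 4 \<sigma> z * pd 3 \<sigma> z / i - J 0 0 2 z * \<sigma> z * pd 4 \<sigma> z / i + 3 * J 0 0 2 z * \<sigma> z * pd 4 (pd 4 \<sigma>) z / (4 * (i^2))"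
proof -
  have G: "grad 1 = (\<lambda>w. pd 3 \<sigma> w)" "grad 2 = (\<lambda>w. w $ 3 * pd 3 \<sigma> w - 3 / (2 * i) * pd 4 \<sigma> w)"
    "grad 3 = (\<lambda>w. pd 1 \<sigma> w + w $ 3 * pd 2 \<sigma> w + 2 * J 0 0 0 w * pd 3 \<sigma> w - J 0 0 1 w / i * pd 4 \<sigma> w)"
    "grad 4 = (\<lambda>w. - (3 / (2 * i)) * pd 2 \<sigma> w - J 0 0 1 w / i * pd 3 \<sigma> w + 3 * J 0 0 2 w / (4 * i^2) * pd 4 \<sigma> w)"
    by (simp_all add: grad_def[abs_def] sum_4 H_entries fun_eq_iff)
  show ?thesis
    unfolding mu_def sum_4 G using i_nonzero sigma_nonzero[OF assms]
    by (simp add: J_rules assms pd_sigma_differentiable sigma_commute)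
      (simp add: field_simps power2_eq_square power4_eq_xxxx)
qed

text \<open>\<open>ricci_conformal\<close> in dimension four, cleared of denominators. Everything
  except the last summand is linear in \<open>\<sigma>\<close>.\<close>

lemma ricci_scaled_eq:
  assumes z: "z \<in> U"
  shows "\<sigma> z * ricci g z $ k $ j = \<sigma> z * ricci h z $ k $ j
    + 2 * (pd j (pd k \<sigma>) z - (\<Sum>m\<in>UNIV. \<Gamma> m j k z * pd m \<sigma> z)) + h z $ j $ k * mu z"
proof -
  have "(\<Sum>l\<in>UNIV. \<Sum>m\<in>UNIV. \<Gamma> l l m z * grad m z) = (\<Sum>m\<in>UNIV. (\<Sum>l\<in>UNIV. \<Gamma> l l m z) * grad m z)"
    unfolding sum_distrib_right by (rule sum.swap)
  then have 0: "(\<Sum>l\<in>UNIV. \<Sum>m\<in>UNIV. \<Gamma> l l m z * grad m z) = 0"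
    by (simp add: christoffel_trace[OF z])
  show ?thesis
    unfolding ricci_conformal[OF z] 0 mu_def using sigma_nonzero[OF z]
    by (simp add: field_simps power2_eq_square)
qed

lemma ricci_scaled_sym:
  assumes z: "z \<in> U" shows "ricci g z $ k $ j = ricci g z $ j $ k"
proof -
  have "\<sigma> z * ricci g z $ k $ j = \<sigma> z * ricci g z $ j $ k"
    unfolding ricci_scaled_eq[OF z] ricci_hat_sym[OF z, of k j] symmetric[of z j k]
      pd_commute[OF open_dom z smooth_sigma, of j k] christoffel_sym[of _ j k z] ..
  then show ?thesis using sigma_nonzero[OF z] by simp
qed

text \<open>The summand with \<open>mu\<close> stays unexpanded: as the pure trace part it is
  eliminated when equations are extracted, and evaluated only when Ricci flatness is
  verified.\<close>

lemma ricci_scaled: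
  assumes z: "z \<in> U"
  shows "\<sigma> z * ricci g z $ 1 $ 1 = 2 * pd 1 (pd 1 \<sigma>) z - 2 * J 0 0 1 z * pd 1 \<sigma> z / 3 - 2 * ((J 0 0 1 z)^2) * \<sigma> z / 9 - J 0 1 0 z * \<sigma> z + 2 * J 1 0 0 z * pd 3 \<sigma> z - 4 * J 0 0 0 z * J 0 0 1 z * pd 3 \<sigma> z / 3 + J 0 0 0 z * J 0 0 2 z * \<sigma> z - 2 * J 0 0 1 z * z $ 3 * pd 2 \<sigma> z / 3 + 2 * ((J 0 0 1 z)^2) * pd 4 \<sigma> z / (3 * i) + 2 * J 0 0 2 z * z $ 3 * pd 1 \<sigma> z / 3 + 2 * J 0 0 2 z * ((z $ 3)^2) * pd 2 \<sigma> z / 3 - ((J 0 0 2 z)^2) * ((z $ 3)^2) * \<sigma> z / 18 - J 0 0 3 z * ((z $ 3)^2) * pd 1 \<sigma> z / 3 - J 0 0 3 z * ((z $ 3)^3) * pd 2 \<sigma> z / 3 + 3 * J 0 1 0 z * pd 4 \<sigma> z / i - 2 * J 0 1 0 z * z $ 3 * pd 3 \<sigma> z + 4 * J 0 1 1 z * z $ 3 * \<sigma> z / 3 + 4 * J 0 1 1 z * ((z $ 3)^2) * pd 3 \<sigma> z / 3 - 5 * J 0 1 2 z * ((z $ 3)^2) * \<sigma> z / 6 - J 0 1 2 z * ((z $ 3)^3) * pd 3 \<sigma> z / 3 + J 0 1 3 z * ((z $ 3)^3) * \<sigma> z / 3 - 2 * J 1 0 1 z * pd 4 \<sigma> z / i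 - J 1 0 2 z * z $ 3 * \<sigma> z / 3 - J 1 0 2 z * ((z $ 3)^2) * pd 3 \<sigma> z / 3 + J 1 0 3 z * ((z $ 3)^2) * \<sigma> z / 3 + 4 * J 0 0 0 z * J 0 0 2 z * z $ 3 * pd 3 \<sigma> z / 3 - 2 * J 0 0 0 z * J 0 0 3 z * z $ 3 * \<sigma> z / 3 - 2 * J 0 0 0 z * J 0 0 3 z * ((z $ 3)^2) * pd 3 \<sigma> z / 3 + J 0 0 0 z * J 0 0 4 z * ((z $ 3)^2) * \<sigma> z / 3 - 2 * J 0 0 1 z * J 0 0 2 z * z $ 3 * \<sigma> z / 9 + J 0 0 1 z * J 0 0 3 z * ((z $ 3)^2) * \<sigma> z / 3 - 2 * J 0 1 1 z * z $ 3 * pd 4 \<sigma> z / i + J 0 1 2 z * ((z $ 3)^2) * pd 4 \<sigma> z / (2 * i) + J 1 0 2 z * z $ 3 * pd 4 \<sigma> z / i - 2 * J 0 0 1 z * J 0 0 2 z * z $ 3 * pd 4 \<sigma> z / (3 * i) + J 0 0 1 z * J 0 0 3 z * ((z $ 3)^2) * pd 4 \<sigma> z / (3 * i) + h z $ 1 $ 1 * mu z"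
    "\<sigma> z * ricci g z $ 1 $ 2 = 2 * pd 1 (pd 2 \<sigma>) z - J 0 0 2 z * pd 1 \<sigma> z / 3 + 2 * J 0 1 0 z * pd 3 \<sigma> z - 2 * J 0 1 1 z * \<sigma> z / 3 + J 1 0 2 z * \<sigma> z / 6 - 2 * J 0 0 0 z * J 0 0 2 z * pd 3 \<sigma> z / 3 + J 0 0 0 z * J 0 0 3 z * \<sigma> z / 3 + J 0 0 1 z * J 0 0 2 z * \<sigma> z / 9 - J 0 0 2 z * z $ 3 * pd 2 \<sigma> z / 3 + ((J 0 0 2 z)^2) * z $ 3 * \<sigma> z / 18 + J 0 0 3 z * z $ 3 * pd 1 \<sigma> z / 3 + J 0 0 3 z * ((z $ 3)^2) * pd 2 \<sigma> z / 3 - 4 * J 0 1 1 z * z $ 3 * pd 3 \<sigma> z / 3 + 2 * J 0 1 2 z * z $ 3 * \<sigma> z / 3 + J 0 1 2 z * ((z $ 3)^2) * pd 3 \<sigma> z / 3 - J 0 1 3 z * ((z $ 3)^2) * \<sigma> z / 3 - J 1 0 2 z * pd 4 \<sigma> z / (2 * i) + J 1 0 2 z * z $ 3 * pd 3 \<sigma> z / 3 - J 1 0 3 z * z $ 3 * \<sigma> z / 3 + 2 * J 0 0 0 z * J 0 0 3 z * z $ 3 * pd 3 \<sigma> z / 3 - J 0 0 0 z * J 0 0 4 z * z $ 3 * \<sigma> z / 3 + J 0 0 1 z * J 0 0 2 z * pd 4 \<sigma> z / (3 * i) - J 0 0 1 z * J 0 0 3 z * z $ 3 * \<sigma> z / 3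 - J 0 0 1 z * J 0 0 3 z * z $ 3 * pd 4 \<sigma> z / (3 * i) + h z $ 1 $ 2 * mu z"
    "\<sigma> z * ricci g z $ 1 $ 3 = pd 2 \<sigma> z + 2 * pd 1 (pd 3 \<sigma>) z + 4 * J 0 0 1 z * pd 3 \<sigma> z / 3 - J 0 0 2 z * \<sigma> z / 2 - J 0 0 2 z * pd 4 \<sigma> z / i - J 0 0 2 z * z $ 3 * pd 3 \<sigma> z / 3 + J 0 0 3 z * z $ 3 * \<sigma> z / 6 + J 0 0 3 z * z $ 3 * pd 4 \<sigma> z / (2 * i) + h z $ 1 $ 3 * mu z"
    "\<sigma> z * ricci g z $ 1 $ 4 = 2 * pd 1 (pd 4 \<sigma>) z + 2 * i * pd 1 \<sigma> z / 3 - 2 * J 0 0 1 z * pd 4 \<sigma> z / 3 + 2 * i * z $ 3 * pd 2 \<sigma> z / 3 + 4 * J 0 0 0 z * i * pd 3 \<sigma> z / 3 - 2 * J 0 0 1 z * i * \<sigma> z / 9 - J 0 0 2 z * i * z $ 3 * \<sigma> z / 9 + h z $ 1 $ 4 * mu z"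
    "\<sigma> z * ricci g z $ 2 $ 2 = 2 * pd 2 (pd 2 \<sigma>) z - ((J 0 0 2 z)^2) * \<sigma> z / 18 - J 0 0 3 z * pd 1 \<sigma> z / 3 + 4 * J 0 1 1 z * pd 3 \<sigma> z / 3 - J 0 1 2 z * \<sigma> z / 2 - J 1 0 2 z * pd 3 \<sigma> z / 3 + J 1 0 3 z * \<sigma> z / 3 - 2 * J 0 0 0 z * J 0 0 3 z * pd 3 \<sigma> z / 3 + J 0 0 0 z * J 0 0 4 z * \<sigma> z / 3 + J 0 0 1 z * J 0 0 3 z * \<sigma> z / 3 - J 0 0 3 z * z $ 3 * pd 2 \<sigma> z / 3 - J 0 1 2 z * pd 4 \<sigma> z / (2 * i) - J 0 1 2 z * z $ 3 * pd 3 \<sigma> z / 3 + J 0 1 3 z * z $ 3 * \<sigma> z / 3 + J 0 0 1 z * J 0 0 3 z * pd 4 \<sigma> z / (3 * i) + h z $ 2 $ 2 * mu z"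
    "\<sigma> z * ricci g z $ 2 $ 3 = 2 * pd 2 (pd 3 \<sigma>) z + J 0 0 2 z * pd 3 \<sigma> z / 3 - J 0 0 3 z * \<sigma> z / 6 - J 0 0 3 z * pd 4 \<sigma> z / (2 * i) + h z $ 2 $ 3 * mu z"
    "\<sigma> z * ricci g z $ 2 $ 4 = 2 * pd 2 (pd 4 \<sigma>) z + J 0 0 2 z * i * \<sigma> z / 9 + h z $ 2 $ 4 * mu z"
    "\<sigma> z * ricci g z $ 3 $ 3 = 2 * pd 3 (pd 3 \<sigma>) z + h z $ 3 $ 3 * mu z"
    "\<sigma> z * ricci g z $ 3 $ 4 = 2 * pd 3 (pd 4 \<sigma>) z - 2 * i * pd 3 \<sigma> z / 3 + h z $ 3 $ 4 * mu z"
    "\<sigma> z * ricci g z $ 4 $ 4 = 2 * pd 4 (pd 4 \<sigma>) z - 2 * (i^2) * \<sigma> z / 9 + h z $ 4 $ 4 * mu z"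
  unfolding ricci_scaled_eq[OF z] ricci_hat[OF z] sum_4 christoffel_hat_sym christoffel_hat[OF z]
    sigma_commute[OF z] symmetric[of z 2 1] symmetric[of z 3 1] symmetric[of z 4 1] symmetric[of z 3 2]
    symmetric[of z 4 2] symmetric[of z 4 3]
  using i_nonzero by (simp_all add: field_simps power2_eq_square power3_eq_cube)

text \<open>Every component states that an expression linear in sigma equals the corresponding entry
  of \<open>h\<close> times the same unknown factor nu. The conclusions are those combinations of
  components for which the entries of \<open>h\<close> add up to 0; the first three come from the
  vanishing entries 33, 34 and 44.\<close>

lemma einstein_necessary:
  assumes z: "z \<in> U" and E: "ricci g z = \<Lambda> *\<^sub>R g z"
  shows "pd 3 (pd 3 \<sigma>) z = 0" "pd 3 (pd 4 \<sigma>) z = i / 3 * pd 3 \<sigma> z"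
    "pd 4 (pd 4 \<sigma>) z = i^2 / 9 * \<sigma> z"
    "2 * pd 1 (pd 4 \<sigma>) z + 2 * i * pd 1 \<sigma> z / 3 + 2 * z $ 3 * pd 2 (pd 4 \<sigma>) z - 2 * J 0 0 1 z * pd 4 \<sigma> z / 3 + 2 * i * z $ 3 * pd 2 \<sigma> z / 3 + 4 * J 0 0 0 z * i * pd 3 \<sigma> z / 3 - 2 * J 0 0 1 z * i * \<sigma> z / 9 = 0"
    "2 * pd 1 (pd 1 \<sigma>) z + 4 * z $ 3 * pd 1 (pd 2 \<sigma>) z + 2 * ((z $ 3)^2) * pd 2 (pd 2 \<sigma>) z - 2 * J 0 0 1 z * pd 1 \<sigma> z / 3 - 2 * ((J 0 0 1 z)^2) * \<sigma> z / 9 - J 0 1 0 z * \<sigma> z + 2 * J 1 0 0 z * pd 3 \<sigma> z - 6 * J 0 0 0 z * pd 2 (pd 4 \<sigma>) z / i - 4 * J 0 0 0 z * J 0 0 1 z * pd 3 \<sigma> z / 3 + 2 * J 0 0 0 z * J 0 0 2 z * \<sigma> z / 3 - 2 * J 0 0 1 z * z $ 3 * pd 2 \<sigma> z / 3 + 2 * ((J 0 0 1 z)^2) * pd 4 \<sigma> z / (3 * i) + 3 * J 0 1 0 z * pd 4 \<sigma> z / i + 2 * J 0 1 0 z * z $ 3 * pd 3 \<sigma> z - 2 * J 1 0 1 z * pd 4 \<sigma> z / i - 2 * J 0 1 1 z * z $ 3 * pd 4 \<sigma> z / i = 0"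
proof -
  define \<nu> where "\<nu> = \<Lambda> / \<sigma> z - mu z"
  have "\<sigma> z * ricci g z $ k $ j = h z $ k $ j * (\<nu> + mu z)" for k j
    using sigma_nonzero[OF z] by (simp add: E g_def \<nu>_def power2_eq_square)
  note e = this[of 1 1, unfolded ricci_scaled[OF z]] this[of 1 2, unfolded ricci_scaled[OF z]]
    this[of 1 4, unfolded ricci_scaled[OF z]] this[of 2 2, unfolded ricci_scaled[OF z]]
    this[of 2 4, unfolded ricci_scaled[OF z]] this[of 3 3, unfolded ricci_scaled[OF z]]
    this[of 3 4, unfolded ricci_scaled[OF z]] this[of 4 4, unfolded ricci_scaled[OF z]]
  have e': "X = c * \<nu>" if "X + c * mu z = c * (\<nu> + mu z)" for X c
    using that by (simp add: algebra_simps)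
  note e = e[THEN e', unfolded h_entries]
  show "pd 3 (pd 3 \<sigma>) z = 0" "pd 3 (pd 4 \<sigma>) z = i / 3 * pd 3 \<sigma> z"
    "pd 4 (pd 4 \<sigma>) z = i^2 / 9 * \<sigma> z"
    using e(6-8) by (simp_all add: field_simps)
  \<comment> \<open>Component 14 plus p times component 24; indeed h14 + p h24 = 0.\<close>
  have "2 * pd 1 (pd 4 \<sigma>) z + 2 * i * pd 1 \<sigma> z / 3 + 2 * z $ 3 * pd 2 (pd 4 \<sigma>) z - 2 * J 0 0 1 z * pd 4 \<sigma> z / 3 + 2 * i * z $ 3 * pd 2 \<sigma> z / 3 + 4 * J 0 0 0 z * i * pd 3 \<sigma> z / 3 - 2 * J 0 0 1 z * i * \<sigma> z / 9 = (2 * pd 1 (pd 4 \<sigma>) z + 2 * i * pd 1 \<sigma> z / 3 - 2 * J 0 0 1 z * pd 4 \<sigma> z / 3 + 2 * i * z $ 3 * pd 2 \<sigma> z / 3 + 4 * J 0 0 0 z * i * pd 3 \<sigma> z / 3 - 2 * J 0 0 1 z * i * \<sigma> z / 9 - J 0 0 2 z * i * z $ 3 * \<sigma> z / 9) + z $ 3 * (2 * pd 2 (pd 4 \<sigma>) z + J 0 0 2 z * i * \<sigma> z / 9)"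
    by (simp add: algebra_simps)
  also have "\<dots> = 0" unfolding e(3) e(5) by (simp add: algebra_simps)
  finally show "2 * pd 1 (pd 4 \<sigma>) z + 2 * i * pd 1 \<sigma> z / 3 + 2 * z $ 3 * pd 2 (pd 4 \<sigma>) z - 2 * J 0 0 1 z * pd 4 \<sigma> z / 3 + 2 * i * z $ 3 * pd 2 \<sigma> z / 3 + 4 * J 0 0 0 z * i * pd 3 \<sigma> z / 3 - 2 * J 0 0 1 z * i * \<sigma> z / 9 = 0" .
  \<comment> \<open>Components 11 + 2 p 12 + p^2 22, for which the entries of \<open>h\<close> sum
    to - 2 Q. Since h24 = - 2 i / 3, subtracting 3 Q / i times component 24 balances this.\<close>
  have "2 * pd 1 (pd 1 \<sigma>) z + 4 * z $ 3 * pd 1 (pd 2 \<sigma>) z + 2 * ((z $ 3)^2) * pd 2 (pd 2 \<sigma>) z - 2 * J 0 0 1 z * pd 1 \<sigma> z / 3 - 2 * ((J 0 0 1 z)^2) * \<sigma> z / 9 - J 0 1 0 z * \<sigma> z + 2 * J 1 0 0 z * pd 3 \<sigma> z - 6 * J 0 0 0 z * pd 2 (pd 4 \<sigma>) z / i - 4 * J 0 0 0 z * J 0 0 1 z * pd 3 \<sigma> z / 3 + 2 * J 0 0 0 z * J 0 0 2 z * \<sigma> z / 3 - 2 * J 0 0 1 z * z $ 3 * pd 2 \<sigma> z / 3 + 2 * ((J 0 0 1 z)^2) * pd 4 \<sigma> z / (3 * i) + 3 * J 0 1 0 z * pd 4 \<sigma> z / i + 2 * J 0 1 0 z * z $ 3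 * pd 3 \<sigma> z - 2 * J 1 0 1 z * pd 4 \<sigma> z / i - 2 * J 0 1 1 z * z $ 3 * pd 4 \<sigma> z / i = (2 * pd 1 (pd 1 \<sigma>) z - 2 * J 0 0 1 z * pd 1 \<sigma> z / 3 - 2 * ((J 0 0 1 z)^2) * \<sigma> z / 9 - J 0 1 0 z * \<sigma> z + 2 * J 1 0 0 z * pd 3 \<sigma> z - 4 * J 0 0 0 z * J 0 0 1 z * pd 3 \<sigma> z / 3 + J 0 0 0 z * J 0 0 2 z * \<sigma> z - 2 * J 0 0 1 z * z $ 3 * pd 2 \<sigma> z / 3 + 2 * ((J 0 0 1 z)^2) * pd 4 \<sigma> z / (3 * i) + 2 * J 0 0 2 z * z $ 3 * pd 1 \<sigma> z / 3 + 2 * J 0 0 2 z * ((z $ 3)^2) * pd 2 \<sigma> z / 3 - ((J 0 0 2 z)^2) * ((z $ 3)^2) * \<sigma> z / 18 - J 0 0 3 z * ((z $ 3)^2) * pd 1 \<sigma> z / 3 - J 0 0 3 z * ((z $ 3)^3) * pd 2 \<sigma> z / 3 + 3 * J 0 1 0 z * pd 4 \<sigma> z / i - 2 * J 0 1 0 z * z $ 3 * pd 3 \<sigma> z + 4 * J 0 1 1 z * z $ 3 * \<sigma> z / 3 + 4 * J 0 1 1 z * ((z $ 3)^2) * pd 3 \<sigma> z / 3 - 5 * J 0 1 2 z * ((z $ 3)^2) * \<sigma> z / 6 - J 0 1 2 z * ((z $ 3)^3) * pd 3 \<sigma> z / 3 + J 0 1 3 z * ((z $ 3)^3) * \<sigma>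 z / 3 - 2 * J 1 0 1 z * pd 4 \<sigma> z / i - J 1 0 2 z * z $ 3 * \<sigma> z / 3 - J 1 0 2 z * ((z $ 3)^2) * pd 3 \<sigma> z / 3 + J 1 0 3 z * ((z $ 3)^2) * \<sigma> z / 3 + 4 * J 0 0 0 z * J 0 0 2 z * z $ 3 * pd 3 \<sigma> z / 3 - 2 * J 0 0 0 z * J 0 0 3 z * z $ 3 * \<sigma> z / 3 - 2 * J 0 0 0 z * J 0 0 3 z * ((z $ 3)^2) * pd 3 \<sigma> z / 3 + J 0 0 0 z * J 0 0 4 z * ((z $ 3)^2) * \<sigma> z / 3 - 2 * J 0 0 1 z * J 0 0 2 z * z $ 3 * \<sigma> z / 9 + J 0 0 1 z * J 0 0 3 z * ((z $ 3)^2) * \<sigma> z / 3 - 2 * J 0 1 1 z * z $ 3 * pd 4 \<sigma> z / i + J 0 1 2 z * ((z $ 3)^2) * pd 4 \<sigma> z / (2 * i) + J 1 0 2 z * z $ 3 * pd 4 \<sigma> z / i - 2 * J 0 0 1 z * J 0 0 2 z * z $ 3 * pd 4 \<sigma> z / (3 * i) + J 0 0 1 z * J 0 0 3 z * ((z $ 3)^2) * pd 4 \<sigma> z / (3 * i)) + 2 * z $ 3 * (2 * pd 1 (pd 2 \<sigma>) z - J 0 0 2 z * pd 1 \<sigma> z / 3 + 2 * J 0 1 0 z * pd 3 \<sigma> z - 2 * J 0 1 1 z * \<sigma> z / 3 + J 1 0 2 z * \<sigma> z / 6 - 2 * J 0 0 0 z * J 0 0 2 z * pd 3 \<sigma> z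 / 3 + J 0 0 0 z * J 0 0 3 z * \<sigma> z / 3 + J 0 0 1 z * J 0 0 2 z * \<sigma> z / 9 - J 0 0 2 z * z $ 3 * pd 2 \<sigma> z / 3 + ((J 0 0 2 z)^2) * z $ 3 * \<sigma> z / 18 + J 0 0 3 z * z $ 3 * pd 1 \<sigma> z / 3 + J 0 0 3 z * ((z $ 3)^2) * pd 2 \<sigma> z / 3 - 4 * J 0 1 1 z * z $ 3 * pd 3 \<sigma> z / 3 + 2 * J 0 1 2 z * z $ 3 * \<sigma> z / 3 + J 0 1 2 z * ((z $ 3)^2) * pd 3 \<sigma> z / 3 - J 0 1 3 z * ((z $ 3)^2) * \<sigma> z / 3 - J 1 0 2 z * pd 4 \<sigma> z / (2 * i) + J 1 0 2 z * z $ 3 * pd 3 \<sigma> z / 3 - J 1 0 3 z * z $ 3 * \<sigma> z / 3 + 2 * J 0 0 0 z * J 0 0 3 z * z $ 3 * pd 3 \<sigma> z / 3 - J 0 0 0 z * J 0 0 4 z * z $ 3 * \<sigma> z / 3 + J 0 0 1 z * J 0 0 2 z * pd 4 \<sigma> z / (3 * i) - J 0 0 1 z * J 0 0 3 z * z $ 3 * \<sigma> z / 3 - J 0 0 1 z * J 0 0 3 z * z $ 3 * pd 4 \<sigma> z / (3 * i)) + (z $ 3)^2 * (2 * pd 2 (pd 2 \<sigma>) z - ((J 0 0 2 z)^2) * \<sigma> z / 18 - J 0 0 3 z * pd 1 \<sigma> z / 3 + 4 * J 0 1 1 z * pd 3 \<sigma> z / 3 - J 0 1 2 z * \<sigma>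 z / 2 - J 1 0 2 z * pd 3 \<sigma> z / 3 + J 1 0 3 z * \<sigma> z / 3 - 2 * J 0 0 0 z * J 0 0 3 z * pd 3 \<sigma> z / 3 + J 0 0 0 z * J 0 0 4 z * \<sigma> z / 3 + J 0 0 1 z * J 0 0 3 z * \<sigma> z / 3 - J 0 0 3 z * z $ 3 * pd 2 \<sigma> z / 3 - J 0 1 2 z * pd 4 \<sigma> z / (2 * i) - J 0 1 2 z * z $ 3 * pd 3 \<sigma> z / 3 + J 0 1 3 z * z $ 3 * \<sigma> z / 3 + J 0 0 1 z * J 0 0 3 z * pd 4 \<sigma> z / (3 * i)) - 3 * J 0 0 0 z / i * (2 * pd 2 (pd 4 \<sigma>) z + J 0 0 2 z * i * \<sigma> z / 9)"
    using i_nonzero by (simp add: field_simps power2_eq_square power3_eq_cube)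
  also have "\<dots> = 0" unfolding e(1) e(2) e(4) e(5) using i_nonzero by (simp add: field_simps power2_eq_square)
  finally show "2 * pd 1 (pd 1 \<sigma>) z + 4 * z $ 3 * pd 1 (pd 2 \<sigma>) z + 2 * ((z $ 3)^2) * pd 2 (pd 2 \<sigma>) z - 2 * J 0 0 1 z * pd 1 \<sigma> z / 3 - 2 * ((J 0 0 1 z)^2) * \<sigma> z / 9 - J 0 1 0 z * \<sigma> z + 2 * J 1 0 0 z * pd 3 \<sigma> z - 6 * J 0 0 0 z * pd 2 (pd 4 \<sigma>) z / i - 4 * J 0 0 0 z * J 0 0 1 z * pd 3 \<sigma> z / 3 + 2 * J 0 0 0 z * J 0 0 2 z * \<sigma> z / 3 - 2 * J 0 0 1 z * z $ 3 * pd 2 \<sigma> z / 3 + 2 * ((J 0 0 1 z)^2) * pd 4 \<sigma> z / (3 * i) + 3 * J 0 1 0 z * pd 4 \<sigma> z / i + 2 * J 0 1 0 z * z $ 3 * pd 3 \<sigma> z - 2 * J 1 0 1 z * pd 4 \<sigma> z / i - 2 * J 0 1 1 z * z $ 3 * pd 4 \<sigma> z / i = 0" .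
qed

lemma ricci_zeroI:
  assumes z: "z \<in> U" and "\<And>k j. (k, j) \<in> {(1,1),(1,2),(1,3),(1,4),(2,2),(2,3),(2,4),(3,3),(3,4),(4,4)} \<Longrightarrow>
    \<sigma> z * ricci g z $ k $ j = 0"
  shows "ricci g z = 0"
proof -
  have "ricci g z $ k $ j = 0" for k j
    using assms(2)[of k j] assms(2)[of j k] ricci_scaled_sym[OF z, of k j] sigma_nonzero[OF z]
      exhaust_4[of k] exhaust_4[of j] by auto
  then show ?thesis by (simp add: vec_eq_iff)
qed

text \<open>The hypotheses \<open>A\<close> are, in order, \<open>eq_plus\<close> for sigma, its
  derivatives by x, y, p and pp, and \<open>eq_plus_mixed\<close>. Each component of the Ricci
  tensor is a linear combination of their left sides.\<close>

lemma ricci_flat_plus: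
  assumes z: "z \<in> U"
    and s: "pd 4 \<sigma> z = i / 3 * \<sigma> z" "pd 1 (pd 4 \<sigma>) z = i / 3 * pd 1 \<sigma> z" "pd 2 (pd 4 \<sigma>) z = i / 3 * pd 2 \<sigma> z"
      "pd 3 (pd 4 \<sigma>) z = i / 3 * pd 3 \<sigma> z" "pd 4 (pd 4 \<sigma>) z = i^2 / 9 * \<sigma> z" "pd 3 (pd 3 \<sigma>) z = 0"
    and A: "pd 1 \<sigma> z + J 0 0 0 z * pd 3 \<sigma> z - J 0 0 1 z * \<sigma> z / 3 + pd 2 \<sigma> z * z $ 3 = 0"
      "pd 1 (pd 1 \<sigma>) z + J 0 0 0 z * pd 1 (pd 3 \<sigma>) z - J 0 0 1 z * pd 1 \<sigma> z / 3 + J 1 0 0 z * pd 3 \<sigma> z - J 1 0 1 z * \<sigma> z / 3 + pd 1 (pd 2 \<sigma>) z * z $ 3 = 0"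
      "pd 1 (pd 2 \<sigma>) z + J 0 0 0 z * pd 2 (pd 3 \<sigma>) z - J 0 0 1 z * pd 2 \<sigma> z / 3 + J 0 1 0 z * pd 3 \<sigma> z - J 0 1 1 z * \<sigma> z / 3 + pd 2 (pd 2 \<sigma>) z * z $ 3 = 0"
      "pd 2 \<sigma> z + pd 1 (pd 3 \<sigma>) z + 2 * J 0 0 1 z * pd 3 \<sigma> z / 3 - J 0 0 2 z * \<sigma> z / 3 + pd 2 (pd 3 \<sigma>) z * z $ 3 = 0"
      "2 * pd 2 (pd 3 \<sigma>) z + J 0 0 2 z * pd 3 \<sigma> z / 3 - J 0 0 3 z * \<sigma> z / 3 = 0"
      "2 * pd 2 (pd 2 \<sigma>) z + 4 * J 0 0 1 z * pd 2 (pd 3 \<sigma>) z / 3 - 2 * J 0 0 2 z * pd 2 \<sigma> z / 3 - J 0 0 2 z * pd 1 (pd 3 \<sigma>) z / 3 + J 0 0 3 z * pd 1 \<sigma> z / 3 + 4 * J 0 1 1 z * pd 3 \<sigma> z / 3 - 2 * J 0 1 2 z * \<sigma> z / 3 - J 1 0 2 z * pd 3 \<sigma> z / 3 + J 1 0 3 z * \<sigma> z / 3 + J 0 0 0 z * J 0 0 4 z * \<sigma> z / 3 - J 0 0 2 z * pd 2 (pd 3 \<sigma>) z * z $ 3 / 3 + J 0 0 3 z * pd 2 \<sigma> z * z $ 3 / 3 - J 0 1 2 z * pd 3 \<sigma> z * z $ 3 / 3 + J 0 1 3 z * \<sigma> z * z $ 3 / 3 = 0"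
  shows "ricci g z = 0"
proof (rule ricci_zeroI[OF z])
  note nz = sigma_nonzero[OF z]
  let ?A0 = "pd 1 \<sigma> z + J 0 0 0 z * pd 3 \<sigma> z - J 0 0 1 z * \<sigma> z / 3 + pd 2 \<sigma> z * z $ 3"
  let ?Ax = "pd 1 (pd 1 \<sigma>) z + J 0 0 0 z * pd 1 (pd 3 \<sigma>) z - J 0 0 1 z * pd 1 \<sigma> z / 3 + J 1 0 0 z * pd 3 \<sigma> z - J 1 0 1 z * \<sigma> z / 3 + pd 1 (pd 2 \<sigma>) z * z $ 3"
  let ?Ay = "pd 1 (pd 2 \<sigma>) z + J 0 0 0 z * pd 2 (pd 3 \<sigma>) z - J 0 0 1 z * pd 2 \<sigma> z / 3 + J 0 1 0 z * pd 3 \<sigma> z - J 0 1 1 z * \<sigma> z / 3 + pd 2 (pd 2 \<sigma>) z * z $ 3"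
  let ?Ap = "pd 2 \<sigma> z + pd 1 (pd 3 \<sigma>) z + 2 * J 0 0 1 z * pd 3 \<sigma> z / 3 - J 0 0 2 z * \<sigma> z / 3 + pd 2 (pd 3 \<sigma>) z * z $ 3"
  let ?App = "2 * pd 2 (pd 3 \<sigma>) z + J 0 0 2 z * pd 3 \<sigma> z / 3 - J 0 0 3 z * \<sigma> z / 3"
  let ?C = "2 * pd 2 (pd 2 \<sigma>) z + 4 * J 0 0 1 z * pd 2 (pd 3 \<sigma>) z / 3 - 2 * J 0 0 2 z * pd 2 \<sigma> z / 3 - J 0 0 2 z * pd 1 (pd 3 \<sigma>) z / 3 + J 0 0 3 z * pd 1 \<sigma> z / 3 + 4 * J 0 1 1 z * pd 3 \<sigma> z / 3 - 2 * J 0 1 2 z * \<sigma> z / 3 - J 1 0 2 z * pd 3 \<sigma> z / 3 + J 1 0 3 z * \<sigma> z / 3 + J 0 0 0 z * J 0 0 4 z * \<sigma> z / 3 - J 0 0 2 z * pd 2 (pd 3 \<sigma>) z * z $ 3 / 3 + J 0 0 3 z * pd 2 \<sigma> z * z $ 3 / 3 - J 0 1 2 z * pd 3 \<sigma> z * z $ 3 / 3 + J 0 1 3 z * \<sigma> z * z $ 3 / 3"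
  let ?p = "z $ 3" and ?s = "\<sigma> z"
  \<comment> \<open>Modulo the equations, \<open>mu\<close> takes precisely the value that
    annihilates the component 24. This is where a cosmological constant is excluded.\<close>
  have "?s * mu z = ?s * (pd 2 \<sigma> z + J 0 0 2 z * \<sigma> z / 6) - 6 * pd 3 \<sigma> z * ?A0 + 2 * ?s * ?Ap"
    unfolding mu_explicit[OF z] s using i_nonzero by (simp add: field_simps power2_eq_square)
  then have m: "mu z = pd 2 \<sigma> z + J 0 0 2 z * \<sigma> z / 6"
    unfolding A using nz by simp
  have 1: "\<sigma> z * ricci g z $ 1 $ 1 = (2 / 3 * J 0 0 2 z * ?p - 2 / 3 * J 0 0 3 z * ?p^2) * ?A0 + 2 * ?Ax - 2 * ?p * ?Ay
      + (1 / 3 * J 0 0 2 z * ?p^2 - 2 * Q (jet z)) * ?Ap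
      + (2 * Q (jet z) * ?p - 2 / 3 * J 0 0 1 z * ?p^2) * ?App + ?p^2 * ?C"
    unfolding ricci_scaled[OF z] m s h_entries using i_nonzero
    by (simp add: field_simps power2_eq_square power3_eq_cube)
  have 2: "\<sigma> z * ricci g z $ 1 $ 2 = (2 / 3 * J 0 0 3 z * ?p - 1 / 3 * J 0 0 2 z) * ?A0 + 2 * ?Ay
      - 1 / 3 * J 0 0 2 z * ?p * ?Ap + (2 / 3 * J 0 0 1 z * ?p - Q (jet z)) * ?App - ?p * ?C"
    unfolding ricci_scaled[OF z] m s h_entries using i_nonzero
    by (simp add: field_simps power2_eq_square power3_eq_cube)
  have 3: "\<sigma> z * ricci g z $ 1 $ 3 = 2 * ?Ap - ?p * ?App"
    unfolding ricci_scaled[OF z] m s h_entries using i_nonzero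
    by (simp add: field_simps power2_eq_square power3_eq_cube)
  have 4: "\<sigma> z * ricci g z $ 1 $ 4 = 4 / 3 * i * ?A0"
    unfolding ricci_scaled[OF z] m s h_entries using i_nonzero
    by (simp add: field_simps power2_eq_square power3_eq_cube)
  have 5: "\<sigma> z * ricci g z $ 2 $ 2 = - 2 / 3 * J 0 0 3 z * ?A0 + 1 / 3 * J 0 0 2 z * ?Ap - 2 / 3 * J 0 0 1 z * ?App + ?C"
    unfolding ricci_scaled[OF z] m s h_entries using i_nonzero
    by (simp add: field_simps power2_eq_square power3_eq_cube)
  have 6: "\<sigma> z * ricci g z $ 2 $ 3 = ?App"
    unfolding ricci_scaled[OF z] m s h_entries using i_nonzero
    by (simp add: field_simps power2_eq_square power3_eq_cube)
  have 7: "\<sigma> z * ricci g z $ 2 $ 4 = 0" "\<sigma> z * ricci g z $ 3 $ 3 = 0" "\<sigma> z * ricci g z $ 3 $ 4 = 0"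
    "\<sigma> z * ricci g z $ 4 $ 4 = 0"
    unfolding ricci_scaled[OF z] m s h_entries using i_nonzero
    by (simp_all add: field_simps power2_eq_square power3_eq_cube)
  show "\<sigma> z * ricci g z $ k $ j = 0" if "(k, j) \<in> {(1,1),(1,2),(1,3),(1,4),(2,2),(2,3),(2,4),(3,3),(3,4),(4,4)}" for k j
    using that 1 2 3 4 5 6 7 unfolding A by auto
qed

text \<open>The hypotheses \<open>A\<close> are \<open>eq_minus\<close> for sigma and its first two
  p-derivatives. They control the components 11, 12 and 22; the other components vanish once
  \<open>mu\<close> is evaluated.\<close>

lemma ricci_flat_minus:
  assumes z: "z \<in> U"
    and s: "pd 4 \<sigma> z = - i / 3 * \<sigma> z" "pd 1 (pd 4 \<sigma>) z = - i / 3 * pd 1 \<sigma> z" "pd 2 (pd 4 \<sigma>) z = - i / 3 * pd 2 \<sigma> z"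
      "pd 3 \<sigma> z = 0" "pd 1 (pd 3 \<sigma>) z = 0" "pd 2 (pd 3 \<sigma>) z = 0" "pd 3 (pd 3 \<sigma>) z = 0"
      "pd 3 (pd 4 \<sigma>) z = 0" "pd 4 (pd 4 \<sigma>) z = i^2 / 9 * \<sigma> z"
    and A: "18 * pd 1 (pd 1 \<sigma>) z + 18 * J 0 0 0 z * pd 2 \<sigma> z - 6 * J 0 0 1 z * pd 1 \<sigma> z - 4 * ((J 0 0 1 z)^2) * \<sigma> z - 18 * J 0 1 0 z * \<sigma> z + 6 * J 1 0 1 z * \<sigma> z + 18 * pd 2 (pd 2 \<sigma>) z * ((z $ 3)^2) + 36 * pd 1 (pd 2 \<sigma>) z * z $ 3 + 6 * J 0 0 0 z * J 0 0 2 z * \<sigma> z - 6 * J 0 0 1 z * pd 2 \<sigma> z * z $ 3 + 6 * J 0 1 1 z * \<sigma> z * z $ 3 = 0"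
      "36 * pd 1 (pd 2 \<sigma>) z + 12 * J 0 0 1 z * pd 2 \<sigma> z - 6 * J 0 0 2 z * pd 1 \<sigma> z - 12 * J 0 1 1 z * \<sigma> z + 6 * J 1 0 2 z * \<sigma> z + 36 * pd 2 (pd 2 \<sigma>) z * z $ 3 + 6 * J 0 0 0 z * J 0 0 3 z * \<sigma> z - 2 * J 0 0 1 z * J 0 0 2 z * \<sigma> z - 6 * J 0 0 2 z * pd 2 \<sigma> z * z $ 3 + 6 * J 0 1 2 z * \<sigma> z * z $ 3 = 0"
      "36 * pd 2 (pd 2 \<sigma>) z + 6 * J 0 0 2 z * pd 2 \<sigma> z - 2 * ((J 0 0 2 z)^2) * \<sigma> z - 6 * J 0 0 3 z * pd 1 \<sigma> z - 6 * J 0 1 2 z * \<sigma> z + 6 * J 1 0 3 z * \<sigma> z + 6 * J 0 0 0 z * J 0 0 4 z * \<sigma> z + 4 * J 0 0 1 z * J 0 0 3 z * \<sigma> z - 6 * J 0 0 3 z * pd 2 \<sigma> z * z $ 3 + 6 * J 0 1 3 z * \<sigma> z * z $ 3 = 0"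
  shows "ricci g z = 0"
proof (rule ricci_zeroI[OF z])
  note nz = sigma_nonzero[OF z]
  let ?T = "18 * pd 1 (pd 1 \<sigma>) z + 18 * J 0 0 0 z * pd 2 \<sigma> z - 6 * J 0 0 1 z * pd 1 \<sigma> z - 4 * ((J 0 0 1 z)^2) * \<sigma> z - 18 * J 0 1 0 z * \<sigma> z + 6 * J 1 0 1 z * \<sigma> z + 18 * pd 2 (pd 2 \<sigma>) z * ((z $ 3)^2) + 36 * pd 1 (pd 2 \<sigma>) z * z $ 3 + 6 * J 0 0 0 z * J 0 0 2 z * \<sigma> z - 6 * J 0 0 1 z * pd 2 \<sigma> z * z $ 3 + 6 * J 0 1 1 z * \<sigma> z * z $ 3"
  let ?Tp = "36 * pd 1 (pd 2 \<sigma>) z + 12 * J 0 0 1 z * pd 2 \<sigma> z - 6 * J 0 0 2 z * pd 1 \<sigma> z - 12 * J 0 1 1 z * \<sigma> z + 6 * J 1 0 2 z * \<sigma> z + 36 * pd 2 (pd 2 \<sigma>) z * z $ 3 + 6 * J 0 0 0 z * J 0 0 3 z * \<sigma> z - 2 * J 0 0 1 z * J 0 0 2 z * \<sigma> z - 6 * J 0 0 2 z * pd 2 \<sigma> z * z $ 3 + 6 * J 0 1 2 z * \<sigma> z * z $ 3"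
  let ?Tpp = "36 * pd 2 (pd 2 \<sigma>) z + 6 * J 0 0 2 z * pd 2 \<sigma> z - 2 * ((J 0 0 2 z)^2) * \<sigma> z - 6 * J 0 0 3 z * pd 1 \<sigma> z - 6 * J 0 1 2 z * \<sigma> z + 6 * J 1 0 3 z * \<sigma> z + 6 * J 0 0 0 z * J 0 0 4 z * \<sigma> z + 4 * J 0 0 1 z * J 0 0 3 z * \<sigma> z - 6 * J 0 0 3 z * pd 2 \<sigma> z * z $ 3 + 6 * J 0 1 3 z * \<sigma> z * z $ 3"
  let ?p = "z $ 3" and ?s = "\<sigma> z"
  have "?s * mu z = ?s * (- pd 2 \<sigma> z + J 0 0 2 z * \<sigma> z / 6)"
    unfolding mu_explicit[OF z] s using i_nonzero by (simp add: field_simps power2_eq_square)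
  then have m: "mu z = - pd 2 \<sigma> z + J 0 0 2 z * \<sigma> z / 6"
    using nz by simp
  have 1: "\<sigma> z * ricci g z $ 1 $ 1 = 1 / 9 * ?T - 1 / 9 * ?p * ?Tp + 1 / 18 * ?p^2 * ?Tpp"
    unfolding ricci_scaled[OF z] m s h_entries using i_nonzero
    by (simp add: field_simps power2_eq_square power3_eq_cube)
  have 2: "\<sigma> z * ricci g z $ 1 $ 2 = 1 / 18 * ?Tp - 1 / 18 * ?p * ?Tpp"
    unfolding ricci_scaled[OF z] m s h_entries using i_nonzero
    by (simp add: field_simps power2_eq_square power3_eq_cube)
  have 3: "\<sigma> z * ricci g z $ 2 $ 2 = 1 / 18 * ?Tpp"
    unfolding ricci_scaled[OF z] m s h_entries using i_nonzero
    by (simp add: field_simps power2_eq_square power3_eq_cube)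
  have 4: "\<sigma> z * ricci g z $ 1 $ 3 = 0" "\<sigma> z * ricci g z $ 1 $ 4 = 0" "\<sigma> z * ricci g z $ 2 $ 3 = 0"
    "\<sigma> z * ricci g z $ 2 $ 4 = 0" "\<sigma> z * ricci g z $ 3 $ 3 = 0" "\<sigma> z * ricci g z $ 3 $ 4 = 0"
    "\<sigma> z * ricci g z $ 4 $ 4 = 0"
    unfolding ricci_scaled[OF z] m s h_entries using i_nonzero
    by (simp_all add: field_simps power2_eq_square power3_eq_cube)
  show "\<sigma> z * ricci g z $ k $ j = 0" if "(k, j) \<in> {(1,1),(1,2),(1,3),(1,4),(2,2),(2,3),(2,4),(3,3),(3,4),(4,4)}" for k j
    using that 1 2 3 4 unfolding A by auto
qed

end

section \<open>Restriction to slices phi = const and separation of the two exponentials\<close>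

section \<open>Splitting the Einstein equations\<close>

lemma slice_jets:
  assumes "open U" "smooth_on U f" "level t v \<in> U"
  shows "mpd 1 0 0 (\<lambda>v. f (level t v)) v = pd 1 f (level t v)"
    "mpd 0 1 0 (\<lambda>v. f (level t v)) v = pd 2 f (level t v)"
    "mpd 0 0 1 (\<lambda>v. f (level t v)) v = pd 3 f (level t v)"
    "mpd 2 0 0 (\<lambda>v. f (level t v)) v = pd 1 (pd 1 f) (level t v)"
    "mpd 1 1 0 (\<lambda>v. f (level t v)) v = pd 1 (pd 2 f) (level t v)"
    "mpd 1 0 1 (\<lambda>v. f (level t v)) v = pd 1 (pd 3 f) (level t v)"
    "mpd 0 2 0 (\<lambda>v. f (level t v)) v = pd 2 (pd 2 f) (level t v)"
    "mpd 0 1 1 (\<lambda>v. f (level t v)) v = pd 2 (pd 3 f) (level t v)"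
    "mpd 0 0 2 (\<lambda>v. f (level t v)) v = pd 3 (pd 3 f) (level t v)"
proof -
  let ?S = "level t -` U" and ?F = "\<lambda>v. f (level t v)"
  have S: "open ?S" "v \<in> ?S" using assms open_level_vimage by auto
  have d: "f differentiable (at (level t w))" "pd k f differentiable (at (level t w))" if "w \<in> ?S" for w k
    using that smooth_on_differentiable[OF assms(2)] smooth_on_differentiable[OF smooth_on_pd[OF assms(2)]] by auto
  have 1: "pd 1 ?F w = pd 1 f (level t w)" "pd 2 ?F w = pd 2 f (level t w)" "pd 3 ?F w = pd 3 f (level t w)"
    if "w \<in> ?S" for w using d[OF that] by simp_all
  show "mpd 1 0 0 ?F v = pd 1 f (level t v)" "mpd 0 1 0 ?F v = pd 2 f (level t v)"
    "mpd 0 0 1 ?F v = pd 3 f (level t v)"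
    using 1[OF S(2)] by (simp_all add: mpd_def)
  show "mpd 2 0 0 ?F v = pd 1 (pd 1 f) (level t v)" "mpd 1 1 0 ?F v = pd 1 (pd 2 f) (level t v)"
    "mpd 1 0 1 ?F v = pd 1 (pd 3 f) (level t v)" "mpd 0 2 0 ?F v = pd 2 (pd 2 f) (level t v)"
    "mpd 0 1 1 ?F v = pd 2 (pd 3 f) (level t v)" "mpd 0 0 2 ?F v = pd 3 (pd 3 f) (level t v)"
    using pd_cong[OF S 1(1), where k=1] pd_cong[OF S 1(2), where k=1] pd_cong[OF S 1(3), where k=1]
      pd_cong[OF S 1(2), where k=2] pd_cong[OF S 1(3), where k=2] pd_cong[OF S 1(3), where k=3] d[OF S(2)]
    by (simp_all add: mpd_def numeral_2_eq_2)
qed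

context fefferman_scaled
begin

lemma jet_patch_level: "jet_patch Q (level t -` U)"
proof
  show "open (level t -` U)" by (rule open_level_vimage[OF open_dom])
  have "level t -` U \<subseteq> jet ` U" by (metis image_eqI jet_level subsetI vimageE)
  then show "smooth_on (level t -` U) Q" by (rule smooth_on_subset[OF smooth_Q])
qed

lemmas sigma_slice_jets = slice_jets[OF open_dom smooth_sigma]

lemma pd_const_on: "z \<in> U \<Longrightarrow> (\<And>w. w \<in> U \<Longrightarrow> f w = f' w) \<Longrightarrow> pd k f z = pd k f' z"
  by (rule pd_cong[OF open_dom])

text \<open>Hypothesis \<open>A\<close> is \<open>eq_plus\<close> for the restriction of sigma to
  every slice. Its differential consequences on the slice through \<open>z\<close> are the pointwise
  hypotheses of \<open>ricci_flat_plus\<close>.\<close>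

lemma ricci_flat_plus_family:
  assumes 4: "\<And>z. z \<in> U \<Longrightarrow> pd 4 \<sigma> z = i / 3 * \<sigma> z"
    and 33: "\<And>z. z \<in> U \<Longrightarrow> pd 3 (pd 3 \<sigma>) z = 0"
    and A: "\<And>z. z \<in> U \<Longrightarrow> pd 1 \<sigma> z + z $ 3 * pd 2 \<sigma> z + Q (jet z) * pd 3 \<sigma> z = J 0 0 1 z * \<sigma> z / 3"
    and z: "z \<in> U"
  shows "ricci g z = 0"
proof -
  let ?t = "z $ 4" and ?v = "jet z"
  let ?S = "level ?t -` U" and ?\<alpha> = "\<lambda>v. \<sigma> (level ?t v)"
  interpret jet_patch Q ?S by (rule jet_patch_level)
  have v: "?v \<in> ?S" using z by simp
  have sa: "smooth_on ?S ?\<alpha>" by (rule smooth_on_level[OF open_dom smooth_sigma])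
  have app: "mpd 0 0 2 ?\<alpha> v = 0" if "v \<in> ?S" for v
    using that sigma_slice_jets(9)[of ?t v] 33 by simp
  have eq: "eq_plus ?\<alpha> v = 0" if "v \<in> ?S" for v
    using that A[of "level ?t v"] unfolding eq_plus_def by (simp add: sigma_slice_jets[unfolded One_nat_def])
  have s4: "pd k (pd 4 \<sigma>) z = i / 3 * pd k \<sigma> z" for k
  proof -
    have "pd k (pd 4 \<sigma>) z = pd k (\<lambda>w. i / 3 * \<sigma> w) z"
      by (rule pd_const_on[OF z 4])
    then show ?thesis using pd_sigma_differentiable[OF z] by simp
  qed
  have lz: "level ?t ?v \<in> U" using z by simp
  note j = sigma_slice_jets[OF lz]
  show ?thesis
  proof (rule ricci_flat_plus[OF z 4[OF z] s4 s4 s4 _ 33[OF z]])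
    show "pd 4 (pd 4 \<sigma>) z = i^2 / 9 * \<sigma> z"
      unfolding s4 4[OF z] by (simp add: power2_eq_square)
  qed (use eq_plus_p[OF sa app eq v] eq_plus_pp[OF sa app eq v] eq_plus_x[OF sa app eq v]
      eq_plus_y[OF sa app eq v] eq_plus_mixed[OF sa app eq v] A[OF z] j j[unfolded One_nat_def] in
      \<open>simp_all add: algebra_simps\<close>)
qed

lemma ricci_flat_minus_family:
  assumes 4: "\<And>z. z \<in> U \<Longrightarrow> pd 4 \<sigma> z = - i / 3 * \<sigma> z"
    and 3: "\<And>z. z \<in> U \<Longrightarrow> pd 3 \<sigma> z = 0"
    and T: "\<And>z. z \<in> U \<Longrightarrow> jet_patch.eq_minus Q (\<lambda>v. \<sigma> (level (z $ 4) v)) (jet z) = 0"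
    and z: "z \<in> U"
  shows "ricci g z = 0"
proof -
  let ?t = "z $ 4" and ?v = "jet z"
  let ?S = "level ?t -` U" and ?\<beta> = "\<lambda>v. \<sigma> (level ?t v)"
  interpret jet_patch Q ?S by (rule jet_patch_level)
  have v: "?v \<in> ?S" using z by simp
  have sb: "smooth_on ?S ?\<beta>" by (rule smooth_on_level[OF open_dom smooth_sigma])
  have bp: "mpd 0 0 1 ?\<beta> v = 0" if "v \<in> ?S" for v
    using that sigma_slice_jets(3)[of ?t v] 3 by simp
  have eq: "eq_minus ?\<beta> v = 0" if "v \<in> ?S" for v
    using that T[of "level ?t v"] by simp
  have s4: "pd k (pd 4 \<sigma>) z = - i / 3 * pd k \<sigma> z" for k
  proof -
    have "pd k (pd 4 \<sigma>) z = pd k (\<lambda>w. - i / 3 * \<sigma> w) z"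
      by (rule pd_const_on[OF z 4])
    then show ?thesis using pd_sigma_differentiable[OF z] by simp
  qed
  have s3: "pd k (pd 3 \<sigma>) z = 0" for k
    using pd_const_on[OF z 3, where k=k] by simp
  have lz: "level ?t ?v \<in> U" using z by simp
  note j = sigma_slice_jets[OF lz]
  show ?thesis
  proof (rule ricci_flat_minus[OF z 4[OF z] s4 s4 3[OF z] s3 s3 s3])
    show "pd 4 (pd 4 \<sigma>) z = i^2 / 9 * \<sigma> z" "pd 3 (pd 4 \<sigma>) z = 0"
      unfolding s4 4[OF z] 3[OF z] by (simp_all add: power2_eq_square)
  qed (use eq_minus_0[OF sb bp eq v] eq_minus_p[OF sb bp eq v] eq_minus_pp[OF sb bp eq v]
      j j[unfolded One_nat_def] in \<open>simp_all add: algebra_simps\<close>)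
qed

text \<open>With \<open>minus_part\<close>, the projections onto the eigenspaces of d/dphi for i/3
  and - i/3, as sigma_phiphi = i^2 / 9 sigma suggests. They keep their exponential factors, so no
  coefficient function on the jet space has to be split off globally.\<close>

definition plus_part :: "real^4 \<Rightarrow> real" where
  "plus_part z = (3 / i * pd 4 \<sigma> z + \<sigma> z) / 2"

definition minus_part :: "real^4 \<Rightarrow> real" where
  "minus_part z = (\<sigma> z - 3 / i * pd 4 \<sigma> z) / 2"

lemma smooth_parts: "smooth_on U plus_part" "smooth_on U minus_part"
  unfolding plus_part_def[abs_def] minus_part_def[abs_def] divide_inverse
  by (intro smooth_intros smooth_sigma open_dom)+

lemma sigma_parts: "\<sigma> = (\<lambda>z. plus_part z + minus_part z)"
    "pd 4 \<sigma> = (\<lambda>z. i / 3 * (plus_part z - minus_part z))"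
  using i_nonzero by (auto simp: plus_part_def minus_part_def fun_eq_iff field_simps)

context
  fixes \<Lambda> :: real
  assumes E: "\<And>z. z \<in> U \<Longrightarrow> ricci g z = \<Lambda> *\<^sub>R g z"
begin

lemma pd_parts:
  assumes z: "z \<in> U"
  shows "pd 3 plus_part z = pd 3 \<sigma> z" "pd 3 minus_part z = 0"
    "pd 4 plus_part z = i / 3 * plus_part z" "pd 4 minus_part z = - i / 3 * minus_part z"
proof -
  note n = einstein_necessary[OF z E[OF z]]
  note d = pd_sigma_differentiable[OF z]
  show "pd 3 plus_part z = pd 3 \<sigma> z" "pd 3 minus_part z = 0"
    "pd 4 plus_part z = i / 3 * plus_part z" "pd 4 minus_part z = - i / 3 * minus_part z"
    using n(2,3) i_nonzero unfolding plus_part_def[abs_def] minus_part_def[abs_def]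
    by (simp_all add: d) (simp_all add: field_simps power2_eq_square)
qed

lemma pd_sigma_parts:
  assumes z: "z \<in> U"
  shows "pd k \<sigma> z = pd k plus_part z + pd k minus_part z"
    "pd k (pd 1 \<sigma>) z = pd k (pd 1 plus_part) z + pd k (pd 1 minus_part) z"
    "pd k (pd 2 \<sigma>) z = pd k (pd 2 plus_part) z + pd k (pd 2 minus_part) z"
    "pd k (pd 4 \<sigma>) z = i / 3 * (pd k plus_part z - pd k minus_part z)"
proof -
  have d: "plus_part differentiable (at w)" "minus_part differentiable (at w)"
    "pd j plus_part differentiable (at w)" "pd j minus_part differentiable (at w)" if "w \<in> U" for w j
    using that smooth_parts smooth_on_pd smooth_on_differentiable by blast+
  have 1: "pd k \<sigma> w = pd k plus_part w + pd k minus_part w" if "w \<in> U" for k w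
    by (subst sigma_parts(1)) (simp add: d[OF that])
  show "pd k \<sigma> z = pd k plus_part z + pd k minus_part z" by (rule 1[OF z])
  have "pd k (pd l \<sigma>) z = pd k (pd l plus_part) z + pd k (pd l minus_part) z" for l
    using pd_const_on[OF z 1, where k=k] d[OF z] by simp
  from this[of 1] this[of 2] show "pd k (pd 1 \<sigma>) z = pd k (pd 1 plus_part) z + pd k (pd 1 minus_part) z"
    "pd k (pd 2 \<sigma>) z = pd k (pd 2 plus_part) z + pd k (pd 2 minus_part) z" .
  show "pd k (pd 4 \<sigma>) z = i / 3 * (pd k plus_part z - pd k minus_part z)"
    by (subst sigma_parts(2)) (simp add: d[OF z])
qed

text \<open>The fourth equation of \<open>einstein_necessary\<close> involves the plus part only.
  The fifth mixes both parts, but its plus part is a differential consequence of the fourth and can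
  be subtracted.\<close>

lemma slice_equations:
  assumes v: "level t v \<in> U"
  shows "mpd 0 0 2 (\<lambda>v. plus_part (level t v)) v = 0"
    "jet_patch.eq_plus Q (\<lambda>v. plus_part (level t v)) v = 0"
    "mpd 0 0 1 (\<lambda>v. minus_part (level t v)) v = 0"
    "jet_patch.eq_minus Q (\<lambda>v. minus_part (level t v)) v = 0"
proof -
  let ?S = "level t -` U" and ?\<alpha> = "\<lambda>v. plus_part (level t v)" and ?\<beta> = "\<lambda>v. minus_part (level t v)"
  interpret jet_patch Q ?S by (rule jet_patch_level)
  note ja = slice_jets[OF open_dom smooth_parts(1)] and jb = slice_jets[OF open_dom smooth_parts(2)]
  have sa: "smooth_on ?S ?\<alpha>" by (rule smooth_on_level[OF open_dom smooth_parts(1)])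
  have sb: "smooth_on ?S ?\<beta>" by (rule smooth_on_level[OF open_dom smooth_parts(2)])
  have app: "mpd 0 0 2 ?\<alpha> v = 0" if "v \<in> ?S" for v
  proof -
    have z: "level t v \<in> U" using that by simp
    have "pd 3 (pd 3 plus_part) (level t v) = pd 3 (pd 3 \<sigma>) (level t v)"
      by (rule pd_const_on[OF z pd_parts(1)])
    then show ?thesis using ja(9)[OF z] einstein_necessary(1)[OF z E[OF z]] by simp
  qed
  have bp: "mpd 0 0 1 ?\<beta> v = 0" if "v \<in> ?S" for v
    using that jb(3)[of t v] pd_parts(2)[of "level t v"] by simp
  have eq: "eq_plus ?\<alpha> v = 0" if "v \<in> ?S" for v
  proof -
    have z: "level t v \<in> U" using that by simp
    \<comment> \<open>In the fourth equation the terms with d/dphi carry the opposite sign on the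
      minus part and cancel it, while they double the plus part.\<close>
    have "4 / 3 * i * eq_plus ?\<alpha> v = 0"
      using einstein_necessary(4)[OF z E[OF z]] i_nonzero
      unfolding eq_plus_def pd_sigma_parts[OF z] ja[OF z, symmetric] jb[OF z, symmetric] bp[OF that]
      unfolding pd_parts(3,4)[OF z] sigma_parts(2) fun_cong[OF sigma_parts(1), of "level t v"]
      by (simp add: field_simps)
    then show ?thesis using i_nonzero by simp
  qed
  show "mpd 0 0 2 ?\<alpha> v = 0" "eq_plus ?\<alpha> v = 0" "mpd 0 0 1 ?\<beta> v = 0"
    using app eq bp v by simp_all
  have v': "v \<in> ?S" using v by simp
  have z: "level t v \<in> U" by (rule v)
  have s: "pd 3 \<sigma> (level t v) = mpd 0 0 1 ?\<alpha> v"
    using pd_sigma_parts(1)[OF z, of 3] ja(3)[OF z] jb(3)[OF z] bp[OF v'] by simp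
  have s4: "pd 4 \<sigma> (level t v) = i / 3 * (plus_part (level t v) - minus_part (level t v))"
    by (rule fun_cong[OF sigma_parts(2)])
  have "2 * (mpd 2 0 0 ?\<alpha> v + mpd 2 0 0 ?\<beta> v) + 4 * v $ 3 * (mpd 1 1 0 ?\<alpha> v + mpd 1 1 0 ?\<beta> v) + 2 * ((v $ 3)^2) * (mpd 0 2 0 ?\<alpha> v + mpd 0 2 0 ?\<beta> v) - 2 * q 0 0 1 v * (mpd 1 0 0 ?\<alpha> v + mpd 1 0 0 ?\<beta> v) / 3 - 2 * ((q 0 0 1 v)^2) * (plus_part (level t v) + minus_part (level t v)) / 9 - q 0 1 0 v * (plus_part (level t v) + minus_part (level t v)) + 2 * q 1 0 0 v * (mpd 0 0 1 ?\<alpha> v) - 6 * Q v * (i / 3 * (mpd 0 1 0 ?\<alpha> v - mpd 0 1 0 ?\<beta> v)) / i - 4 * Q v * q 0 0 1 v * (mpd 0 0 1 ?\<alpha> v) / 3 + 2 * Q v * q 0 0 2 v * (plus_part (level t v) + minus_part (level t v)) / 3 - 2 * q 0 0 1 v * v $ 3 * (mpd 0 1 0 ?\<alpha> v + mpd 0 1 0 ?\<beta> v) / 3 + 2 * ((q 0 0 1 v)^2) * (i / 3 * (plus_part (level t v) - minus_part (level t v))) / (3 * i) + 3 * q 0 1 0 v * (i / 3 * (plus_part (level t v) - minus_part (level t v))) / i + 2 * q 0 1 0 v * v $ 3 * (mpd 0 0 1 ?\<alpha> v) - 2 * q 1 0 1 v * (i / 3 * (plus_part (level t v) - minus_part (level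 t v))) / i - 2 * q 0 1 1 v * v $ 3 * (i / 3 * (plus_part (level t v) - minus_part (level t v))) / i = 0"
    using einstein_necessary(5)[OF z E[OF z]] s4 fun_cong[OF sigma_parts(1), of "level t v"]
    by (simp only: s pd_sigma_parts(1)[OF z, of 1] pd_sigma_parts(1)[OF z, of 2] pd_sigma_parts(2-)[OF z] ja[OF z] jb[OF z] jet_level level_nth mpd_0)
  moreover have "2 * mpd 2 0 0 ?\<alpha> v + 2 * mpd 2 0 0 ?\<beta> v - 2 * Q v * mpd 0 1 0 ?\<alpha> v + 2 * Q v * mpd 0 1 0 ?\<beta> v - 2 * q 0 0 1 v * mpd 1 0 0 ?\<alpha> v / 3 - 2 * q 0 0 1 v * mpd 1 0 0 ?\<beta> v / 3 - 4 * ((q 0 0 1 v)^2) * minus_part (level t v) / 9 - 2 * q 0 1 0 v * minus_part (level t v) + 2 * q 1 0 0 v * mpd 0 0 1 ?\<alpha> v - 2 * q 1 0 1 v * plus_part (level t v) / 3 + 2 * q 1 0 1 v * minus_part (level t v) / 3 + 2 * mpd 0 2 0 ?\<alpha> v * ((v $ 3)^2) + 4 * mpd 1 1 0 ?\<alpha> v * v $ 3 + 2 * mpd 0 2 0 ?\<beta> v * ((v $ 3)^2) + 4 * mpd 1 1 0 ?\<beta> v * v $ 3 - 4 * Q v * q 0 0 1 v * mpd 0 0 1 ?\<alpha> v / 3 + 2 * Q v * q 0 0 2 v * plus_part (level t v) / 3 + 2 * Q v * q 0 0 2 v * minus_part (level t v) / 3 - 2 * q 0 0 1 v * mpd 0 1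 0 ?\<alpha> v * v $ 3 / 3 - 2 * q 0 0 1 v * mpd 0 1 0 ?\<beta> v * v $ 3 / 3 + 2 * q 0 1 0 v * mpd 0 0 1 ?\<alpha> v * v $ 3 - 2 * q 0 1 1 v * plus_part (level t v) * v $ 3 / 3 + 2 * q 0 1 1 v * minus_part (level t v) * v $ 3 / 3 = 2 * (mpd 2 0 0 ?\<alpha> v + mpd 2 0 0 ?\<beta> v) + 4 * v $ 3 * (mpd 1 1 0 ?\<alpha> v + mpd 1 1 0 ?\<beta> v) + 2 * ((v $ 3)^2) * (mpd 0 2 0 ?\<alpha> v + mpd 0 2 0 ?\<beta> v) - 2 * q 0 0 1 v * (mpd 1 0 0 ?\<alpha> v + mpd 1 0 0 ?\<beta> v) / 3 - 2 * ((q 0 0 1 v)^2) * (plus_part (level t v) + minus_part (level t v)) / 9 - q 0 1 0 v * (plus_part (level t v) + minus_part (level t v)) + 2 * q 1 0 0 v * (mpd 0 0 1 ?\<alpha> v) - 6 * Q v * (i / 3 * (mpd 0 1 0 ?\<alpha> v - mpd 0 1 0 ?\<beta> v)) / i - 4 * Q v * q 0 0 1 v * (mpd 0 0 1 ?\<alpha> v) / 3 + 2 * Q v * q 0 0 2 v * (plus_part (level t v) + minus_part (level t v)) / 3 - 2 * q 0 0 1 v * v $ 3 * (mpd 0 1 0 ?\<alpha> v + mpd 0 1 0 ?\<beta> v) / 3 + 2 * ((q 0 0 1 v)^2) * (i / 3 * (plus_part (level t v) - minus_part (level t v))) / (3 * i) + 3 * q 0 1 0 v * (i / 3 * (plus_part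 (level t v) - minus_part (level t v))) / i + 2 * q 0 1 0 v * v $ 3 * (mpd 0 0 1 ?\<alpha> v) - 2 * q 1 0 1 v * (i / 3 * (plus_part (level t v) - minus_part (level t v))) / i - 2 * q 0 1 1 v * v $ 3 * (i / 3 * (plus_part (level t v) - minus_part (level t v))) / i"
    using i_nonzero by (simp add: field_simps power2_eq_square)
  ultimately have X: "2 * mpd 2 0 0 ?\<alpha> v + 2 * mpd 2 0 0 ?\<beta> v - 2 * Q v * mpd 0 1 0 ?\<alpha> v + 2 * Q v * mpd 0 1 0 ?\<beta> v - 2 * q 0 0 1 v * mpd 1 0 0 ?\<alpha> v / 3 - 2 * q 0 0 1 v * mpd 1 0 0 ?\<beta> v / 3 - 4 * ((q 0 0 1 v)^2) * minus_part (level t v) / 9 - 2 * q 0 1 0 v * minus_part (level t v) + 2 * q 1 0 0 v * mpd 0 0 1 ?\<alpha> v - 2 * q 1 0 1 v * plus_part (level t v) / 3 + 2 * q 1 0 1 v * minus_part (level t v) / 3 + 2 * mpd 0 2 0 ?\<alpha> v * ((v $ 3)^2) + 4 * mpd 1 1 0 ?\<alpha> v * v $ 3 + 2 * mpd 0 2 0 ?\<beta> v * ((v $ 3)^2) + 4 * mpd 1 1 0 ?\<beta> v * v $ 3 - 4 * Q v * q 0 0 1 v * mpd 0 0 1 ?\<alpha> v / 3 + 2 * Q v * q 0 0 2 v * plus_part (level t v) / 3 + 2 * Q v * q 0 0 2 v * minus_part (level t v) / 3 - 2 * q 0 0 1 v * mpd 0 1 0 ?\<alpha> v * v $ 3 /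 3 - 2 * q 0 0 1 v * mpd 0 1 0 ?\<beta> v * v $ 3 / 3 + 2 * q 0 1 0 v * mpd 0 0 1 ?\<alpha> v * v $ 3 - 2 * q 0 1 1 v * plus_part (level t v) * v $ 3 / 3 + 2 * q 0 1 1 v * minus_part (level t v) * v $ 3 / 3 = 0"
    by (simp only:)
  \<comment> \<open>Nine times the fifth equation is the \<open>eq_minus\<close> expression of the
    minus part plus 18 D(A) - 36 Q A_p, where A is the \<open>eq_plus\<close> expression of the plus
    part.\<close>
  have "18 * mpd 2 0 0 ?\<beta> v + 18 * Q v * mpd 0 1 0 ?\<beta> v - 6 * q 0 0 1 v * mpd 1 0 0 ?\<beta> v - 4 * ((q 0 0 1 v)^2) * minus_part (level t v) - 18 * q 0 1 0 v * minus_part (level t v) + 6 * q 1 0 1 v * minus_part (level t v) + 18 * mpd 0 2 0 ?\<beta> v * ((v $ 3)^2) + 36 * mpd 1 1 0 ?\<beta> v * v $ 3 + 6 * Q v * q 0 0 2 v * minus_part (level t v) - 6 * q 0 0 1 v * mpd 0 1 0 ?\<beta> v * v $ 3 + 6 * q 0 1 1 v * minus_part (level t v) * v $ 3 =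
      9 * (2 * mpd 2 0 0 ?\<alpha> v + 2 * mpd 2 0 0 ?\<beta> v - 2 * Q v * mpd 0 1 0 ?\<alpha> v + 2 * Q v * mpd 0 1 0 ?\<beta> v - 2 * q 0 0 1 v * mpd 1 0 0 ?\<alpha> v / 3 - 2 * q 0 0 1 v * mpd 1 0 0 ?\<beta> v / 3 - 4 * ((q 0 0 1 v)^2) * minus_part (level t v) / 9 - 2 * q 0 1 0 v * minus_part (level t v) + 2 * q 1 0 0 v * mpd 0 0 1 ?\<alpha> v - 2 * q 1 0 1 v * plus_part (level t v) / 3 + 2 * q 1 0 1 v * minus_part (level t v) / 3 + 2 * mpd 0 2 0 ?\<alpha> v * ((v $ 3)^2) + 4 * mpd 1 1 0 ?\<alpha> v * v $ 3 + 2 * mpd 0 2 0 ?\<beta> v * ((v $ 3)^2) + 4 * mpd 1 1 0 ?\<beta> v * v $ 3 - 4 * Q v * q 0 0 1 v * mpd 0 0 1 ?\<alpha> v / 3 + 2 * Q v * q 0 0 2 v * plus_part (level t v) / 3 + 2 * Q v * q 0 0 2 v * minus_part (level t v) / 3 - 2 * q 0 0 1 v * mpd 0 1 0 ?\<alpha> v * v $ 3 / 3 - 2 * q 0 0 1 v * mpd 0 1 0 ?\<beta> v * v $ 3 / 3 + 2 * q 0 1 0 v * mpd 0 0 1 ?\<alpha> v * v $ 3 - 2 * q 0 1 1 v * plus_part (level t v) * v $ 3 / 3 + 2 * q 0 1 1 v * minus_part (level t v) * v $ 3 / 3)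
      - 18 * (mpd 2 0 0 ?\<alpha> v + Q v * mpd 1 0 1 ?\<alpha> v - q 0 0 1 v * mpd 1 0 0 ?\<alpha> v / 3 + q 1 0 0 v * mpd 0 0 1 ?\<alpha> v - q 1 0 1 v * plus_part (level t v) / 3 + mpd 1 1 0 ?\<alpha> v * v $ 3 + v $ 3 * (mpd 1 1 0 ?\<alpha> v + Q v * mpd 0 1 1 ?\<alpha> v - q 0 0 1 v * mpd 0 1 0 ?\<alpha> v / 3 + q 0 1 0 v * mpd 0 0 1 ?\<alpha> v - q 0 1 1 v * plus_part (level t v) / 3 + mpd 0 2 0 ?\<alpha> v * v $ 3) + Q v * (mpd 0 1 0 ?\<alpha> v + mpd 1 0 1 ?\<alpha> v + 2 * q 0 0 1 v * mpd 0 0 1 ?\<alpha> v / 3 - q 0 0 2 v * plus_part (level t v) / 3 + mpd 0 1 1 ?\<alpha> v * v $ 3)) + 36 * Q v * (mpd 0 1 0 ?\<alpha> v + mpd 1 0 1 ?\<alpha> v + 2 * q 0 0 1 v * mpd 0 0 1 ?\<alpha> v / 3 - q 0 0 2 v * plus_part (level t v) / 3 + mpd 0 1 1 ?\<alpha> v * v $ 3)"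
    by (simp add: field_simps power2_eq_square)
  also have "\<dots> = 0"
    unfolding X using eq_plus_x[OF sa app eq v'] eq_plus_y[OF sa app eq v'] eq_plus_p[OF sa app eq v']
    by simp
  finally show "eq_minus ?\<beta> v = 0"
    unfolding eq_minus_def by (simp add: algebra_simps)
qed

end

end

section \<open>Local solutions of linear Pfaffian systems with vanishing curvature\<close>

section \<open>A Frobenius theorem for flat linear systems\<close>

lemma abs_sum_UNIV_le:
  fixes f :: "'a::finite \<Rightarrow> real"
  assumes "\<And>i. \<bar>f i\<bar> \<le> x"
  shows "\<bar>\<Sum>i\<in>UNIV. f i\<bar> \<le> real CARD('a) * x"
  using sum_norm_bound[of UNIV f x] assms by simp

lemma uniform_bound_finite:
  fixes f :: "'i::finite \<Rightarrow> 'a \<Rightarrow> real"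
  assumes "\<And>i. \<exists>c. \<forall>z\<in>K. \<bar>f i z\<bar> \<le> c"
  shows "\<exists>c. \<forall>i. \<forall>z\<in>K. \<bar>f i z\<bar> \<le> c"
proof -
  obtain c where c: "\<And>i. \<forall>z\<in>K. \<bar>f i z\<bar> \<le> c i" using assms by metis
  have "c i \<le> Max (range c)" for i by simp
  then show ?thesis using c order_trans by blast
qed

lemma geometric_tail:
  fixes f :: "nat \<Rightarrow> real"
  assumes "\<And>n. \<bar>f n\<bar> \<le> D / 2 ^ n"
  shows "summable f" "\<bar>(\<Sum>i<n. f i) - suminf f\<bar> \<le> 2 * D / 2 ^ n"
proof -
  have g: "summable (\<lambda>n. D / 2 ^ n)" "(\<lambda>i. D / 2 ^ (i + n)) sums (2 * D / 2 ^ n)" for n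
    using summable_mult[OF summable_geometric[of "1/2::real"], of D]
      sums_mult[OF geometric_sums[of "1/2::real"], of "D / 2 ^ n"]
    by (simp_all add: power_divide power_add field_simps)
  show s: "summable f"
    by (rule summable_comparison_test'[OF g(1), of 0]) (use assms in simp)
  have "\<bar>suminf f - (\<Sum>i<n. f i)\<bar> = \<bar>\<Sum>i. f (i + n)\<bar>"
    using suminf_minus_initial_segment[OF s, of n] by simp
  also have "\<dots> \<le> (\<Sum>i. D / 2 ^ (i + n))"
    using norm_suminf_le[of "\<lambda>i. f (i + n)" "\<lambda>i. D / 2 ^ (i + n)"] sums_summable[OF g(2)[of n]] assms
    by simp
  also have "\<dots> = 2 * D / 2 ^ n" using g(2)[of n] sums_unique by metis
  finally show "\<bar>(\<Sum>i<n. f i) - suminf f\<bar> \<le> 2 * D / 2 ^ n" by (simp add: abs_minus_commute)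
qed

text \<open>The condition \<open>flat\<close> is the compatibility of mixed partials for dW = M W.
  The product in \<open>small\<close> bounds the integral operator along rays, which therefore
  contracts the supremum norm on the ball by the factor 1/4.\<close>

locale flat_system =
  fixes M :: "'n::finite \<Rightarrow> 'm::finite \<Rightarrow> 'm \<Rightarrow> real^'n \<Rightarrow> real" and r c :: real
  assumes r: "0 < r" and c: "0 \<le> c"
    and small: "real CARD('n) * real CARD('m) * c * r \<le> 1 / 4"
    and diff_M: "z \<in> ball 0 r \<Longrightarrow> M j a b differentiable (at z)"
    and cont_pd_M: "continuous_on (ball 0 r) (pd k (M j a b))"
    and bound_M: "z \<in> ball 0 r \<Longrightarrow> \<bar>M j a b z\<bar> \<le> c"
    and bound_pd_M: "z \<in> ball 0 r \<Longrightarrow> \<bar>pd k (M j a b) z\<bar> \<le> c"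
    and flat: "z \<in> ball 0 r \<Longrightarrow> pd k (M j a b) z + (\<Sum>d\<in>UNIV. M j a d z * M k d b z) =
      pd j (M k a b) z + (\<Sum>d\<in>UNIV. M k a d z * M j d b z)"
begin

abbreviation "B \<equiv> ball (0::real^'n) r"

lemma scale_in_B: "z \<in> B \<Longrightarrow> t \<in> {0..1} \<Longrightarrow> t *\<^sub>R z \<in> B"
  using mult_left_le_one_le[of "norm z" t] by auto

lemma cont_M: "continuous_on B (M j a b)"
  by (auto intro!: continuous_at_imp_continuous_on differentiable_imp_continuous_within diff_M)

text \<open>The equation is solved along rays: \<open>\<phi>\<close> is the radial derivative prescribed for a solution,
  and \<open>\<psi>\<close> is what differentiating the resulting integral equation yields for the partial
  derivatives of a solution.\<close>

definition \<phi> :: "('m \<Rightarrow> real^'n \<Rightarrow> real) \<Rightarrow> 'm \<Rightarrow> real^'n \<Rightarrow> real \<Rightarrow> real" where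
  "\<phi> W a z t = (\<Sum>j\<in>UNIV. \<Sum>b\<in>UNIV. z $ j * (M j a b (t *\<^sub>R z) * W b (t *\<^sub>R z)))"

definition \<psi> :: "('m \<Rightarrow> real^'n \<Rightarrow> real) \<Rightarrow> ('n \<Rightarrow> 'm \<Rightarrow> real^'n \<Rightarrow> real) \<Rightarrow>
    'n \<Rightarrow> 'm \<Rightarrow> real^'n \<Rightarrow> real \<Rightarrow> real" where
  "\<psi> W V k a z t = (\<Sum>b\<in>UNIV. M k a b (t *\<^sub>R z) * W b (t *\<^sub>R z)) +
    (\<Sum>j\<in>UNIV. \<Sum>b\<in>UNIV. z $ j * (t * (pd k (M j a b) (t *\<^sub>R z) * W b (t *\<^sub>R z)
      + M j a b (t *\<^sub>R z) * V k b (t *\<^sub>R z))))"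

text \<open>The candidates \<open>V\<close> for the partial derivatives of \<open>W\<close> are
  carried as separate functions, so that they can be iterated, estimated and summed in parallel with
  \<open>W\<close>.\<close>

definition C1 :: "('m \<Rightarrow> real^'n \<Rightarrow> real) \<Rightarrow> ('n \<Rightarrow> 'm \<Rightarrow> real^'n \<Rightarrow> real) \<Rightarrow> bool" where
  "C1 W V \<longleftrightarrow> (\<forall>b. \<forall>x\<in>B. (W b has_derivative (\<lambda>h. \<Sum>k\<in>UNIV. h $ k * V k b x)) (at x)) \<and>
    (\<forall>k b. continuous_on B (V k b))"

lemma continuous_ray:
  assumes "continuous_on B f"
  shows "continuous_on (B \<times> {0..1}) (\<lambda>(z, t). f (t *\<^sub>R z))"
  unfolding case_prod_beta
proof (rule continuous_on_compose2[OF assms])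
  show "(\<lambda>x. snd x *\<^sub>R fst x) ` (B \<times> {0..1}) \<subseteq> B"
    using scale_in_B by force
qed (intro continuous_intros)

lemma C1_continuous: "C1 W V \<Longrightarrow> continuous_on B (W b)"
  unfolding C1_def by (meson has_derivative_continuous continuous_at_imp_continuous_on)

lemma continuous_\<phi>:
  assumes "\<And>b. continuous_on B (W b)"
  shows "continuous_on (B \<times> {0..1}) (\<lambda>(z, t). \<phi> W a z t)"
  using continuous_ray[OF cont_M] continuous_ray[OF assms]
  unfolding \<phi>_def case_prod_beta by (intro continuous_intros) auto

lemma continuous_\<psi>:
  assumes "\<And>b. continuous_on B (W b)" "\<And>k b. continuous_on B (V k b)"
  shows "continuous_on (B \<times> {0..1}) (\<lambda>(z, t). \<psi> W V k a z t)"
  using continuous_ray[OF cont_M] continuous_ray[OF assms(1)] continuous_ray[OF assms(2)]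
    continuous_ray[OF cont_pd_M]
  unfolding \<psi>_def case_prod_beta by (intro continuous_intros) auto

lemma continuous_slice:
  assumes "continuous_on (B \<times> {0..1}) (\<lambda>(z, t). f z t)" "z \<in> B"
  shows "continuous_on {0..1} (f z)"
proof -
  have "continuous_on {0..1} (\<lambda>t. (\<lambda>(z, t). f z t) (z, t))"
    by (rule continuous_on_compose2[OF assms(1)]) (use assms(2) in \<open>auto intro!: continuous_intros\<close>)
  then show ?thesis by simp
qed

lemma has_derivative_\<phi>:
  assumes "C1 W V" "z \<in> B" "t \<in> {0..1}"
  shows "((\<lambda>z. \<phi> W a z t) has_derivative (\<lambda>h. \<Sum>k\<in>UNIV. h $ k * \<psi> W V k a z t)) (at z)"
proof -
  have tz: "t *\<^sub>R z \<in> B" by (rule scale_in_B[OF assms(2,3)])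
  have ray: "((\<lambda>z. t *\<^sub>R z) has_derivative (\<lambda>h. t *\<^sub>R h)) (at z)"
    by (auto intro!: derivative_eq_intros)
  have dW: "((\<lambda>z. W b (t *\<^sub>R z)) has_derivative (\<lambda>h. \<Sum>k\<in>UNIV. h $ k * (t * V k b (t *\<^sub>R z)))) (at z)" for b
    using diff_chain_at[OF ray, of "W b"] assms(1) tz unfolding C1_def
    by (fastforce simp: o_def ac_simps)
  have dM: "((\<lambda>z. M j a b (t *\<^sub>R z)) has_derivative (\<lambda>h. \<Sum>k\<in>UNIV. h $ k * (t * pd k (M j a b) (t *\<^sub>R z)))) (at z)" for j b
  proof -
    have "(M j a b has_derivative frechet_derivative (M j a b) (at (t *\<^sub>R z))) (at (t *\<^sub>R z))"
      using diff_M[OF tz] frechet_derivative_works by blast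
    then have "(M j a b has_derivative (\<lambda>h. \<Sum>k\<in>UNIV. h $ k * pd k (M j a b) (t *\<^sub>R z))) (at (t *\<^sub>R z))"
      by (simp add: frechet_derivative_eq_sum_pd[OF diff_M[OF tz], abs_def])
    from diff_chain_at[OF ray this] show ?thesis by (simp add: o_def ac_simps)
  qed
  have dz: "((\<lambda>z. z $ j) has_derivative (\<lambda>h. h $ j)) (at z)" for j
    by (rule bounded_linear_imp_has_derivative[OF bounded_linear_vec_nth])
  have "((\<lambda>z. z $ j * (M j a b (t *\<^sub>R z) * W b (t *\<^sub>R z))) has_derivative
      (\<lambda>h. h $ j * (M j a b (t *\<^sub>R z) * W b (t *\<^sub>R z)) + (\<Sum>k\<in>UNIV. h $ k *
         (z $ j * (t * (pd k (M j a b) (t *\<^sub>R z) * W b (t *\<^sub>R z) + M j a b (t *\<^sub>R z) * V k b (t *\<^sub>R z))))))) (at z)" for j b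
    by (rule has_derivative_eq_rhs[OF has_derivative_mult[OF dz has_derivative_mult[OF dM dW]]])
      (simp add: fun_eq_iff sum_distrib_left sum_distrib_right sum.distrib algebra_simps)
  then have "((\<lambda>z. \<phi> W a z t) has_derivative (\<lambda>h. \<Sum>j\<in>UNIV. \<Sum>b\<in>UNIV.
      h $ j * (M j a b (t *\<^sub>R z) * W b (t *\<^sub>R z)) + (\<Sum>k\<in>UNIV. h $ k *
         (z $ j * (t * (pd k (M j a b) (t *\<^sub>R z) * W b (t *\<^sub>R z) + M j a b (t *\<^sub>R z) * V k b (t *\<^sub>R z))))))) (at z)"
    unfolding \<phi>_def by (intro has_derivative_sum)
  moreover have "(\<Sum>j\<in>UNIV. \<Sum>b\<in>UNIV. h $ j * (M j a b (t *\<^sub>R z) * W b (t *\<^sub>R z)) + (\<Sum>k\<in>UNIV. h $ k * X k j b))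
    = (\<Sum>k\<in>UNIV. h $ k * ((\<Sum>b\<in>UNIV. M k a b (t *\<^sub>R z) * W b (t *\<^sub>R z)) + (\<Sum>j\<in>UNIV. \<Sum>b\<in>UNIV. X k j b)))"
    for h and X :: "'n \<Rightarrow> 'n \<Rightarrow> 'm \<Rightarrow> real"
  proof -
    have "(\<Sum>j\<in>UNIV. \<Sum>b\<in>UNIV. \<Sum>k\<in>UNIV. h $ k * X k j b) = (\<Sum>j\<in>UNIV. \<Sum>k\<in>UNIV. \<Sum>b\<in>UNIV. h $ k * X k j b)"
      by (rule sum.cong[OF refl]) (rule sum.swap)
    also have "\<dots> = (\<Sum>k\<in>UNIV. \<Sum>j\<in>UNIV. \<Sum>b\<in>UNIV. h $ k * X k j b)"
      by (rule sum.swap)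
    finally show ?thesis
      by (simp only: sum.distrib distrib_left sum_distrib_left)
  qed
  ultimately show ?thesis
    unfolding \<psi>_def by (simp only:)
qed

text \<open>Differentiation under the integral sign: by \<open>has_derivative_\<phi>\<close> the
  partial derivatives of the integrand \<open>\<phi>\<close> are the functions
  \<open>\<psi>\<close>.\<close>

lemma C1_integral:
  assumes "C1 W V"
  shows "C1 (\<lambda>a z. integral {0..1} (\<phi> W a z)) (\<lambda>k a z. integral {0..1} (\<psi> W V k a z))"
  unfolding C1_def
proof (intro conjI allI ballI)
  have cW: "continuous_on B (W b)" for b by (rule C1_continuous[OF assms])
  have cV: "continuous_on B (V k b)" for k b using assms C1_def by blast
  note c\<psi> = continuous_\<psi>[of W V, OF cW cV]
  show "continuous_on B (\<lambda>z. integral {0..1} (\<psi> W V k a z))" for k a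
    using integral_continuous_on_param[of B 0 1 "\<psi> W V k a"] c\<psi> by (simp add: cbox_interval)
  fix a x assume x: "x \<in> B"
  \<comment> \<open>The Leibniz rule expects the derivative as a bounded linear function depending
    continuously on the parameters; \<open>fx\<close> packs the partial derivatives
    accordingly.\<close>
  define fx :: "real^'n \<Rightarrow> real \<Rightarrow> ((real^'n) \<Rightarrow>\<^sub>L real)" where
    "fx z t = (\<Sum>k\<in>UNIV. \<psi> W V k a z t *\<^sub>R blinfun_inner_right (axis k 1))" for z t
  have fx: "blinfun_apply (fx z t) h = (\<Sum>k\<in>UNIV. h $ k * \<psi> W V k a z t)" for z t h
    by (simp add: fx_def blinfun.sum_left blinfun.scaleR_left inner_axis' ac_simps)
  have "continuous_on (B \<times> cbox 0 1) (\<lambda>(z, t). fx z t)"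
    unfolding fx_def case_prod_beta using c\<psi>
    by (intro continuous_intros) (simp_all add: cbox_interval case_prod_beta)
  then have "((\<lambda>z. integral (cbox 0 1) (\<phi> W a z)) has_derivative integral (cbox 0 1) (fx x)) (at x within B)"
    using x has_derivative_\<phi>[OF assms] continuous_slice[OF continuous_\<phi>[of W, OF cW]]
    by (intro leibniz_rule)
      (auto simp: fx[abs_def] cbox_interval has_derivative_at_withinI integrable_continuous_real simp del: mem_ball)
  then have "((\<lambda>z. integral {0..1} (\<phi> W a z)) has_derivative integral {0..1} (fx x)) (at x)"
    using x at_within_open[of x B] by (simp add: cbox_interval)
  then have d: "((\<lambda>z. integral {0..1} (\<phi> W a z)) has_derivative blinfun_apply (integral {0..1} (fx x))) (at x)" .
  have e: "blinfun_apply (integral {0..1} (fx x)) h = (\<Sum>k\<in>UNIV. h $ k * integral {0..1} (\<psi> W V k a x))" for h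
  proof -
    have ci: "\<psi> W V k a x integrable_on {0..1}" for k
      using continuous_slice[OF c\<psi> x] integrable_continuous_real by blast
    have "fx x integrable_on {0..1}"
      unfolding fx_def using continuous_slice[OF c\<psi> x]
      by (intro integrable_continuous_real continuous_intros)
    then have "blinfun_apply (integral {0..1} (fx x)) h = integral {0..1} (\<lambda>t. \<Sum>k\<in>UNIV. h $ k * \<psi> W V k a x t)"
      by (subst blinfun_apply_integral) (simp_all add: fx)
    also have "\<dots> = (\<Sum>k\<in>UNIV. h $ k * integral {0..1} (\<psi> W V k a x))"
      using ci by (subst integral_sum) (auto intro!: integrable_on_mult_right)
    finally show ?thesis .
  qed
  show "((\<lambda>z. integral {0..1} (\<phi> W a z)) has_derivative
      (\<lambda>h. \<Sum>k\<in>UNIV. h $ k * integral {0..1} (\<psi> W V k a x))) (at x)"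
    by (rule has_derivative_eq_rhs[OF d]) (simp add: fun_eq_iff e)
qed

lemma abs_component_le: "z \<in> B \<Longrightarrow> \<bar>z $ j\<bar> \<le> r"
  using component_le_norm_cart[of z j] by simp

lemma abs_product_le: "\<bar>x\<bar> \<le> a \<Longrightarrow> \<bar>y\<bar> \<le> b \<Longrightarrow> \<bar>x * y\<bar> \<le> a * b" for x y a b :: real
  unfolding abs_mult by (rule mult_mono) auto

lemma \<phi>_bound:
  assumes "z \<in> B" "t \<in> {0..1}" and w: "\<And>b x. x \<in> B \<Longrightarrow> \<bar>W b x\<bar> \<le> w"
  shows "\<bar>\<phi> W a z t\<bar> \<le> w / 4"
proof -
  have tz: "t *\<^sub>R z \<in> B" by (rule scale_in_B[OF assms(1,2)])
  have w0: "0 \<le> w" using w[OF tz] abs_ge_zero order_trans by blast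
  have "\<bar>\<phi> W a z t\<bar> \<le> real CARD('n) * (real CARD('m) * (r * (c * w)))"
    unfolding \<phi>_def
    by (intro abs_sum_UNIV_le abs_product_le abs_component_le bound_M w tz assms(1))
  also have "\<dots> = (real CARD('n) * real CARD('m) * c * r) * w" by (simp add: ac_simps)
  also have "\<dots> \<le> w / 4" using mult_right_mono[OF small w0] by simp
  finally show ?thesis .
qed

text \<open>The first summand of \<open>\<psi>\<close> comes from differentiating the factor z and
  has no small radius in front, hence the term without 1/4. All the rest gains a factor r.\<close>

lemma \<psi>_bound:
  assumes "z \<in> B" "t \<in> {0..1}" and w: "\<And>b x. x \<in> B \<Longrightarrow> \<bar>W b x\<bar> \<le> w"
    and v: "\<And>k b x. x \<in> B \<Longrightarrow> \<bar>V k b x\<bar> \<le> v"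
  shows "\<bar>\<psi> W V k a z t\<bar> \<le> real CARD('m) * c * w + (w + v) / 4"
proof -
  have tz: "t *\<^sub>R z \<in> B" by (rule scale_in_B[OF assms(1,2)])
  have w0: "0 \<le> w" using w[OF tz] abs_ge_zero order_trans by blast
  have v0: "0 \<le> v" using v[OF tz] abs_ge_zero order_trans by blast
  have t: "\<bar>t\<bar> \<le> 1" using assms(2) by auto
  have "\<bar>\<psi> W V k a z t\<bar> \<le> real CARD('m) * (c * w) + real CARD('n) * (real CARD('m) * (r * (1 * (c * w + c * v))))"
    unfolding \<psi>_def
    by (intro order_trans[OF abs_triangle_ineq add_mono] order_trans[OF abs_triangle_ineq[of "_ * _" "_ * _"] add_mono]
        abs_sum_UNIV_le abs_product_le abs_component_le bound_M bound_pd_M w v tz t assms(1) order_refl)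
  also have "\<dots> = real CARD('m) * c * w + (real CARD('n) * real CARD('m) * c * r) * (w + v)" by (simp add: algebra_simps)
  also have "\<dots> \<le> real CARD('m) * c * w + (w + v) / 4"
    using mult_right_mono[OF small, of "w + v"] w0 v0 by simp
  finally show ?thesis .
qed

text \<open>The terms of a Neumann series, not successive approximations: each one is the ray
  integral of the previous one, starting from the constants \<open>w0\<close> with zero derivative.
  Their sum solves the radial equation with value \<open>w0\<close> at the origin.\<close>

primrec iterate :: "('m \<Rightarrow> real) \<Rightarrow> nat \<Rightarrow> ('m \<Rightarrow> real^'n \<Rightarrow> real) \<times> ('n \<Rightarrow> 'm \<Rightarrow> real^'n \<Rightarrow> real)" where
  "iterate w0 0 = (\<lambda>b z. w0 b, \<lambda>k b z. 0)"
| "iterate w0 (Suc n) = (\<lambda>a z. integral {0..1} (\<phi> (fst (iterate w0 n)) a z),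
     \<lambda>k a z. integral {0..1} (\<psi> (fst (iterate w0 n)) (snd (iterate w0 n)) k a z))"

context
  fixes w0 :: "'m \<Rightarrow> real" and C :: real
  assumes w0: "\<And>b. \<bar>w0 b\<bar> \<le> C"
begin

abbreviation "Wn n \<equiv> fst (iterate w0 n)"
abbreviation "Vn n \<equiv> snd (iterate w0 n)"
lemma C_nonneg: "0 \<le> C"
  using w0 abs_ge_zero order_trans by blast

text \<open>Chosen so that the recursive estimate for the derivatives reproduces itself: m c C + C/4
  + D/4 <= D/2, with m the number of unknowns.\<close>

definition D :: real where "D = 4 * (real CARD('m) * c + 1) * C"

lemma D_nonneg: "0 \<le> D"
  using c C_nonneg by (simp add: D_def)

lemma C1_iterate: "C1 (Wn n) (Vn n)"
proof (induction n)
  case 0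
  show ?case by (simp add: C1_def)
next
  case (Suc n)
  then show ?case using C1_integral by simp
qed

lemma iterate_continuous: "continuous_on B (Wn n b)" "continuous_on B (Vn n k b)"
  using C1_continuous[OF C1_iterate] C1_iterate C1_def by blast+

lemma \<phi>_integrable: "z \<in> B \<Longrightarrow> \<phi> (Wn n) a z integrable_on {0..1}"
  by (rule integrable_continuous_real, rule continuous_slice[OF continuous_\<phi>[of "Wn n", OF iterate_continuous(1)]])

lemma \<psi>_continuous: "z \<in> B \<Longrightarrow> continuous_on {0..1} (\<psi> (Wn n) (Vn n) k a z)"
  by (rule continuous_slice[OF continuous_\<psi>[of "Wn n" "Vn n", OF iterate_continuous]])

lemma abs_integral_le:
  fixes f :: "real \<Rightarrow> real"
  assumes "f integrable_on {0..1}" "\<And>t. t \<in> {0..1} \<Longrightarrow> \<bar>f t\<bar> \<le> b"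
  shows "\<bar>integral {0..1} f\<bar> \<le> b"
  using integral_norm_bound_integral[OF assms(1) integrable_continuous_real[OF continuous_on_const], of b] assms(2)
  by simp

text \<open>\<open>W\<close> gains 1/4 in each step. The bound for \<open>V\<close> also contains
  the current \<open>W\<close> with a factor that need not be small; the slower rate 2^-n and the
  size of \<open>D\<close> absorb it.\<close>

lemma iterate_bound:
  "z \<in> B \<Longrightarrow> \<bar>Wn n b z\<bar> \<le> C / 4 ^ n" "z \<in> B \<Longrightarrow> \<bar>Vn n k b z\<bar> \<le> D / 2 ^ n"
proof (induction n arbitrary: b k z)
  case 0
  { case 1 show ?case using w0 by simp }
  { case 2 show ?case using D_nonneg by simp }
next
  case (Suc n)
  { case 1
    have "\<bar>integral {0..1} (\<phi> (Wn n) b z)\<bar> \<le> C / 4 ^ n / 4"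
      by (rule abs_integral_le[OF \<phi>_integrable[OF 1] \<phi>_bound[OF 1]]) (use Suc.IH(1) in auto)
    then show ?case by simp }
  { case 2
    have "\<bar>integral {0..1} (\<psi> (Wn n) (Vn n) k b z)\<bar> \<le> real CARD('m) * c * (C / 4 ^ n) + (C / 4 ^ n + D / 2 ^ n) / 4"
      by (rule abs_integral_le[OF integrable_continuous_real[OF \<psi>_continuous[OF 2]] \<psi>_bound[OF 2]])
        (use Suc.IH in auto)
    also have "\<dots> \<le> real CARD('m) * c * (C / 2 ^ n) + (C / 2 ^ n + D / 2 ^ n) / 4"
    proof -
      have "C / 4 ^ n \<le> C / 2 ^ n"
        using C_nonneg by (intro divide_left_mono power_mono) auto
      then show ?thesis
        by (intro add_mono divide_right_mono mult_left_mono order_refl) (use c in auto)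
    qed
    also have "\<dots> = (real CARD('m) * c * C + C / 4 + D / 4) / 2 ^ n"
      by (simp add: add_divide_distrib)
    also have "\<dots> \<le> (D / 2) / 2 ^ n"
    proof (rule divide_right_mono)
      have "real CARD('m) * c * C + C / 4 + D / 4 = D / 2 - 3 / 4 * C"
        by (simp add: D_def algebra_simps)
      then show "real CARD('m) * c * C + C / 4 + D / 4 \<le> D / 2" using C_nonneg by simp
    qed simp
    finally show ?case by simp }
qed

lemma iterate_bound': "z \<in> B \<Longrightarrow> \<bar>Wn n b z\<bar> \<le> C / 2 ^ n"
proof -
  have "C / 4 ^ n \<le> C / 2 ^ n"
    using C_nonneg by (intro divide_left_mono power_mono) auto
  then show "z \<in> B \<Longrightarrow> \<bar>Wn n b z\<bar> \<le> C / 2 ^ n" using iterate_bound(1) order_trans by blast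
qed

definition W where "W b z = (\<Sum>n. Wn n b z)"
definition V where "V k b z = (\<Sum>n. Vn n k b z)"

lemma W_sums: "z \<in> B \<Longrightarrow> (\<lambda>n. Wn n b z) sums W b z"
  unfolding W_def by (rule summable_sums[OF geometric_tail(1)[OF iterate_bound']])

lemma V_sums: "z \<in> B \<Longrightarrow> (\<lambda>n. Vn n k b z) sums V k b z"
  unfolding V_def by (rule summable_sums[OF geometric_tail(1)[OF iterate_bound(2)]])

lemma V_tail: "z \<in> B \<Longrightarrow> \<bar>(\<Sum>i<n. Vn i k b z) - V k b z\<bar> \<le> 2 * D / 2 ^ n"
  unfolding V_def by (rule geometric_tail(2)[OF iterate_bound(2)])

lemma eventually_small: "e > 0 \<Longrightarrow> \<forall>\<^sub>F n in sequentially. K / 2 ^ n \<le> (e::real)"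
proof -
  assume "e > 0"
  have "(\<lambda>n. K * (1 / 2) ^ n) \<longlonglongrightarrow> K * 0"
    by (intro tendsto_intros LIMSEQ_realpow_zero) auto
  then have "\<forall>\<^sub>F n in sequentially. K * (1 / 2) ^ n < e"
    using \<open>e > 0\<close> order_tendstoD(2) by fastforce
  then show ?thesis by eventually_elim (simp add: power_divide)
qed

lemma W_has_derivative:
  assumes z: "z \<in> B"
  shows "(W b has_derivative (\<lambda>h. \<Sum>k\<in>UNIV. h $ k * V k b z)) (at z)"
proof -
  have "\<exists>g. \<forall>x\<in>B. (\<lambda>n. Wn n b x) sums g x \<and>
      (g has_derivative (\<lambda>h. \<Sum>k\<in>UNIV. h $ k * V k b x)) (at x within B)"
  proof (rule has_derivative_series[OF convex_ball])
    show "(Wn n b has_derivative (\<lambda>h. \<Sum>k\<in>UNIV. h $ k * Vn n k b x)) (at x within B)" if "x \<in> B" for n x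
      using C1_iterate that has_derivative_at_withinI unfolding C1_def by blast
    show "(\<lambda>n. Wn n b z) sums W b z" by (rule W_sums[OF z])
    fix e :: real assume "e > 0"
    show "\<forall>\<^sub>F n in sequentially. \<forall>x\<in>B. \<forall>h.
        norm ((\<Sum>i<n. \<Sum>k\<in>UNIV. h $ k * Vn i k b x) - (\<Sum>k\<in>UNIV. h $ k * V k b x)) \<le> e * norm h"
      using eventually_small[OF \<open>e > 0\<close>, of "real CARD('n) * (2 * D)"]
    proof eventually_elim
      case (elim n)
      show ?case
      proof (intro ballI allI)
        fix x h assume x: "x \<in> B"
        have "(\<Sum>i<n. \<Sum>k\<in>UNIV. h $ k * Vn i k b x) - (\<Sum>k\<in>UNIV. h $ k * V k b x) =
            (\<Sum>k\<in>UNIV. h $ k * ((\<Sum>i<n. Vn i k b x) - V k b x))"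
          by (subst sum.swap) (simp only: sum_distrib_left sum_subtractf right_diff_distrib)
        also have "\<bar>\<dots>\<bar> \<le> real CARD('n) * (norm h * (2 * D / 2 ^ n))"
          by (intro abs_sum_UNIV_le abs_product_le V_tail x component_le_norm_cart)
        also have "\<dots> = (real CARD('n) * (2 * D) / 2 ^ n) * norm h" by simp
        also have "\<dots> \<le> e * norm h" using elim by (intro mult_right_mono) auto
        finally show "norm ((\<Sum>i<n. \<Sum>k\<in>UNIV. h $ k * Vn i k b x) - (\<Sum>k\<in>UNIV. h $ k * V k b x)) \<le> e * norm h"
          by simp
      qed
    qed
  qed (rule z)
  then obtain g where g: "\<And>x. x \<in> B \<Longrightarrow> (\<lambda>n. Wn n b x) sums g x"
      "(g has_derivative (\<lambda>h. \<Sum>k\<in>UNIV. h $ k * V k b z)) (at z within B)"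
    using z by blast
  have "(g has_derivative (\<lambda>h. \<Sum>k\<in>UNIV. h $ k * V k b z)) (at z)"
    using g(2) at_within_open[OF z open_ball] by simp
  then show ?thesis
  proof (rule has_derivative_transform_within_open[OF _ open_ball z])
    show "g x = W b x" if "x \<in> B" for x
      using g(1)[OF that] W_sums[OF that] sums_unique2 by blast
  qed
qed

lemma V_continuous: "continuous_on B (V k b)"
proof -
  have "uniform_limit B (\<lambda>n x. \<Sum>i<n. Vn i k b x) (\<lambda>x. \<Sum>i. Vn i k b x) sequentially"
  proof (rule Weierstrass_m_test)
    show "norm (Vn n k b x) \<le> D / 2 ^ n" if "x \<in> B" for n x
      using iterate_bound(2)[OF that] by simp
    show "summable (\<lambda>n. D / 2 ^ n)"
      using geometric_tail(1)[of "\<lambda>n. D / 2 ^ n" D] D_nonneg by simp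
  qed
  moreover have "\<forall>\<^sub>F n in sequentially. continuous_on B (\<lambda>x. \<Sum>i<n. Vn i k b x)"
    by (intro always_eventually allI continuous_on_sum iterate_continuous)
  ultimately show ?thesis
    unfolding V_def[abs_def] by (intro uniform_limit_theorem) auto
qed

lemma C1_limit: "C1 W V"
  unfolding C1_def using W_has_derivative V_continuous by blast

text \<open>Uniform convergence allows summing the recursion for the derivatives under the integral
  sign.\<close>

lemma V_integral_equation:
  assumes z: "z \<in> B"
  shows "V k a z = integral {0..1} (\<psi> W V k a z)"
proof -
  let ?f = "\<lambda>n. \<psi> (Wn n) (Vn n) k a z"
  let ?G = "real CARD('m) * c * C + (C + D) / 4"
  have s: "(\<lambda>n. ?f n t) sums \<psi> W V k a z t" if "t \<in> {0..1}" for t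
    unfolding \<psi>_def
    by (intro sums_add sums_sum sums_mult W_sums V_sums scale_in_B[OF z that])
  have "uniform_limit {0..1} (\<lambda>n t. \<Sum>i<n. ?f i t) (\<lambda>t. \<Sum>i. ?f i t) sequentially"
  proof (rule Weierstrass_m_test)
    show "norm (?f n t) \<le> ?G / 2 ^ n" if "t \<in> {0..1}" for n t
      using \<psi>_bound[where W="Wn n" and V="Vn n", OF z that iterate_bound' iterate_bound(2)]
      by (simp add: add_divide_distrib ac_simps)
    show "summable (\<lambda>n. ?G / 2 ^ n)"
      using geometric_tail(1)[of "\<lambda>n. ?G / 2 ^ n" ?G] c C_nonneg D_nonneg by simp
  qed
  then have u: "uniform_limit (cbox 0 1) (\<lambda>n t. \<Sum>i<n. ?f i t) (\<psi> W V k a z) sequentially"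
    unfolding cbox_interval
    by (rule uniform_limit_cong'[THEN iffD1, rotated 2]) (use sums_unique[OF s] in auto)
  have cont: "continuous_on (cbox 0 1) (\<lambda>t. \<Sum>i<n. ?f i t)" for n
    unfolding cbox_interval by (intro continuous_on_sum \<psi>_continuous z)
  obtain I J where IJ: "\<And>n. ((\<lambda>t. \<Sum>i<n. ?f i t) has_integral I n) (cbox 0 1)"
      "(\<psi> W V k a z has_integral J) (cbox 0 1)" "I \<longlonglongrightarrow> J"
    using uniform_limit_integral_cbox[OF u cont sequentially_bot] by blast
  have "I n = (\<Sum>i<n. Vn (Suc i) k a z)" for n
  proof -
    have "I n = integral {0..1} (\<lambda>t. \<Sum>i<n. ?f i t)"
      using IJ(1)[of n] by (simp add: cbox_interval integral_unique)
    also have "\<dots> = (\<Sum>i<n. integral {0..1} (?f i))"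
      by (intro integral_sum) (auto intro: integrable_continuous_real \<psi>_continuous[OF z])
    finally show ?thesis by simp
  qed
  then have e: "I = (\<lambda>n. \<Sum>i<n. Vn (Suc i) k a z)" by (rule ext)
  have "(\<lambda>i. Vn (Suc i) k a z) sums J"
    unfolding sums_def e[symmetric] by (rule IJ(3))
  \<comment> \<open>The shift of the index is harmless because the term of index 0 is the zero
    function.\<close>
  then have "(\<lambda>i. Vn i k a z) sums J"
    using sums_Suc_iff[of "\<lambda>i. Vn i k a z" J] by simp
  then have "V k a z = J" using V_sums[OF z] sums_unique2 by blast
  then show ?thesis using IJ(2) by (simp add: cbox_interval integral_unique)
qed

text \<open>The defect of \<open>W\<close> in the full system. By construction the equation is
  enforced in the radial direction only.\<close>

definition F where "F k a z = V k a z - (\<Sum>b\<in>UNIV. M k a b z * W b z)"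

text \<open>Both \<open>V\<close> and the sum of M W are integrals over the same ray. In the
  difference of the integrands, flatness trades the antisymmetrized derivatives of M for
  commutators, and the terms regroup into an expression linear and homogeneous in the
  defect.\<close>

lemma F_integral_equation:
  assumes z: "z \<in> B"
  shows "((\<lambda>t. t * (\<Sum>j\<in>UNIV. z $ j * ((\<Sum>d\<in>UNIV. M j a d (t *\<^sub>R z) * F k d (t *\<^sub>R z))
    - (\<Sum>d\<in>UNIV. M k a d (t *\<^sub>R z) * F j d (t *\<^sub>R z))))) has_integral F k a z) {0..1}"
proof -
  \<comment> \<open>Thanks to the factor t, this function vanishes at 0 and equals the sum of M W at
    \<open>z\<close> for t = 1, so that integrating its derivative recovers that sum.\<close>
  let ?P = "\<lambda>t. t * (\<Sum>b\<in>UNIV. M k a b (t *\<^sub>R z) * W b (t *\<^sub>R z))"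
  let ?P' = "\<lambda>t. (\<Sum>b\<in>UNIV. M k a b (t *\<^sub>R z) * W b (t *\<^sub>R z)) + t * (\<Sum>j\<in>UNIV. \<Sum>b\<in>UNIV. z $ j *
      (pd j (M k a b) (t *\<^sub>R z) * W b (t *\<^sub>R z) + M k a b (t *\<^sub>R z) * V j b (t *\<^sub>R z)))"
  have P: "(?P has_vector_derivative ?P' t) (at t within {0..1})" if t: "t \<in> {0..1}" for t
  proof -
    have tz: "t *\<^sub>R z \<in> B" by (rule scale_in_B[OF z t])
    have ray: "((\<lambda>t. t *\<^sub>R z) has_derivative (\<lambda>s. s *\<^sub>R z)) (at t)"
      by (auto intro!: derivative_eq_intros)
    have "((\<lambda>t. W b (t *\<^sub>R z)) has_derivative (\<lambda>s. s * (\<Sum>j\<in>UNIV. z $ j * V j b (t *\<^sub>R z)))) (at t)" for b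
      using diff_chain_at[OF ray W_has_derivative[OF tz]]
      by (simp add: o_def sum_distrib_left mult.assoc)
    then have dW: "((\<lambda>t. W b (t *\<^sub>R z)) has_real_derivative (\<Sum>j\<in>UNIV. z $ j * V j b (t *\<^sub>R z))) (at t)" for b
      by (simp add: has_field_derivative_def mult_commute_abs)
    have "(M k a b has_derivative frechet_derivative (M k a b) (at (t *\<^sub>R z))) (at (t *\<^sub>R z))" for b
      using diff_M[OF tz] frechet_derivative_works by blast
    then have "(M k a b has_derivative (\<lambda>h. \<Sum>j\<in>UNIV. h $ j * pd j (M k a b) (t *\<^sub>R z))) (at (t *\<^sub>R z))" for b
      by (simp add: frechet_derivative_eq_sum_pd[OF diff_M[OF tz], abs_def])
    from diff_chain_at[OF ray this]
    have "((\<lambda>t. M k a b (t *\<^sub>R z)) has_derivative (\<lambda>s. s * (\<Sum>j\<in>UNIV. z $ j * pd j (M k a b) (t *\<^sub>R z)))) (at t)" for b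
      by (simp add: o_def sum_distrib_left mult.assoc)
    then have dM: "((\<lambda>t. M k a b (t *\<^sub>R z)) has_real_derivative (\<Sum>j\<in>UNIV. z $ j * pd j (M k a b) (t *\<^sub>R z))) (at t)" for b
      by (simp add: has_field_derivative_def mult_commute_abs)
    have "(\<Sum>j\<in>UNIV. \<Sum>b\<in>UNIV. z $ j *
        (pd j (M k a b) (t *\<^sub>R z) * W b (t *\<^sub>R z) + M k a b (t *\<^sub>R z) * V j b (t *\<^sub>R z))) =
        (\<Sum>b\<in>UNIV. (\<Sum>j\<in>UNIV. z $ j * pd j (M k a b) (t *\<^sub>R z)) * W b (t *\<^sub>R z)
          + (\<Sum>j\<in>UNIV. z $ j * V j b (t *\<^sub>R z)) * M k a b (t *\<^sub>R z))"
      by (subst sum.swap) (simp only: sum_distrib_left sum_distrib_right sum.distrib distrib_left ac_simps)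
    then have "(?P has_real_derivative ?P' t) (at t)"
      by (intro DERIV_cong[OF DERIV_mult[OF DERIV_ident DERIV_sum[OF DERIV_mult[OF dM dW]]]]) simp
    then show ?thesis
      by (simp add: has_real_derivative_iff_has_vector_derivative has_vector_derivative_at_within)
  qed
  have "(?P' has_integral ?P 1 - ?P 0) {0..1}"
    by (rule fundamental_theorem_of_calculus) (use P in auto)
  then have 1: "(?P' has_integral (\<Sum>b\<in>UNIV. M k a b z * W b z)) {0..1}" by simp
  have "\<psi> W V k a z integrable_on {0..1}"
    using continuous_slice[OF continuous_\<psi>[of W V, OF C1_continuous[OF C1_limit] V_continuous] z]
    by (rule integrable_continuous_real)
  then have 2: "(\<psi> W V k a z has_integral V k a z) {0..1}"
    unfolding V_integral_equation[OF z] by (rule integrable_integral)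
  have "\<psi> W V k a z t - ?P' t = t * (\<Sum>j\<in>UNIV. z $ j * ((\<Sum>d\<in>UNIV. M j a d (t *\<^sub>R z) * F k d (t *\<^sub>R z))
    - (\<Sum>d\<in>UNIV. M k a d (t *\<^sub>R z) * F j d (t *\<^sub>R z))))" if t: "t \<in> {0..1}" for t
  proof -
    let ?x = "t *\<^sub>R z"
    have x: "?x \<in> B" by (rule scale_in_B[OF z t])
    have swap: "(\<Sum>b\<in>UNIV. (\<Sum>d\<in>UNIV. M j a d ?x * M k d b ?x) * W b ?x) =
        (\<Sum>d\<in>UNIV. M j a d ?x * (\<Sum>b\<in>UNIV. M k d b ?x * W b ?x))" for j k
      unfolding sum_distrib_left sum_distrib_right
      by (subst sum.swap) (simp only: ac_simps)
    have fl: "pd k (M j a b) ?x - pd j (M k a b) ?x =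
        (\<Sum>d\<in>UNIV. M k a d ?x * M j d b ?x) - (\<Sum>d\<in>UNIV. M j a d ?x * M k d b ?x)" for j b
      using flat[OF x, of k j a b] by simp
    have "(\<Sum>b\<in>UNIV. (pd k (M j a b) ?x - pd j (M k a b) ?x) * W b ?x) =
        (\<Sum>d\<in>UNIV. M k a d ?x * (\<Sum>b\<in>UNIV. M j d b ?x * W b ?x)) -
        (\<Sum>d\<in>UNIV. M j a d ?x * (\<Sum>b\<in>UNIV. M k d b ?x * W b ?x))" for j
      unfolding fl left_diff_distrib sum_subtractf swap ..
    then have "(\<Sum>b\<in>UNIV. (pd k (M j a b) ?x - pd j (M k a b) ?x) * W b ?x + M j a b ?x * V k b ?x
        - M k a b ?x * V j b ?x) =
      (\<Sum>d\<in>UNIV. M j a d ?x * F k d ?x) - (\<Sum>d\<in>UNIV. M k a d ?x * F j d ?x)" for j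
      by (simp add: F_def sum.distrib sum_subtractf right_diff_distrib)
    moreover have "\<psi> W V k a z t - ?P' t = t * (\<Sum>j\<in>UNIV. z $ j * (\<Sum>b\<in>UNIV.
        (pd k (M j a b) ?x - pd j (M k a b) ?x) * W b ?x + M j a b ?x * V k b ?x - M k a b ?x * V j b ?x))"
      unfolding \<psi>_def
      by (simp add: sum_distrib_left sum_subtractf[symmetric] algebra_simps)
    ultimately show ?thesis by simp
  qed
  then show ?thesis
    unfolding F_def by (intro has_integral_eq[OF _ has_integral_diff[OF 2 1]]) auto
qed

text \<open>The homogeneous integral equation halves any uniform bound on the defect: two sums, each
  contributing at most 1/4. Iteration from the crude bound \<open>b0\<close> leaves only 0.\<close>

lemma F_zero:
  assumes "z \<in> B"
  shows "F k a z = 0"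
proof -
  have V_bound: "\<bar>V k a z\<bar> \<le> 2 * D" if "z \<in> B" for k a z
    using V_tail[OF that, where n=0] by simp
  have W_bound: "\<bar>W b z\<bar> \<le> 2 * C" if "z \<in> B" for b z
    unfolding W_def using geometric_tail(2)[of "\<lambda>n. Wn n b z" C 0] iterate_bound'[OF that] by simp
  define b0 where "b0 = 2 * D + real CARD('m) * (c * (2 * C))"
  have "\<bar>F k a z\<bar> \<le> b0 / 2 ^ n" if "z \<in> B" for k a z n
    using that
  proof (induction n arbitrary: k a z)
    case 0
    show ?case
      unfolding F_def b0_def
      using order_trans[OF abs_triangle_ineq4 add_mono[OF V_bound[OF 0]
          abs_sum_UNIV_le[OF abs_product_le[OF bound_M[OF 0] W_bound[OF 0]]]]] by simp
  next
    case (Suc n)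
    let ?b = "b0 / 2 ^ n"
    have b: "0 \<le> ?b" using Suc.IH[OF Suc.prems] abs_ge_zero order_trans by blast
    have "\<bar>t * (\<Sum>j\<in>UNIV. z $ j * ((\<Sum>d\<in>UNIV. M j a d (t *\<^sub>R z) * F k d (t *\<^sub>R z))
        - (\<Sum>d\<in>UNIV. M k a d (t *\<^sub>R z) * F j d (t *\<^sub>R z))))\<bar> \<le> ?b / 2" if t: "t \<in> {0..1}" for t
    proof -
      have x: "t *\<^sub>R z \<in> B" by (rule scale_in_B[OF Suc.prems t])
      have "\<bar>t\<bar> \<le> 1" using t by auto
      then have "\<bar>t * (\<Sum>j\<in>UNIV. z $ j * ((\<Sum>d\<in>UNIV. M j a d (t *\<^sub>R z) * F k d (t *\<^sub>R z))
        - (\<Sum>d\<in>UNIV. M k a d (t *\<^sub>R z) * F j d (t *\<^sub>R z))))\<bar>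
        \<le> 1 * (real CARD('n) * (r * (real CARD('m) * (c * ?b) + real CARD('m) * (c * ?b))))"
        by (intro abs_product_le abs_sum_UNIV_le abs_component_le[OF Suc.prems]
            order_trans[OF abs_triangle_ineq4 add_mono] bound_M[OF x] Suc.IH[OF x])
      also have "\<dots> = 2 * (real CARD('n) * real CARD('m) * c * r) * ?b" by (simp add: algebra_simps)
      also have "\<dots> \<le> ?b / 2" using mult_right_mono[OF small b] by simp
      finally show ?thesis .
    qed
    note le = this
    note I = F_integral_equation[OF Suc.prems, where k=k and a=a]
    from abs_integral_le[OF has_integral_integrable[OF I] le] have "\<bar>F k a z\<bar> \<le> ?b / 2"
      unfolding integral_unique[OF I] .
    then show ?case by simp
  qed
  note bd = this[OF assms]
  have "\<bar>F k a z\<bar> \<le> e" if e: "e > 0" for e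
  proof -
    obtain n where "b0 / 2 ^ n \<le> e"
      using eventually_small[OF e, of b0] unfolding eventually_sequentially by blast
    then show ?thesis using bd[where n=n and k=k and a=a] by linarith
  qed
  then show ?thesis using field_le_epsilon[of "\<bar>F k a z\<bar>" 0] by simp
qed

lemma W_solves:
  assumes "z \<in> B"
  shows "W b differentiable (at z)" "pd k (W a) z = (\<Sum>b\<in>UNIV. M k a b z * W b z)"
proof -
  show "W b differentiable (at z)"
    using W_has_derivative[OF assms] differentiableI by blast
  have "pd k (W a) z = (\<Sum>j\<in>UNIV. axis k 1 $ j * V j a z)"
    by (rule pd_eqI[OF W_has_derivative[OF assms]])
  also have "\<dots> = (\<Sum>j\<in>UNIV. if j = k then V j a z else 0)"
    by (rule sum.cong) (auto simp: axis_def)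
  also have "\<dots> = V k a z" by simp
  finally show "pd k (W a) z = (\<Sum>b\<in>UNIV. M k a b z * W b z)"
    using F_zero[OF assms, of k a] by (simp add: F_def)
qed

text \<open>At the origin the ray is constant, so all terms of the series after the first vanish
  there.\<close>

lemma W_initial: "W b 0 = w0 b"
proof -
  have "Wn n b 0 = (if n = 0 then w0 b else 0)" for n
    by (cases n) (simp_all add: \<phi>_def[abs_def])
  then show ?thesis
    unfolding W_def using sums_unique[OF sums_single[of 0 "\<lambda>_. w0 b"]] by simp
qed

end

lemma flat_system_solution:
  "\<exists>W. (\<forall>b. W b 0 = w0 b) \<and> (\<forall>z\<in>ball 0 r. \<forall>b. W b differentiable (at z)) \<and>
    (\<forall>z\<in>ball 0 r. \<forall>k a. pd k (W a) z = (\<Sum>b\<in>UNIV. M k a b z * W b z))"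
proof -
  have "\<bar>w0 b\<bar> \<le> Max (range (\<lambda>b. \<bar>w0 b\<bar>))" for b by simp
  note b = this
  show ?thesis
    by (intro exI[of _ "W w0"] conjI ballI allI W_initial[OF b] W_solves[OF b])
qed

end

text \<open>Compactness of a closed ball bounds the coefficients and their derivatives; translating
  its centre to the origin and shrinking the radius gives a \<open>flat_system\<close>. Smoothness
  follows afterwards from \<open>smooth_on_linear_system\<close>.\<close>

theorem frobenius_linear:
  fixes M :: "'n::finite \<Rightarrow> 'm::finite \<Rightarrow> 'm \<Rightarrow> real^'n \<Rightarrow> real"
  assumes "open S" "x0 \<in> S" and M: "\<And>j a b. smooth_on S (M j a b)"
    and flat: "\<And>z k j a b. z \<in> S \<Longrightarrow> pd k (M j a b) z + (\<Sum>d\<in>UNIV. M j a d z * M k d b z) =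
      pd j (M k a b) z + (\<Sum>d\<in>UNIV. M k a d z * M j d b z)"
  obtains N W where "open N" "x0 \<in> N" "N \<subseteq> S" "\<And>b. W b x0 = w0 b" "\<And>b. smooth_on N (W b)"
    "\<And>z k a. z \<in> N \<Longrightarrow> pd k (W a) z = (\<Sum>b\<in>UNIV. M k a b z * W b z)"
proof -
  obtain R where R: "R > 0" "cball x0 R \<subseteq> S" using assms(1,2) open_contains_cball by blast
  have bdd: "\<exists>c. \<forall>z\<in>cball x0 R. \<bar>f z\<bar> \<le> c" if "continuous_on S f" for f :: "real^'n \<Rightarrow> real"
  proof -
    have "bounded (f ` cball x0 R)"
      using compact_continuous_image[OF continuous_on_subset[OF that R(2)] compact_cball] compact_imp_bounded by blast
    then show ?thesis by (auto simp: bounded_iff)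
  qed
  have "\<exists>c. \<forall>i::'n \<times> 'm \<times> 'm. \<forall>z\<in>cball x0 R. \<bar>M (fst i) (fst (snd i)) (snd (snd i)) z\<bar> \<le> c"
    by (rule uniform_bound_finite, rule bdd, rule smooth_on_continuous[OF M])
  then obtain c1 where c1: "\<And>i z. z \<in> cball x0 R \<Longrightarrow> \<bar>M (fst i) (fst (snd i)) (snd (snd i)) z\<bar> \<le> c1"
    by blast
  have "\<exists>c. \<forall>i::'n \<times> 'n \<times> 'm \<times> 'm. \<forall>z\<in>cball x0 R.
      \<bar>pd (fst i) (M (fst (snd i)) (fst (snd (snd i))) (snd (snd (snd i)))) z\<bar> \<le> c"
    by (rule uniform_bound_finite, rule bdd, rule smooth_on_continuous[OF smooth_on_pd[OF M]])
  then obtain c2 where c2: "\<And>i z. z \<in> cball x0 R \<Longrightarrow>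
      \<bar>pd (fst i) (M (fst (snd i)) (fst (snd (snd i))) (snd (snd (snd i)))) z\<bar> \<le> c2"
    by blast
  define c where "c = max 0 (max c1 c2)"
  have cM: "\<bar>M j a b z\<bar> \<le> c" if "z \<in> cball x0 R" for j a b z
    using c1[OF that, of "(j, a, b)"] by (simp add: c_def)
  have cpM: "\<bar>pd k (M j a b) z\<bar> \<le> c" if "z \<in> cball x0 R" for k j a b z
    using c2[OF that, of "(k, j, a, b)"] by (simp add: c_def)
  define K where "K = real CARD('n) * real CARD('m) * c"
  \<comment> \<open>The \<open>K + 1\<close> keeps the quotient meaningful when all coefficients
    vanish, and still gives K r <= 1/4.\<close>
  define r where "r = min R (1 / (4 * (K + 1)))"
  have K: "K \<ge> 0" by (simp add: K_def c_def)
  have r: "0 < r" "r \<le> R" "K * r \<le> 1 / 4"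
  proof -
    show "0 < r" "r \<le> R" using R K by (simp_all add: r_def)
    have "K * r \<le> (K + 1) * (1 / (4 * (K + 1)))"
      using K \<open>0 < r\<close> by (intro mult_mono) (auto simp: r_def)
    also have "\<dots> = 1 / 4" using K by simp
    finally show "K * r \<le> 1 / 4" .
  qed
  have in_ball: "x0 + z \<in> cball x0 R" "x0 + z \<in> S" if "z \<in> ball 0 r" for z
    using that r R by (auto simp: dist_norm)
  have sub: "ball x0 r \<subseteq> S"
    using r(2) R(2) ball_subset_cball[of x0 r] subset_cball[of r R x0] by blast
  let ?M = "\<lambda>j a b z. M j a b (x0 + z)"
  have dM: "M j a b differentiable (at (x0 + z))" if "z \<in> ball 0 r" for j a b z
    using smooth_on_differentiable[OF M in_ball(2)[OF that]] .
  have pdM: "pd k (?M j a b) z = pd k (M j a b) (x0 + z)" if "z \<in> ball 0 r" for k j a b z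
    using pd_compose_affine[OF bounded_linear_ident dM[OF that]] by simp
  interpret flat_system ?M r c
  proof
    fix z :: "real^'n" assume z: "z \<in> ball 0 r"
    show "?M j a b differentiable (at z)" for j a b
      using differentiable_compose_affine[OF bounded_linear_ident dM[OF z]] .
    show "\<bar>M j a b (x0 + z)\<bar> \<le> c" for j a b by (rule cM[OF in_ball(1)[OF z]])
    show "\<bar>pd k (?M j a b) z\<bar> \<le> c" for k j a b unfolding pdM[OF z] by (rule cpM[OF in_ball(1)[OF z]])
    show "pd k (?M j a b) z + (\<Sum>d\<in>UNIV. M j a d (x0 + z) * M k d b (x0 + z)) =
      pd j (?M k a b) z + (\<Sum>d\<in>UNIV. M k a d (x0 + z) * M j d b (x0 + z))" for k j a b
      unfolding pdM[OF z] by (rule flat[OF in_ball(2)[OF z]])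
  next
    show "continuous_on (ball 0 r) (pd k (?M j a b))" for k j a b
    proof -
      have "continuous_on (ball 0 r) (\<lambda>z. pd k (M j a b) (x0 + z))"
        by (rule continuous_on_compose2[OF smooth_on_continuous[OF smooth_on_pd[OF M]]])
          (use sub in \<open>auto intro!: continuous_intros simp del: mem_ball\<close>)
      then show ?thesis by (rule continuous_on_eq) (use pdM in auto)
    qed
  qed (use r K in \<open>auto simp: K_def c_def\<close>)
  obtain W where W: "\<And>b. W b 0 = w0 b" "\<And>z b. z \<in> ball 0 r \<Longrightarrow> W b differentiable (at z)"
    "\<And>z k a. z \<in> ball 0 r \<Longrightarrow> pd k (W a) z = (\<Sum>b\<in>UNIV. M k a b (x0 + z) * W b z)"
    using flat_system_solution[of w0] by blast
  have shift: "- x0 + x \<in> ball 0 r" if "x \<in> ball x0 r" for x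
    using that by (simp add: dist_norm norm_minus_commute)
  have d: "(\<lambda>x. W b (- x0 + x)) differentiable (at x)" if "x \<in> ball x0 r" for b x
    by (rule differentiable_compose_affine[OF bounded_linear_ident W(2)[OF shift[OF that]]])
  have p: "pd k (\<lambda>x. W a (- x0 + x)) x = (\<Sum>b\<in>UNIV. M k a b x * W b (- x0 + x))" if "x \<in> ball x0 r" for k a x
    using pd_compose_affine[OF bounded_linear_ident W(2)[OF shift[OF that]]] W(3)[OF shift[OF that]] by simp
  have s: "smooth_on (ball x0 r) (\<lambda>x. W b (- x0 + x))" for b
    by (rule smooth_on_linear_system[OF open_ball smooth_on_subset[OF M sub] d p])
  show ?thesis
  proof (rule that[of "ball x0 r" "\<lambda>b x. W b (- x0 + x)"])
    show "open (ball x0 r)" "x0 \<in> ball x0 r" using r by simp_all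
    show "W b (- x0 + x0) = w0 b" for b using W(1) by simp
    show "ball x0 r \<subseteq> S" by (rule sub)
    show "smooth_on (ball x0 r) (\<lambda>x. W b (- x0 + x))" for b by (rule s)
    show "pd k (\<lambda>x. W a (- x0 + x)) z = (\<Sum>b\<in>UNIV. M k a b z * W b (- x0 + z))" if "z \<in> ball x0 r" for z k a
      by (rule p[OF that])
  qed
qed

section \<open>Vanishing of the full curvature for a pure e^(-i phi/3) solution with w2 = 0\<close>

section \<open>Flat Fefferman metrics\<close>

lemma riemann_antisym: "riemann \<gamma> l k j i z = - riemann \<gamma> l k i j z"
  by (simp add: riemann_def sum_subtractf)

context fefferman_scaled
begin

context
  assumes 4: "\<And>z. z \<in> U \<Longrightarrow> pd 4 \<sigma> z = - i / 3 * \<sigma> z"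
    and 3: "\<And>z. z \<in> U \<Longrightarrow> pd 3 \<sigma> z = 0"
    and T: "\<And>z. z \<in> U \<Longrightarrow> jet_patch.eq_minus Q (\<lambda>v. \<sigma> (level (z $ 4) v)) (jet z) = 0"
    and J4: "\<And>z. z \<in> U \<Longrightarrow> J 0 0 4 z = 0"
begin

text \<open>With \<open>Y\<close>, the x- and y-components of - d ln |sigma|; its p-component is 0
  and its phi-component the constant i/3. In these variables sigma itself disappears from the
  Christoffel symbols and the curvature.\<close>

definition X :: "real^4 \<Rightarrow> real" where "X z = - pd 1 \<sigma> z / \<sigma> z"
definition Y :: "real^4 \<Rightarrow> real" where "Y z = - pd 2 \<sigma> z / \<sigma> z"

text \<open>Since sigma has no zeros, \<open>eq_minus_obstruction\<close> on each slice forces w1 =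
  0. The other three conclusions are \<open>eq_minus\<close> and its first two p-derivatives for the
  slice of sigma.\<close>

lemma w1_vanishes:
  assumes z: "z \<in> U"
  shows "6 * J 0 2 0 z - 4 * J 1 1 1 z + J 2 0 2 z - 3 * J 0 0 0 z * J 0 1 2 z + 2 * J 0 0 0 z * J 1 0 3 z + 4 * J 0 0 1 z * J 0 1 1 z - J 0 0 1 z * J 1 0 2 z - 3 * J 0 0 2 z * J 0 1 0 z + J 0 0 3 z * J 1 0 0 z - 4 * J 0 2 1 z * z $ 3 + J 0 2 2 z * ((z $ 3)^2) + 2 * J 1 1 2 z * z $ 3 + 2 * J 0 0 0 z * J 0 1 3 z * z $ 3 - J 0 0 1 z * J 0 1 2 z * z $ 3 + J 0 0 3 z * J 0 1 0 z * z $ 3 = 0"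
    and "18 * pd 1 (pd 1 \<sigma>) z + 18 * J 0 0 0 z * pd 2 \<sigma> z - 6 * J 0 0 1 z * pd 1 \<sigma> z - 4 * ((J 0 0 1 z)^2) * \<sigma> z - 18 * J 0 1 0 z * \<sigma> z + 6 * J 1 0 1 z * \<sigma> z + 18 * pd 2 (pd 2 \<sigma>) z * ((z $ 3)^2) + 36 * pd 1 (pd 2 \<sigma>) z * z $ 3 + 6 * J 0 0 0 z * J 0 0 2 z * \<sigma> z - 6 * J 0 0 1 z * pd 2 \<sigma> z * z $ 3 + 6 * J 0 1 1 z * \<sigma> z * z $ 3 = 0"
      "36 * pd 1 (pd 2 \<sigma>) z + 12 * J 0 0 1 z * pd 2 \<sigma> z - 6 * J 0 0 2 z * pd 1 \<sigma> z - 12 * J 0 1 1 z * \<sigma> z + 6 * J 1 0 2 z * \<sigma> z + 36 * pd 2 (pd 2 \<sigma>) z * z $ 3 + 6 * J 0 0 0 z * J 0 0 3 z * \<sigma> z - 2 * J 0 0 1 z * J 0 0 2 z * \<sigma> z - 6 * J 0 0 2 z * pd 2 \<sigma> z * z $ 3 + 6 * J 0 1 2 z * \<sigma> z * z $ 3 = 0"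
      "36 * pd 2 (pd 2 \<sigma>) z + 6 * J 0 0 2 z * pd 2 \<sigma> z - 2 * ((J 0 0 2 z)^2) * \<sigma> z - 6 * J 0 0 3 z * pd 1 \<sigma> z - 6 * J 0 1 2 z * \<sigma> z + 6 * J 1 0 3 z * \<sigma> z + 6 * J 0 0 0 z * J 0 0 4 z * \<sigma> z + 4 * J 0 0 1 z * J 0 0 3 z * \<sigma> z - 6 * J 0 0 3 z * pd 2 \<sigma> z * z $ 3 + 6 * J 0 1 3 z * \<sigma> z * z $ 3 = 0"
proof -
  let ?t = "z $ 4" and ?v = "jet z"
  let ?S = "level ?t -` U" and ?\<beta> = "\<lambda>v. \<sigma> (level ?t v)"
  interpret jet_patch Q ?S by (rule jet_patch_level)
  have v: "?v \<in> ?S" using z by simp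
  have sb: "smooth_on ?S ?\<beta>" by (rule smooth_on_level[OF open_dom smooth_sigma])
  have bp: "mpd 0 0 1 ?\<beta> v = 0" if "v \<in> ?S" for v
    using that sigma_slice_jets(3)[of ?t v] 3 by simp
  have eq: "eq_minus ?\<beta> v = 0" if "v \<in> ?S" for v
    using that T[of "level ?t v"] by simp
  have lz: "level ?t ?v \<in> U" using z by simp
  note j = sigma_slice_jets[OF lz]
  show "18 * pd 1 (pd 1 \<sigma>) z + 18 * J 0 0 0 z * pd 2 \<sigma> z - 6 * J 0 0 1 z * pd 1 \<sigma> z - 4 * ((J 0 0 1 z)^2) * \<sigma> z - 18 * J 0 1 0 z * \<sigma> z + 6 * J 1 0 1 z * \<sigma> z + 18 * pd 2 (pd 2 \<sigma>) z * ((z $ 3)^2) + 36 * pd 1 (pd 2 \<sigma>) z * z $ 3 + 6 * J 0 0 0 z * J 0 0 2 z * \<sigma> z - 6 * J 0 0 1 z * pd 2 \<sigma> z * z $ 3 + 6 * J 0 1 1 z * \<sigma> z * z $ 3 = 0"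
      "36 * pd 1 (pd 2 \<sigma>) z + 12 * J 0 0 1 z * pd 2 \<sigma> z - 6 * J 0 0 2 z * pd 1 \<sigma> z - 12 * J 0 1 1 z * \<sigma> z + 6 * J 1 0 2 z * \<sigma> z + 36 * pd 2 (pd 2 \<sigma>) z * z $ 3 + 6 * J 0 0 0 z * J 0 0 3 z * \<sigma> z - 2 * J 0 0 1 z * J 0 0 2 z * \<sigma> z - 6 * J 0 0 2 z * pd 2 \<sigma> z * z $ 3 + 6 * J 0 1 2 z * \<sigma> z * z $ 3 = 0"
      "36 * pd 2 (pd 2 \<sigma>) z + 6 * J 0 0 2 z * pd 2 \<sigma> z - 2 * ((J 0 0 2 z)^2) * \<sigma> z - 6 * J 0 0 3 z * pd 1 \<sigma> z - 6 * J 0 1 2 z * \<sigma> z + 6 * J 1 0 3 z * \<sigma> z + 6 * J 0 0 0 z * J 0 0 4 z * \<sigma> z + 4 * J 0 0 1 z * J 0 0 3 z * \<sigma> z - 6 * J 0 0 3 z * pd 2 \<sigma> z * z $ 3 + 6 * J 0 1 3 z * \<sigma> z * z $ 3 = 0"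
    using eq_minus_0[OF sb bp eq v] eq_minus_p[OF sb bp eq v] eq_minus_pp[OF sb bp eq v]
      j j[unfolded One_nat_def] by (simp_all add: algebra_simps)
  have "w1 Q (jet z) = 0"
    using eq_minus_obstruction[OF sb bp eq v] sigma_nonzero[OF z] by simp
  then show "6 * J 0 2 0 z - 4 * J 1 1 1 z + J 2 0 2 z - 3 * J 0 0 0 z * J 0 1 2 z + 2 * J 0 0 0 z * J 1 0 3 z + 4 * J 0 0 1 z * J 0 1 1 z - J 0 0 1 z * J 1 0 2 z - 3 * J 0 0 2 z * J 0 1 0 z + J 0 0 3 z * J 1 0 0 z - 4 * J 0 2 1 z * z $ 3 + J 0 2 2 z * ((z $ 3)^2) + 2 * J 1 1 2 z * z $ 3 + 2 * J 0 0 0 z * J 0 1 3 z * z $ 3 - J 0 0 1 z * J 0 1 2 z * z $ 3 + J 0 0 3 z * J 0 1 0 z * z $ 3 = 0"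
    using J4[OF z] unfolding w1_jets[OF v] by (simp add: algebra_simps)
qed

lemma pd_sigma_XY:
  assumes z: "z \<in> U"
  shows "pd 1 \<sigma> z = - X z * \<sigma> z" "pd 2 \<sigma> z = - Y z * \<sigma> z"
  using sigma_nonzero[OF z] by (simp_all add: X_def Y_def)

text \<open>A linear second order system for sigma becomes a Riccati system for its logarithmic
  derivatives. All derivatives of \<open>X\<close> and \<open>Y\<close> are thereby expressed
  through \<open>X\<close>, \<open>Y\<close>, p and jets of Q.\<close>

lemma pd_XY:
  assumes z: "z \<in> U"
  shows "pd 1 X z = - 2 * ((J 0 0 1 z)^2) / 9 - J 0 1 0 z + J 1 0 1 z / 3 + ((X z)^2) + J 0 0 0 z * J 0 0 2 z / 3 - J 0 0 0 z * Y z + J 0 0 1 z * X z / 3 - ((J 0 0 2 z)^2) * ((z $ 3)^2) / 18 + J 0 1 1 z * z $ 3 - J 0 1 2 z * ((z $ 3)^2) / 2 + J 0 1 3 z * ((z $ 3)^3) / 6 - J 1 0 2 z * z $ 3 / 3 + J 1 0 3 z * ((z $ 3)^2) / 6 - J 0 0 0 z * J 0 0 3 z * z $ 3 / 3 + J 0 0 1 z * J 0 0 2 z * z $ 3 / 9 + J 0 0 1 z * J 0 0 3 z * ((z $ 3)^2) / 9 + J 0 0 1 z * Y z * z $ 3 - J 0 0 2 z * X z * z $ 3 / 3 - J 0 0 2 z * Y z * ((z $ 3)^2) / 2 + J 0 0 3 z * X z * ((z $ 3)^2) / 6 + J 0 0 3 z * Y z * ((z $ 3)^3) / 6"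
    "pd 2 X z = - J 0 1 1 z / 3 + J 1 0 2 z / 6 + J 0 0 0 z * J 0 0 3 z / 6 - J 0 0 1 z * J 0 0 2 z / 18 - J 0 0 1 z * Y z / 3 + J 0 0 2 z * X z / 6 + ((J 0 0 2 z)^2) * z $ 3 / 18 + J 0 1 2 z * z $ 3 / 3 - J 0 1 3 z * ((z $ 3)^2) / 6 - J 1 0 3 z * z $ 3 / 6 + X z * Y z - J 0 0 1 z * J 0 0 3 z * z $ 3 / 9 + J 0 0 2 z * Y z * z $ 3 / 3 - J 0 0 3 z * X z * z $ 3 / 6 - J 0 0 3 z * Y z * ((z $ 3)^2) / 6" "pd 1 Y z = - J 0 1 1 z / 3 + J 1 0 2 z / 6 + J 0 0 0 z * J 0 0 3 z / 6 - J 0 0 1 z * J 0 0 2 z / 18 - J 0 0 1 z * Y z / 3 + J 0 0 2 z * X z / 6 + ((J 0 0 2 z)^2) * z $ 3 / 18 + J 0 1 2 z * z $ 3 / 3 - J 0 1 3 z * ((z $ 3)^2) / 6 - J 1 0 3 z * z $ 3 / 6 + X z * Y z - J 0 0 1 z * J 0 0 3 z * z $ 3 / 9 + J 0 0 2 z * Y z * z $ 3 / 3 - J 0 0 3 z * X z * z $ 3 / 6 - J 0 0 3 z * Y z * ((z $ 3)^2) / 6"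
    "pd 2 Y z = - ((J 0 0 2 z)^2) / 18 - J 0 1 2 z / 6 + J 1 0 3 z / 6 + ((Y z)^2) + J 0 0 1 z * J 0 0 3 z / 9 - J 0 0 2 z * Y z / 6 + J 0 0 3 z * X z / 6 + J 0 1 3 z * z $ 3 / 6 + J 0 0 3 z * Y z * z $ 3 / 6"
    "pd 3 X z = 0" "pd 4 X z = 0" "pd 3 Y z = 0" "pd 4 Y z = 0"
    "X differentiable (at z)" "Y differentiable (at z)"
proof -
  note nz = sigma_nonzero[OF z] and d = pd_sigma_differentiable[OF z]
  have s4: "pd k (pd 4 \<sigma>) z = - i / 3 * pd k \<sigma> z" for k
  proof -
    have "pd k (pd 4 \<sigma>) z = pd k (\<lambda>w. - i / 3 * \<sigma> w) z"
      by (rule pd_const_on[OF z 4])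
    then show ?thesis using d by simp
  qed
  have s3: "pd k (pd 3 \<sigma>) z = 0" for k
    using pd_const_on[OF z 3, where k=k] by simp
  have XY: "pd k X z = - pd k (pd 1 \<sigma>) z / \<sigma> z - X z * pd k \<sigma> z / \<sigma> z"
    "pd k Y z = - pd k (pd 2 \<sigma>) z / \<sigma> z - Y z * pd k \<sigma> z / \<sigma> z" for k
    unfolding X_def[abs_def] Y_def[abs_def] using nz by (simp_all add: d diff_divide_distrib)
  show "X differentiable (at z)" "Y differentiable (at z)"
    unfolding X_def[abs_def] Y_def[abs_def] using nz by (simp_all add: d)
  show "pd 3 X z = 0" "pd 4 X z = 0" "pd 3 Y z = 0" "pd 4 Y z = 0"
    unfolding XY sigma_commute[OF z] s3 s4 3[OF z] 4[OF z] using nz by (simp_all add: X_def Y_def)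
  note t = w1_vanishes(2-4)[OF z, unfolded J4[OF z] pd_sigma_XY[OF z]]
  \<comment> \<open>The three relations are triangular: the last one gives sigma_yy, then the middle
    one sigma_xy, and finally the first one sigma_xx.\<close>
  have 22: "pd 2 (pd 2 \<sigma>) z = \<sigma> z * (Y z * Y z - (- ((J 0 0 2 z)^2) / 18 - J 0 1 2 z / 6 + J 1 0 3 z / 6 + ((Y z)^2) + J 0 0 1 z * J 0 0 3 z / 9 - J 0 0 2 z * Y z / 6 + J 0 0 3 z * X z / 6 + J 0 1 3 z * z $ 3 / 6 + J 0 0 3 z * Y z * z $ 3 / 6))"
    using t(3) by (simp add: field_simps power2_eq_square)
  have "36 * pd 1 (pd 2 \<sigma>) z = 36 * (\<sigma> z * (X z * Y z - (- J 0 1 1 z / 3 + J 1 0 2 z / 6 + J 0 0 0 z * J 0 0 3 z / 6 - J 0 0 1 z * J 0 0 2 z / 18 - J 0 0 1 z * Y z / 3 + J 0 0 2 z * X z / 6 + ((J 0 0 2 z)^2) * z $ 3 / 18 + J 0 1 2 z * z $ 3 / 3 - J 0 1 3 z * ((z $ 3)^2) / 6 - J 1 0 3 z * z $ 3 / 6 + X z * Y z - J 0 0 1 z * J 0 0 3 z * z $ 3 / 9 + J 0 0 2 z * Y z * z $ 3 / 3 - J 0 0 3 z * X z * z $ 3 / 6 - J 0 0 3 z * Y z * ((z $ 3)^2) / 6)))"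
    using t(2) unfolding 22 by (simp add: field_simps power2_eq_square)
  then have 12: "pd 1 (pd 2 \<sigma>) z = \<sigma> z * (X z * Y z - (- J 0 1 1 z / 3 + J 1 0 2 z / 6 + J 0 0 0 z * J 0 0 3 z / 6 - J 0 0 1 z * J 0 0 2 z / 18 - J 0 0 1 z * Y z / 3 + J 0 0 2 z * X z / 6 + ((J 0 0 2 z)^2) * z $ 3 / 18 + J 0 1 2 z * z $ 3 / 3 - J 0 1 3 z * ((z $ 3)^2) / 6 - J 1 0 3 z * z $ 3 / 6 + X z * Y z - J 0 0 1 z * J 0 0 3 z * z $ 3 / 9 + J 0 0 2 z * Y z * z $ 3 / 3 - J 0 0 3 z * X z * z $ 3 / 6 - J 0 0 3 z * Y z * ((z $ 3)^2) / 6))" by simp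
  have "18 * pd 1 (pd 1 \<sigma>) z = 18 * (\<sigma> z * (X z * X z - (- 2 * ((J 0 0 1 z)^2) / 9 - J 0 1 0 z + J 1 0 1 z / 3 + ((X z)^2) + J 0 0 0 z * J 0 0 2 z / 3 - J 0 0 0 z * Y z + J 0 0 1 z * X z / 3 - ((J 0 0 2 z)^2) * ((z $ 3)^2) / 18 + J 0 1 1 z * z $ 3 - J 0 1 2 z * ((z $ 3)^2) / 2 + J 0 1 3 z * ((z $ 3)^3) / 6 - J 1 0 2 z * z $ 3 / 3 + J 1 0 3 z * ((z $ 3)^2) / 6 - J 0 0 0 z * J 0 0 3 z * z $ 3 / 3 + J 0 0 1 z * J 0 0 2 z * z $ 3 / 9 + J 0 0 1 z * J 0 0 3 z * ((z $ 3)^2) / 9 + J 0 0 1 z * Y z * z $ 3 - J 0 0 2 z * X z * z $ 3 / 3 - J 0 0 2 z * Y z * ((z $ 3)^2) / 2 + J 0 0 3 z * X z * ((z $ 3)^2) / 6 + J 0 0 3 z * Y z * ((z $ 3)^3) / 6)))"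
    using t(1) unfolding 22 12 by (simp add: field_simps power2_eq_square power3_eq_cube)
  then have 11: "pd 1 (pd 1 \<sigma>) z = \<sigma> z * (X z * X z - (- 2 * ((J 0 0 1 z)^2) / 9 - J 0 1 0 z + J 1 0 1 z / 3 + ((X z)^2) + J 0 0 0 z * J 0 0 2 z / 3 - J 0 0 0 z * Y z + J 0 0 1 z * X z / 3 - ((J 0 0 2 z)^2) * ((z $ 3)^2) / 18 + J 0 1 1 z * z $ 3 - J 0 1 2 z * ((z $ 3)^2) / 2 + J 0 1 3 z * ((z $ 3)^3) / 6 - J 1 0 2 z * z $ 3 / 3 + J 1 0 3 z * ((z $ 3)^2) / 6 - J 0 0 0 z * J 0 0 3 z * z $ 3 / 3 + J 0 0 1 z * J 0 0 2 z * z $ 3 / 9 + J 0 0 1 z * J 0 0 3 z * ((z $ 3)^2) / 9 + J 0 0 1 z * Y z * z $ 3 - J 0 0 2 z * X z * z $ 3 / 3 - J 0 0 2 z * Y z * ((z $ 3)^2) / 2 + J 0 0 3 z * X z * ((z $ 3)^2) / 6 + J 0 0 3 z * Y z * ((z $ 3)^3) / 6))" by simp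
  \<comment> \<open>Each second derivative has been brought to the form sigma (a - b) with a the
    product of the two logarithmic derivatives involved; the quotient rule then leaves exactly
    b.\<close>
  have c: "- (s * (a - b)) / s - x * (- y * s) / s = b" if "x * y = a" "s \<noteq> 0" for s a b x y :: real
    using that by (simp add: field_simps)
  show "pd 1 X z = - 2 * ((J 0 0 1 z)^2) / 9 - J 0 1 0 z + J 1 0 1 z / 3 + ((X z)^2) + J 0 0 0 z * J 0 0 2 z / 3 - J 0 0 0 z * Y z + J 0 0 1 z * X z / 3 - ((J 0 0 2 z)^2) * ((z $ 3)^2) / 18 + J 0 1 1 z * z $ 3 - J 0 1 2 z * ((z $ 3)^2) / 2 + J 0 1 3 z * ((z $ 3)^3) / 6 - J 1 0 2 z * z $ 3 / 3 + J 1 0 3 z * ((z $ 3)^2) / 6 - J 0 0 0 z * J 0 0 3 z * z $ 3 / 3 + J 0 0 1 z * J 0 0 2 z * z $ 3 / 9 + J 0 0 1 z * J 0 0 3 z * ((z $ 3)^2) / 9 + J 0 0 1 z * Y z * z $ 3 - J 0 0 2 z * X z * z $ 3 / 3 - J 0 0 2 z * Y z * ((z $ 3)^2) / 2 + J 0 0 3 z * X z * ((z $ 3)^2) / 6 + J 0 0 3 z * Y z * ((z $ 3)^3) / 6"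
    unfolding XY 11 pd_sigma_XY[OF z] by (rule c[OF refl nz])
  show "pd 2 X z = - J 0 1 1 z / 3 + J 1 0 2 z / 6 + J 0 0 0 z * J 0 0 3 z / 6 - J 0 0 1 z * J 0 0 2 z / 18 - J 0 0 1 z * Y z / 3 + J 0 0 2 z * X z / 6 + ((J 0 0 2 z)^2) * z $ 3 / 18 + J 0 1 2 z * z $ 3 / 3 - J 0 1 3 z * ((z $ 3)^2) / 6 - J 1 0 3 z * z $ 3 / 6 + X z * Y z - J 0 0 1 z * J 0 0 3 z * z $ 3 / 9 + J 0 0 2 z * Y z * z $ 3 / 3 - J 0 0 3 z * X z * z $ 3 / 6 - J 0 0 3 z * Y z * ((z $ 3)^2) / 6"
    unfolding XY sigma_commute[OF z] 12 pd_sigma_XY[OF z] by (rule c[OF refl nz])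
  show "pd 1 Y z = - J 0 1 1 z / 3 + J 1 0 2 z / 6 + J 0 0 0 z * J 0 0 3 z / 6 - J 0 0 1 z * J 0 0 2 z / 18 - J 0 0 1 z * Y z / 3 + J 0 0 2 z * X z / 6 + ((J 0 0 2 z)^2) * z $ 3 / 18 + J 0 1 2 z * z $ 3 / 3 - J 0 1 3 z * ((z $ 3)^2) / 6 - J 1 0 3 z * z $ 3 / 6 + X z * Y z - J 0 0 1 z * J 0 0 3 z * z $ 3 / 9 + J 0 0 2 z * Y z * z $ 3 / 3 - J 0 0 3 z * X z * z $ 3 / 6 - J 0 0 3 z * Y z * ((z $ 3)^2) / 6"
    unfolding XY 12 pd_sigma_XY[OF z] by (rule c[OF mult.commute nz])
  show "pd 2 Y z = - ((J 0 0 2 z)^2) / 18 - J 0 1 2 z / 6 + J 1 0 3 z / 6 + ((Y z)^2) + J 0 0 1 z * J 0 0 3 z / 9 - J 0 0 2 z * Y z / 6 + J 0 0 3 z * X z / 6 + J 0 1 3 z * z $ 3 / 6 + J 0 0 3 z * Y z * z $ 3 / 6"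
    unfolding XY 22 pd_sigma_XY[OF z] by (rule c[OF refl nz])
qed

lemma christoffel_flat:
  assumes z: "z \<in> U"
  shows "christoffel g 1 1 1 z = J 0 0 1 z / 3 + 2 * X z - J 0 0 2 z * z $ 3 / 3 + J 0 0 3 z * ((z $ 3)^2) / 6"
    "christoffel g 1 1 2 z = J 0 0 2 z / 6 + Y z - J 0 0 3 z * z $ 3 / 6"
    "christoffel g 1 1 3 z = 0"
    "christoffel g 1 1 4 z = 0"
    "christoffel g 1 2 2 z = J 0 0 3 z / 6"
    "christoffel g 1 2 3 z = 0"
    "christoffel g 1 2 4 z = 0"
    "christoffel g 1 3 3 z = 0"
    "christoffel g 1 3 4 z = 0"
    "christoffel g 1 4 4 z = 0"
    "christoffel g 2 1 1 z = - J 0 0 0 z + J 0 0 1 z * z $ 3 - J 0 0 2 z * ((z $ 3)^2) / 2 + J 0 0 3 z * ((z $ 3)^3) / 6"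
    "christoffel g 2 1 2 z = - J 0 0 1 z / 3 + X z + J 0 0 2 z * z $ 3 / 3 - J 0 0 3 z * ((z $ 3)^2) / 6"
    "christoffel g 2 1 3 z = 0"
    "christoffel g 2 1 4 z = 0"
    "christoffel g 2 2 2 z = - J 0 0 2 z / 6 + 2 * Y z + J 0 0 3 z * z $ 3 / 6"
    "christoffel g 2 2 3 z = 0"
    "christoffel g 2 2 4 z = 0"
    "christoffel g 2 3 3 z = 0"
    "christoffel g 2 3 4 z = 0"
    "christoffel g 2 4 4 z = 0"
    "christoffel g 3 1 1 z = - J 1 0 0 z + 2 * J 0 0 0 z * X z + 4 * ((J 0 0 1 z)^2) * z $ 3 / 9 + J 0 1 0 z * z $ 3 - 2 * J 0 1 1 z * ((z $ 3)^2) / 3 + J 0 1 2 z * ((z $ 3)^3) / 6 + J 1 0 2 z * ((z $ 3)^2) / 6 - 2 * J 0 0 0 z * J 0 0 2 z * z $ 3 / 3 + J 0 0 0 z * J 0 0 3 z * ((z $ 3)^2) / 3 + 2 * J 0 0 0 z * Y z * z $ 3 - J 0 0 1 z * J 0 0 2 z * ((z $ 3)^2) / 9 - 4 * J 0 0 1 z * X z * z $ 3 / 3 - 4 * J 0 0 1 z * Y z * ((z $ 3)^2) / 3 + J 0 0 2 z * X z * ((z $ 3)^2) / 3 + J 0 0 2 z * Y z * ((z $ 3)^3) / 3"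
    "christoffel g 3 1 2 z = - 2 * ((J 0 0 1 z)^2) / 9 - J 0 1 0 z + J 0 0 0 z * J 0 0 2 z / 3 + 2 * J 0 0 1 z * X z / 3 + 2 * J 0 1 1 z * z $ 3 / 3 - J 0 1 2 z * ((z $ 3)^2) / 6 - J 1 0 2 z * z $ 3 / 6 - J 0 0 0 z * J 0 0 3 z * z $ 3 / 3 + J 0 0 1 z * J 0 0 2 z * z $ 3 / 9 + 2 * J 0 0 1 z * Y z * z $ 3 / 3 - J 0 0 2 z * X z * z $ 3 / 3 - J 0 0 2 z * Y z * ((z $ 3)^2) / 3"
    "christoffel g 3 1 3 z = - J 0 0 1 z / 3 + J 0 0 2 z * z $ 3 / 6 - Y z * z $ 3"
    "christoffel g 3 1 4 z = - 2 * J 0 0 0 z * i / 3 + 2 * J 0 0 1 z * i * z $ 3 / 9 - 2 * X z * i * z $ 3 / 3 - 2 * Y z * i * ((z $ 3)^2) / 3"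
    "christoffel g 3 2 2 z = - 2 * J 0 1 1 z / 3 + J 1 0 2 z / 6 + J 0 0 0 z * J 0 0 3 z / 3 - J 0 0 1 z * J 0 0 2 z / 9 + J 0 0 2 z * X z / 3 + J 0 1 2 z * z $ 3 / 6 + J 0 0 2 z * Y z * z $ 3 / 3"
    "christoffel g 3 2 3 z = - J 0 0 2 z / 6 + Y z"
    "christoffel g 3 2 4 z = - 2 * J 0 0 1 z * i / 9 + 2 * X z * i / 3 + 2 * Y z * i * z $ 3 / 3"
    "christoffel g 3 3 3 z = 0"
    "christoffel g 3 3 4 z = 2 * i / 3"
    "christoffel g 3 4 4 z = 0"
    "christoffel g 4 1 1 z = - ((J 0 0 1 z)^2) / (3 * i) - 3 * J 0 1 0 z / (2 * i) + J 1 0 1 z / i + J 0 0 0 z * J 0 0 2 z / (2 * i) - 3 * J 0 0 0 z * Y z / i + ((J 0 0 2 z)^2) * ((z $ 3)^2) / (12 * i) + J 0 1 1 z * z $ 3 / i - J 0 1 2 z * ((z $ 3)^2) / (4 * i) - J 1 0 2 z * z $ 3 / (2 * i) - J 0 0 1 z * J 0 0 3 z * ((z $ 3)^2) / (6 * i) + 2 * J 0 0 1 z * Y z * z $ 3 / i - J 0 0 2 z * Y z * ((z $ 3)^2) / (2 * i)"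
    "christoffel g 4 1 2 z = J 1 0 2 z / (4 * i) - J 0 0 1 z * Y z / i - ((J 0 0 2 z)^2) * z $ 3 / (12 * i) + J 0 0 1 z * J 0 0 3 z * z $ 3 / (6 * i) + J 0 0 2 z * Y z * z $ 3 / (2 * i)"
    "christoffel g 4 1 3 z = J 0 0 2 z / (4 * i) + 3 * Y z / (2 * i) - J 0 0 3 z * z $ 3 / (4 * i)"
    "christoffel g 4 1 4 z = J 0 0 1 z / 3 + X z - J 0 0 2 z * z $ 3 / 6 + Y z * z $ 3"
    "christoffel g 4 2 2 z = ((J 0 0 2 z)^2) / (12 * i) + J 0 1 2 z / (4 * i) - J 0 0 1 z * J 0 0 3 z / (6 * i) - J 0 0 2 z * Y z / (2 * i)"
    "christoffel g 4 2 3 z = J 0 0 3 z / (4 * i)"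
    "christoffel g 4 2 4 z = J 0 0 2 z / 6"
    "christoffel g 4 3 3 z = 0"
    "christoffel g 4 3 4 z = 0"
    "christoffel g 4 4 4 z = 2 * i / 3"
  unfolding christoffel_conformal[OF z] christoffel_hat[OF z] shift_def grad_def sum_4 H_entries h_entries
    3[OF z] 4[OF z] pd_sigma_XY[OF z]
  using i_nonzero sigma_nonzero[OF z] by (simp_all add: field_simps power2_eq_square power3_eq_cube)

lemma christoffel_flat_sym:
  "christoffel g l 2 1 = christoffel g l 1 2" "christoffel g l 3 1 = christoffel g l 1 3"
  "christoffel g l 4 1 = christoffel g l 1 4" "christoffel g l 3 2 = christoffel g l 2 3"
  "christoffel g l 4 2 = christoffel g l 2 4" "christoffel g l 4 3 = christoffel g l 3 4"
proof -
  have "christoffel g l j k = christoffel g l k j" for j k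
  proof
    fix z
    have "(\<lambda>w. g w $ k $ j) = (\<lambda>w. g w $ j $ k)"
      by (rule ext) (simp add: g_def symmetric[of _ k j])
    then show "christoffel g l j k z = christoffel g l k j z"
      unfolding christoffel_def by (simp add: add.commute)
  qed
  then show
  "christoffel g l 2 1 = christoffel g l 1 2" "christoffel g l 3 1 = christoffel g l 1 3"
  "christoffel g l 4 1 = christoffel g l 1 4" "christoffel g l 3 2 = christoffel g l 2 3"
  "christoffel g l 4 2 = christoffel g l 2 4" "christoffel g l 4 3 = christoffel g l 3 4" by blast+
qed

text \<open>After substituting \<open>pd_XY\<close> the curvature components are polynomials in
  \<open>X\<close>, \<open>Y\<close>, p and jets of Q with constants depending on \<open>i\<close>.
  For the upper indices 1 and 2 they cancel outright; w1 shows up only for the upper indices 3 and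
  4.\<close>

lemma riemann_zero_1:
  assumes z: "z \<in> U"
  shows "riemann g 1 1 1 2 z = 0"
    "riemann g 1 1 1 3 z = 0"
    "riemann g 1 1 1 4 z = 0"
    "riemann g 1 1 2 3 z = 0"
    "riemann g 1 1 2 4 z = 0"
    "riemann g 1 1 3 4 z = 0"
    "riemann g 1 2 1 2 z = 0"
    "riemann g 1 2 1 3 z = 0"
    "riemann g 1 2 1 4 z = 0"
    "riemann g 1 2 2 3 z = 0"
    "riemann g 1 2 2 4 z = 0"
    "riemann g 1 2 3 4 z = 0"
    "riemann g 1 3 1 2 z = 0"
    "riemann g 1 3 1 3 z = 0"
    "riemann g 1 3 1 4 z = 0"
    "riemann g 1 3 2 3 z = 0"
    "riemann g 1 3 2 4 z = 0"
    "riemann g 1 3 3 4 z = 0"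
    "riemann g 1 4 1 2 z = 0"
    "riemann g 1 4 1 3 z = 0"
    "riemann g 1 4 1 4 z = 0"
    "riemann g 1 4 2 3 z = 0"
    "riemann g 1 4 2 4 z = 0"
    "riemann g 1 4 3 4 z = 0"
proof -
  note c = christoffel_flat[THEN pd_cong[OF open_dom z]]
  note r = riemann_def sum_4 christoffel_flat_sym christoffel_flat[OF z]
  show "riemann g 1 1 1 2 z = 0"
    "riemann g 1 1 1 3 z = 0"
    "riemann g 1 1 1 4 z = 0"
    "riemann g 1 1 2 3 z = 0"
    "riemann g 1 1 2 4 z = 0"
    "riemann g 1 1 3 4 z = 0"
    "riemann g 1 2 1 2 z = 0"
    "riemann g 1 2 1 3 z = 0"
    "riemann g 1 2 1 4 z = 0"
    "riemann g 1 2 2 3 z = 0"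
    "riemann g 1 2 2 4 z = 0"
    "riemann g 1 2 3 4 z = 0"
    "riemann g 1 3 1 2 z = 0"
    "riemann g 1 3 1 3 z = 0"
    "riemann g 1 3 1 4 z = 0"
    "riemann g 1 3 2 3 z = 0"
    "riemann g 1 3 2 4 z = 0"
    "riemann g 1 3 3 4 z = 0"
    "riemann g 1 4 1 2 z = 0"
    "riemann g 1 4 1 3 z = 0"
    "riemann g 1 4 1 4 z = 0"
    "riemann g 1 4 2 3 z = 0"
    "riemann g 1 4 2 4 z = 0"
    "riemann g 1 4 3 4 z = 0"
    unfolding r using i_nonzero
    by (simp_all add: c J_rules z J4[OF z] pd_XY[OF z])
      (simp_all add: field_simps power2_eq_square power3_eq_cube power4_eq_xxxx)
qed

lemma riemann_zero_2:
  assumes z: "z \<in> U"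
  shows "riemann g 2 1 1 2 z = 0"
    "riemann g 2 1 1 3 z = 0"
    "riemann g 2 1 1 4 z = 0"
    "riemann g 2 1 2 3 z = 0"
    "riemann g 2 1 2 4 z = 0"
    "riemann g 2 1 3 4 z = 0"
    "riemann g 2 2 1 2 z = 0"
    "riemann g 2 2 1 3 z = 0"
    "riemann g 2 2 1 4 z = 0"
    "riemann g 2 2 2 3 z = 0"
    "riemann g 2 2 2 4 z = 0"
    "riemann g 2 2 3 4 z = 0"
    "riemann g 2 3 1 2 z = 0"
    "riemann g 2 3 1 3 z = 0"
    "riemann g 2 3 1 4 z = 0"
    "riemann g 2 3 2 3 z = 0"
    "riemann g 2 3 2 4 z = 0"
    "riemann g 2 3 3 4 z = 0"
    "riemann g 2 4 1 2 z = 0"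
    "riemann g 2 4 1 3 z = 0"
    "riemann g 2 4 1 4 z = 0"
    "riemann g 2 4 2 3 z = 0"
    "riemann g 2 4 2 4 z = 0"
    "riemann g 2 4 3 4 z = 0"
proof -
  note c = christoffel_flat[THEN pd_cong[OF open_dom z]]
  note r = riemann_def sum_4 christoffel_flat_sym christoffel_flat[OF z]
  show "riemann g 2 1 1 2 z = 0"
    "riemann g 2 1 1 3 z = 0"
    "riemann g 2 1 1 4 z = 0"
    "riemann g 2 1 2 3 z = 0"
    "riemann g 2 1 2 4 z = 0"
    "riemann g 2 1 3 4 z = 0"
    "riemann g 2 2 1 2 z = 0"
    "riemann g 2 2 1 3 z = 0"
    "riemann g 2 2 1 4 z = 0"
    "riemann g 2 2 2 3 z = 0"
    "riemann g 2 2 2 4 z = 0"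
    "riemann g 2 2 3 4 z = 0"
    "riemann g 2 3 1 2 z = 0"
    "riemann g 2 3 1 3 z = 0"
    "riemann g 2 3 1 4 z = 0"
    "riemann g 2 3 2 3 z = 0"
    "riemann g 2 3 2 4 z = 0"
    "riemann g 2 3 3 4 z = 0"
    "riemann g 2 4 1 2 z = 0"
    "riemann g 2 4 1 3 z = 0"
    "riemann g 2 4 1 4 z = 0"
    "riemann g 2 4 2 3 z = 0"
    "riemann g 2 4 2 4 z = 0"
    "riemann g 2 4 3 4 z = 0"
    unfolding r using i_nonzero
    by (simp_all add: c J_rules z J4[OF z] pd_XY[OF z])
      (simp_all add: field_simps power2_eq_square power3_eq_cube power4_eq_xxxx)
qed

text \<open>The components 3112 and 3212 reduce to - p w1 / 6 and w1 / 6. The remaining ones cancel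
  without appeal to w1.\<close>

lemma riemann_zero_3:
  assumes z: "z \<in> U"
  shows "riemann g 3 1 1 2 z = 0"
    "riemann g 3 1 1 3 z = 0"
    "riemann g 3 1 1 4 z = 0"
    "riemann g 3 1 2 3 z = 0"
    "riemann g 3 1 2 4 z = 0"
    "riemann g 3 1 3 4 z = 0"
    "riemann g 3 2 1 2 z = 0"
    "riemann g 3 2 1 3 z = 0"
    "riemann g 3 2 1 4 z = 0"
    "riemann g 3 2 2 3 z = 0"
    "riemann g 3 2 2 4 z = 0"
    "riemann g 3 2 3 4 z = 0"
    "riemann g 3 3 1 2 z = 0"
    "riemann g 3 3 1 3 z = 0"
    "riemann g 3 3 1 4 z = 0"
    "riemann g 3 3 2 3 z = 0"
    "riemann g 3 3 2 4 z = 0"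
    "riemann g 3 3 3 4 z = 0"
    "riemann g 3 4 1 2 z = 0"
    "riemann g 3 4 1 3 z = 0"
    "riemann g 3 4 1 4 z = 0"
    "riemann g 3 4 2 3 z = 0"
    "riemann g 3 4 2 4 z = 0"
    "riemann g 3 4 3 4 z = 0"
proof -
  note c = christoffel_flat[THEN pd_cong[OF open_dom z]]
  note r = riemann_def sum_4 christoffel_flat_sym christoffel_flat[OF z]
  have "riemann g 3 1 1 2 z = - z $ 3 / 6 * (6 * J 0 2 0 z - 4 * J 1 1 1 z + J 2 0 2 z - 3 * J 0 0 0 z * J 0 1 2 z + 2 * J 0 0 0 z * J 1 0 3 z + 4 * J 0 0 1 z * J 0 1 1 z - J 0 0 1 z * J 1 0 2 z - 3 * J 0 0 2 z * J 0 1 0 z + J 0 0 3 z * J 1 0 0 z - 4 * J 0 2 1 z * z $ 3 + J 0 2 2 z * ((z $ 3)^2) + 2 * J 1 1 2 z * z $ 3 + 2 * J 0 0 0 z * J 0 1 3 z * z $ 3 - J 0 0 1 z * J 0 1 2 z * z $ 3 + J 0 0 3 z * J 0 1 0 z * z $ 3)"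
    unfolding r using i_nonzero
    by (simp add: c J_rules z J4[OF z] pd_XY[OF z])
      (simp add: field_simps power2_eq_square power3_eq_cube power4_eq_xxxx)
  then show "riemann g 3 1 1 2 z = 0"
    unfolding w1_vanishes(1)[OF z] by simp
  have "riemann g 3 2 1 2 z = 1 / 6 * (6 * J 0 2 0 z - 4 * J 1 1 1 z + J 2 0 2 z - 3 * J 0 0 0 z * J 0 1 2 z + 2 * J 0 0 0 z * J 1 0 3 z + 4 * J 0 0 1 z * J 0 1 1 z - J 0 0 1 z * J 1 0 2 z - 3 * J 0 0 2 z * J 0 1 0 z + J 0 0 3 z * J 1 0 0 z - 4 * J 0 2 1 z * z $ 3 + J 0 2 2 z * ((z $ 3)^2) + 2 * J 1 1 2 z * z $ 3 + 2 * J 0 0 0 z * J 0 1 3 z * z $ 3 - J 0 0 1 z * J 0 1 2 z * z $ 3 + J 0 0 3 z * J 0 1 0 z * z $ 3)"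
    unfolding r using i_nonzero
    by (simp add: c J_rules z J4[OF z] pd_XY[OF z])
      (simp add: field_simps power2_eq_square power3_eq_cube power4_eq_xxxx)
  then show "riemann g 3 2 1 2 z = 0"
    unfolding w1_vanishes(1)[OF z] by simp
  show "riemann g 3 1 1 3 z = 0"
    "riemann g 3 1 1 4 z = 0"
    "riemann g 3 1 2 3 z = 0"
    "riemann g 3 1 2 4 z = 0"
    "riemann g 3 1 3 4 z = 0"
    "riemann g 3 2 1 3 z = 0"
    "riemann g 3 2 1 4 z = 0"
    "riemann g 3 2 2 3 z = 0"
    "riemann g 3 2 2 4 z = 0"
    "riemann g 3 2 3 4 z = 0"
    "riemann g 3 3 1 2 z = 0"
    "riemann g 3 3 1 3 z = 0"
    "riemann g 3 3 1 4 z = 0"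
    "riemann g 3 3 2 3 z = 0"
    "riemann g 3 3 2 4 z = 0"
    "riemann g 3 3 3 4 z = 0"
    "riemann g 3 4 1 2 z = 0"
    "riemann g 3 4 1 3 z = 0"
    "riemann g 3 4 1 4 z = 0"
    "riemann g 3 4 2 3 z = 0"
    "riemann g 3 4 2 4 z = 0"
    "riemann g 3 4 3 4 z = 0"
    unfolding r using i_nonzero
    by (simp_all add: c J_rules z J4[OF z] pd_XY[OF z])
      (simp_all add: field_simps power2_eq_square power3_eq_cube power4_eq_xxxx)
qed

text \<open>Here 4112 is the only component that leaves a multiple of w1, namely w1 / (4 i).\<close>

lemma riemann_zero_4:
  assumes z: "z \<in> U"
  shows "riemann g 4 1 1 2 z = 0"
    "riemann g 4 1 1 3 z = 0"
    "riemann g 4 1 1 4 z = 0"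
    "riemann g 4 1 2 3 z = 0"
    "riemann g 4 1 2 4 z = 0"
    "riemann g 4 1 3 4 z = 0"
    "riemann g 4 2 1 2 z = 0"
    "riemann g 4 2 1 3 z = 0"
    "riemann g 4 2 1 4 z = 0"
    "riemann g 4 2 2 3 z = 0"
    "riemann g 4 2 2 4 z = 0"
    "riemann g 4 2 3 4 z = 0"
    "riemann g 4 3 1 2 z = 0"
    "riemann g 4 3 1 3 z = 0"
    "riemann g 4 3 1 4 z = 0"
    "riemann g 4 3 2 3 z = 0"
    "riemann g 4 3 2 4 z = 0"
    "riemann g 4 3 3 4 z = 0"
    "riemann g 4 4 1 2 z = 0"
    "riemann g 4 4 1 3 z = 0"
    "riemann g 4 4 1 4 z = 0"
    "riemann g 4 4 2 3 z = 0"
    "riemann g 4 4 2 4 z = 0"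
    "riemann g 4 4 3 4 z = 0"
proof -
  note c = christoffel_flat[THEN pd_cong[OF open_dom z]]
  note r = riemann_def sum_4 christoffel_flat_sym christoffel_flat[OF z]
  have "riemann g 4 1 1 2 z = 1 / (4 * i) * (6 * J 0 2 0 z - 4 * J 1 1 1 z + J 2 0 2 z - 3 * J 0 0 0 z * J 0 1 2 z + 2 * J 0 0 0 z * J 1 0 3 z + 4 * J 0 0 1 z * J 0 1 1 z - J 0 0 1 z * J 1 0 2 z - 3 * J 0 0 2 z * J 0 1 0 z + J 0 0 3 z * J 1 0 0 z - 4 * J 0 2 1 z * z $ 3 + J 0 2 2 z * ((z $ 3)^2) + 2 * J 1 1 2 z * z $ 3 + 2 * J 0 0 0 z * J 0 1 3 z * z $ 3 - J 0 0 1 z * J 0 1 2 z * z $ 3 + J 0 0 3 z * J 0 1 0 z * z $ 3)"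
    unfolding r using i_nonzero
    by (simp add: c J_rules z J4[OF z] pd_XY[OF z])
      (simp add: field_simps power2_eq_square power3_eq_cube power4_eq_xxxx)
  then show "riemann g 4 1 1 2 z = 0"
    unfolding w1_vanishes(1)[OF z] by simp
  show "riemann g 4 1 1 3 z = 0"
    "riemann g 4 1 1 4 z = 0"
    "riemann g 4 1 2 3 z = 0"
    "riemann g 4 1 2 4 z = 0"
    "riemann g 4 1 3 4 z = 0"
    "riemann g 4 2 1 2 z = 0"
    "riemann g 4 2 1 3 z = 0"
    "riemann g 4 2 1 4 z = 0"
    "riemann g 4 2 2 3 z = 0"
    "riemann g 4 2 2 4 z = 0"
    "riemann g 4 2 3 4 z = 0"
    "riemann g 4 3 1 2 z = 0"
    "riemann g 4 3 1 3 z = 0"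
    "riemann g 4 3 1 4 z = 0"
    "riemann g 4 3 2 3 z = 0"
    "riemann g 4 3 2 4 z = 0"
    "riemann g 4 3 3 4 z = 0"
    "riemann g 4 4 1 2 z = 0"
    "riemann g 4 4 1 3 z = 0"
    "riemann g 4 4 1 4 z = 0"
    "riemann g 4 4 2 3 z = 0"
    "riemann g 4 4 2 4 z = 0"
    "riemann g 4 4 3 4 z = 0"
    unfolding r using i_nonzero
    by (simp_all add: c J_rules z J4[OF z] pd_XY[OF z])
      (simp_all add: field_simps power2_eq_square power3_eq_cube power4_eq_xxxx)
qed

lemma riemann_zero:
  assumes z: "z \<in> U"
  shows "riemann g l k a b z = 0"
proof -
  have "riemann g l k a b z = 0" if "(a, b) \<in> {(1,2),(1,3),(1,4),(2,3),(2,4),(3,4)}" for a b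
    using that exhaust_4[of l] exhaust_4[of k] riemann_zero_1[OF z] riemann_zero_2[OF z]
      riemann_zero_3[OF z] riemann_zero_4[OF z] by auto
  moreover have "riemann g l k a a z = 0" for a
    using riemann_antisym[of g l k a a z] by simp
  ultimately show ?thesis
    using riemann_antisym[of g l k a b z] exhaust_4[of a] exhaust_4[of b] by auto
qed

end

end

section \<open>The equation for beta as a flat linear system of rank three when w1 = w2 = 0\<close>

section \<open>Solving the second equation when both invariants vanish\<close>

context jet_patch
begin

context
  assumes w1_zero: "\<And>v. v \<in> S \<Longrightarrow> w1 Q v = 0" and w2_zero: "\<And>v. v \<in> S \<Longrightarrow> q 0 0 4 v = 0"
begin

lemma cubic_jets:
  assumes "v \<in> S"
  shows "q 0 0 4 v = 0" "q 0 1 4 v = 0" "q 1 0 4 v = 0" "q 0 2 4 v = 0" "q 1 1 4 v = 0" "q 2 0 4 v = 0"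
    "q 0 0 5 v = 0" "q 0 1 5 v = 0" "q 1 0 5 v = 0"
  using mpd_eq_0[OF smooth_QS w2_zero assms, of 0 0 0] mpd_eq_0[OF smooth_QS w2_zero assms, of 0 1 0]
    mpd_eq_0[OF smooth_QS w2_zero assms, of 1 0 0] mpd_eq_0[OF smooth_QS w2_zero assms, of 0 2 0]
    mpd_eq_0[OF smooth_QS w2_zero assms, of 1 1 0] mpd_eq_0[OF smooth_QS w2_zero assms, of 2 0 0]
    mpd_eq_0[OF smooth_QS w2_zero assms, of 0 0 1] mpd_eq_0[OF smooth_QS w2_zero assms, of 0 1 1]
    mpd_eq_0[OF smooth_QS w2_zero assms, of 1 0 1]
  by (simp_all add: two_eq_Suc)

lemma w1_cubic:
  assumes "v \<in> S"
  shows "6 * q 0 2 0 v - 4 * q 1 1 1 v + q 2 0 2 v - 3 * q 0 0 0 v * q 0 1 2 v + 2 * q 0 0 0 v * q 1 0 3 v + 4 * q 0 0 1 v * q 0 1 1 v - q 0 0 1 v * q 1 0 2 v - 3 * q 0 0 2 v * q 0 1 0 v + q 0 0 3 v * q 1 0 0 v - 4 * q 0 2 1 v * v $ 3 + q 0 2 2 v * ((v $ 3)^2) + 2 * q 1 1 2 v * v $ 3 + 2 * q 0 0 0 v * q 0 1 3 v * v $ 3 - q 0 0 1 v * q 0 1 2 v * v $ 3 + q 0 0 3 v * q 0 1 0 v * v $ 3 = 0"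
  using w1_zero[OF assms] unfolding w1_jets[OF assms] cubic_jets[OF assms] by (simp add: algebra_simps)

lemma w1_cubic_p:
  assumes "v \<in> S"
  shows "2 * q 0 2 1 v - 2 * q 1 1 2 v + q 2 0 3 v - q 0 0 0 v * q 0 1 3 v + q 0 0 1 v * q 1 0 3 v + q 0 0 2 v * q 0 1 1 v - q 0 0 2 v * q 1 0 2 v - 2 * q 0 0 3 v * q 0 1 0 v + q 0 0 3 v * q 1 0 1 v - 2 * q 0 2 2 v * v $ 3 + q 0 2 3 v * ((v $ 3)^2) + 2 * q 1 1 3 v * v $ 3 + q 0 0 1 v * q 0 1 3 v * v $ 3 - q 0 0 2 v * q 0 1 2 v * v $ 3 + q 0 0 3 v * q 0 1 1 v * v $ 3 = 0"
proof -
  have "0 = pd 3 (\<lambda>v. 6 * q 0 2 0 v - 4 * q 1 1 1 v + q 2 0 2 v - 3 * q 0 0 0 v * q 0 1 2 v + 2 * q 0 0 0 v * q 1 0 3 v + 4 * q 0 0 1 v * q 0 1 1 v - q 0 0 1 v * q 1 0 2 v - 3 * q 0 0 2 v * q 0 1 0 v + q 0 0 3 v * q 1 0 0 v - 4 * q 0 2 1 v * v $ 3 + q 0 2 2 v * ((v $ 3)^2) + 2 * q 1 1 2 v * v $ 3 + 2 * q 0 0 0 v * q 0 1 3 v * v $ 3 - q 0 0 1 v * q 0 1 2 v * v $ 3 + q 0 0 3 v * q 0 1 0 v * v $ 3) v"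
    using pd_eq_0[OF assms w1_cubic] by simp
  then show ?thesis
    by (simp add: jet_rules[OF smooth_QS assms] cubic_jets[OF assms] cubic_jets(2,3,8,9)[OF assms, unfolded One_nat_def]
      two_eq_Suc algebra_simps power2_eq_square)
qed

text \<open>The equation \<open>eq_minus \<beta> = 0\<close> and its first two derivatives with respect to the third
  coordinate determine the second derivatives of \<open>\<beta>\<close>; this is the resulting first order system for
  $(\beta, \beta_x, \beta_y)$.\<close>

definition M :: "3 \<Rightarrow> 3 \<Rightarrow> 3 \<Rightarrow> real^3 \<Rightarrow> real" where
  "M j m n v = (if j = 1 then
       (if m = 1 then (if n = 2 then 1 else 0) else if m = 2 then
          (if n = 1 then 2 * ((q 0 0 1 v)^2) / 9 + q 0 1 0 v - q 1 0 1 v / 3 - q 0 0 0 v * q 0 0 2 v / 3 + ((q 0 0 2 v)^2) * ((v $ 3)^2) / 18 - q 0 1 1 v * v $ 3 + q 0 1 2 v * ((v $ 3)^2) / 2 - q 0 1 3 v * ((v $ 3)^3) / 6 + q 1 0 2 v * v $ 3 / 3 - q 1 0 3 v * ((v $ 3)^2) / 6 + q 0 0 0 v * q 0 0 3 v * v $ 3 / 3 - q 0 0 1 v * q 0 0 2 v * v $ 3 / 9 - q 0 0 1 v * q 0 0 3 v * ((v $ 3)^2) / 9 else if n = 2 then q 0 0 1 v / 3 - q 0 0 2 v * v $ 3 / 3 + q 0 0 3 v * ((v $ 3)^2) / 6 else - q 0 0 0 v + q 0 0 1 v * v $ 3 - q 0 0 2 v * ((v $ 3)^2) / 2 + q 0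 0 3 v * ((v $ 3)^3) / 6)
        else
          (if n = 1 then q 0 1 1 v / 3 - q 1 0 2 v / 6 - q 0 0 0 v * q 0 0 3 v / 6 + q 0 0 1 v * q 0 0 2 v / 18 - ((q 0 0 2 v)^2) * v $ 3 / 18 - q 0 1 2 v * v $ 3 / 3 + q 0 1 3 v * ((v $ 3)^2) / 6 + q 1 0 3 v * v $ 3 / 6 + q 0 0 1 v * q 0 0 3 v * v $ 3 / 9 else if n = 2 then q 0 0 2 v / 6 - q 0 0 3 v * v $ 3 / 6 else - q 0 0 1 v / 3 + q 0 0 2 v * v $ 3 / 3 - q 0 0 3 v * ((v $ 3)^2) / 6))
     else if j = 2 then
       (if m = 1 then (if n = 3 then 1 else 0) else if m = 2 then
          (if n = 1 then q 0 1 1 v / 3 - q 1 0 2 v / 6 - q 0 0 0 v * q 0 0 3 v / 6 + q 0 0 1 v * q 0 0 2 v / 18 - ((q 0 0 2 v)^2) * v $ 3 / 18 - q 0 1 2 v * v $ 3 / 3 + q 0 1 3 v * ((v $ 3)^2) / 6 + q 1 0 3 v * v $ 3 / 6 + q 0 0 1 v * q 0 0 3 v * v $ 3 / 9 else if n = 2 then q 0 0 2 v / 6 - q 0 0 3 v * v $ 3 / 6 else - q 0 0 1 v / 3 + q 0 0 2 v * v $ 3 / 3 - q 0 0 3 v * ((v $ 3)^2) / 6)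
        else
          (if n = 1 then ((q 0 0 2 v)^2) / 18 + q 0 1 2 v / 6 - q 1 0 3 v / 6 - q 0 0 1 v * q 0 0 3 v / 9 - q 0 1 3 v * v $ 3 / 6 else if n = 2 then q 0 0 3 v / 6 else - q 0 0 2 v / 6 + q 0 0 3 v * v $ 3 / 6))
     else 0)"

lemma M_entries:
  shows "M 1 1 1 = (\<lambda>v. 0)"
    "M 1 1 2 = (\<lambda>v. 1)"
    "M 1 1 3 = (\<lambda>v. 0)"
    "M 1 2 1 = (\<lambda>v. 2 * ((q 0 0 1 v)^2) / 9 + q 0 1 0 v - q 1 0 1 v / 3 - q 0 0 0 v * q 0 0 2 v / 3 + ((q 0 0 2 v)^2) * ((v $ 3)^2) / 18 - q 0 1 1 v * v $ 3 + q 0 1 2 v * ((v $ 3)^2) / 2 - q 0 1 3 v * ((v $ 3)^3) / 6 + q 1 0 2 v * v $ 3 / 3 - q 1 0 3 v * ((v $ 3)^2) / 6 + q 0 0 0 v * q 0 0 3 v * v $ 3 / 3 - q 0 0 1 v * q 0 0 2 v * v $ 3 / 9 - q 0 0 1 v * q 0 0 3 v * ((v $ 3)^2) / 9)"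
    "M 1 2 2 = (\<lambda>v. q 0 0 1 v / 3 - q 0 0 2 v * v $ 3 / 3 + q 0 0 3 v * ((v $ 3)^2) / 6)"
    "M 1 2 3 = (\<lambda>v. - q 0 0 0 v + q 0 0 1 v * v $ 3 - q 0 0 2 v * ((v $ 3)^2) / 2 + q 0 0 3 v * ((v $ 3)^3) / 6)"
    "M 1 3 1 = (\<lambda>v. q 0 1 1 v / 3 - q 1 0 2 v / 6 - q 0 0 0 v * q 0 0 3 v / 6 + q 0 0 1 v * q 0 0 2 v / 18 - ((q 0 0 2 v)^2) * v $ 3 / 18 - q 0 1 2 v * v $ 3 / 3 + q 0 1 3 v * ((v $ 3)^2) / 6 + q 1 0 3 v * v $ 3 / 6 + q 0 0 1 v * q 0 0 3 v * v $ 3 / 9)"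
    "M 1 3 2 = (\<lambda>v. q 0 0 2 v / 6 - q 0 0 3 v * v $ 3 / 6)"
    "M 1 3 3 = (\<lambda>v. - q 0 0 1 v / 3 + q 0 0 2 v * v $ 3 / 3 - q 0 0 3 v * ((v $ 3)^2) / 6)"
    "M 2 1 1 = (\<lambda>v. 0)"
    "M 2 1 2 = (\<lambda>v. 0)"
    "M 2 1 3 = (\<lambda>v. 1)"
    "M 2 2 1 = (\<lambda>v. q 0 1 1 v / 3 - q 1 0 2 v / 6 - q 0 0 0 v * q 0 0 3 v / 6 + q 0 0 1 v * q 0 0 2 v / 18 - ((q 0 0 2 v)^2) * v $ 3 / 18 - q 0 1 2 v * v $ 3 / 3 + q 0 1 3 v * ((v $ 3)^2) / 6 + q 1 0 3 v * v $ 3 / 6 + q 0 0 1 v * q 0 0 3 v * v $ 3 / 9)"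
    "M 2 2 2 = (\<lambda>v. q 0 0 2 v / 6 - q 0 0 3 v * v $ 3 / 6)"
    "M 2 2 3 = (\<lambda>v. - q 0 0 1 v / 3 + q 0 0 2 v * v $ 3 / 3 - q 0 0 3 v * ((v $ 3)^2) / 6)"
    "M 2 3 1 = (\<lambda>v. ((q 0 0 2 v)^2) / 18 + q 0 1 2 v / 6 - q 1 0 3 v / 6 - q 0 0 1 v * q 0 0 3 v / 9 - q 0 1 3 v * v $ 3 / 6)"
    "M 2 3 2 = (\<lambda>v. q 0 0 3 v / 6)"
    "M 2 3 3 = (\<lambda>v. - q 0 0 2 v / 6 + q 0 0 3 v * v $ 3 / 6)"
    "M 3 m n = (\<lambda>v. 0)"
  by (simp_all add: M_def fun_eq_iff)

lemma smooth_M: "smooth_on S (M j m n)"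
  using exhaust_3[of j] exhaust_3[of m] exhaust_3[of n]
  by (elim disjE; simp only: M_entries divide_inverse; intro smooth_intros smooth_on_mpd smooth_QS open_S)

text \<open>Where w2 = 0, the solved expressions for beta_xx, beta_xy and beta_yy have coefficients
  free of p. This makes the system compatible with the requirement beta_p = 0, encoded by
  \<open>M 3\<close> being zero.\<close>

lemma M_p:
  assumes "v \<in> S"
  shows "pd 3 (M j m n) v = 0"
  using exhaust_3[of j] exhaust_3[of m] exhaust_3[of n]
  by (elim disjE; simp only: M_entries; simp add: jet_rules[OF smooth_QS assms] cubic_jets[OF assms]
      cubic_jets(2,3,8,9)[OF assms, unfolded One_nat_def] two_eq_Suc;
      simp add: field_simps power2_eq_square power3_eq_cube)

text \<open>The curvature in the plane of x and y sits in the column belonging to beta. Its entries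
  in the rows of beta_x and beta_y are, up to sign, (w1 - p w1_p) / 6 and w1_p / 6, where w1_p is
  the p-derivative; all other entries cancel identically.\<close>

lemma M_flat_12:
  assumes "v \<in> S"
  shows "pd 2 (M 1 m n) v + (\<Sum>d\<in>UNIV. M 1 m d v * M 2 d n v) =
    pd 1 (M 2 m n) v + (\<Sum>d\<in>UNIV. M 2 m d v * M 1 d n v)"
proof -
  note r = jet_rules[OF smooth_QS assms] cubic_jets[OF assms] cubic_jets(2,3,8,9)[OF assms, unfolded One_nat_def] two_eq_Suc
  have 21: "pd 2 (M 1 2 1) v + (\<Sum>d\<in>UNIV. M 1 2 d v * M 2 d 1 v) =
    pd 1 (M 2 2 1) v + (\<Sum>d\<in>UNIV. M 2 2 d v * M 1 d 1 v) + 1 / 6 * (6 * q 0 2 0 v - 4 * q 1 1 1 v + q 2 0 2 v - 3 * q 0 0 0 v * q 0 1 2 v + 2 * q 0 0 0 v * q 1 0 3 v + 4 * q 0 0 1 v * q 0 1 1 v - q 0 0 1 v * q 1 0 2 v - 3 * q 0 0 2 v * q 0 1 0 v + q 0 0 3 v * q 1 0 0 v - 4 * q 0 2 1 v * v $ 3 + q 0 2 2 v * ((v $ 3)^2) + 2 * q 1 1 2 v * v $ 3 + 2 * q 0 0 0 v * q 0 1 3 v * v $ 3 - q 0 0 1 v * q 0 1 2 v * v $ 3 + q 0 0 3 v * q 0 1 0 v * v $ 3) - 1 / 6 * v $ 3 * (2 * q 0 2 1 v - 2 * q 1 1 2 v + q 2 0 3 v - q 0 0 0 v * q 0 1 3 v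 + q 0 0 1 v * q 1 0 3 v + q 0 0 2 v * q 0 1 1 v - q 0 0 2 v * q 1 0 2 v - 2 * q 0 0 3 v * q 0 1 0 v + q 0 0 3 v * q 1 0 1 v - 2 * q 0 2 2 v * v $ 3 + q 0 2 3 v * ((v $ 3)^2) + 2 * q 1 1 3 v * v $ 3 + q 0 0 1 v * q 0 1 3 v * v $ 3 - q 0 0 2 v * q 0 1 2 v * v $ 3 + q 0 0 3 v * q 0 1 1 v * v $ 3)"
    unfolding sum_3 M_entries
    by (simp add: r) (simp add: field_simps power2_eq_square power3_eq_cube power4_eq_xxxx)
  have 31: "pd 2 (M 1 3 1) v + (\<Sum>d\<in>UNIV. M 1 3 d v * M 2 d 1 v) =
    pd 1 (M 2 3 1) v + (\<Sum>d\<in>UNIV. M 2 3 d v * M 1 d 1 v) + 1 / 6 * (2 * q 0 2 1 v - 2 * q 1 1 2 v + q 2 0 3 v - q 0 0 0 v * q 0 1 3 v + q 0 0 1 v * q 1 0 3 v + q 0 0 2 v * q 0 1 1 v - q 0 0 2 v * q 1 0 2 v - 2 * q 0 0 3 v * q 0 1 0 v + q 0 0 3 v * q 1 0 1 v - 2 * q 0 2 2 v * v $ 3 + q 0 2 3 v * ((v $ 3)^2) + 2 * q 1 1 3 v * v $ 3 + q 0 0 1 v * q 0 1 3 v * v $ 3 - q 0 0 2 v * q 0 1 2 v * v $ 3 + q 0 0 3 v * q 0 1 1 v * v $ 3)"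
    unfolding sum_3 M_entries
    by (simp add: r) (simp add: field_simps power2_eq_square power3_eq_cube power4_eq_xxxx)
  have rest: "pd 2 (M 1 m n) v + (\<Sum>d\<in>UNIV. M 1 m d v * M 2 d n v) =
    pd 1 (M 2 m n) v + (\<Sum>d\<in>UNIV. M 2 m d v * M 1 d n v)" if "\<not> (n = 1 \<and> m \<noteq> 1)"
    using that exhaust_3[of m] exhaust_3[of n]
    by (elim disjE; simp only: sum_3 M_entries; simp add: r;
        simp add: field_simps power2_eq_square power3_eq_cube power4_eq_xxxx)
  show ?thesis
    using 21 31 rest exhaust_3[of m] unfolding w1_cubic[OF assms] w1_cubic_p[OF assms] by auto
qed

lemma M_flat:
  assumes "v \<in> S"
  shows "pd k (M j m n) v + (\<Sum>d\<in>UNIV. M j m d v * M k d n v) =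
    pd j (M k m n) v + (\<Sum>d\<in>UNIV. M k m d v * M j d n v)"
  using exhaust_3[of j] exhaust_3[of k] M_flat_12[OF assms, of m n] M_p[OF assms, of _ m n]
  by (elim disjE) (simp_all add: M_entries(19))

text \<open>The first component of the solution with initial vector (1, 0, 0) is the required beta;
  its value 1 keeps it nonzero near \<open>v0\<close>. The coefficients \<open>M\<close> were
  obtained by solving \<open>eq_minus\<close> and its p-derivatives, so substituting them back
  satisfies \<open>eq_minus\<close>.\<close>

lemma local_solution:
  assumes "v0 \<in> S"
  obtains N \<beta> where "open N" "v0 \<in> N" "N \<subseteq> S" "\<beta> v0 = 1" "smooth_on N \<beta>"
    "\<And>v. v \<in> N \<Longrightarrow> pd 3 \<beta> v = 0" "\<And>v. v \<in> N \<Longrightarrow> eq_minus \<beta> v = 0"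
proof -
  obtain N W where N: "open N" "v0 \<in> N" "N \<subseteq> S" and W0: "\<And>n. W n v0 = (if n = 1 then 1 else 0)"
    and sW: "\<And>n. smooth_on N (W n)"
    and W: "\<And>v k m. v \<in> N \<Longrightarrow> pd k (W m) v = (\<Sum>n\<in>UNIV. M k m n v * W n v)"
    by (rule frobenius_linear[OF open_S assms smooth_M M_flat, of "\<lambda>n. if n = 1 then 1 else 0"]) auto
  have 1: "pd 1 (W 1) v = W 2 v" "pd 2 (W 1) v = W 3 v" "pd 3 (W 1) v = 0" if "v \<in> N" for v
    using W[OF that] by (simp_all add: sum_3 M_entries)
  have "eq_minus (W 1) v = 0" if v: "v \<in> N" for v
  proof -
    have j: "mpd 1 0 0 (W 1) v = W 2 v" "mpd 0 1 0 (W 1) v = W 3 v" "mpd 2 0 0 (W 1) v = pd 1 (W 2) v"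
      "mpd 1 1 0 (W 1) v = pd 1 (W 3) v" "mpd 0 2 0 (W 1) v = pd 2 (W 3) v"
      using 1[OF v] pd_cong[OF N(1) v 1(1), where k=1] pd_cong[OF N(1) v 1(2), where k=1]
        pd_cong[OF N(1) v 1(2), where k=2]
      by (simp_all add: mpd_def numeral_2_eq_2)
    have vS: "v \<in> S" using v N(3) by blast
    show ?thesis
      unfolding eq_minus_def j W[OF v] sum_3 M_entries
      by (simp add: field_simps power2_eq_square power3_eq_cube)
  qed
  then show ?thesis
    by (intro that[of N "W 1"]) (use N W0 sW 1 in auto)
qed

end

end

section \<open>Pure exponential types of sigma and functions descending to the base\<close>

section \<open>Local forms of the solutions\<close>

lemma christoffel_cong:
  assumes "open N" "z \<in> N" "\<And>w. w \<in> N \<Longrightarrow> \<gamma> w = \<gamma>' w"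
  shows "christoffel \<gamma> k i j z = christoffel \<gamma>' k i j z"
proof -
  have "pd a (\<lambda>w. \<gamma> w $ b $ c) z = pd a (\<lambda>w. \<gamma>' w $ b $ c) z" for a b c
    by (rule pd_cong[OF assms(1,2)]) (simp add: assms(3))
  then show ?thesis unfolding christoffel_def by (simp add: assms(2,3))
qed

lemma riemann_cong:
  assumes "open N" "z \<in> N" "\<And>w. w \<in> N \<Longrightarrow> \<gamma> w = \<gamma>' w"
  shows "riemann \<gamma> l k i j z = riemann \<gamma>' l k i j z"
proof -
  have c: "christoffel \<gamma> k i j w = christoffel \<gamma>' k i j w" if "w \<in> N" for w k i j
    by (rule christoffel_cong[OF assms(1) that assms(3)])
  have "pd a (christoffel \<gamma> k i j) z = pd a (christoffel \<gamma>' k i j) z" for a k i j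
    by (rule pd_cong[OF assms(1,2) c])
  then show ?thesis unfolding riemann_def by (simp add: c[OF assms(2)])
qed

lemma fefferman_scale: "fefferman i Q \<rho> z = (\<rho> z)\<^sup>2 *\<^sub>R fefferman i Q (\<lambda>_. 1) z"
  by (simp add: fefferman_def Let_def)

text \<open>Says that sigma is e^(i phi/3) times a solution of \<open>eq_plus\<close> affine in p,
  but through conditions at single points and without naming the coefficient. It therefore passes to
  arbitrary subsets, and from a dense subset to the whole by continuity.\<close>

definition plus_type :: "real \<Rightarrow> (real^3 \<Rightarrow> real) \<Rightarrow> (real^4 \<Rightarrow> real) \<Rightarrow> (real^4) set \<Rightarrow> bool" where
  "plus_type i Q \<sigma> N \<longleftrightarrow> (\<forall>z\<in>N. pd 4 \<sigma> z = i / 3 * \<sigma> z \<and> pd 3 (pd 3 \<sigma>) z = 0 \<and>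
     pd 1 \<sigma> z + z $ 3 * pd 2 \<sigma> z + Q (jet z) * pd 3 \<sigma> z = mpd 0 0 1 Q (jet z) * \<sigma> z / 3)"

definition minus_type :: "real \<Rightarrow> (real^3 \<Rightarrow> real) \<Rightarrow> (real^4 \<Rightarrow> real) \<Rightarrow> (real^4) set \<Rightarrow> bool" where
  "minus_type i Q \<sigma> N \<longleftrightarrow> (\<forall>z\<in>N. pd 4 \<sigma> z = - i / 3 * \<sigma> z \<and> pd 3 \<sigma> z = 0 \<and>
     jet_patch.eq_minus Q (\<lambda>v. \<sigma> (level (z $ 4) v)) (jet z) = 0)"

lemma (in jet_patch) eq_minus_cong:
  assumes "v \<in> S" "\<And>w. w \<in> S \<Longrightarrow> \<beta> w = \<beta>' w"
  shows "eq_minus \<beta> v = eq_minus \<beta>' v"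
  unfolding eq_minus_def using mpd_cong[OF open_S assms(1), of \<beta> \<beta>'] assms by simp

lemma (in fefferman_patch) subpatch: "open N \<Longrightarrow> N \<subseteq> U \<Longrightarrow> fefferman_patch i Q N"
  using i_nonzero smooth_on_subset[OF smooth_Q image_mono] by (simp add: fefferman_patch_def)

lemma plus_type_cong:
  assumes "open N" "\<And>z. z \<in> N \<Longrightarrow> \<sigma> z = \<tau> z" "plus_type i Q \<sigma> N"
  shows "plus_type i Q \<tau> N"
proof -
  have 1: "pd k \<sigma> z = pd k \<tau> z" if "z \<in> N" for k z by (rule pd_cong[OF assms(1) that assms(2)])
  have "pd 3 (pd 3 \<sigma>) z = pd 3 (pd 3 \<tau>) z" if "z \<in> N" for z by (rule pd_cong[OF assms(1) that 1])
  then show ?thesis using assms(3) unfolding plus_type_def by (simp add: 1 assms(2))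
qed

lemma minus_type_cong:
  assumes "open N" "smooth_on (jet ` N) Q" "\<And>z. z \<in> N \<Longrightarrow> \<sigma> z = \<tau> z" "minus_type i Q \<sigma> N"
  shows "minus_type i Q \<tau> N"
  unfolding minus_type_def
proof
  fix z assume z: "z \<in> N"
  have 1: "pd k \<sigma> z = pd k \<tau> z" for k by (rule pd_cong[OF assms(1) z assms(3)])
  let ?S = "level (z $ 4) -` N"
  have "?S \<subseteq> jet ` N" by (metis image_eqI jet_level subsetI vimageE)
  then interpret jet_patch Q ?S
    using open_level_vimage[OF assms(1)] smooth_on_subset[OF assms(2)] by unfold_locales auto
  have "eq_minus (\<lambda>v. \<sigma> (level (z $ 4) v)) (jet z) = eq_minus (\<lambda>v. \<tau> (level (z $ 4) v)) (jet z)"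
    by (rule eq_minus_cong) (use z assms(3) in auto)
  then show "pd 4 \<tau> z = - i / 3 * \<tau> z \<and> pd 3 \<tau> z = 0 \<and> eq_minus (\<lambda>v. \<tau> (level (z $ 4) v)) (jet z) = 0"
    using assms(4)[unfolded minus_type_def, rule_format, OF z] by (simp add: 1 assms(3)[OF z])
qed

context fefferman_scaled
begin

lemma plus_type_ricci_flat: "plus_type i Q \<sigma> U \<Longrightarrow> z \<in> U \<Longrightarrow> ricci g z = 0"
  by (rule ricci_flat_plus_family) (auto simp: plus_type_def)

lemma minus_type_ricci_flat: "minus_type i Q \<sigma> U \<Longrightarrow> z \<in> U \<Longrightarrow> ricci g z = 0"
  by (rule ricci_flat_minus_family) (auto simp: minus_type_def)

lemma minus_type_flat:
  "minus_type i Q \<sigma> U \<Longrightarrow> (\<And>z. z \<in> U \<Longrightarrow> w2 Q (jet z) = 0) \<Longrightarrow> z \<in> U \<Longrightarrow> riemann g l k a b z = 0"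
  by (rule riemann_zero) (auto simp: minus_type_def jet_patch.w2_jets[OF jet_patch_level, symmetric])

lemma g_nonzero:
  assumes "z \<in> U"
  shows "g z \<noteq> 0"
proof
  assume "g z = 0"
  then have "g z $ 1 $ 3 = 0" by simp
  then show False using sigma_nonzero[OF assms] by (simp add: g_def h_entries(3))
qed

context
  fixes \<Lambda> :: real
  assumes E: "\<And>z. z \<in> U \<Longrightarrow> ricci g z = \<Lambda> *\<^sub>R g z"
begin

lemma obstructions:
  assumes z: "z \<in> U"
  shows "w2 Q (jet z) * plus_part z = 0" "w1 Q (jet z) * minus_part z = 0"
proof -
  let ?t = "z $ 4"
  let ?S = "level ?t -` U"
  interpret jet_patch Q ?S by (rule jet_patch_level)
  have v: "jet z \<in> ?S" using z by simp
  have e: "level ?t v \<in> U" if "v \<in> ?S" for v using that by simp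
  note s = slice_equations[OF E e]
  show "w2 Q (jet z) * plus_part z = 0"
    using eq_plus_obstruction[OF smooth_on_level[OF open_dom smooth_parts(1)] s(1,2) v] by (simp add: w2_jets)
  show "w1 Q (jet z) * minus_part z = 0"
    using eq_minus_obstruction[OF smooth_on_level[OF open_dom smooth_parts(2)] s(3,4) v] by simp
qed

lemma plus_type_if:
  assumes "\<And>z. z \<in> U \<Longrightarrow> minus_part z = 0"
  shows "plus_type i Q \<sigma> U"
  unfolding plus_type_def
proof
  fix z assume z: "z \<in> U"
  have s: "\<sigma> w = plus_part w" if "w \<in> U" for w
    using fun_cong[OF sigma_parts(1), of w] assms[OF that] by simp
  have d: "pd k \<sigma> z = pd k plus_part z" for k by (rule pd_const_on[OF z s])
  interpret jet_patch Q "level (z $ 4) -` U" by (rule jet_patch_level)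
  have lz: "level (z $ 4) (jet z) \<in> U" using z by simp
  have "pd 4 \<sigma> z = i / 3 * \<sigma> z"
    using fun_cong[OF sigma_parts(2), of z] assms[OF z] s[OF z] by simp
  moreover have "pd 1 \<sigma> z + z $ 3 * pd 2 \<sigma> z + Q (jet z) * pd 3 \<sigma> z = mpd 0 0 1 Q (jet z) * \<sigma> z / 3"
    using slice_equations(2)[OF E lz] unfolding eq_plus_def slice_jets[OF open_dom smooth_parts(1) lz]
    by (simp add: d s[OF z])
  ultimately show "pd 4 \<sigma> z = i / 3 * \<sigma> z \<and> pd 3 (pd 3 \<sigma>) z = 0 \<and>
     pd 1 \<sigma> z + z $ 3 * pd 2 \<sigma> z + Q (jet z) * pd 3 \<sigma> z = mpd 0 0 1 Q (jet z) * \<sigma> z / 3"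
    using einstein_necessary(1)[OF z E[OF z]] by blast
qed

lemma minus_type_if:
  assumes "\<And>z. z \<in> U \<Longrightarrow> plus_part z = 0"
  shows "minus_type i Q \<sigma> U"
  unfolding minus_type_def
proof
  fix z assume z: "z \<in> U"
  have s: "\<sigma> w = minus_part w" if "w \<in> U" for w
    using fun_cong[OF sigma_parts(1), of w] assms[OF that] by simp
  interpret jet_patch Q "level (z $ 4) -` U" by (rule jet_patch_level)
  have lz: "level (z $ 4) (jet z) \<in> U" using z by simp
  have "pd 4 \<sigma> z = - i / 3 * \<sigma> z"
    using fun_cong[OF sigma_parts(2), of z] assms[OF z] s[OF z] by simp
  moreover have "pd 3 \<sigma> z = pd 3 minus_part z" by (rule pd_const_on[OF z s])
  moreover have "eq_minus (\<lambda>v. \<sigma> (level (z $ 4) v)) (jet z) = eq_minus (\<lambda>v. minus_part (level (z $ 4) v)) (jet z)"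
    by (rule eq_minus_cong) (use z s in auto)
  ultimately show "pd 4 \<sigma> z = - i / 3 * \<sigma> z \<and> pd 3 \<sigma> z = 0 \<and> eq_minus (\<lambda>v. \<sigma> (level (z $ 4) v)) (jet z) = 0"
    using slice_equations(4)[OF E lz] pd_parts(2)[OF E z] by simp
qed

end

end

subsection \<open>Functions of the base variables\<close>

text \<open>The section of the projection to the base with p and phi frozen at their values at
  \<open>z0\<close>; functions constant along the fibres are recovered from their values on
  it.\<close>

definition emb :: "real^4 \<Rightarrow> real^2 \<Rightarrow> real^4" where
  "emb z0 q = vector [q $ 1, q $ 2, z0 $ 3, z0 $ 4]"

lemma emb_nth [simp]: "emb z0 q $ 1 = q $ 1" "emb z0 q $ 2 = q $ 2" "emb z0 q $ 3 = z0 $ 3" "emb z0 q $ 4 = z0 $ 4"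
  by (simp_all add: emb_def)

lemma base_jet_emb [simp]: "base (jet (emb z0 q)) = q"
  by (simp add: vec_eq_iff forall_2)

lemma emb_affine: "emb z0 q = emb z0 0 + emb 0 q"
  by (simp add: vec_eq_iff forall_4)

lemma bounded_linear_emb: "bounded_linear (emb 0)"
  unfolding linear_conv_bounded_linear[symmetric] by (rule linearI; simp add: vec_eq_iff forall_4)

lemma emb_axis [simp]: "emb 0 (axis 1 x) = axis 1 x" "emb 0 (axis 2 x) = axis 2 x"
  by (simp_all add: vec_eq_iff forall_4 axis_def)

text \<open>In a box the section \<open>emb z0\<close> over the projected set stays inside, and the
  segment from it to any point above lies inside as well. General open sets have neither
  property.\<close>

locale coordinate_box =
  fixes a b z0 :: "real^4"
  assumes z0_in: "z0 \<in> box a b"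
begin

abbreviation "N \<equiv> box a b"
abbreviation "N2 \<equiv> base ` jet ` N"

lemma open_N2: "open N2"
  by (intro open_base_image open_jet_image open_box)

lemma emb_in: "q \<in> N2 \<Longrightarrow> emb z0 q \<in> N"
  using z0_in by (auto simp: mem_box_cart forall_4)

text \<open>The segment from \<open>emb z0 (base (jet z))\<close> to \<open>z\<close> moves only in
  the third and fourth coordinates, where the derivative of \<open>f\<close> vanishes.\<close>

lemma constant_on_fibres:
  assumes f: "smooth_on N f" and 3: "\<And>z. z \<in> N \<Longrightarrow> pd 3 f z = 0" and 4: "\<And>z. z \<in> N \<Longrightarrow> pd 4 f z = 0"
    and z: "z \<in> N"
  shows "f z = f (emb z0 (base (jet z)))"
proof -
  let ?z = "emb z0 (base (jet z))"
  have z': "?z \<in> N" by (rule emb_in) (use z in simp)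
  have in_N: "?z + t *\<^sub>R (z - ?z) \<in> N" if "t \<in> {0..1}" for t
    using convexD_alt[OF convex_box(2) z' z, of t] that by (simp add: algebra_simps)
  have "((\<lambda>t. f (?z + t *\<^sub>R (z - ?z))) has_derivative (\<lambda>h. 0)) (at t within {0..1})" if t: "t \<in> {0..1}" for t
  proof -
    let ?w = "?z + t *\<^sub>R (z - ?z)"
    have d: "f differentiable (at ?w)" using smooth_on_differentiable[OF f in_N[OF t]] .
    have "((\<lambda>t. ?z + t *\<^sub>R (z - ?z)) has_derivative (\<lambda>s. s *\<^sub>R (z - ?z))) (at t)"
      by (auto intro!: derivative_eq_intros)
    from diff_chain_at[OF this d[unfolded frechet_derivative_works]]
    have "((\<lambda>t. f (?z + t *\<^sub>R (z - ?z))) has_derivative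
        (\<lambda>s. frechet_derivative f (at ?w) (s *\<^sub>R (z - ?z)))) (at t)"
      by (simp add: o_def)
    moreover have "frechet_derivative f (at ?w) (s *\<^sub>R (z - ?z)) = 0" for s
      unfolding frechet_derivative_eq_sum_pd[OF d] by (simp add: sum_4 3[OF in_N[OF t]] 4[OF in_N[OF t]])
    ultimately show ?thesis by (simp add: has_derivative_at_withinI)
  qed
  then obtain c where "\<forall>t\<in>{0..1}. f (?z + t *\<^sub>R (z - ?z)) = c"
    using has_derivative_zero_constant[of "{0..1}"] by blast
  from this[rule_format, of 0] this[rule_format, of 1] show ?thesis by simp
qed

lemma descend:
  assumes f: "smooth_on N f" and 3: "\<And>z. z \<in> N \<Longrightarrow> pd 3 f z = 0" and 4: "\<And>z. z \<in> N \<Longrightarrow> pd 4 f z = 0"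
  shows "smooth_on N2 (\<lambda>q. f (emb z0 q))"
    and "z \<in> N \<Longrightarrow> f (emb z0 (base (jet z))) = f z"
    and "z \<in> N \<Longrightarrow> pd 1 (\<lambda>q. f (emb z0 q)) (base (jet z)) = pd 1 f z"
    and "z \<in> N \<Longrightarrow> pd 2 (\<lambda>q. f (emb z0 q)) (base (jet z)) = pd 2 f z"
proof -
  have e: "(\<lambda>q. f (emb z0 q)) = (\<lambda>q. f (emb z0 0 + emb 0 q))"
    by (rule ext) (subst emb_affine, rule refl)
  show "smooth_on N2 (\<lambda>q. f (emb z0 q))"
    unfolding e by (rule smooth_on_compose_affine[OF bounded_linear_emb f open_box open_N2])
      (use emb_in emb_affine in metis)
  show "z \<in> N \<Longrightarrow> f (emb z0 (base (jet z))) = f z"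
    using constant_on_fibres[OF f 3 4] by simp
  assume z: "z \<in> N"
  have ez: "emb z0 (base (jet z)) \<in> N" by (rule emb_in) (use z in simp)
  have d: "f differentiable (at (emb z0 0 + emb 0 (base (jet z))))"
    using smooth_on_differentiable[OF f ez] by (simp flip: emb_affine)
  \<comment> \<open>Partial derivatives of \<open>f\<close> are again constant along the fibres,
    because mixed derivatives commute.\<close>
  have fib: "pd k f (emb z0 (base (jet z))) = pd k f z" for k
  proof (rule constant_on_fibres[OF smooth_on_pd[OF f] _ _ z, symmetric])
    fix w assume w: "w \<in> N"
    show "pd 3 (pd k f) w = 0" "pd 4 (pd k f) w = 0"
      using pd_commute[OF open_box w f, where i=3 and j=k] pd_commute[OF open_box w f, where i=4 and j=k]
        pd_cong[OF open_box w 3, where k=k] pd_cong[OF open_box w 4, where k=k] by simp_all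
  qed
  show "pd 1 (\<lambda>q. f (emb z0 q)) (base (jet z)) = pd 1 f z" "pd 2 (\<lambda>q. f (emb z0 q)) (base (jet z)) = pd 2 f z"
    unfolding e using pd_compose_affine[OF bounded_linear_emb d, of 1 1] pd_compose_affine[OF bounded_linear_emb d, of 2 2]
      fib by (simp_all flip: emb_affine)
qed

lemma constant_sign:
  assumes "continuous_on N f" "\<And>z. z \<in> N \<Longrightarrow> f z \<noteq> (0::real)"
  obtains s :: real where "s = 1 \<or> s = -1" "\<And>z. z \<in> N \<Longrightarrow> 0 < s * f z"
proof -
  have c: "connected (f ` N)"
    by (intro connected_continuous_image assms(1) convex_connected convex_box)
  have "(\<forall>z\<in>N. f z > 0) \<or> (\<forall>z\<in>N. f z < 0)"
  proof (rule ccontr)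
    assume "\<not> ?thesis"
    then obtain z w where "z \<in> N" "w \<in> N" "f z < 0" "0 < f w"
      using assms(2) by (meson linorder_neqE_linordered_idom)
    then have "0 \<in> f ` N"
      using c unfolding connected_iff_interval by (meson image_eqI less_imp_le)
    then show False using assms(2) by auto
  qed
  then show ?thesis
  proof
    assume "\<forall>z\<in>N. f z > 0" then show ?thesis using that[of 1] by simp
  next
    assume "\<forall>z\<in>N. f z < 0" then show ?thesis using that[of "-1"] by simp
  qed
qed

end

lemma obtain_box:
  assumes "open U" "(z::real^4) \<in> U"
  obtains a b where "z \<in> box a b" "box a b \<subseteq> U"
proof -
  obtain a b where "z \<in> box a b" "cbox a b \<subseteq> U" by (rule open_contains_cbox[OF assms])
  then show ?thesis using that[of a b] box_subset_cbox[of a b] by blast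
qed

section \<open>Matching the pure exponential types with the explicit families\<close>

section \<open>The explicit families\<close>

lemma eq_iff_factor_eq_0: "x - y = c * e \<Longrightarrow> c \<noteq> 0 \<Longrightarrow> x = y \<longleftrightarrow> e = (0::real)"
  by auto

context fefferman_patch
begin

lemma smooth_on_base_jet: "smooth_on (base ` jet ` U) a \<Longrightarrow> smooth_on U (\<lambda>w. a (base (jet w)))"
  by (intro smooth_on_jet[where F="\<lambda>v. a (base v)"] smooth_on_base open_dom open_jet_dom)

lemma base_jet_rules:
  assumes "smooth_on (base ` jet ` U) a" "z \<in> U"
  shows "pd 1 (\<lambda>w. a (base (jet w))) z = pd 1 a (base (jet z))"
    "pd 2 (\<lambda>w. a (base (jet w))) z = pd 2 a (base (jet z))"
    "pd 3 (\<lambda>w. a (base (jet w))) z = 0" "pd 4 (\<lambda>w. a (base (jet w))) z = 0"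
proof -
  have d: "a differentiable (at (base (jet z)))"
    using smooth_on_differentiable[OF assms(1)] assms(2) by blast
  note D = differentiable_base[OF d]
  show "pd 1 (\<lambda>w. a (base (jet w))) z = pd 1 a (base (jet z))"
    "pd 2 (\<lambda>w. a (base (jet w))) z = pd 2 a (base (jet z))"
    "pd 3 (\<lambda>w. a (base (jet w))) z = 0" "pd 4 (\<lambda>w. a (base (jet w))) z = 0"
    unfolding pd_jet[OF D] pd_base[OF d] by (rule refl)+
qed

text \<open>The ansatz is the reciprocal of the scale factor of the first family, with
  \<open>s\<close> absorbing the sign. The exponentials factor out of the linear equation, leaving
  the displayed relation between Q and Q_p.\<close>

lemma plus_ansatz:
  assumes A: "smooth_on U A" "\<And>z. z \<in> U \<Longrightarrow> pd 3 A z = 0" "\<And>z. z \<in> U \<Longrightarrow> pd 4 A z = 0"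
    and B: "smooth_on U B" "\<And>z. z \<in> U \<Longrightarrow> pd 3 B z = 0" "\<And>z. z \<in> U \<Longrightarrow> pd 4 B z = 0"
    and s: "s \<noteq> 0"
  shows "plus_type i Q (\<lambda>z. s * (z $ 3 + 2 * B z) * exp (2/3 * A z) * exp (i * z $ 4 / 3)) U \<longleftrightarrow>
    (\<forall>z\<in>U. 2/3 * pd 1 A z * (z $ 3 + 2 * B z) + 2 * pd 1 B z
      + z $ 3 * (2/3 * pd 2 A z * (z $ 3 + 2 * B z) + 2 * pd 2 B z)
      + Q (jet z) - J 0 0 1 z * (z $ 3 + 2 * B z) / 3 = 0)"
    (is "plus_type i Q ?\<tau> U \<longleftrightarrow> (\<forall>z\<in>U. ?E z = 0)")
proof -
  have d: "A differentiable (at z)" "B differentiable (at z)" if "z \<in> U" for z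
    using smooth_on_differentiable[OF A(1) that] smooth_on_differentiable[OF B(1) that] .
  let ?P = "\<lambda>z. s * exp (2/3 * A z) * exp (i * z $ 4 / 3)"
  have 3: "pd 3 ?\<tau> z = ?P z" if "z \<in> U" for z
    by (simp add: d[OF that] A(2)[OF that] B(2)[OF that])
  have pd_zero_P: "pd 3 ?P z = 0" if z: "z \<in> U" for z
    by (simp add: d[OF z] A(2)[OF z])
  have 33: "pd 3 (pd 3 ?\<tau>) z = 0" if z: "z \<in> U" for z
  proof -
    have "pd 3 (pd 3 ?\<tau>) z = pd 3 ?P z" by (rule pd_cong[OF open_dom z 3])
    then show ?thesis by (simp only: pd_zero_P[OF z])
  qed
  have 4: "pd 4 ?\<tau> z = i / 3 * ?\<tau> z" if z: "z \<in> U" for z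
    by (simp add: d[OF z] A(3)[OF z] B(3)[OF z])
  have factor: "pd 1 ?\<tau> z + z $ 3 * pd 2 ?\<tau> z + Q (jet z) * pd 3 ?\<tau> z - J 0 0 1 z * ?\<tau> z / 3 = ?P z * ?E z"
    if z: "z \<in> U" for z
    unfolding 3[OF z] by (simp add: d[OF z]) (simp add: field_simps)
  have "pd 1 ?\<tau> z + z $ 3 * pd 2 ?\<tau> z + Q (jet z) * pd 3 ?\<tau> z = J 0 0 1 z * ?\<tau> z / 3 \<longleftrightarrow> ?E z = 0"
    if z: "z \<in> U" for z
    by (rule eq_iff_factor_eq_0[OF factor[OF z]]) (use s in simp)
  then show ?thesis unfolding plus_type_def using 33 4 by simp
qed

text \<open>The ansatz independent of p, the reciprocal of the scale factor of the second family.
  With sigma_p = 0 the equation loses its term in Q and prescribes Q_p instead.\<close>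

lemma plus_ansatz_constant:
  assumes A: "smooth_on U A" "\<And>z. z \<in> U \<Longrightarrow> pd 3 A z = 0" "\<And>z. z \<in> U \<Longrightarrow> pd 4 A z = 0"
    and s: "s \<noteq> 0"
  shows "plus_type i Q (\<lambda>z. s * exp (2/3 * A z) * exp (i * z $ 4 / 3)) U \<longleftrightarrow>
    (\<forall>z\<in>U. J 0 0 1 z = 2 * pd 1 A z + 2 * z $ 3 * pd 2 A z)"
    (is "plus_type i Q ?\<tau> U \<longleftrightarrow> _")
proof -
  note d = smooth_on_differentiable[OF A(1)]
  have 3: "pd 3 ?\<tau> z = 0" if "z \<in> U" for z
    by (simp add: d[OF that] A(2)[OF that])
  have 33: "pd 3 (pd 3 ?\<tau>) z = 0" if z: "z \<in> U" for z
    using pd_cong[OF open_dom z 3, where k=3] by (simp only: pd_const)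
  have 4: "pd 4 ?\<tau> z = i / 3 * ?\<tau> z" if z: "z \<in> U" for z
    by (simp add: d[OF z] A(3)[OF z])
  have factor: "pd 1 ?\<tau> z + z $ 3 * pd 2 ?\<tau> z + Q (jet z) * pd 3 ?\<tau> z - J 0 0 1 z * ?\<tau> z / 3 =
    ?\<tau> z / 3 * (2 * pd 1 A z + 2 * z $ 3 * pd 2 A z - J 0 0 1 z)"
    if z: "z \<in> U" for z
    unfolding 3[OF z] by (simp add: d[OF z]) (simp add: field_simps)
  have "pd 1 ?\<tau> z + z $ 3 * pd 2 ?\<tau> z + Q (jet z) * pd 3 ?\<tau> z = J 0 0 1 z * ?\<tau> z / 3 \<longleftrightarrow>
      2 * pd 1 A z + 2 * z $ 3 * pd 2 A z - J 0 0 1 z = 0"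
    if z: "z \<in> U" for z
    by (rule eq_iff_factor_eq_0[OF factor[OF z]]) (use s in simp)
  then show ?thesis unfolding plus_type_def using 33 4 by auto
qed

text \<open>The expression \<open>eq_minus\<close> transported to functions of four variables. For
  \<open>f\<close> independent of p it equals 18 D^2 f - 6 Q_p D f + (6 D Q_p - 18 Q_y - 4 Q_p^2)
  f.\<close>

definition minus_op :: "(real^4 \<Rightarrow> real) \<Rightarrow> real^4 \<Rightarrow> real" where
  "minus_op f z =
    18 * (pd 1 (pd 1 f) z + 2 * z $ 3 * pd 1 (pd 2 f) z + (z $ 3)^2 * pd 2 (pd 2 f) z + J 0 0 0 z * pd 2 f z)
    - 6 * J 0 0 1 z * (pd 1 f z + z $ 3 * pd 2 f z)
    + (6 * (J 1 0 1 z + z $ 3 * J 0 1 1 z + J 0 0 0 z * J 0 0 2 z) - 18 * J 0 1 0 z - 4 * (J 0 0 1 z)^2) * f z"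

lemma eq_minus_slice:
  assumes "smooth_on U f" "z \<in> U"
  shows "jet_patch.eq_minus Q (\<lambda>v. f (level (z $ 4) v)) (jet z) = minus_op f z"
proof -
  interpret jet_patch Q "jet ` U" by unfold_locales (rule open_jet_dom, rule smooth_Q)
  have "level (z $ 4) (jet z) \<in> U" using assms by simp
  from slice_jets[OF open_dom assms(1) this] show ?thesis
    unfolding eq_minus_def minus_op_def by simp
qed

lemma minus_ansatz:
  assumes G: "smooth_on U G" "\<And>z. z \<in> U \<Longrightarrow> pd 3 G z = 0" "\<And>z. z \<in> U \<Longrightarrow> pd 4 G z = 0"
  shows "minus_type i Q (\<lambda>z. exp (- (i * z $ 4 / 3)) * G z) U \<longleftrightarrow> (\<forall>z\<in>U. minus_op G z = 0)"
    (is "minus_type i Q ?\<tau> U \<longleftrightarrow> _")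
proof -
  note d = smooth_on_differentiable[OF G(1)] smooth_on_differentiable[OF smooth_on_pd[OF G(1)]]
  let ?e = "\<lambda>z::real^4. exp (- (i * z $ 4 / 3))"
  have s: "smooth_on U ?\<tau>" unfolding divide_inverse by (intro smooth_intros open_dom G(1))
  have 1: "pd k ?\<tau> z = ?e z * pd k G z" if "z \<in> U" "k \<noteq> 4" for z k
    using that by (simp add: d)
  have 11: "pd l (pd k ?\<tau>) z = ?e z * pd l (pd k G) z" if z: "z \<in> U" and "k \<noteq> 4" "l \<noteq> 4" for z k l
  proof -
    have "pd l (pd k ?\<tau>) z = pd l (\<lambda>z. ?e z * pd k G z) z"
      by (rule pd_cong[OF open_dom z 1]) (use that in auto)
    also have "\<dots> = ?e z * pd l (pd k G) z" using that by (simp add: d)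
    finally show ?thesis .
  qed
  have "minus_op ?\<tau> z = ?e z * minus_op G z" if z: "z \<in> U" for z
  proof -
    have n: "(1::4) \<noteq> 4" "(2::4) \<noteq> 4" by simp_all
    show ?thesis
      unfolding minus_op_def 1[OF z n(1)] 1[OF z n(2)] 11[OF z n(1) n(1)] 11[OF z n(2) n(1)] 11[OF z n(2) n(2)]
      by (simp add: algebra_simps)
  qed
  moreover have "pd 4 ?\<tau> z = - i / 3 * ?\<tau> z" "pd 3 ?\<tau> z = 0" if "z \<in> U" for z
    using that by (simp_all add: d G)
  ultimately show ?thesis
    unfolding minus_type_def using eq_minus_slice[OF s] by simp
qed

text \<open>The substitution beta = 1/a turns the linear equation into the quadratic one of the
  third family, up to the factor a^3. Here D^2 (1/a) = 2 (D a)^2 / a^3 - D^2 a / a^2.\<close>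

lemma minus_op_inverse:
  assumes A: "smooth_on U A" "\<And>z. z \<in> U \<Longrightarrow> A z \<noteq> 0" and z: "z \<in> U"
  shows "minus_op (\<lambda>z. 1 / A z) z =
    (36 * (pd 1 A z + z $ 3 * pd 2 A z)^2
     + 6 * A z * (- 3 * (pd 1 (pd 1 A) z + 2 * z $ 3 * pd 1 (pd 2 A) z + (z $ 3)^2 * pd 2 (pd 2 A) z + J 0 0 0 z * pd 2 A z)
         + J 0 0 1 z * (pd 1 A z + z $ 3 * pd 2 A z))
     + (A z)^2 * (6 * (J 1 0 1 z + z $ 3 * J 0 1 1 z + J 0 0 0 z * J 0 0 2 z) - 18 * J 0 1 0 z - 4 * (J 0 0 1 z)^2))
    / (A z)^3"
proof -
  note d = smooth_on_differentiable[OF A(1)] smooth_on_differentiable[OF smooth_on_pd[OF A(1)]]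
  have 1: "pd k (\<lambda>z. 1 / A z) z = - (pd k A z / (A z * A z))" if "z \<in> U" for z k
    using A(2)[OF that] by (simp add: d[OF that])
  have 11: "pd l (pd k (\<lambda>z. 1 / A z)) z = 2 * pd l A z * pd k A z / (A z)^3 - pd l (pd k A) z / (A z)^2" for k l
  proof -
    have "pd l (pd k (\<lambda>z. 1 / A z)) z = pd l (\<lambda>z. - (pd k A z / (A z * A z))) z"
      by (rule pd_cong[OF open_dom z 1])
    also have "\<dots> = 2 * pd l A z * pd k A z / (A z)^3 - pd l (pd k A) z / (A z)^2"
      using A(2)[OF z] by (simp add: d[OF z]) (simp add: field_simps power2_eq_square power3_eq_cube)
    finally show ?thesis .
  qed
  have c: "pd 2 (pd 1 A) z = pd 1 (pd 2 A) z" by (rule pd_commute[OF open_dom z A(1)])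
  show ?thesis
    unfolding minus_op_def 1[OF z] 11 using A(2)[OF z]
    by (simp add: field_simps power2_eq_square power3_eq_cube)
qed

lemma third_equation:
  assumes a: "smooth_on (base ` jet ` U) a" and z: "z \<in> U" and nz: "\<And>z. z \<in> U \<Longrightarrow> a (base (jet z)) \<noteq> 0"
  defines "A \<equiv> \<lambda>v. a (base v)" and "v \<equiv> jet z"
  shows "36 * (total_deriv Q A v)^2 + 6 * A v * (- 3 * total_deriv Q (total_deriv Q A) v + pd 3 Q v * total_deriv Q A v)
      + (A v)^2 * (6 * total_deriv Q (pd 3 Q) v - 18 * pd 2 Q v - 4 * (pd 3 Q v)^2)
    = minus_op (\<lambda>z. 1 / a (base (jet z))) z * (a (base (jet z)))^3"
proof -
  have pa: "smooth_on (base ` jet ` U) (pd k a)" for k by (rule smooth_on_pd[OF a])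
  have ob: "open (base ` jet ` U)" by (intro open_base_image open_jet_dom)
  have d: "a differentiable (at (base w))" "pd k a differentiable (at (base w))" if "w \<in> jet ` U" for w k
    using smooth_on_differentiable[OF a] smooth_on_differentiable[OF pa] that by blast+
  have v: "v \<in> jet ` U" using z by (simp add: v_def)
  have D: "total_deriv Q A w = pd 1 a (base w) + w $ 3 * pd 2 a (base w)" if "w \<in> jet ` U" for w
    unfolding total_deriv_def A_def using d[OF that] by simp
  have "pd k (total_deriv Q A) v = pd k (\<lambda>w. pd 1 a (base w) + w $ 3 * pd 2 a (base w)) v" for k
    by (rule pd_cong[OF open_jet_dom v D])
  then have DD: "total_deriv Q (total_deriv Q A) v = pd 1 (pd 1 a) (base v) + v $ 3 * pd 1 (pd 2 a) (base v)
      + v $ 3 * (pd 2 (pd 1 a) (base v) + v $ 3 * pd 2 (pd 2 a) (base v)) + Q v * pd 2 a (base v)"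
    using d[OF v] by (simp add: total_deriv_def[of Q "total_deriv Q A"])
  have c: "pd 2 (pd 1 a) (base v) = pd 1 (pd 2 a) (base v)"
    using pd_commute[OF ob _ a] v by blast
  have DQ: "total_deriv Q (pd 3 Q) v = J 1 0 1 z + z $ 3 * J 0 1 1 z + J 0 0 0 z * J 0 0 2 z"
    unfolding total_deriv_def v_def by (simp add: mpd_def numeral_2_eq_2)
  have J: "pd 3 Q v = J 0 0 1 z" "pd 2 Q v = J 0 1 0 z" by (simp_all add: mpd_def v_def)
  let ?A = "\<lambda>z. a (base (jet z))"
  have r: "pd l (pd 1 ?A) z = pd l (\<lambda>w. pd 1 a (base (jet w))) z"
    "pd l (pd 2 ?A) z = pd l (\<lambda>w. pd 2 a (base (jet w))) z" for l
    by (rule pd_cong[OF open_dom z base_jet_rules(1)[OF a]], assumption)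
      (rule pd_cong[OF open_dom z base_jet_rules(2)[OF a]])
  have 2: "pd 1 (pd 1 ?A) z = pd 1 (pd 1 a) (base v)" "pd 1 (pd 2 ?A) z = pd 1 (pd 2 a) (base v)"
    "pd 2 (pd 2 ?A) z = pd 2 (pd 2 a) (base v)"
    unfolding r base_jet_rules[OF pa z] by (simp_all add: v_def)
  have "minus_op (\<lambda>z. 1 / ?A z) z * (?A z)^3 = 36 * (pd 1 ?A z + z $ 3 * pd 2 ?A z)^2
     + 6 * ?A z * (- 3 * (pd 1 (pd 1 ?A) z + 2 * z $ 3 * pd 1 (pd 2 ?A) z + (z $ 3)^2 * pd 2 (pd 2 ?A) z + J 0 0 0 z * pd 2 ?A z)
         + J 0 0 1 z * (pd 1 ?A z + z $ 3 * pd 2 ?A z))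
     + (?A z)^2 * (6 * (J 1 0 1 z + z $ 3 * J 0 1 1 z + J 0 0 0 z * J 0 0 2 z) - 18 * J 0 1 0 z - 4 * (J 0 0 1 z)^2)"
    by (subst minus_op_inverse[where A="?A", OF smooth_on_base_jet[OF a] nz z]) (use nz[OF z] in simp_all)
  then show ?thesis
    unfolding D[OF v] DD DQ J c by (simp add: A_def 2 base_jet_rules[OF a z] v_def algebra_simps power2_eq_square)
qed

end

lemma pd_cubic_rhs:
  assumes "open T" "smooth_on T a" "smooth_on T b" "smooth_on T c" "base v \<in> T"
  shows "pd 3 (cubic_rhs a b c) v = 3 * (v $ 3)^2 * c (base v)
    + 2 * v $ 3 * (6 * b (base v) * c (base v) - 2 * pd 2 a (base v))
    + (12 * (b (base v))^2 * c (base v) - 3 * pd 2 b (base v) - 6 * b (base v) * pd 2 a (base v) - pd 1 a (base v))"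
proof -
  have e: "(cubic_rhs a b c) = (\<lambda>v. (v $ 3)^3 * c (base v) + (v $ 3)^2 * (6 * b (base v) * c (base v) - 2 * pd 2 a (base v))
        + v $ 3 * (12 * (b (base v))^2 * c (base v) - 3 * pd 2 b (base v) - 6 * b (base v) * pd 2 a (base v) - pd 1 a (base v))
        + 8 * (b (base v))^3 * c (base v) - 2 * b (base v) * pd 2 b (base v) - 4 * (b (base v))^2 * pd 2 a (base v)
        - 2 * pd 1 b (base v) - 2 * b (base v) * pd 1 a (base v))"
    by (rule ext) (simp add: cubic_rhs_def Let_def)
  have d: "b differentiable (at (base v))" "c differentiable (at (base v))" "pd k a differentiable (at (base v))"
    "pd k b differentiable (at (base v))" for k
    using assms smooth_on_differentiable smooth_on_pd by blast+
  show ?thesis unfolding e by (simp add: d)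
qed

lemma pd_quadratic_rhs:
  assumes "smooth_on T a" "smooth_on T b" "base v \<in> T"
  shows "pd 3 (quadratic_rhs a b) v = 2 * v $ 3 * pd 2 a (base v) + 2 * pd 1 a (base v)"
proof -
  have e: "(quadratic_rhs a b) = (\<lambda>v. (v $ 3)^2 * pd 2 a (base v) + 2 * v $ 3 * pd 1 a (base v) + b (base v))"
    by (rule ext) (simp add: quadratic_rhs_def Let_def)
  have d: "b differentiable (at (base v))" "pd k a differentiable (at (base v))" for k
    using assms smooth_on_differentiable smooth_on_pd by blast+
  show ?thesis unfolding e by (simp add: d)
qed

locale fefferman_metric = fefferman_patch +
  fixes \<rho> :: "real^4 \<Rightarrow> real"
  assumes scale_factor: "scale_factor_on U \<rho>"
begin

lemma smooth_rho: "smooth_on U \<rho>" and rho_nonzero: "z \<in> U \<Longrightarrow> \<rho> z \<noteq> 0"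
  using scale_factor by (auto simp: scale_factor_on_def)

abbreviation \<sigma> :: "real^4 \<Rightarrow> real" where "\<sigma> \<equiv> \<lambda>z. inverse (\<rho> z)"

sublocale fefferman_scaled i Q U \<sigma>
  by unfold_locales (use smooth_on_inverse[OF open_dom smooth_rho] rho_nonzero in auto)

lemma fefferman_eq_g: "fefferman i Q \<rho> = g"
  by (rule ext) (simp add: g_def fefferman_scale[of i Q \<rho>] divide_inverse power_inverse)

lemma submetric: "open N \<Longrightarrow> N \<subseteq> U \<Longrightarrow> fefferman_metric i Q N \<rho>"
  using subpatch smooth_on_subset[OF smooth_rho] rho_nonzero
  by (auto simp: fefferman_metric_def fefferman_metric_axioms_def scale_factor_on_def)

lemma fefferman_nonzero: "z \<in> U \<Longrightarrow> fefferman i Q \<rho> z \<noteq> 0"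
  unfolding fefferman_eq_g by (rule g_nonzero)

lemma plus_type_ricci_flat_on: "plus_type i Q \<sigma> U \<Longrightarrow> ricci_flat_on U (fefferman i Q \<rho>)"
  unfolding ricci_flat_on_def fefferman_eq_g using plus_type_ricci_flat by blast

lemma minus_type_ricci_flat_on: "minus_type i Q \<sigma> U \<Longrightarrow> ricci_flat_on U (fefferman i Q \<rho>)"
  unfolding ricci_flat_on_def fefferman_eq_g using minus_type_ricci_flat by blast

lemma minus_type_flat_on:
  "minus_type i Q \<sigma> U \<Longrightarrow> (\<And>v. v \<in> jet ` U \<Longrightarrow> w2 Q v = 0) \<Longrightarrow> flat_on U (fefferman i Q \<rho>)"
  unfolding flat_on_def fefferman_eq_g using minus_type_flat by blast

context
  fixes \<Lambda> assumes E: "einstein_on U (fefferman i Q \<rho>) \<Lambda>"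
begin

lemma einstein_equations: "z \<in> U \<Longrightarrow> ricci g z = \<Lambda> *\<^sub>R g z"
  using E by (simp add: einstein_on_def fefferman_eq_g)

lemma einstein_w1_or_w2:
  assumes z: "z \<in> U"
  shows "w1 Q (jet z) = 0 \<or> w2 Q (jet z) = 0"
proof (rule ccontr)
  assume "\<not> ?thesis"
  then have "plus_part z = 0" "minus_part z = 0" using obstructions[OF einstein_equations z] by auto
  then show False using fun_cong[OF sigma_parts(1), of z] sigma_nonzero[OF z] by simp
qed

lemma einstein_plus_type:
  assumes "\<And>v. v \<in> jet ` U \<Longrightarrow> w1 Q v \<noteq> 0"
  shows "plus_type i Q \<sigma> U"
proof (rule plus_type_if[OF einstein_equations])
  fix z assume z: "z \<in> U"
  show "minus_part z = 0" using obstructions(2)[OF einstein_equations z] assms z by auto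
qed

lemma einstein_minus_type:
  assumes "\<And>v. v \<in> jet ` U \<Longrightarrow> w2 Q v \<noteq> 0"
  shows "minus_type i Q \<sigma> U"
proof (rule minus_type_if[OF einstein_equations])
  fix z assume z: "z \<in> U"
  show "plus_part z = 0" using obstructions(1)[OF einstein_equations z] assms z by auto
qed

end

lemma ricci_flat_imp_einstein: "ricci_flat_on U (fefferman i Q \<rho>) \<Longrightarrow> einstein_on U (fefferman i Q \<rho>) 0"
  by (simp add: ricci_flat_on_def einstein_on_def)

subsection \<open>From the families to the Einstein equations\<close>

lemma obtain_sign:
  assumes "equal_up_to_sign_on U \<rho> f"
  obtains s :: real where "s = 1 \<or> s = -1" "\<And>z. z \<in> U \<Longrightarrow> \<sigma> z = s * inverse (f z)"
  using assms that[of 1] that[of "-1"] unfolding equal_up_to_sign_on_def by force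

lemma first_family_plus_type:
  assumes "first_family_on i Q \<rho> U"
  shows "plus_type i Q \<sigma> U"
proof -
  obtain a b c where a: "smooth_on (base ` jet ` U) a" and b: "smooth_on (base ` jet ` U) b"
    and c: "smooth_on (base ` jet ` U) c"
    and nz: "\<And>z. z \<in> U \<Longrightarrow> z $ 3 + 2 * b (base (jet z)) \<noteq> 0"
    and r: "equal_up_to_sign_on U \<rho> (\<lambda>z. exp (- (2/3) * a (base (jet z))) / (z$3 + 2 * b (base (jet z)))
              * exp (- (i * z$4 / 3)))"
    and Q: "\<And>v. v \<in> jet ` U \<Longrightarrow> Q v = cubic_rhs a b c v"
    using assms unfolding first_family_on_def by blast
  obtain s :: real where s: "s = 1 \<or> s = -1" and sig: "\<And>z. z \<in> U \<Longrightarrow>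
    \<sigma> z = s * inverse (exp (- (2/3) * a (base (jet z))) / (z$3 + 2 * b (base (jet z))) * exp (- (i * z$4 / 3)))"
    using obtain_sign[OF r] by blast
  let ?A = "\<lambda>z. a (base (jet z))" and ?B = "\<lambda>z. b (base (jet z))"
  have E: "2/3 * pd 1 ?A z * (z $ 3 + 2 * ?B z) + 2 * pd 1 ?B z
      + z $ 3 * (2/3 * pd 2 ?A z * (z $ 3 + 2 * ?B z) + 2 * pd 2 ?B z)
      + Q (jet z) - J 0 0 1 z * (z $ 3 + 2 * ?B z) / 3 = 0" if z: "z \<in> U" for z
  proof -
    have v: "jet z \<in> jet ` U" "base (jet z) \<in> base ` jet ` U" using z by auto
    have "J 0 0 1 z = pd 3 (cubic_rhs a b c) (jet z)"
      using pd_cong[OF open_jet_dom v(1) Q, where k=3] by (simp add: mpd_def)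
    then have Jz: "J 0 0 1 z = 3 * (z $ 3)^2 * c (base (jet z))
    + 2 * z $ 3 * (6 * ?B z * c (base (jet z)) - 2 * pd 2 a (base (jet z)))
    + (12 * (?B z)^2 * c (base (jet z)) - 3 * pd 2 b (base (jet z)) - 6 * ?B z * pd 2 a (base (jet z)) - pd 1 a (base (jet z)))"
      using pd_cubic_rhs[OF open_base_image[OF open_jet_dom] a b c v(2)] by simp
    show ?thesis
      unfolding base_jet_rules(1,2)[OF a z] base_jet_rules(1,2)[OF b z] Jz Q[OF v(1)] cubic_rhs_def Let_def
      by (simp add: field_simps power2_eq_square power3_eq_cube)
  qed
  have "plus_type i Q (\<lambda>z. s * (z $ 3 + 2 * ?B z) * exp (2/3 * ?A z) * exp (i * z $ 4 / 3)) U"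
    by (rule iffD2[OF plus_ansatz[OF smooth_on_base_jet[OF a] base_jet_rules(3)[OF a] base_jet_rules(4)[OF a]
          smooth_on_base_jet[OF b] base_jet_rules(3)[OF b] base_jet_rules(4)[OF b]]])
      (use s E in auto)
  then show ?thesis
    by (rule plus_type_cong[OF open_dom, rotated]) (simp only: sig, simp add: exp_minus field_simps)
qed

lemma second_family_plus_type:
  assumes "second_family_on i Q \<rho> U"
  shows "plus_type i Q \<sigma> U"
proof -
  obtain a b where a: "smooth_on (base ` jet ` U) a" and b: "smooth_on (base ` jet ` U) b"
    and r: "equal_up_to_sign_on U \<rho> (\<lambda>z. exp (- (2/3) * a (base (jet z))) * exp (- (i * z$4 / 3)))"
    and Q: "\<And>v. v \<in> jet ` U \<Longrightarrow> Q v = quadratic_rhs a b v"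
    using assms unfolding second_family_on_def by blast
  obtain s :: real where s: "s = 1 \<or> s = -1" and sig: "\<And>z. z \<in> U \<Longrightarrow>
    \<sigma> z = s * inverse (exp (- (2/3) * a (base (jet z))) * exp (- (i * z$4 / 3)))"
    using obtain_sign[OF r] by blast
  let ?A = "\<lambda>z. a (base (jet z))"
  have E: "J 0 0 1 z = 2 * pd 1 ?A z + 2 * z $ 3 * pd 2 ?A z" if z: "z \<in> U" for z
  proof -
    have v: "jet z \<in> jet ` U" "base (jet z) \<in> base ` jet ` U" using z by auto
    have "J 0 0 1 z = pd 3 (quadratic_rhs a b) (jet z)"
      using pd_cong[OF open_jet_dom v(1) Q, where k=3] by (simp add: mpd_def)
    then show ?thesis using pd_quadratic_rhs[OF a b v(2)] by (simp add: base_jet_rules[OF a z])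
  qed
  have "plus_type i Q (\<lambda>z. s * exp (2/3 * ?A z) * exp (i * z $ 4 / 3)) U"
    by (rule iffD2[OF plus_ansatz_constant[OF smooth_on_base_jet[OF a] base_jet_rules(3)[OF a] base_jet_rules(4)[OF a]]])
      (use s E in auto)
  then show ?thesis
    by (rule plus_type_cong[OF open_dom, rotated]) (simp only: sig, simp add: exp_minus field_simps)
qed

lemma third_family_minus_type:
  assumes "third_family_on i Q \<rho> U"
  shows "minus_type i Q \<sigma> U"
proof -
  obtain a where a: "smooth_on (base ` jet ` U) a"
    and r: "\<And>z. z \<in> U \<Longrightarrow> \<rho> z = a (base (jet z)) * exp (i * z$4 / 3)"
    and ode: "\<And>v. v \<in> jet ` U \<Longrightarrow> (let D = total_deriv Q; A = (\<lambda>v. a (base v)); Qy = pd 2 Q; Qp = pd 3 Q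
          in 36 * (D A v)^2 + 6 * A v * (- 3 * D (D A) v + Qp v * D A v)
             + (A v)^2 * (6 * D Qp v - 18 * Qy v - 4 * (Qp v)^2) = 0)"
    using assms unfolding third_family_on_def by blast
  let ?A = "\<lambda>z. a (base (jet z))"
  have nz: "?A z \<noteq> 0" if "z \<in> U" for z using r[OF that] rho_nonzero[OF that] by auto
  have E: "minus_op (\<lambda>z. 1 / ?A z) z = 0" if z: "z \<in> U" for z
    using third_equation[OF a z nz] ode[OF imageI[OF z]] nz[OF z] by (simp add: Let_def)
  have sm: "smooth_on U (\<lambda>z. 1 / ?A z)"
    by (intro smooth_on_divide smooth_on_const smooth_on_base_jet[OF a] open_dom nz)
  have p: "pd 3 (\<lambda>z. 1 / ?A z) z = 0" "pd 4 (\<lambda>z. 1 / ?A z) z = 0" if z: "z \<in> U" for z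
    using nz[OF z] smooth_on_differentiable[OF smooth_on_base_jet[OF a] z] by (simp_all add: base_jet_rules[OF a z])
  have "minus_type i Q (\<lambda>z. exp (- (i * z $ 4 / 3)) * (1 / ?A z)) U"
    by (rule iffD2[OF minus_ansatz[OF sm p]]) (use E in auto)
  then show ?thesis
    by (rule minus_type_cong[OF open_dom smooth_Q, rotated]) (simp add: r exp_minus field_simps)
qed

end

subsection \<open>From the Einstein equations to the families\<close>

locale fefferman_box = coordinate_box a b z0 + fefferman_metric i Q "box a b" \<rho>
  for a b z0 :: "real^4" and i Q \<rho>
begin

text \<open>Without its exponential, sigma is f p + h with f nonzero; writing f (p + 2 B) with f = s
  e^(2A/3) gives the scale factor. The shape of Q follows by differentiating the remaining equation
  twice in p and solving back from Q_ppp.\<close>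

lemma first_family_if:
  assumes P: "plus_type i Q \<sigma> N" and nz: "\<And>z. z \<in> N \<Longrightarrow> pd 3 \<sigma> z \<noteq> 0"
    and w2: "\<And>v. v \<in> jet ` N \<Longrightarrow> w2 Q v = 0"
  shows "first_family_on i Q \<rho> N"
proof -
  have J4: "J 0 0 4 z = 0" if "z \<in> N" for z
    using w2[OF imageI[OF that]] by (simp add: w2_def mpd_def numeral_eq_Suc)
  let ?e = "\<lambda>z::real^4. exp (- (i * z $ 4 / 3))"
  \<comment> \<open>Slope and intercept of sigma in p after removal of the exponential; both depend
    on x and y only.\<close>
  let ?f = "\<lambda>z. ?e z * pd 3 \<sigma> z" and ?h = "\<lambda>z. ?e z * (\<sigma> z - z $ 3 * pd 3 \<sigma> z)"
  have d: "\<sigma> differentiable (at z)" "pd 3 \<sigma> differentiable (at z)" if "z \<in> N" for z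
    using pd_sigma_differentiable that by blast+
  have p: "pd 4 \<sigma> z = i / 3 * \<sigma> z" "pd 3 (pd 3 \<sigma>) z = 0"
    "pd 1 \<sigma> z + z $ 3 * pd 2 \<sigma> z + Q (jet z) * pd 3 \<sigma> z = J 0 0 1 z * \<sigma> z / 3" if "z \<in> N" for z
    using P that unfolding plus_type_def by blast+
  have p43: "pd 4 (pd 3 \<sigma>) z = i / 3 * pd 3 \<sigma> z" if z: "z \<in> N" for z
  proof -
    have "pd 4 (pd 3 \<sigma>) z = pd 3 (pd 4 \<sigma>) z" by (rule sigma_commute(6)[OF z])
    also have "\<dots> = pd 3 (\<lambda>z. i / 3 * \<sigma> z) z" by (rule pd_cong[OF open_dom z p(1)])
    also have "\<dots> = i / 3 * pd 3 \<sigma> z" using d[OF z] by (subst pd_mult) simp_all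
    finally show ?thesis .
  qed
  have sf: "smooth_on N ?f" "smooth_on N ?h"
    unfolding divide_inverse by (intro smooth_intros open_dom smooth_sigma)+
  have fh: "pd 3 ?f z = 0" "pd 4 ?f z = 0" "pd 3 ?h z = 0" "pd 4 ?h z = 0" if z: "z \<in> N" for z
  proof -
    note dz = d[OF z]
    have e: "?e differentiable (at z)" "pd 3 ?e z = 0" "pd 4 ?e z = - i / 3 * ?e z" by simp_all
    have x: "(\<lambda>z. z $ 3 * pd 3 \<sigma> z) differentiable (at z)" "(\<lambda>z. \<sigma> z - z $ 3 * pd 3 \<sigma> z) differentiable (at z)"
      using dz by simp_all
    show "pd 3 ?f z = 0" "pd 4 ?f z = 0"
      unfolding pd_mult[OF e(1) dz(2)] e(2,3) p(2)[OF z] p43[OF z] by simp_all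
    show "pd 3 ?h z = 0" "pd 4 ?h z = 0"
      unfolding pd_mult[OF e(1) x(2)] pd_diff[OF dz(1) x(1)] pd_mult[OF differentiable_component dz(2)]
        e(2,3) p(1,2)[OF z] p43[OF z] by (simp_all add: field_simps)
  qed
  obtain s :: real where s: "s = 1 \<or> s = -1" and pos: "\<And>z. z \<in> N \<Longrightarrow> 0 < s * ?f z"
    by (rule constant_sign[OF smooth_on_continuous[OF sf(1)]]) (use nz in auto)
  \<comment> \<open>The witnesses solve e^(2A/3) = s f and f p + h = f (p + 2 B); on a box f has a
    constant sign s.\<close>
  define A where "A z = 3/2 * ln (s * ?f z)" for z
  define B where "B z = ?h z / (2 * ?f z)" for z
  have fnz: "?f z \<noteq> 0" if "z \<in> N" for z using nz[OF that] by simp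
  have sA: "smooth_on N A" unfolding A_def[abs_def]
    by (intro smooth_on_mult smooth_on_const smooth_on_ln sf open_dom pos)
  have sB: "smooth_on N B" unfolding B_def[abs_def]
    by (intro smooth_on_divide smooth_on_mult smooth_on_const sf open_dom) (use fnz in auto)
  note dA = smooth_on_differentiable[OF sA] and dB = smooth_on_differentiable[OF sB]
  have expA: "exp (2/3 * A z) = s * ?f z" if "z \<in> N" for z
    using pos[OF that] by (simp add: A_def)
  have ss: "s * s = 1" using s by auto
  have fA: "?f z = s * exp (2/3 * A z)" if "z \<in> N" for z
    unfolding expA[OF that] using ss by (simp flip: mult.assoc)
  have hB: "?h z = 2 * B z * ?f z" if "z \<in> N" for z
    using fnz[OF that] by (simp add: B_def)
  have pf: "pd k ?f z = s * exp (2/3 * A z) * (2/3 * pd k A z)" if z: "z \<in> N" for z k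
  proof -
    have "pd k ?f z = pd k (\<lambda>z. s * exp (2/3 * A z)) z" by (rule pd_cong[OF open_dom z fA])
    then show ?thesis using dA[OF z] by simp
  qed
  have ph: "pd k ?h z = 2 * B z * pd k ?f z + 2 * pd k B z * ?f z" if z: "z \<in> N" for z k
  proof -
    have "pd k ?h z = pd k (\<lambda>z. 2 * B z * ?f z) z" by (rule pd_cong[OF open_dom z hB])
    also have "\<dots> = 2 * B z * pd k ?f z + pd k (\<lambda>z. 2 * B z) z * ?f z"
      by (rule pd_mult) (use dB[OF z] smooth_on_differentiable[OF sf(1) z] in simp_all)
    finally show ?thesis using dB[OF z] by simp
  qed
  have A34: "pd 3 A z = 0" "pd 4 A z = 0" if z: "z \<in> N" for z
    using pf[OF z, of 3] pf[OF z, of 4] fh(1,2)[OF z] s by auto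
  have B34: "pd 3 B z = 0" "pd 4 B z = 0" if z: "z \<in> N" for z
    using ph[OF z, of 3] ph[OF z, of 4] fh[OF z] nz[OF z] by auto
  have sig: "\<sigma> z = s * (z $ 3 + 2 * B z) * exp (2/3 * A z) * exp (i * z $ 4 / 3)" if z: "z \<in> N" for z
  proof -
    have "s * (z $ 3 + 2 * B z) * exp (2/3 * A z) = z $ 3 * ?f z + 2 * B z * ?f z"
      using fA[OF z] by (simp add: algebra_simps)
    also have "\<dots> = z $ 3 * ?f z + ?h z" unfolding hB[OF z] ..
    also have "\<dots> = ?e z * \<sigma> z" by (simp add: algebra_simps)
    finally show ?thesis by (simp add: exp_minus)
  qed
  have E: "2/3 * pd 1 A z * (z $ 3 + 2 * B z) + 2 * pd 1 B z
      + z $ 3 * (2/3 * pd 2 A z * (z $ 3 + 2 * B z) + 2 * pd 2 B z)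
      + Q (jet z) - J 0 0 1 z * (z $ 3 + 2 * B z) / 3 = 0" if z: "z \<in> N" for z
  proof -
    have "plus_type i Q (\<lambda>z. s * (z $ 3 + 2 * B z) * exp (2/3 * A z) * exp (i * z $ 4 / 3)) N"
      by (rule plus_type_cong[OF open_dom sig P])
    then show ?thesis
      using plus_ansatz[OF sA A34 sB B34, of s] s z by auto
  qed
  have p3: "pd 3 (pd k A) z = 0" "pd 3 (pd k B) z = 0" if z: "z \<in> N" for z k
  proof -
    have "pd 3 (pd k A) z = pd k (pd 3 A) z" "pd 3 (pd k B) z = pd k (pd 3 B) z"
      using pd_commute[OF open_dom z sA] pd_commute[OF open_dom z sB] by blast+
    moreover have "pd k (pd 3 A) z = pd k (\<lambda>_. 0) z" "pd k (pd 3 B) z = pd k (\<lambda>_. 0) z"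
      by (rule pd_cong[OF open_dom z A34(1)], assumption) (rule pd_cong[OF open_dom z B34(1)])
    ultimately show "pd 3 (pd k A) z = 0" "pd 3 (pd k B) z = 0" by simp_all
  qed
  have dk: "pd k A differentiable (at z)" "pd k B differentiable (at z)" if z: "z \<in> N" for z k
    using smooth_on_differentiable[OF smooth_on_pd[OF sA] z] smooth_on_differentiable[OF smooth_on_pd[OF sB] z] by blast+
  \<comment> \<open>Differentiating the equation in p expresses Q_p through Q_pp, and once more, in
    \<open>E2\<close>, Q_pp through Q_ppp.\<close>
  have E1: "2/3 * pd 1 A z + 2/3 * pd 2 A z * (2 * z $ 3 + 2 * B z) + 2 * pd 2 B z
      + 2/3 * J 0 0 1 z - J 0 0 2 z * (z $ 3 + 2 * B z) / 3 = 0" if z: "z \<in> N" for z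
  proof -
    have "pd 3 (\<lambda>z. 2/3 * pd 1 A z * (z $ 3 + 2 * B z) + 2 * pd 1 B z
      + z $ 3 * (2/3 * pd 2 A z * (z $ 3 + 2 * B z) + 2 * pd 2 B z)
      + Q (jet z) - J 0 0 1 z * (z $ 3 + 2 * B z) / 3) z = pd 3 (\<lambda>_. 0) z"
      by (rule pd_cong[OF open_dom z E])
    then show ?thesis
      by (simp add: dA[OF z] dB[OF z] dk[OF z] p3[OF z] A34[OF z] B34[OF z] J_pd[OF z] J_diff[OF z] Q_pd[OF z] two_eq_Suc field_simps)
  qed
  have E2: "4/3 * pd 2 A z + 1/3 * J 0 0 2 z - J 0 0 3 z * (z $ 3 + 2 * B z) / 3 = 0" if z: "z \<in> N" for z
  proof -
    have "pd 3 (\<lambda>z. 2/3 * pd 1 A z + 2/3 * pd 2 A z * (2 * z $ 3 + 2 * B z) + 2 * pd 2 B z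
      + 2/3 * J 0 0 1 z - J 0 0 2 z * (z $ 3 + 2 * B z) / 3) z = pd 3 (\<lambda>_. 0) z"
      by (rule pd_cong[OF open_dom z E1])
    then show ?thesis
      by (simp add: dA[OF z] dB[OF z] dk[OF z] p3[OF z] A34[OF z] B34[OF z] J_pd[OF z] J_diff[OF z] Q_pd[OF z] two_eq_Suc field_simps)
  qed
  \<comment> \<open>The coefficient of p^3. It depends on x and y only because w2 = 0 makes Q_ppp
    independent of p.\<close>
  define C where "C z = J 0 0 3 z / 6" for z
  have sC: "smooth_on N C" unfolding C_def[abs_def] divide_inverse
    by (intro smooth_on_mult smooth_on_const open_dom smooth_J)
  have C34: "pd 3 C z = 0" "pd 4 C z = 0" if z: "z \<in> N" for z
    using J4[OF z] unfolding C_def[abs_def] by (simp_all add: J_pd[OF z] J_diff[OF z] Q_pd[OF z] two_eq_Suc)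
  show ?thesis
    unfolding first_family_on_def
  proof (intro exI conjI ballI)
    show "smooth_on N2 (\<lambda>q. A (emb z0 q))" by (rule descend(1)[OF sA A34])
    show "smooth_on N2 (\<lambda>q. B (emb z0 q))" by (rule descend(1)[OF sB B34])
    show "smooth_on N2 (\<lambda>q. C (emb z0 q))" by (rule descend(1)[OF sC C34])
    show "z $ 3 + 2 * B (emb z0 (base (jet z))) \<noteq> 0" if z: "z \<in> N" for z
      using sig[OF z] sigma_nonzero[OF z] descend(2)[OF sB B34 z] by auto
    have "\<rho> z = s * (exp (- (2/3) * A z) / (z $ 3 + 2 * B z) * exp (- (i * z $ 4 / 3)))" if z: "z \<in> N" for z
    proof -
      have inv_s: "inverse s = s" using s by auto
      have m: "- (2/3) * A z = - (2/3 * A z)" by simp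
      have "\<rho> z = inverse (\<sigma> z)" by simp
      also have "\<dots> = s * (exp (- (2/3) * A z) / (z $ 3 + 2 * B z) * exp (- (i * z $ 4 / 3)))"
        unfolding sig[OF z] m
        unfolding exp_minus inverse_mult_distrib inv_s divide_inverse by (simp only: mult_ac)
      finally show ?thesis .
    qed
    then show "equal_up_to_sign_on N \<rho> (\<lambda>z. exp (- (2/3) * A (emb z0 (base (jet z))))
        / (z $ 3 + 2 * B (emb z0 (base (jet z)))) * exp (- (i * z $ 4 / 3)))"
      using s descend(2)[OF sA A34] descend(2)[OF sB B34] unfolding equal_up_to_sign_on_def by auto
  next
    fix v assume "v \<in> jet ` N"
    then obtain z where z: "z \<in> N" and v: "v = jet z" by blast
    \<comment> \<open>Back substitution: Q_ppp yields Q_pp by \<open>E2\<close>, then Q_p by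
      \<open>E1\<close>, then Q by \<open>E\<close>; the result is the cubic polynomial.\<close>
    have J3: "J 0 0 3 z = 6 * C z" by (simp add: C_def)
    have J2: "J 0 0 2 z = 6 * C z * (z $ 3 + 2 * B z) - 4 * pd 2 A z"
      using E2[OF z] unfolding J3 by (simp add: algebra_simps)
    have J1: "J 0 0 1 z = J 0 0 2 z * (z $ 3 + 2 * B z) / 2 - pd 1 A z - pd 2 A z * (2 * z $ 3 + 2 * B z) - 3 * pd 2 B z"
      using E1[OF z] by (simp add: field_simps)
    have Qz: "Q (jet z) = J 0 0 1 z * (z $ 3 + 2 * B z) / 3 - 2/3 * pd 1 A z * (z $ 3 + 2 * B z) - 2 * pd 1 B z
      - z $ 3 * (2/3 * pd 2 A z * (z $ 3 + 2 * B z) + 2 * pd 2 B z)"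
      using E[OF z] by simp
    have DA: "pd 1 (\<lambda>q. A (emb z0 q)) (base (jet z)) = pd 1 A z" "pd 2 (\<lambda>q. A (emb z0 q)) (base (jet z)) = pd 2 A z"
      by (rule descend(3)[OF sA A34 z], assumption+) (rule descend(4)[OF sA A34 z], assumption+)
    have DB: "pd 1 (\<lambda>q. B (emb z0 q)) (base (jet z)) = pd 1 B z" "pd 2 (\<lambda>q. B (emb z0 q)) (base (jet z)) = pd 2 B z"
      by (rule descend(3)[OF sB B34 z], assumption+) (rule descend(4)[OF sB B34 z], assumption+)
    have DC: "B (emb z0 (base (jet z))) = B z" "C (emb z0 (base (jet z))) = C z"
      by (rule descend(2)[OF sB B34 z], assumption+) (rule descend(2)[OF sC C34 z], assumption+)
    show "Q v = cubic_rhs (\<lambda>q. A (emb z0 q)) (\<lambda>q. B (emb z0 q)) (\<lambda>q. C (emb z0 q)) v"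
      by (simp only: cubic_rhs_def Let_def v DA DB DC jet_nth Qz J1 J2)
        (simp add: field_simps power2_eq_square power3_eq_cube)
  qed
qed

text \<open>With sigma_p = 0 only one function A is left in sigma, and the equation says Q_p = 2 A_x
  + 2 p A_y. Integration in p leaves an arbitrary function of x and y.\<close>

lemma second_family_if:
  assumes P: "plus_type i Q \<sigma> N" and 3: "\<And>z. z \<in> N \<Longrightarrow> pd 3 \<sigma> z = 0"
  shows "second_family_on i Q \<rho> N"
proof -
  let ?e = "\<lambda>z::real^4. exp (- (i * z $ 4 / 3))"
  let ?f = "\<lambda>z. ?e z * \<sigma> z"
  have d: "\<sigma> differentiable (at z)" if "z \<in> N" for z
    using pd_sigma_differentiable that by blast
  have p4: "pd 4 \<sigma> z = i / 3 * \<sigma> z" if "z \<in> N" for z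
    using P that unfolding plus_type_def by blast
  have sf: "smooth_on N ?f"
    unfolding divide_inverse[of "_ :: real" 3] by (intro smooth_intros open_dom smooth_sigma)
  have f34: "pd 3 ?f z = 0" "pd 4 ?f z = 0" if z: "z \<in> N" for z
  proof -
    have e: "?e differentiable (at z)" "pd 3 ?e z = 0" "pd 4 ?e z = - i / 3 * ?e z" by simp_all
    show "pd 3 ?f z = 0" "pd 4 ?f z = 0"
      unfolding pd_mult[OF e(1) d[OF z]] e(2,3) 3[OF z] p4[OF z] by simp_all
  qed
  obtain s :: real where s: "s = 1 \<or> s = -1" and pos: "\<And>z. z \<in> N \<Longrightarrow> 0 < s * ?f z"
    by (rule constant_sign[OF smooth_on_continuous[OF sf]]) (use sigma_nonzero in auto)
  define A where "A z = 3/2 * ln (s * ?f z)" for z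
  have sA: "smooth_on N A" unfolding A_def[abs_def]
    by (intro smooth_on_mult smooth_on_const smooth_on_ln sf open_dom pos)
  note dA = smooth_on_differentiable[OF sA]
  have expA: "exp (2/3 * A z) = s * ?f z" if "z \<in> N" for z
    using pos[OF that] by (simp add: A_def)
  have ss: "s * s = 1" using s by auto
  have fA: "?f z = s * exp (2/3 * A z)" if "z \<in> N" for z
    unfolding expA[OF that] using ss by (simp flip: mult.assoc)
  have pf: "pd k ?f z = s * exp (2/3 * A z) * (2/3 * pd k A z)" if z: "z \<in> N" for z k
  proof -
    have "pd k ?f z = pd k (\<lambda>z. s * exp (2/3 * A z)) z" by (rule pd_cong[OF open_dom z fA])
    then show ?thesis using dA[OF z] by simp
  qed
  have A34: "pd 3 A z = 0" "pd 4 A z = 0" if z: "z \<in> N" for z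
    using pf[OF z, of 3] pf[OF z, of 4] f34[OF z] s by auto
  have sig: "\<sigma> z = s * exp (2/3 * A z) * exp (i * z $ 4 / 3)" if z: "z \<in> N" for z
    unfolding fA[OF z, symmetric] by (simp add: exp_minus)
  have E: "J 0 0 1 z = 2 * pd 1 A z + 2 * z $ 3 * pd 2 A z" if z: "z \<in> N" for z
  proof -
    have "plus_type i Q (\<lambda>z. s * exp (2/3 * A z) * exp (i * z $ 4 / 3)) N"
      by (rule plus_type_cong[OF open_dom sig P])
    then show ?thesis
      using plus_ansatz_constant[OF sA A34, of s] s z by auto
  qed
  have p3: "pd 3 (pd k A) z = 0" if z: "z \<in> N" for z k
  proof -
    have "pd 3 (pd k A) z = pd k (pd 3 A) z" by (rule pd_commute[OF open_dom z sA])
    also have "\<dots> = pd k (\<lambda>_. 0) z" by (rule pd_cong[OF open_dom z A34(1)])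
    finally show ?thesis by simp
  qed
  have p4A: "pd 4 (pd k A) z = 0" if z: "z \<in> N" for z k
  proof -
    have "pd 4 (pd k A) z = pd k (pd 4 A) z" by (rule pd_commute[OF open_dom z sA])
    also have "\<dots> = pd k (\<lambda>_. 0) z" by (rule pd_cong[OF open_dom z A34(2)])
    finally show ?thesis by simp
  qed
  have dk: "pd k A differentiable (at z)" if z: "z \<in> N" for z k
    using smooth_on_differentiable[OF smooth_on_pd[OF sA] z] .
  \<comment> \<open>The constant of integration: Q minus a p-antiderivative of 2 A_x + 2 p
    A_y.\<close>
  define B where "B z = J 0 0 0 z - (z $ 3)^2 * pd 2 A z - 2 * z $ 3 * pd 1 A z" for z
  have sB: "smooth_on N B" unfolding B_def[abs_def]
    by (intro smooth_intros smooth_J sA open_dom)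
  have B34: "pd 3 B z = 0" "pd 4 B z = 0" if z: "z \<in> N" for z
    unfolding B_def[abs_def] using E[OF z]
    by (simp_all add: dk[OF z] p3[OF z] p4A[OF z] J_pd[OF z] J_diff[OF z] Q_pd[OF z] two_eq_Suc algebra_simps)
  show ?thesis
    unfolding second_family_on_def
  proof (intro exI conjI ballI)
    show "smooth_on N2 (\<lambda>q. A (emb z0 q))" by (rule descend(1)[OF sA A34])
    show "smooth_on N2 (\<lambda>q. B (emb z0 q))" by (rule descend(1)[OF sB B34])
    have "\<rho> z = s * (exp (- (2/3) * A z) * exp (- (i * z $ 4 / 3)))" if z: "z \<in> N" for z
    proof -
      have inv_s: "inverse s = s" using s by auto
      have m: "- (2/3) * A z = - (2/3 * A z)" by simp
      have "\<rho> z = inverse (\<sigma> z)" by simp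
      also have "\<dots> = s * (exp (- (2/3) * A z) * exp (- (i * z $ 4 / 3)))"
        unfolding sig[OF z] m
        unfolding exp_minus inverse_mult_distrib inv_s divide_inverse by (simp only: mult_ac)
      finally show ?thesis .
    qed
    then show "equal_up_to_sign_on N \<rho> (\<lambda>z. exp (- (2/3) * A (emb z0 (base (jet z)))) * exp (- (i * z $ 4 / 3)))"
      using s descend(2)[OF sA A34] unfolding equal_up_to_sign_on_def by auto
  next
    fix v assume "v \<in> jet ` N"
    then obtain z where z: "z \<in> N" and v: "v = jet z" by blast
    show "Q v = quadratic_rhs (\<lambda>q. A (emb z0 q)) (\<lambda>q. B (emb z0 q)) v"
    proof -
      have "pd 1 (\<lambda>q. A (emb z0 q)) (base (jet z)) = pd 1 A z" "pd 2 (\<lambda>q. A (emb z0 q)) (base (jet z)) = pd 2 A z"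
        by (rule descend(3)[OF sA A34 z], assumption+) (rule descend(4)[OF sA A34 z], assumption+)
      moreover have "B (emb z0 (base (jet z))) = B z" by (rule descend(2)[OF sB B34 z])
      ultimately show ?thesis
        by (simp only: quadratic_rhs_def Let_def v) (simp add: B_def)
    qed
  qed
qed

text \<open>The scale factor without its exponential has vanishing p- and phi-derivatives and
  descends to a function on the base; \<open>third_equation\<close> then translates the linear
  equation for its reciprocal.\<close>

lemma third_family_if:
  assumes P: "minus_type i Q \<sigma> N"
  shows "third_family_on i Q \<rho> N"
proof -
  let ?e = "\<lambda>z::real^4. exp (- (i * z $ 4 / 3))"
  define A where "A z = ?e z * \<rho> z" for z
  have nz: "A z \<noteq> 0" if "z \<in> N" for z using rho_nonzero[OF that] by (simp add: A_def)
  have sA: "smooth_on N A"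
    unfolding A_def[abs_def] divide_inverse[of "_ :: real" 3] by (intro smooth_intros open_dom smooth_rho)
  note dA = smooth_on_differentiable[OF sA]
  have sig: "\<sigma> z = ?e z * (1 / A z)" for z by (simp add: A_def exp_minus field_simps)
  have ps: "pd 4 \<sigma> z = - i / 3 * \<sigma> z" "pd 3 \<sigma> z = 0" if "z \<in> N" for z
    using P that unfolding minus_type_def by blast+
  have A34: "pd 3 A z = 0" "pd 4 A z = 0" if z: "z \<in> N" for z
  proof -
    have s: "pd k \<sigma> z = pd k (\<lambda>z. ?e z * (1 / A z)) z" for k by (simp only: sig)
    have e: "?e differentiable (at z)" "pd 3 ?e z = 0" "pd 4 ?e z = - i / 3 * ?e z" by simp_all
    have i: "(\<lambda>z. 1 / A z) differentiable (at z)" "pd k (\<lambda>z. 1 / A z) z = - pd k A z / (A z * A z)" for k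
      using dA[OF z] nz[OF z] by simp_all
    show "pd 3 A z = 0" "pd 4 A z = 0"
      using ps[OF z] nz[OF z] unfolding s pd_mult[OF e(1) i(1)] e(2,3) i(2) unfolding sig by simp_all
  qed
  let ?a = "\<lambda>q. A (emb z0 q)"
  have sa: "smooth_on N2 ?a" by (rule descend(1)[OF sA A34])
  have a: "?a (base (jet z)) = A z" if "z \<in> N" for z by (rule descend(2)[OF sA A34 that])
  have sm: "smooth_on N (\<lambda>z. 1 / ?a (base (jet z)))"
    by (intro smooth_on_divide smooth_on_const smooth_on_base_jet[OF sa] open_dom) (simp add: a nz)
  have p: "pd k (\<lambda>z. 1 / ?a (base (jet z))) z = 0" if z: "z \<in> N" and k: "k = 3 \<or> k = 4" for z k
    using k base_jet_rules(3,4)[OF sa z] smooth_on_differentiable[OF smooth_on_base_jet[OF sa] z] nz[OF z] a[OF z]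
    by auto
  have "minus_type i Q (\<lambda>z. ?e z * (1 / ?a (base (jet z)))) N"
    by (rule minus_type_cong[OF open_dom smooth_Q _ P]) (simp only: sig a)
  then have E: "minus_op (\<lambda>z. 1 / ?a (base (jet z))) z = 0" if "z \<in> N" for z
    using minus_ansatz[OF sm p p] that by simp
  show ?thesis
    unfolding third_family_on_def
  proof (intro exI conjI ballI)
    show "smooth_on N2 ?a" by (rule sa)
    show "\<rho> z = ?a (base (jet z)) * exp (i * z $ 4 / 3)" if "z \<in> N" for z
      unfolding a[OF that] by (simp add: A_def exp_minus)
  next
    fix v assume "v \<in> jet ` N"
    then obtain z where z: "z \<in> N" and v: "v = jet z" by blast
    show "let D = total_deriv Q; A = \<lambda>v. ?a (base v); Qy = pd 2 Q; Qp = pd 3 Q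
      in 36 * (D A v)^2 + 6 * A v * (- 3 * D (D A) v + Qp v * D A v)
         + (A v)^2 * (6 * D Qp v - 18 * Qy v - 4 * (Qp v)^2) = 0"
      unfolding Let_def v using third_equation[OF sa z] a nz E[OF z] by simp
  qed
qed

end

section \<open>Assembly: conformal flatness, dense families, and the cosmological constant\<close>

section \<open>The classification\<close>

lemma fefferman_rescale: "(c z)\<^sup>2 *\<^sub>R fefferman i Q \<rho> z = fefferman i Q (\<lambda>z. c z * \<rho> z) z"
  by (simp add: fefferman_def Let_def power_mult_distrib mult_ac)

lemma open_nonzero_set:
  fixes f :: "'a::topological_space \<Rightarrow> real"
  assumes "open U" "continuous_on U f"
  shows "open {z \<in> U. f z \<noteq> 0}"
proof -
  have "{z \<in> U. f z \<noteq> 0} = U \<inter> f -` (- {0})" by auto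
  then show ?thesis using continuous_open_preimage[OF assms(2,1) open_Compl[OF closed_singleton[of 0]]] by simp
qed

lemma zero_on_closure:
  fixes f :: "'a::topological_space \<Rightarrow> real"
  assumes "open U" "continuous_on U f" "U \<subseteq> closure G" "\<And>z. z \<in> G \<Longrightarrow> f z = 0" "z \<in> U"
  shows "f z = 0"
proof (rule ccontr)
  assume "f z \<noteq> 0"
  moreover have "{z \<in> U. f z \<noteq> 0} \<inter> G = {}" using assms(4) by blast
  then have "{z \<in> U. f z \<noteq> 0} \<inter> closure G = {}"
    using open_Int_closure_eq_empty[OF open_nonzero_set[OF assms(1,2)]] by blast
  ultimately show False using assms(3,5) by blast
qed

lemma plus_type_subset: "plus_type i Q \<sigma> U \<Longrightarrow> N \<subseteq> U \<Longrightarrow> plus_type i Q \<sigma> N"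
  unfolding plus_type_def by blast

lemma minus_type_subset: "minus_type i Q \<sigma> U \<Longrightarrow> N \<subseteq> U \<Longrightarrow> minus_type i Q \<sigma> N"
  unfolding minus_type_def by blast

context fefferman_metric
begin

lemma smooth_w1: "smooth_on (jet ` U) (w1 Q)"
  unfolding w1_def[abs_def] Let_def total_deriv_def[abs_def]
  by (intro smooth_intros open_jet_dom smooth_Q)

lemma smooth_w2: "smooth_on (jet ` U) (w2 Q)"
  unfolding w2_def by (intro smooth_on_pd smooth_Q)

text \<open>A local solution beta of the second equation, multiplied by e^(-i phi/3), serves as
  reciprocal scale factor; \<open>minus_type_flat_on\<close> makes the resulting metric
  flat.\<close>

lemma conformally_flat:
  assumes w1: "\<And>v. v \<in> jet ` U \<Longrightarrow> w1 Q v = 0" and w2: "\<And>v. v \<in> jet ` U \<Longrightarrow> w2 Q v = 0"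
  shows "conformally_flat_on U (fefferman i Q \<rho>)"
  unfolding conformally_flat_on_def locally_everywhere_def
proof
  fix z0 assume z0: "z0 \<in> U"
  interpret P: jet_patch Q "jet ` U" by unfold_locales (rule open_jet_dom, rule smooth_Q)
  have w2': "mpd 0 0 4 Q v = 0" if "v \<in> jet ` U" for v using w2[OF that] by (simp add: P.w2_jets)
  obtain S \<beta> where S: "open S" "jet z0 \<in> S" "S \<subseteq> jet ` U" "\<beta> (jet z0) = 1" "smooth_on S \<beta>"
    and b3: "\<And>v. v \<in> S \<Longrightarrow> pd 3 \<beta> v = 0" and bm: "\<And>v. v \<in> S \<Longrightarrow> P.eq_minus \<beta> v = 0"
    by (rule P.local_solution[OF w1 w2' imageI[OF z0]]) auto
  \<comment> \<open>beta equals 1 at the given point but may vanish elsewhere in \<open>S\<close>,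
    so the neighbourhood is cut down to the set where it is nonzero.\<close>
  define N where "N = U \<inter> jet -` {v \<in> S. \<beta> v \<noteq> 0}"
  have "open (jet -` {v \<in> S. \<beta> v \<noteq> 0})"
    by (rule open_vimage[OF open_nonzero_set[OF S(1) smooth_on_continuous[OF S(5)]]
          linear_continuous_on[OF bounded_linear_jet]])
  then have N: "open N" "z0 \<in> N" "N \<subseteq> U"
    unfolding N_def using z0 S(2,4) open_dom by auto
  let ?G = "\<lambda>z. \<beta> (jet z)"
  define \<tau> where "\<tau> z = exp (- (i * z $ 4 / 3)) * ?G z" for z
  have jN: "jet ` N \<subseteq> S" by (auto simp: N_def)
  have G: "smooth_on N ?G" by (rule smooth_on_jet[OF N(1) smooth_on_subset[OF S(5) jN]])
  have st: "smooth_on N \<tau>"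
    unfolding \<tau>_def[abs_def] divide_inverse by (intro smooth_intros N(1) G)
  have tnz: "\<tau> z \<noteq> 0" if "z \<in> N" for z using that by (simp add: \<tau>_def N_def)
  interpret M: fefferman_metric i Q N "\<lambda>z. inverse (\<tau> z)"
    using subpatch[OF N(1,3)] smooth_on_inverse[OF N(1) st tnz] tnz
    by (simp add: fefferman_metric_def fefferman_metric_axioms_def scale_factor_on_def)
  have pG: "pd 3 ?G z = 0" "pd 4 ?G z = 0" if "z \<in> N" for z
    using jN that b3 smooth_on_differentiable[OF S(5)] by (simp_all add: image_subset_iff)
  have "M.minus_op ?G z = 0" if z: "z \<in> N" for z
    using M.eq_minus_slice[OF G z] bm[of "jet z"] jN z by auto
  then have "minus_type i Q (\<lambda>z. exp (- (i * z $ 4 / 3)) * ?G z) N"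
    using M.minus_ansatz[OF G pG] by blast
  then have "minus_type i Q (\<lambda>z. inverse (inverse (\<tau> z))) N" by (simp add: \<tau>_def)
  then have flat: "flat_on N (fefferman i Q (\<lambda>z. inverse (\<tau> z)))"
    by (rule M.minus_type_flat_on) (use w2 N(3) in blast)
  \<comment> \<open>The factor that removes the given scale factor and installs the flat
    one.\<close>
  let ?c = "\<lambda>z. inverse (\<tau> z) / \<rho> z"
  have c: "scale_factor_on N ?c"
    unfolding scale_factor_on_def using N(3) rho_nonzero tnz
    by (auto intro!: smooth_on_divide N(1) smooth_on_inverse st smooth_on_subset[OF smooth_rho])
  have e: "(?c z)\<^sup>2 *\<^sub>R fefferman i Q \<rho> z = fefferman i Q (\<lambda>z. inverse (\<tau> z)) z" if "z \<in> N" for z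
  proof -
    have cz: "?c z * \<rho> z = inverse (\<tau> z)" using rho_nonzero that N(3) by (simp add: subset_iff)
    have "(?c z)\<^sup>2 *\<^sub>R fefferman i Q \<rho> z = (?c z * \<rho> z)\<^sup>2 *\<^sub>R h z"
      by (rule trans[OF fefferman_rescale[where c="?c"] fefferman_scale])
    also have "\<dots> = fefferman i Q (\<lambda>z. inverse (\<tau> z)) z"
      unfolding cz by (rule fefferman_scale[symmetric])
    finally show ?thesis .
  qed
  have "flat_on N (\<lambda>z. (?c z)\<^sup>2 *\<^sub>R fefferman i Q \<rho> z)"
    using flat unfolding flat_on_def by (simp add: riemann_cong[OF N(1) _ e])
  then show "\<exists>N. open N \<and> z0 \<in> N \<and> N \<subseteq> U \<and> (\<exists>\<sigma>. scale_factor_on N \<sigma> \<and>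
      flat_on N (\<lambda>z. (\<sigma> z)\<^sup>2 *\<^sub>R fefferman i Q \<rho> z))"
    using N c by blast
qed

text \<open>A rescaled Fefferman metric is the Fefferman metric of the same Q with scale factor c
  rho. If both invariants were nonzero, the obstructions would annihilate both parts of the
  nonvanishing sigma.\<close>

lemma conformally_einstein_w1_or_w2:
  assumes "conformally_einstein_on U (fefferman i Q \<rho>)" "z \<in> U"
  shows "w1 Q (jet z) = 0 \<or> w2 Q (jet z) = 0"
proof -
  obtain N c \<Lambda> where N: "open N" "z \<in> N" "N \<subseteq> U" and c: "scale_factor_on N c"
    and E: "einstein_on N (\<lambda>z. (c z)\<^sup>2 *\<^sub>R fefferman i Q \<rho> z) \<Lambda>"
    using assms unfolding conformally_einstein_on_def locally_everywhere_def by blast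
  interpret M: fefferman_metric i Q N "\<lambda>z. c z * \<rho> z"
    using subpatch[OF N(1,3)] c smooth_on_subset[OF smooth_rho N(3)] rho_nonzero N(1,3)
    by (auto simp: fefferman_metric_def fefferman_metric_axioms_def scale_factor_on_def intro!: smooth_on_mult)
  have "(\<lambda>z. (c z)\<^sup>2 *\<^sub>R fefferman i Q \<rho> z) = fefferman i Q (\<lambda>z. c z * \<rho> z)"
    by (rule ext) (rule fefferman_rescale[where c=c])
  then show ?thesis using M.einstein_w1_or_w2[OF _ N(2)] E by simp
qed

lemma obtain_fefferman_box:
  assumes "open V" "z \<in> V" "V \<subseteq> U"
  obtains a b where "fefferman_box a b z i Q \<rho>" "z \<in> box a b" "box a b \<subseteq> V"
proof -
  obtain a b where ab: "z \<in> box a b" "box a b \<subseteq> V" by (rule obtain_box[OF assms(1,2)])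
  have "fefferman_metric i Q (box a b) \<rho>"
    by (rule submetric[OF open_box]) (use ab assms(3) in blast)
  then show ?thesis
    using that[of a b] ab by (simp add: fefferman_box_def coordinate_box_def)
qed

text \<open>The first family covers the open set where sigma_p is nonzero, the second one the
  interior of its zero set. The boundary between the two contains no open set, so their union is
  dense.\<close>

lemma locally_generic_if_plus_type:
  assumes P: "plus_type i Q \<sigma> U" and w2: "\<And>v. v \<in> jet ` U \<Longrightarrow> w2 Q v = 0"
  shows "locally_generic U (\<lambda>N. first_family_on i Q \<rho> N \<or> second_family_on i Q \<rho> N)"
proof -
  define G where "G = {z\<in>U. \<exists>N. open N \<and> z \<in> N \<and> N \<subseteq> U \<and>
    (first_family_on i Q \<rho> N \<or> second_family_on i Q \<rho> N)}"
  have 1: "y \<in> G" if V: "open V" "y \<in> V" "V \<subseteq> U" and nz: "\<And>z. z \<in> V \<Longrightarrow> pd 3 \<sigma> z \<noteq> 0" for V y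
  proof -
    obtain a b where B: "fefferman_box a b y i Q \<rho>" "y \<in> box a b" "box a b \<subseteq> V"
      by (rule obtain_fefferman_box[OF V])
    have "first_family_on i Q \<rho> (box a b)"
      by (rule fefferman_box.first_family_if[OF B(1) plus_type_subset[OF P]]) (use B V nz w2 in blast)+
    then show ?thesis unfolding G_def using B V open_box by blast
  qed
  have 2: "y \<in> G" if V: "open V" "y \<in> V" "V \<subseteq> U" and nz: "\<And>z. z \<in> V \<Longrightarrow> pd 3 \<sigma> z = 0" for V y
  proof -
    obtain a b where B: "fefferman_box a b y i Q \<rho>" "y \<in> box a b" "box a b \<subseteq> V"
      by (rule obtain_fefferman_box[OF V])
    have "second_family_on i Q \<rho> (box a b)"
      by (rule fefferman_box.second_family_if[OF B(1) plus_type_subset[OF P]]) (use B V nz in blast)+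
    then show ?thesis unfolding G_def using B V open_box by blast
  qed
  have "z \<in> closure G" if z: "z \<in> U" for z
  proof (rule ccontr)
    assume nz: "z \<notin> closure G"
    \<comment> \<open>A nonempty open set avoiding \<open>G\<close> would contain a point with
      sigma_p nonzero, or sigma_p would vanish on all of it; either way it meets
      \<open>G\<close>.\<close>
    define V where "V = U - closure G"
    have V: "open V" "z \<in> V" "V \<subseteq> U" "V \<inter> G = {}"
      using z nz open_dom closure_subset[of G] unfolding V_def by auto
    show False
    proof (cases "\<exists>y\<in>V. pd 3 \<sigma> y \<noteq> 0")
      case True
      have "open {y \<in> V. pd 3 \<sigma> y \<noteq> 0}"
        by (intro open_nonzero_set V(1) smooth_on_continuous smooth_on_pd smooth_on_subset[OF smooth_sigma V(3)])
      then show False using 1[of "{y \<in> V. pd 3 \<sigma> y \<noteq> 0}"] True V(3,4) by blast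
    next
      case False
      then show False using 2[OF V(1-3)] V(2,4) by blast
    qed
  qed
  then show ?thesis unfolding locally_generic_def G_def[symmetric] by blast
qed

text \<open>The conditions of \<open>plus_type\<close> are equations between continuous functions on
  \<open>U\<close>. They hold at each point of the dense set covered by the families and hence on
  all of \<open>U\<close>.\<close>

lemma plus_type_if_locally_generic:
  assumes "locally_generic U (\<lambda>N. first_family_on i Q \<rho> N \<or> second_family_on i Q \<rho> N)"
  shows "plus_type i Q \<sigma> U"
proof -
  define G where "G = {z\<in>U. \<exists>N. open N \<and> z \<in> N \<and> N \<subseteq> U \<and>
    (first_family_on i Q \<rho> N \<or> second_family_on i Q \<rho> N)}"
  have cl: "U \<subseteq> closure G" using assms unfolding locally_generic_def G_def .
  have p: "plus_type i Q \<sigma> {z}" if zG: "z \<in> G" for z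
  proof -
    obtain N where N: "open N" "z \<in> N" "N \<subseteq> U" "first_family_on i Q \<rho> N \<or> second_family_on i Q \<rho> N"
      using zG unfolding G_def by blast
    interpret M: fefferman_metric i Q N \<rho> by (rule submetric[OF N(1,3)])
    have "plus_type i Q \<sigma> N"
      using N(4) by (elim disjE) (rule M.first_family_plus_type, assumption, rule M.second_family_plus_type)
    then show ?thesis by (rule plus_type_subset) (use N(2) in simp)
  qed
  have "pd 4 \<sigma> z - i / 3 * \<sigma> z = 0" if "z \<in> U" for z
  proof (rule zero_on_closure[OF open_dom _ cl _ that])
    show "continuous_on U (\<lambda>z. pd 4 \<sigma> z - i / 3 * \<sigma> z)"
      by (intro smooth_on_continuous smooth_intros smooth_sigma open_dom)
  qed (use p in \<open>simp add: plus_type_def\<close>)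
  moreover have "pd 3 (pd 3 \<sigma>) z = 0" if "z \<in> U" for z
  proof (rule zero_on_closure[OF open_dom _ cl _ that])
    show "continuous_on U (pd 3 (pd 3 \<sigma>))"
      by (intro smooth_on_continuous smooth_intros smooth_sigma open_dom)
  qed (use p in \<open>simp add: plus_type_def\<close>)
  moreover have "pd 1 \<sigma> z + z $ 3 * pd 2 \<sigma> z + J 0 0 0 z * pd 3 \<sigma> z - J 0 0 1 z * \<sigma> z * (1 / 3) = 0"
    if "z \<in> U" for z
  proof (rule zero_on_closure[OF open_dom _ cl _ that])
    show "continuous_on U (\<lambda>z. pd 1 \<sigma> z + z $ 3 * pd 2 \<sigma> z + J 0 0 0 z * pd 3 \<sigma> z - J 0 0 1 z * \<sigma> z * (1 / 3))"
      by (intro smooth_on_continuous smooth_intros smooth_sigma smooth_J open_dom)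
  qed (use p in \<open>simp add: plus_type_def\<close>)
  ultimately show ?thesis unfolding plus_type_def by simp
qed

lemma locally_third_family_if:
  assumes P: "minus_type i Q \<sigma> U"
  shows "locally_everywhere U (third_family_on i Q \<rho>)"
  unfolding locally_everywhere_def
proof
  fix z assume z: "z \<in> U"
  obtain a b where B: "fefferman_box a b z i Q \<rho>" "z \<in> box a b" "box a b \<subseteq> U"
    by (rule obtain_fefferman_box[OF open_dom z order_refl])
  have "third_family_on i Q \<rho> (box a b)"
    by (rule fefferman_box.third_family_if[OF B(1) minus_type_subset[OF P B(3)]])
  then show "\<exists>N. open N \<and> z \<in> N \<and> N \<subseteq> U \<and> third_family_on i Q \<rho> N"
    using B open_box by blast
qed

lemma ricci_flat_if_locally_third:
  assumes "locally_everywhere U (third_family_on i Q \<rho>)"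
  shows "ricci_flat_on U (fefferman i Q \<rho>)"
  unfolding ricci_flat_on_def
proof
  fix z assume "z \<in> U"
  then obtain N where N: "open N" "z \<in> N" "N \<subseteq> U" "third_family_on i Q \<rho> N"
    using assms unfolding locally_everywhere_def by blast
  interpret M: fefferman_metric i Q N \<rho> by (rule submetric[OF N(1,3)])
  show "ricci (fefferman i Q \<rho>) z = 0"
    using M.minus_type_ricci_flat_on[OF M.third_family_minus_type[OF N(4)]] N(2)
    by (simp add: ricci_flat_on_def)
qed

text \<open>A metric that is not conformally flat has a point where w1 or w2 is nonzero. Near it one
  exponential alone survives, so the metric is Ricci flat there, and \<open>\<Lambda>\<close> times
  a nonzero matrix vanishes.\<close>

lemma einstein_constant_zero:
  assumes E: "einstein_on U (fefferman i Q \<rho>) \<Lambda>" and nf: "\<not> conformally_flat_on U (fefferman i Q \<rho>)"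
  shows "\<Lambda> = 0"
proof -
  obtain z where z: "z \<in> U" and nz: "w1 Q (jet z) \<noteq> 0 \<or> w2 Q (jet z) \<noteq> 0"
    using conformally_flat nf by blast
  have c: "open {z \<in> U. w1 Q (jet z) \<noteq> 0}" "open {z \<in> U. w2 Q (jet z) \<noteq> 0}"
    by (intro open_nonzero_set open_dom smooth_on_continuous smooth_on_jet[where F="w1 Q"] smooth_on_jet[where F="w2 Q"]
        smooth_w1 smooth_w2)+
  have "ricci (fefferman i Q \<rho>) z = 0"
    using nz
  proof
    assume "w1 Q (jet z) \<noteq> 0"
    let ?N = "{z \<in> U. w1 Q (jet z) \<noteq> 0}"
    interpret M: fefferman_metric i Q ?N \<rho> by (rule submetric[OF c(1)]) blast
    have "einstein_on ?N (fefferman i Q \<rho>) \<Lambda>" using E by (simp add: einstein_on_def)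
    then have "ricci_flat_on ?N (fefferman i Q \<rho>)"
      by (intro M.plus_type_ricci_flat_on M.einstein_plus_type) auto
    then show ?thesis using z \<open>w1 Q (jet z) \<noteq> 0\<close> by (simp add: ricci_flat_on_def)
  next
    assume "w2 Q (jet z) \<noteq> 0"
    let ?N = "{z \<in> U. w2 Q (jet z) \<noteq> 0}"
    interpret M: fefferman_metric i Q ?N \<rho> by (rule submetric[OF c(2)]) blast
    have "einstein_on ?N (fefferman i Q \<rho>) \<Lambda>" using E by (simp add: einstein_on_def)
    then have "ricci_flat_on ?N (fefferman i Q \<rho>)"
      by (intro M.minus_type_ricci_flat_on M.einstein_minus_type) auto
    then show ?thesis using z \<open>w2 Q (jet z) \<noteq> 0\<close> by (simp add: ricci_flat_on_def)
  qed
  then show ?thesis using E z fefferman_nonzero[OF z] by (simp add: einstein_on_def)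
qed

end

theorem mainTheorem5:
  fixes i :: real and Q :: "real^3 \<Rightarrow> real"
    and \<rho> :: "real^4 \<Rightarrow> real" and U :: "(real^4) set"
  assumes "i \<noteq> 0"
    and "open U"
    and "smooth_on (jet ` U) Q"
    and "scale_factor_on U \<rho>"
  shows "(conformally_einstein_on U (fefferman i Q \<rho>) \<longrightarrow>
       (\<forall>v\<in>jet ` U. (w1 Q v = 0 \<and> w2 Q v = 0) \<or> (w2 Q v = 0 \<and> w1 Q v \<noteq> 0)
                       \<or> (w2 Q v \<noteq> 0 \<and> w1 Q v = 0)))
    \<and> ((\<forall>v\<in>jet ` U. w1 Q v = 0 \<and> w2 Q v = 0) \<longrightarrow>
       conformally_flat_on U (fefferman i Q \<rho>))
    \<and> ((\<forall>v\<in>jet ` U. w2 Q v = 0 \<and> w1 Q v \<noteq> 0) \<longrightarrow>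
       ((\<exists>\<Lambda>. einstein_on U (fefferman i Q \<rho>) \<Lambda>) \<longleftrightarrow>
          locally_generic U (\<lambda>N. first_family_on i Q \<rho> N \<or> second_family_on i Q \<rho> N))
       \<and> ((\<exists>\<Lambda>. einstein_on U (fefferman i Q \<rho>) \<Lambda>) \<longrightarrow>
          ricci_flat_on U (fefferman i Q \<rho>)))
    \<and> ((\<forall>v\<in>jet ` U. w2 Q v \<noteq> 0 \<and> w1 Q v = 0) \<longrightarrow>
       ((\<exists>\<Lambda>. einstein_on U (fefferman i Q \<rho>) \<Lambda>) \<longleftrightarrow>
          locally_everywhere U (third_family_on i Q \<rho>))
       \<and> ((\<exists>\<Lambda>. einstein_on U (fefferman i Q \<rho>) \<Lambda>) \<longrightarrow>
          ricci_flat_on U (fefferman i Q \<rho>)))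
    \<and> (\<forall>\<Lambda>. einstein_on U (fefferman i Q \<rho>) \<Lambda> \<and>
            \<not> conformally_flat_on U (fefferman i Q \<rho>) \<longrightarrow> \<Lambda> = 0)"
proof -
  interpret fefferman_metric i Q U \<rho> by unfold_locales (fact assms)+
  let ?g = "fefferman i Q \<rho>"
  have 1: "(w1 Q v = 0 \<and> w2 Q v = 0) \<or> (w2 Q v = 0 \<and> w1 Q v \<noteq> 0) \<or> (w2 Q v \<noteq> 0 \<and> w1 Q v = 0)"
    if "conformally_einstein_on U ?g" "v \<in> jet ` U" for v
    using conformally_einstein_w1_or_w2[OF that(1)] that(2) by auto
  have 2: "conformally_flat_on U ?g" if "\<forall>v\<in>jet ` U. w1 Q v = 0 \<and> w2 Q v = 0"
    by (rule conformally_flat) (use that in auto)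
  have plus: "plus_type i Q \<sigma> U" if "\<forall>v\<in>jet ` U. w2 Q v = 0 \<and> w1 Q v \<noteq> 0" "einstein_on U ?g \<Lambda>" for \<Lambda>
    by (rule einstein_plus_type[OF that(2)]) (use that(1) in auto)
  have minus: "minus_type i Q \<sigma> U" if "\<forall>v\<in>jet ` U. w2 Q v \<noteq> 0 \<and> w1 Q v = 0" "einstein_on U ?g \<Lambda>" for \<Lambda>
    by (rule einstein_minus_type[OF that(2)]) (use that(1) in auto)
  have 3: "((\<exists>\<Lambda>. einstein_on U ?g \<Lambda>) \<longleftrightarrow>
          locally_generic U (\<lambda>N. first_family_on i Q \<rho> N \<or> second_family_on i Q \<rho> N))
       \<and> ((\<exists>\<Lambda>. einstein_on U ?g \<Lambda>) \<longrightarrow> ricci_flat_on U ?g)"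
    if w: "\<forall>v\<in>jet ` U. w2 Q v = 0 \<and> w1 Q v \<noteq> 0"
  proof (intro conjI iffI impI)
    assume "\<exists>\<Lambda>. einstein_on U ?g \<Lambda>"
    then have P: "plus_type i Q \<sigma> U" using plus[OF w] by (elim exE)
    show "locally_generic U (\<lambda>N. first_family_on i Q \<rho> N \<or> second_family_on i Q \<rho> N)"
      by (rule locally_generic_if_plus_type[OF P]) (use w in auto)
    show "ricci_flat_on U ?g" by (rule plus_type_ricci_flat_on[OF P])
  next
    assume "locally_generic U (\<lambda>N. first_family_on i Q \<rho> N \<or> second_family_on i Q \<rho> N)"
    then show "\<exists>\<Lambda>. einstein_on U ?g \<Lambda>"
      by (intro exI[of _ 0] ricci_flat_imp_einstein plus_type_ricci_flat_on plus_type_if_locally_generic)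
  qed
  have 4: "((\<exists>\<Lambda>. einstein_on U ?g \<Lambda>) \<longleftrightarrow> locally_everywhere U (third_family_on i Q \<rho>))
       \<and> ((\<exists>\<Lambda>. einstein_on U ?g \<Lambda>) \<longrightarrow> ricci_flat_on U ?g)"
    if w: "\<forall>v\<in>jet ` U. w2 Q v \<noteq> 0 \<and> w1 Q v = 0"
  proof (intro conjI iffI impI)
    assume "\<exists>\<Lambda>. einstein_on U ?g \<Lambda>"
    then have P: "minus_type i Q \<sigma> U" using minus[OF w] by (elim exE)
    show "locally_everywhere U (third_family_on i Q \<rho>)" by (rule locally_third_family_if[OF P])
    show "ricci_flat_on U ?g" by (rule minus_type_ricci_flat_on[OF P])
  next
    assume "locally_everywhere U (third_family_on i Q \<rho>)"
    then show "\<exists>\<Lambda>. einstein_on U ?g \<Lambda>"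
      by (intro exI[of _ 0] ricci_flat_imp_einstein ricci_flat_if_locally_third)
  qed
  show ?thesis
    by (rule conjI, rule impI, rule ballI, erule (1) 1, rule conjI, rule impI, erule 2,
        rule conjI, rule impI, erule 3, rule conjI, rule impI, erule 4,
        use einstein_constant_zero in blast)
qed

end
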